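(* Let $(M,\omega)$ be a symplectic $4$-manifold and let $L_t=\phi_t(L_0)$, $t\in[0,1]$, be a smooth isotopy of embedded closed orientable surfaces in $M$, where $\phi_t\in\mathrm{Diff}^+_o(M)$ is a smooth path with $\phi_0=\mathrm{id}$, the surfaces $L_0$ and $L_1$ are $\omega$-Lagrangian, and $\phi_1^*\omega=\omega$ near $L_0$. If the path $(L_t)_{t\in[0,1]}$ is homotopic, through smooth isotopies of embedded surfaces from $L_0$ to $L_1$ (i.e. with the endpoints $L_0$ and $L_1$ preserved), to a Lagrangian isotopy, then $n(L_1,L_0;[\phi_t])=0$.
   Context: $\mathrm{Diff}^+_o(M)$ is the identity component of the group of orientation-preserving diffeomorphisms of $M$ (oriented by $\omega^2$). A Lagrangian isotopy is a smooth isotopy all of whose surfaces are $\omega$-Lagrangian. Definition of $n(L_1,L_0;[L_t])=n(L_1,L_0;[\phi_t])$. Fix an $\omega$-compatible almost complex structure $J_\omega$ on $M$ and let $g_\omega=\omega(\cdot,J_\omega\cdot)$ be the induced Riemannian metric. An almost complex structure $J$ is $g_\omega$-skad if it is $g_\omega$-skew-adjoint. Let $\mathcal E\to M$ be the bundle with fiber $SO(4)/U(2)\cong S^2$ whose sections are the $g_\omega$-skad almost complex structures compatible with the orientation; equivalently, the unit sphere bundle of a rank-$3$ vector bundle (suitably normalized self-dual $2$-forms). Every symplectic form $\tau$ inducing the given orientation has a unique associated $\tau$-compatible $g_\omega$-skad almost complex structure, obtained by polar decomposition: writing $\tau(u,v)=g_\omega(Au,v)$ with $A$ skew-adjoint,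 it is, up to the sign fixed by the compatibility convention, the orthogonal part of $A$. Fix a symplectic form $\omega^+$ (inducing the same orientation) defined near $L_0$ such that $L_0$ is $\omega^+$-symplectic. Put $\omega_t:=(\phi_t^{-1})^*\omega$ and $\omega_t^+:=(\phi_t^{-1})^*\omega^+$, so that $L_t$ is $\omega_t$-Lagrangian and $\omega^+_t$-symplectic. Let $J_t$ and $J_t^+$ be the associated $\omega_t$-compatible, respectively $\omega_t^+$-compatible, $g_\omega$-skad almost complex structures on $T_{L_t}M=TM|_{L_t}$; $J_t$ and $J_t^+$ are taken to be pointwise linearly independent, so that $(J_t,J_t^+,J_t^+\circ J_t)$ determines (after orthonormalization) a trivialization $\mathcal E|_{L_t}\cong S^2\times L_t$, depending smoothly on $t$, in which $J_t$ corresponds to the constant map to a fixed point $*\in S^2$. Note that $J_t=J_\omega|_{L_t}$ for $t=0,1$. In this trivialization, with $L_t$ parametrized by $L:=L_0$ via $\phi_t$, the sections $J_\omega|_{L_t}$ become a map $L\times[0,1]\to S^2$ that is constantly $*$ on $L\times\{0,1\}$, hence a map $F:X\to S^2$ with $X:=(L\times[0,1])/(L\times\{0,1\})$. Define $n(L_1,L_0;[\phi_t])\in[X,S^2]$ to be the homotopy class of $F$, and write $n(L_1,L_0;[\phi_t])=0$ if it is the class of the constant map. Equivalently, $n(L_1,L_0;[\phi_t])=0$ if and only if the section $(x,t)\mapsto J_\omega|_{\phi_t(x)}$ is homotopic to the section $(x,t)\mapsto J_t|_{\phi_t(x)}$, as sections over $L\times[0,1]$ of the pullback of $\mathcal E$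 by $(x,t)\mapsto\phi_t(x)$, relative to $L\times\{0,1\}$. *)

theory Defs
  imports "HOL-Analysis.Analysis"
begin

section \<open>Smooth functions on subsets of normed spaces\<close>

primrec Ck_on :: "nat \<Rightarrow> 'a::real_normed_vector set \<Rightarrow> ('a \<Rightarrow> 'b::real_normed_vector) \<Rightarrow> bool" where
  "Ck_on 0 U f \<longleftrightarrow> continuous_on U f"
| "Ck_on (Suc n) U f \<longleftrightarrow> (\<forall>x\<in>U. f differentiable (at x)) \<and>
     (\<forall>v. Ck_on n U (\<lambda>x. frechet_derivative f (at x) v))"

text \<open>The set \<open>S\<close> is arbitrary (closed intervals and subsets of surfaces occur): smooth means
  locally extendable to a smooth function on an open set.\<close>

definition smooth_on :: "'a::real_normed_vector set \<Rightarrow> ('a \<Rightarrow> 'b::real_normed_vector) \<Rightarrow> bool" where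
  "smooth_on S f \<longleftrightarrow>
     (\<forall>x\<in>S. \<exists>U g. open U \<and> x \<in> U \<and> (\<forall>n. Ck_on n U g) \<and> (\<forall>y\<in>S \<inter> U. g y = f y))"

text \<open>Continuous families of smooth functions: all derivatives with respect to the second
  argument exist and are jointly continuous, i.e. continuity in the parameter holds in the
  \<open>C\<^sup>\<infinity>\<close> sense. No differentiability in the parameter is required.\<close>

primrec Ck_family_on ::
  "nat \<Rightarrow> ('s::topological_space \<times> 'a::real_normed_vector) set \<Rightarrow>
   ('s \<Rightarrow> 'a \<Rightarrow> 'b::real_normed_vector) \<Rightarrow> bool" where
  "Ck_family_on 0 W f \<longleftrightarrow> continuous_on W (\<lambda>(s, x). f s x)"
| "Ck_family_on (Suc n) W f \<longleftrightarrow> continuous_on W (\<lambda>(s, x). f s x) \<and>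
     (\<forall>(s, x)\<in>W. f s differentiable (at x)) \<and>
     (\<forall>v. Ck_family_on n W (\<lambda>s x. frechet_derivative (f s) (at x) v))"

definition smooth_family_on ::
  "'s::topological_space set \<Rightarrow> ('s \<times> 'a::real_normed_vector) set \<Rightarrow>
   ('s \<Rightarrow> 'a \<Rightarrow> 'b::real_normed_vector) \<Rightarrow> bool" where
  "smooth_family_on P D f \<longleftrightarrow>
     (\<forall>z\<in>D. \<exists>W g. openin (top_of_set (P \<times> UNIV)) W \<and> z \<in> W \<and> (\<forall>n. Ck_family_on n W g) \<and>
        (\<forall>(s, y)\<in>D \<inter> W. g s y = f s y))"

section \<open>Smooth 4-manifolds and smooth maps\<close>

type_synonym 'a chart = "'a set \<times> ('a \<Rightarrow> real^4)"

record 'a smooth_space =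
  mtop :: "'a topology"
  atlas :: "'a chart set"

abbreviation pts :: "'a smooth_space \<Rightarrow> 'a set" where
  "pts M \<equiv> topspace (mtop M)"

definition chart_on :: "'a topology \<Rightarrow> 'a chart \<Rightarrow> bool" where
  "chart_on T k \<longleftrightarrow> openin T (fst k) \<and> open (snd k ` fst k) \<and>
     homeomorphic_map (subtopology T (fst k)) (top_of_set (snd k ` fst k)) (snd k)"

definition chart_inv :: "'a chart \<Rightarrow> real^4 \<Rightarrow> 'a" where
  "chart_inv k = inv_into (fst k) (snd k)"

definition charts_compatible :: "'a chart \<Rightarrow> 'a chart \<Rightarrow> bool" where
  "charts_compatible k l \<longleftrightarrow>
     smooth_on (snd k ` (fst k \<inter> fst l)) (\<lambda>x. snd l (chart_inv k x)) \<and>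
     smooth_on (snd l ` (fst k \<inter> fst l)) (\<lambda>x. snd k (chart_inv l x))"

definition smooth_4_manifold :: "'a smooth_space \<Rightarrow> bool" where
  "smooth_4_manifold M \<longleftrightarrow>
     Hausdorff_space (mtop M) \<and> second_countable (mtop M) \<and>
     (\<Union>k\<in>atlas M. fst k) = pts M \<and>
     (\<forall>k. k \<in> atlas M \<longleftrightarrow> chart_on (mtop M) k \<and> (\<forall>l\<in>atlas M. charts_compatible k l))"

text \<open>The last clause says that the atlas is maximal. Tensor fields are given by their
  components in all charts of this maximal atlas.\<close>

definition charts_at :: "'a smooth_space \<Rightarrow> 'a \<Rightarrow> 'a chart set" where
  "charts_at M p = {k \<in> atlas M. p \<in> fst k}"

definition smooth_map :: "'a smooth_space \<Rightarrow> 'a set \<Rightarrow> ('a \<Rightarrow> 'a) \<Rightarrow> bool" where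
  "smooth_map M S f \<longleftrightarrow>
     continuous_map (subtopology (mtop M) S) (mtop M) f \<and>
     (\<forall>k\<in>atlas M. \<forall>l\<in>atlas M.
        smooth_on (snd k ` {p \<in> fst k \<inter> S. f p \<in> fst l}) (\<lambda>x. snd l (f (chart_inv k x))))"

definition smooth_path_of_maps :: "'a smooth_space \<Rightarrow> 'a set \<Rightarrow> (real \<Rightarrow> 'a \<Rightarrow> 'a) \<Rightarrow> bool" where
  "smooth_path_of_maps M S f \<longleftrightarrow>
     continuous_map (prod_topology (top_of_set {0..1}) (subtopology (mtop M) S)) (mtop M)
       (\<lambda>(t, p). f t p) \<and>
     (\<forall>k\<in>atlas M. \<forall>l\<in>atlas M.
        smooth_on
          ((\<lambda>(t, p). (t, snd k p)) ` {(t, p). t \<in> {0..1} \<and> p \<in> fst k \<inter> S \<and> f t p \<in> fst l})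
          (\<lambda>(t, x). snd l (f t (chart_inv k x))))"

definition diffeo :: "'a smooth_space \<Rightarrow> ('a \<Rightarrow> 'a) \<Rightarrow> bool" where
  "diffeo M f \<longleftrightarrow> bij_betw f (pts M) (pts M) \<and> smooth_map M (pts M) f \<and>
     smooth_map M (pts M) (inv_into (pts M) f)"

text \<open>The differential of \<open>f\<close> at \<open>p\<close> in the charts \<open>k\<close> at \<open>p\<close> and \<open>l\<close> at \<open>f p\<close>.\<close>

definition tderiv ::
  "('a \<Rightarrow> 'a) \<Rightarrow> 'a chart \<Rightarrow> 'a chart \<Rightarrow> 'a \<Rightarrow> real^4 \<Rightarrow> real^4" where
  "tderiv f k l p = frechet_derivative (\<lambda>x. snd l (f (chart_inv k x))) (at (snd k p))"

section \<open>Two-forms and symplectic forms\<close>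

type_synonym 'a two_form = "'a chart \<Rightarrow> 'a \<Rightarrow> real^4 \<Rightarrow> real^4 \<Rightarrow> real"

definition two_form_on :: "'a smooth_space \<Rightarrow> 'a set \<Rightarrow> 'a two_form \<Rightarrow> bool" where
  "two_form_on M S \<tau> \<longleftrightarrow>
     (\<forall>p\<in>S. \<forall>k\<in>charts_at M p. bilinear (\<tau> k p) \<and> (\<forall>u. \<tau> k p u u = 0)) \<and>
     (\<forall>p\<in>S. \<forall>k\<in>charts_at M p. \<forall>l\<in>charts_at M p. \<forall>u v.
        \<tau> k p u v = \<tau> l p (tderiv id k l p u) (tderiv id k l p v)) \<and>
     (\<forall>k\<in>atlas M. \<forall>u v. smooth_on (snd k ` (fst k \<inter> S)) (\<lambda>x. \<tau> k (chart_inv k x) u v))"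

text \<open>The exterior derivative in the chart \<open>k\<close>, evaluated at the point with coordinates \<open>x\<close>
  on three constant coordinate vector fields.\<close>

definition ext_deriv ::
  "'a two_form \<Rightarrow> 'a chart \<Rightarrow> real^4 \<Rightarrow> real^4 \<Rightarrow> real^4 \<Rightarrow> real^4 \<Rightarrow> real" where
  "ext_deriv \<tau> k x u v w =
     frechet_derivative (\<lambda>y. \<tau> k (chart_inv k y) v w) (at x) u
     - frechet_derivative (\<lambda>y. \<tau> k (chart_inv k y) u w) (at x) v
     + frechet_derivative (\<lambda>y. \<tau> k (chart_inv k y) u v) (at x) w"

definition symplectic_on :: "'a smooth_space \<Rightarrow> 'a set \<Rightarrow> 'a two_form \<Rightarrow> bool" where
  "symplectic_on M S \<tau> \<longleftrightarrow> two_form_on M S \<tau> \<and>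
     (\<forall>p\<in>S. \<forall>k\<in>charts_at M p. \<forall>u v w. ext_deriv \<tau> k (snd k p) u v w = 0) \<and>
     (\<forall>p\<in>S. \<forall>k\<in>charts_at M p. \<forall>u. u \<noteq> 0 \<longrightarrow> (\<exists>v. \<tau> k p u v \<noteq> 0))"

definition pullback :: "'a smooth_space \<Rightarrow> ('a \<Rightarrow> 'a) \<Rightarrow> 'a two_form \<Rightarrow> 'a two_form" where
  "pullback M f \<tau> k p u v =
     (let l = (SOME l. l \<in> charts_at M (f p))
      in \<tau> l (f p) (tderiv f k l p u) (tderiv f k l p v))"

text \<open>\<open>\<tau> \<and> \<tau>\<close> on the standard basis of \<open>\<real>\<^sup>4\<close>, i.e. twice the Pfaffian of \<open>\<tau>\<close>.\<close>

definition wedge_square :: "(real^4 \<Rightarrow> real^4 \<Rightarrow> real) \<Rightarrow> real" where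
  "wedge_square \<tau> =
     (let e = (\<lambda>i. axis i 1)
      in 2 * (\<tau> (e 1) (e 2) * \<tau> (e 3) (e 4) - \<tau> (e 1) (e 3) * \<tau> (e 2) (e 4)
              + \<tau> (e 1) (e 4) * \<tau> (e 2) (e 3)))"

definition same_orientation_on ::
  "'a smooth_space \<Rightarrow> 'a set \<Rightarrow> 'a two_form \<Rightarrow> 'a two_form \<Rightarrow> bool" where
  "same_orientation_on M S \<sigma> \<tau> \<longleftrightarrow>
     (\<forall>p\<in>S. \<forall>k\<in>charts_at M p. wedge_square (\<sigma> k p) * wedge_square (\<tau> k p) > 0)"

definition orientation_preserving_diffeo ::
  "'a smooth_space \<Rightarrow> 'a two_form \<Rightarrow> ('a \<Rightarrow> 'a) \<Rightarrow> bool" where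
  "orientation_preserving_diffeo M \<omega> f \<longleftrightarrow>
     diffeo M f \<and> same_orientation_on M (pts M) \<omega> (pullback M f \<omega>)"

text \<open>The identity component of the group of orientation-preserving diffeomorphisms, \<open>M\<close> being
  oriented by \<open>\<omega>\<^sup>2\<close>: those that are joined to the identity by a smooth path in that group.\<close>

definition Diff_plus_0 :: "'a smooth_space \<Rightarrow> 'a two_form \<Rightarrow> ('a \<Rightarrow> 'a) set" where
  "Diff_plus_0 M \<omega> = {f. \<exists>h. smooth_path_of_maps M (pts M) h \<and>
     (\<forall>t\<in>{0..1}. orientation_preserving_diffeo M \<omega> (h t)) \<and>
     (\<forall>p\<in>pts M. h 0 p = p \<and> h 1 p = f p)}"

section \<open>Embedded surfaces and isotopies\<close>

definition slice_chart :: "'a smooth_space \<Rightarrow> 'a set \<Rightarrow> 'a chart \<Rightarrow> bool" where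
  "slice_chart M L k \<longleftrightarrow> k \<in> atlas M \<and>
     snd k ` (fst k \<inter> L) = {x \<in> snd k ` fst k. x $ 3 = 0 \<and> x $ 4 = 0}"

definition embedded_surface :: "'a smooth_space \<Rightarrow> 'a set \<Rightarrow> bool" where
  "embedded_surface M L \<longleftrightarrow> L \<subseteq> pts M \<and> (\<forall>p\<in>L. \<exists>k. slice_chart M L k \<and> p \<in> fst k)"

text \<open>An oriented atlas of \<open>L\<close> made of slice charts: the transition maps of \<open>L\<close> are given by the
  first two coordinates, whose Jacobian determinant must be positive.\<close>

definition orientable_surface :: "'a smooth_space \<Rightarrow> 'a set \<Rightarrow> bool" where
  "orientable_surface M L \<longleftrightarrow> embedded_surface M L \<and>
     (\<exists>B. (\<forall>k\<in>B. slice_chart M L k) \<and> L \<subseteq> (\<Union>k\<in>B. fst k) \<and>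
       (\<forall>k\<in>B. \<forall>l\<in>B. \<forall>p\<in>fst k \<inter> fst l \<inter> L.
          let D = tderiv id k l p
          in D (axis 1 1) $ 1 * D (axis 2 1) $ 2 - D (axis 2 1) $ 1 * D (axis 1 1) $ 2 > 0))"

definition closed_orientable_surface :: "'a smooth_space \<Rightarrow> 'a set \<Rightarrow> bool" where
  "closed_orientable_surface M L \<longleftrightarrow>
     embedded_surface M L \<and> compactin (mtop M) L \<and> orientable_surface M L"

text \<open>The tangent space of \<open>L\<close> at \<open>p\<close> in the chart \<open>k\<close>, as the set of velocities of curves.\<close>

definition tangent_space :: "'a set \<Rightarrow> 'a chart \<Rightarrow> 'a \<Rightarrow> (real^4) set" where
  "tangent_space L k p = {v. \<exists>\<gamma> \<epsilon>. \<epsilon> > 0 \<and> \<gamma> 0 = p \<and>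
     (\<forall>r\<in>{-\<epsilon><..<\<epsilon>}. \<gamma> r \<in> L \<inter> fst k) \<and>
     smooth_on {-\<epsilon><..<\<epsilon>} (\<lambda>r. snd k (\<gamma> r)) \<and>
     ((\<lambda>r. snd k (\<gamma> r)) has_vector_derivative v) (at 0)}"

definition lagrangian_surface :: "'a smooth_space \<Rightarrow> 'a two_form \<Rightarrow> 'a set \<Rightarrow> bool" where
  "lagrangian_surface M \<tau> L \<longleftrightarrow> embedded_surface M L \<and>
     (\<forall>p\<in>L. \<forall>k\<in>charts_at M p. \<forall>u\<in>tangent_space L k p. \<forall>v\<in>tangent_space L k p. \<tau> k p u v = 0)"

definition symplectic_surface :: "'a smooth_space \<Rightarrow> 'a two_form \<Rightarrow> 'a set \<Rightarrow> bool" where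
  "symplectic_surface M \<tau> L \<longleftrightarrow> embedded_surface M L \<and>
     (\<forall>p\<in>L. \<forall>k\<in>charts_at M p. \<forall>u\<in>tangent_space L k p. u \<noteq> 0 \<longrightarrow>
        (\<exists>v\<in>tangent_space L k p. \<tau> k p u v \<noteq> 0))"

definition smooth_embedding :: "'a smooth_space \<Rightarrow> 'a set \<Rightarrow> ('a \<Rightarrow> 'a) \<Rightarrow> bool" where
  "smooth_embedding M L f \<longleftrightarrow> smooth_map M L f \<and> inj_on f L \<and>
     embedded_surface M (f ` L) \<and> smooth_map M (f ` L) (inv_into L f)"

definition surface_isotopy :: "'a smooth_space \<Rightarrow> 'a set \<Rightarrow> (real \<Rightarrow> 'a \<Rightarrow> 'a) \<Rightarrow> bool" where
  "surface_isotopy M L \<psi> \<longleftrightarrow>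
     smooth_path_of_maps M L \<psi> \<and> (\<forall>t\<in>{0..1}. smooth_embedding M L (\<psi> t))"

text \<open>A continuous family, parametrized by \<open>s \<in> [0,1]\<close>, of smooth isotopies \<open>t \<mapsto> \<Psi> s t\<close>.\<close>

definition homotopy_of_isotopies ::
  "'a smooth_space \<Rightarrow> 'a set \<Rightarrow> (real \<Rightarrow> real \<Rightarrow> 'a \<Rightarrow> 'a) \<Rightarrow> bool" where
  "homotopy_of_isotopies M L \<Psi> \<longleftrightarrow>
     (\<forall>s\<in>{0..1}. surface_isotopy M L (\<Psi> s)) \<and>
     continuous_map
       (prod_topology (top_of_set {0..1})
         (prod_topology (top_of_set {0..1}) (subtopology (mtop M) L)))
       (mtop M) (\<lambda>(s, t, p). \<Psi> s t p) \<and>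
     (\<forall>k\<in>atlas M. \<forall>l\<in>atlas M.
        smooth_family_on {0..1}
          ((\<lambda>(s, t, p). (s, t, snd k p)) `
             {(s, t, p). s \<in> {0..1} \<and> t \<in> {0..1} \<and> p \<in> fst k \<inter> L \<and> \<Psi> s t p \<in> fst l})
          (\<lambda>s (t, x). snd l (\<Psi> s t (chart_inv k x))))"

text \<open>The homotopy is one of paths of unparametrized surfaces: only the images of \<open>L\<close> are
  prescribed for \<open>s = 0\<close> and \<open>t \<in> {0,1}\<close>.\<close>

definition homotopic_to_lagrangian_isotopy ::
  "'a smooth_space \<Rightarrow> 'a two_form \<Rightarrow> 'a set \<Rightarrow> (real \<Rightarrow> 'a set) \<Rightarrow> bool" where
  "homotopic_to_lagrangian_isotopy M \<omega> L Lt \<longleftrightarrow>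
     (\<exists>\<Psi>. homotopy_of_isotopies M L \<Psi> \<and>
       (\<forall>t\<in>{0..1}. \<Psi> 0 t ` L = Lt t) \<and>
       (\<forall>s\<in>{0..1}. \<Psi> s 0 ` L = Lt 0 \<and> \<Psi> s 1 ` L = Lt 1) \<and>
       (\<forall>t\<in>{0..1}. lagrangian_surface M \<omega> (\<Psi> 1 t ` L)))"

section \<open>Almost complex structures\<close>

type_synonym 'a endo_field = "'a chart \<Rightarrow> 'a \<Rightarrow> real^4 \<Rightarrow> real^4"

definition almost_complex :: "'a smooth_space \<Rightarrow> 'a endo_field \<Rightarrow> bool" where
  "almost_complex M J \<longleftrightarrow>
     (\<forall>p\<in>pts M. \<forall>k\<in>charts_at M p. linear (J k p) \<and> (\<forall>u. J k p (J k p u) = - u)) \<and>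
     (\<forall>p\<in>pts M. \<forall>k\<in>charts_at M p. \<forall>l\<in>charts_at M p. \<forall>u.
        tderiv id k l p (J k p u) = J l p (tderiv id k l p u)) \<and>
     (\<forall>k\<in>atlas M. \<forall>u. smooth_on (snd k ` fst k) (\<lambda>x. J k (chart_inv k x) u))"

definition compatible :: "(real^4 \<Rightarrow> real^4 \<Rightarrow> real) \<Rightarrow> (real^4 \<Rightarrow> real^4) \<Rightarrow> bool" where
  "compatible \<tau> J \<longleftrightarrow> (\<forall>u v. \<tau> (J u) (J v) = \<tau> u v) \<and> (\<forall>u. u \<noteq> 0 \<longrightarrow> \<tau> u (J u) > 0)"

definition compatible_acs :: "'a smooth_space \<Rightarrow> 'a two_form \<Rightarrow> 'a endo_field \<Rightarrow> bool" where
  "compatible_acs M \<omega> J \<longleftrightarrow> almost_complex M J \<and>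
     (\<forall>p\<in>pts M. \<forall>k\<in>charts_at M p. compatible (\<omega> k p) (J k p))"

definition induced_metric :: "'a two_form \<Rightarrow> 'a endo_field \<Rightarrow> 'a two_form" where
  "induced_metric \<omega> J k p u v = \<omega> k p u (J k p v)"

text \<open>The unique \<open>\<tau>\<close>-compatible \<open>g\<close>-skew-adjoint complex structure; equivalently the
  orthogonal part of \<open>A\<close> where \<open>\<tau>(u,v) = g(Au,v)\<close>.\<close>

definition associated_acs ::
  "(real^4 \<Rightarrow> real^4 \<Rightarrow> real) \<Rightarrow> (real^4 \<Rightarrow> real^4 \<Rightarrow> real) \<Rightarrow> (real^4 \<Rightarrow> real^4)" where
  "associated_acs g \<tau> = (THE J. linear J \<and> (\<forall>u. J (J u) = - u) \<and>
     (\<forall>u v. g (J u) v = - g u (J v)) \<and> compatible \<tau> J)"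

definition moved_form ::
  "'a smooth_space \<Rightarrow> (real \<Rightarrow> 'a \<Rightarrow> 'a) \<Rightarrow> 'a two_form \<Rightarrow> real \<Rightarrow> 'a two_form" where
  "moved_form M \<phi> \<tau> t = pullback M (inv_into (pts M) (\<phi> t)) \<tau>"

text \<open>For \<open>\<tau> = \<omega>\<close> and \<open>\<tau> = \<omega>\<^sup>+\<close> these are \<open>J\<^sub>t\<close> and \<open>J\<^sub>t\<^sup>+\<close>.\<close>

definition moved_acs ::
  "'a smooth_space \<Rightarrow> 'a two_form \<Rightarrow> (real \<Rightarrow> 'a \<Rightarrow> 'a) \<Rightarrow> 'a two_form \<Rightarrow> real \<Rightarrow> 'a endo_field" where
  "moved_acs M g \<phi> \<tau> t k p = associated_acs (g k p) (moved_form M \<phi> \<tau> t k p)"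

definition endos_independent :: "(real^4 \<Rightarrow> real^4) \<Rightarrow> (real^4 \<Rightarrow> real^4) \<Rightarrow> bool" where
  "endos_independent I J \<longleftrightarrow>
     (\<forall>a b :: real. (\<forall>u. a *\<^sub>R I u + b *\<^sub>R J u = 0) \<longrightarrow> a = 0 \<and> b = 0)"

section \<open>The invariant\<close>

text \<open>On \<open>g\<close>-skew-adjoint endomorphisms this is the inner product induced by \<open>g\<close>, scaled so that
  complex structures have norm 1; written with the trace it does not depend on the chart.\<close>

definition endo_inner :: "(real^4 \<Rightarrow> real^4) \<Rightarrow> (real^4 \<Rightarrow> real^4) \<Rightarrow> real" where
  "endo_inner I J = - trace (matrix (I \<circ> J)) / 4"

text \<open>Coordinates of \<open>I\<close> in the orthonormal frame \<open>(J, K, K \<circ> J)\<close>, where \<open>K\<close> is \<open>J'\<close>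
  orthonormalized against \<open>J\<close>. (The endomorphism \<open>J' \<circ> J\<close> itself is skew-adjoint only if
  \<open>J\<close> and \<open>J'\<close> are orthogonal; its skew-adjoint part is a multiple of \<open>K \<circ> J\<close>.)\<close>

definition frame_coords ::
  "(real^4 \<Rightarrow> real^4) \<Rightarrow> (real^4 \<Rightarrow> real^4) \<Rightarrow> (real^4 \<Rightarrow> real^4) \<Rightarrow> real^3" where
  "frame_coords J J' I =
     (let P = (\<lambda>u. J' u - endo_inner J' J *\<^sub>R J u);
          K = (\<lambda>u. (1 / sqrt (endo_inner P P)) *\<^sub>R P u)
      in vector [endo_inner I J, endo_inner I K, endo_inner I (K \<circ> J)])"

definition F_map ::
  "'a smooth_space \<Rightarrow> 'a two_form \<Rightarrow> 'a endo_field \<Rightarrow> 'a two_form \<Rightarrow> (real \<Rightarrow> 'a \<Rightarrow> 'a) \<Rightarrow>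
   'a \<times> real \<Rightarrow> real^3" where
  "F_map M \<omega> J \<omega>p \<phi> = (\<lambda>(x, t).
     let p = \<phi> t x; k = (SOME k. k \<in> charts_at M p); g = induced_metric \<omega> J
     in frame_coords (moved_acs M g \<phi> \<omega> t k p) (moved_acs M g \<phi> \<omega>p t k p) (J k p))"

text \<open>The quotient space \<open>Y/B\<close>; its points are the set \<open>B\<close> and the singletons \<open>{y}\<close> with
  \<open>y \<notin> B\<close>.\<close>

definition collapse :: "'b set \<Rightarrow> 'b \<Rightarrow> 'b set" where
  "collapse B y = (if y \<in> B then B else {y})"

definition collapse_topology :: "'b topology \<Rightarrow> 'b set \<Rightarrow> 'b set topology" where
  "collapse_topology Y B = topology (\<lambda>V. V \<subseteq> collapse B ` topspace Y \<and>
     openin Y {y \<in> topspace Y. collapse B y \<in> V})"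

lemma openin_collapse_topology:
  "openin (collapse_topology Y B) V \<longleftrightarrow>
     V \<subseteq> collapse B ` topspace Y \<and> openin Y {y \<in> topspace Y. collapse B y \<in> V}"
proof -
  have "istopology (\<lambda>V. V \<subseteq> collapse B ` topspace Y \<and>
     openin Y {y \<in> topspace Y. collapse B y \<in> V})"
    unfolding istopology_def
  proof (intro conjI allI impI; (elim conjE)?)
    fix S T
    assume "openin Y {y \<in> topspace Y. collapse B y \<in> S}"
      and "openin Y {y \<in> topspace Y. collapse B y \<in> T}"
    moreover have "{y \<in> topspace Y. collapse B y \<in> S \<inter> T} =
        {y \<in> topspace Y. collapse B y \<in> S} \<inter> {y \<in> topspace Y. collapse B y \<in> T}" by auto
    ultimately show "openin Y {y \<in> topspace Y. collapse B y \<in> S \<inter> T}" by auto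
  next
    fix \<K> assume *: "\<forall>K\<in>\<K>. K \<subseteq> collapse B ` topspace Y \<and>
        openin Y {y \<in> topspace Y. collapse B y \<in> K}"
    have "{y \<in> topspace Y. collapse B y \<in> \<Union>\<K>} =
        (\<Union>K\<in>\<K>. {y \<in> topspace Y. collapse B y \<in> K})" by auto
    with * show "openin Y {y \<in> topspace Y. collapse B y \<in> \<Union>\<K>}" by auto
  qed auto
  then show ?thesis
    by (simp add: collapse_topology_def topology_inverse')
qed

lemma quotient_map_collapse: "quotient_map Y (collapse_topology Y B) (collapse B)"
proof -
  have "topspace (collapse_topology Y B) = collapse B ` topspace Y"
  proof
    show "topspace (collapse_topology Y B) \<subseteq> collapse B ` topspace Y"
      using openin_topspace[of "collapse_topology Y B"] openin_collapse_topology by blast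
    have "{y \<in> topspace Y. collapse B y \<in> collapse B ` topspace Y} = topspace Y" by auto
    then have "openin (collapse_topology Y B) (collapse B ` topspace Y)"
      by (simp add: openin_collapse_topology)
    then show "collapse B ` topspace Y \<subseteq> topspace (collapse_topology Y B)"
      by (rule openin_subset)
  qed
  then show ?thesis
    by (simp add: quotient_map_def openin_collapse_topology)
qed

definition homotopy_class :: "'b topology \<Rightarrow> 'c topology \<Rightarrow> ('b \<Rightarrow> 'c) \<Rightarrow> ('b \<Rightarrow> 'c) set" where
  "homotopy_class X Y f = {h. homotopic_with (\<lambda>_. True) X Y f h}"

definition cylinder_ends :: "'a set \<Rightarrow> ('a \<times> real) set" where
  "cylinder_ends L = L \<times> {0, 1}"

definition X_space :: "'a smooth_space \<Rightarrow> 'a set \<Rightarrow> ('a \<times> real) set topology" where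
  "X_space M L = collapse_topology
     (prod_topology (subtopology (mtop M) L) (top_of_set {0..1})) (cylinder_ends L)"

abbreviation sphere2 :: "(real^3) topology" where
  "sphere2 \<equiv> top_of_set (sphere 0 1)"

definition n_invariant ::
  "'a smooth_space \<Rightarrow> 'a two_form \<Rightarrow> 'a endo_field \<Rightarrow> 'a two_form \<Rightarrow> (real \<Rightarrow> 'a \<Rightarrow> 'a) \<Rightarrow> 'a set \<Rightarrow>
   (('a \<times> real) set \<Rightarrow> real^3) set" where
  "n_invariant M \<omega> J \<omega>p \<phi> L =
     homotopy_class (X_space M L) sphere2 (\<lambda>C. F_map M \<omega> J \<omega>p \<phi> (SOME z. z \<in> C))"

definition null_class :: "'a smooth_space \<Rightarrow> 'a set \<Rightarrow> (('a \<times> real) set \<Rightarrow> real^3) set" where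
  "null_class M L = homotopy_class (X_space M L) sphere2 (\<lambda>_. axis 1 1)"

end

theory Submission
  imports Defs
begin

text \<open>An oriented plane in a tangent space of \<open>M\<close> determines a point of the sphere of skew-adjoint
  complex structures, the one that preserves the plane and rotates it positively; the plane is
  \<open>\<omega>\<close>-Lagrangian exactly if this point is orthogonal to \<open>J\<close>. Along the homotopy \<open>\<Psi> s t\<close> from the given
  path to a Lagrangian isotopy the tangent planes therefore give a section \<open>b\<close> of the sphere bundle,
  orthogonal to \<open>J\<close> for \<open>s = 1\<close> and for \<open>t \<in> {0, 1}\<close>. Since the bundle orthogonal to \<open>J\<close> over the square is
  pulled back, up to isomorphism, from the side \<open>s = 1\<close>, it has a unit section \<open>E\<close> that equals \<open>b\<close>
  there. In the frame \<open>(J, E, J \<circ> E)\<close> the structures \<open>J\<^sub>t\<close> become a map \<open>a\<close> with value \<open>(1, 0, 0)\<close> for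
  \<open>t \<in> {0, 1}\<close>, and \<open>a \<noteq> \<plusminus>b\<close> for \<open>s = 0\<close> because \<open>L\<^sub>t\<close> is Lagrangian for the form that tames \<open>J\<^sub>t\<close>. So \<open>a\<close>
  can be rotated into \<open>b\<close>, which is contracted across the square to a constant, while the ends are
  kept fixed by compensating rotations. Hence \<open>J\<^sub>t\<close> is homotopic to \<open>J\<close> relative to the ends, and the
  coordinates with respect to \<open>J\<^sub>t\<close> and \<open>J\<^sub>t\<^sup>+\<close> carry this homotopy to one from a constant to \<open>F\<close>.\<close>

section \<open>Homotopies relative to the ends\<close>

text \<open>The frame built from \<open>J_t\<close> and \<open>J_t^+\<close> exists only over the
  given path, whereas the tangent planes must be followed through the whole homotopy, over which the
  plane bundle orthogonal to \<open>J\<close> comes with no trivialization. The Lagrangian side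
  removes this obstacle, because there the tangent planes are themselves a unit section. Once
  \<open>E\<close> exists, all data are maps to one fixed sphere. But \<open>a\<close> is defined
  only for \<open>s = 0\<close>, while \<open>b\<close> is constant only for \<open>s = 1\<close>;
  so they are compared around the sides \<open>t = 0\<close>, \<open>s = 0\<close> and
  \<open>t = 1\<close>, with \<open>a\<close> extended by \<open>J\<close> over the first and the
  last. On each of these sides the two are independent: on the ends \<open>b\<close> is orthogonal
  to \<open>J\<close>, and for \<open>s = 0\<close> a structure that tames a form cannot preserve a
  plane on which the form vanishes. The homotopy prescribes only images of \<open>L\<close>, so
  \<open>\<Psi> 0 t\<close> and \<open>\<phi> t\<close> parametrize the same surface differently.
  Everything is computed along \<Psi> and carried back at the end by \<open>beta\<close>. The
  orientation of \<open>L\<close> is what gives \<open>b\<close> a definite sign.\<close>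

abbreviation unit_interval :: "real topology" where
  "unit_interval \<equiv> top_of_set {0..1}"

lemma cm_compose_on:
  assumes "continuous_map X euclidean f" "continuous_on S h" "\<And>x. x \<in> topspace X \<Longrightarrow> f x \<in> S"
  shows "continuous_map X euclidean (\<lambda>x. h (f x))"
proof -
  have "continuous_map X (top_of_set S) f"
    using assms by (auto simp: continuous_map_in_subtopology)
  moreover have "continuous_map (top_of_set S) euclidean h"
    using assms by simp
  ultimately show ?thesis
    using continuous_map_compose[of X "top_of_set S" f euclidean h] by (simp add: o_def)
qed

lemma cm_compose:
  assumes "continuous_map X Y f" "continuous_map Y Z h"
  shows "continuous_map X Z (\<lambda>x. h (f x))"
  using continuous_map_compose[OF assms] by (simp add: o_def)

lemma cm_scaleR [continuous_intros]:
  fixes f :: "'x \<Rightarrow> 'b::real_normed_vector"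
  assumes "continuous_map X euclideanreal c" "continuous_map X euclidean f"
  shows "continuous_map X euclidean (\<lambda>x. c x *\<^sub>R f x)"
  using assms by (simp add: continuous_map_atin tendsto_scaleR)

lemma cm_sgn:
  fixes f :: "'x \<Rightarrow> 'b::real_normed_vector"
  assumes "continuous_map X euclidean f" "\<And>x. x \<in> topspace X \<Longrightarrow> f x \<noteq> 0"
  shows "continuous_map X euclidean (\<lambda>x. sgn (f x))"
  using assms by (simp add: continuous_map_atin tendsto_sgn)

lemma cm_into_interval:
  assumes "continuous_map X euclideanreal c" "\<And>x. x \<in> topspace X \<Longrightarrow> c x \<in> {0..1}"
  shows "continuous_map X unit_interval c"
  using assms by (auto simp: continuous_map_in_subtopology)

lemma cm_of_interval: "continuous_map X unit_interval c \<Longrightarrow> continuous_map X euclideanreal c"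
  by (simp add: continuous_map_in_subtopology)

lemma cm_pair:
  assumes "continuous_map X Y f" "continuous_map X Z g"
  shows "continuous_map X (prod_topology Y Z) (\<lambda>x. (f x, g x))"
  using assms by (simp add: continuous_map_paired)

lemma cm_fst_real: "continuous_map (prod_topology unit_interval X) euclideanreal fst"
  by (rule cm_of_interval) (rule continuous_map_fst)

lemma cm_vec3:
  assumes "continuous_map X euclideanreal f" "continuous_map X euclideanreal g" "continuous_map X euclideanreal h"
  shows "continuous_map X euclidean (\<lambda>x. vector [f x, g x, h x] :: real^3)"
proof -
  have "(\<lambda>x. vector [f x, g x, h x] :: real^3) = (\<lambda>x. f x *\<^sub>R axis 1 1 + g x *\<^sub>R axis 2 1 + h x *\<^sub>R axis 3 1)"
    by (auto simp: vec_eq_iff forall_3 axis_def)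
  then show ?thesis
    using assms by (auto intro!: continuous_intros)
qed

lemma cm_nth:
  fixes f :: "'x \<Rightarrow> real^'n"
  assumes "continuous_map X euclidean f"
  shows "continuous_map X euclideanreal (\<lambda>x. f x $ i)"
  using assms by (simp add: continuous_map_atin tendsto_vec_nth)

lemma cm_inner:
  fixes f g :: "'x \<Rightarrow> 'b::real_inner"
  assumes "continuous_map X euclidean f" "continuous_map X euclidean g"
  shows "continuous_map X euclideanreal (\<lambda>x. f x \<bullet> g x)"
  using assms by (simp add: continuous_map_atin tendsto_inner)

abbreviation homotopic_rel_ends ::
  "'x topology \<Rightarrow> (real \<times> 'x \<Rightarrow> real^3) \<Rightarrow> (real \<times> 'x \<Rightarrow> real^3) \<Rightarrow> bool" where
  "homotopic_rel_ends X \<equiv>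
     homotopic_with (\<lambda>h. \<forall>x\<in>topspace X. h (0, x) = axis 1 1 \<and> h (1, x) = axis 1 1)
       (prod_topology unit_interval X) sphere2"

text \<open>\<open>homotopic_with\<close> asks for the values \<open>p\<close> and \<open>q\<close>
  at all points, also outside the space. The condition on the ends reads values on the space only,
  so prescribing the homotopy there suffices.\<close>

lemma homotopic_rel_endsI:
  fixes h :: "real \<times> real \<times> 'x \<Rightarrow> real^3"
  assumes "continuous_map (prod_topology unit_interval (prod_topology unit_interval X)) euclidean h"
    and "\<And>r t x. \<lbrakk>r \<in> {0..1}; t \<in> {0..1}; x \<in> topspace X\<rbrakk> \<Longrightarrow> norm (h (r, t, x)) = 1"
    and "\<And>r x. \<lbrakk>r \<in> {0..1}; x \<in> topspace X\<rbrakk> \<Longrightarrow> h (r, 0, x) = axis 1 1"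
    and "\<And>r x. \<lbrakk>r \<in> {0..1}; x \<in> topspace X\<rbrakk> \<Longrightarrow> h (r, 1, x) = axis 1 1"
    and "\<And>t x. \<lbrakk>t \<in> {0..1}; x \<in> topspace X\<rbrakk> \<Longrightarrow> h (0, t, x) = p (t, x)"
    and "\<And>t x. \<lbrakk>t \<in> {0..1}; x \<in> topspace X\<rbrakk> \<Longrightarrow> h (1, t, x) = q (t, x)"
  shows "homotopic_rel_ends X p q"
proof (subst homotopic_with, goal_cases)
  case (1 h k)
  have "h (0, x) = k (0, x) \<and> h (1, x) = k (1, x)" if "x \<in> topspace X" for x
    using 1 that by simp
  then show ?case by auto
next
  case 2
  show ?case
    using assms by (intro exI[of _ h]) (auto simp: continuous_map_in_subtopology)
qed

lemma sgn_of_unit: "norm (v :: 'b::real_normed_vector) = 1 \<Longrightarrow> sgn v = v"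
  by (simp add: sgn_div_norm)

text \<open>The homotopy deforms \<open>A\<close> into \<open>B\<close> inside the planes spanned by \<open>A\<close> and \<open>B\<close>, and the
  rotation \<open>\<rho>\<close> of the plane of the first two axes undoes the motion of the end values.\<close>

lemma homotopic_rel_ends_rotate:
  fixes A B :: "real \<times> 'x \<Rightarrow> real^3"
  assumes cA: "continuous_map (prod_topology unit_interval X) euclidean A"
    and cB: "continuous_map (prod_topology unit_interval X) euclidean B"
    and nA: "\<And>t x. \<lbrakk>t \<in> {0..1}; x \<in> topspace X\<rbrakk> \<Longrightarrow> norm (A (t, x)) = 1"
    and nB: "\<And>t x. \<lbrakk>t \<in> {0..1}; x \<in> topspace X\<rbrakk> \<Longrightarrow> norm (B (t, x)) = 1"
    and ne: "\<And>t x. \<lbrakk>t \<in> {0..1}; x \<in> topspace X\<rbrakk> \<Longrightarrow> A (t, x) \<noteq> B (t, x) \<and> A (t, x) \<noteq> - B (t, x)"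
    and eA: "\<And>x. x \<in> topspace X \<Longrightarrow> A (0, x) = axis 1 1 \<and> A (1, x) = axis 1 1"
    and eB: "\<And>x. x \<in> topspace X \<Longrightarrow> B (0, x) = axis 2 1 \<and> B (1, x) = axis 2 1"
  shows "homotopic_rel_ends X A (\<lambda>z. vector [B z $ 2, - (B z $ 1), B z $ 3])"
proof -
  let ?c = "\<lambda>z::real \<times> real \<times> 'x. cos (fst z * pi / 2)" and ?s = "\<lambda>z::real \<times> real \<times> 'x. sin (fst z * pi / 2)"
  define w where "w z = sgn (?c z *\<^sub>R A (snd z) + ?s z *\<^sub>R B (snd z))" for z
  define h :: "real \<times> real \<times> 'x \<Rightarrow> real^3" where
    "h z = vector [?c z * w z $ 1 + ?s z * w z $ 2, ?c z * w z $ 2 - ?s z * w z $ 1, w z $ 3]" for z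
  \<comment> \<open>For unit vectors a vanishing combination forces \<open>c\<close> and
    \<open>s\<close> to have equal modulus, and then \<open>A\<close> is \<open>B\<close> or
    \<open>- B\<close>. So the path may be normalized.\<close>
  have nz: "c *\<^sub>R A (t, x) + s *\<^sub>R B (t, x) \<noteq> 0"
    if "t \<in> {0..1}" "x \<in> topspace X" "c\<^sup>2 + s\<^sup>2 = 1" for c s t x
  proof
    assume 0: "c *\<^sub>R A (t, x) + s *\<^sub>R B (t, x) = 0"
    then have "c *\<^sub>R A (t, x) = (- s) *\<^sub>R B (t, x)" by (simp add: eq_neg_iff_add_eq_0)
    moreover from this have "\<bar>c\<bar> = \<bar>s\<bar>"
      using nA[OF that(1,2)] nB[OF that(1,2)] norm_scaleR[of c "A (t, x)"] norm_scaleR[of "-s" "B (t, x)"] by simp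
    moreover from this have "c \<noteq> 0" "s = c \<or> s = - c"
      using that(3) by (auto simp: abs_eq_iff)
    ultimately have "A (t, x) = - B (t, x) \<or> A (t, x) = B (t, x)"
      by (metis add.inverse_inverse scaleR_cancel_left scaleR_minus_left scaleR_minus_right)
    with ne[OF that(1,2)] show False by blast
  qed
  have [continuous_intros]: "continuous_map (prod_topology unit_interval (prod_topology unit_interval X)) euclideanreal ?c"
    "continuous_map (prod_topology unit_interval (prod_topology unit_interval X)) euclideanreal ?s"
    by (rule cm_compose_on[OF cm_fst_real, of UNIV]; auto intro!: continuous_intros)+
  have cw: "continuous_map (prod_topology unit_interval (prod_topology unit_interval X)) euclidean w"
    unfolding w_def
    by (rule cm_sgn)
      (auto intro!: continuous_intros cm_compose[OF continuous_map_snd cA] cm_compose[OF continuous_map_snd cB] simp: nz)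
  have nw: "norm (w (r, t, x)) = 1" if "t \<in> {0..1}" "x \<in> topspace X" for r t x
    using nz[OF that, of "cos (r * pi / 2)" "sin (r * pi / 2)"] by (simp add: w_def norm_sgn)
  have n3: "norm (vector [c * v $ 1 + s * v $ 2, c * v $ 2 - s * v $ 1, v $ 3] :: real^3) = norm v"
    if "c\<^sup>2 + s\<^sup>2 = 1" for c s and v :: "real^3"
  proof -
    have "(c * v $ 1 + s * v $ 2)\<^sup>2 + (c * v $ 2 - s * v $ 1)\<^sup>2 = (c\<^sup>2 + s\<^sup>2) * ((v $ 1)\<^sup>2 + (v $ 2)\<^sup>2)"
      by algebra
    then show ?thesis
      using that by (simp add: norm_eq_sqrt_inner inner_vec_def sum_3 flip: power2_eq_square)
  qed
  have ends: "h (r, t, x) = axis 1 1"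
    if "A (t, x) = axis 1 1" "B (t, x) = axis 2 1" for r t x
  proof -
    have "norm (cos (r * pi / 2) *\<^sub>R axis 1 1 + sin (r * pi / 2) *\<^sub>R axis 2 1 :: real^3) = 1"
      by (simp add: norm_eq_sqrt_inner inner_vec_def sum_3 axis_def flip: power2_eq_square)
    then show ?thesis
      using that by (simp add: h_def w_def sgn_of_unit)
        (simp add: vec_eq_iff forall_3 axis_def flip: power2_eq_square)
  qed
  show ?thesis
  proof (rule homotopic_rel_endsI[of X h])
    show "continuous_map (prod_topology unit_interval (prod_topology unit_interval X)) euclidean h"
      unfolding h_def by (intro cm_vec3 continuous_intros cm_nth[OF cw])
    show "norm (h (r, t, x)) = 1" if "r \<in> {0..1}" "t \<in> {0..1}" "x \<in> topspace X" for r t x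
      using nw[OF that(2,3)] by (simp add: h_def n3)
    show "h (0, t, x) = A (t, x)" if "t \<in> {0..1}" "x \<in> topspace X" for t x
      using nA[OF that] by (simp add: h_def w_def sgn_of_unit vec_eq_iff forall_3)
    show "h (1, t, x) = vector [B (t, x) $ 2, - (B (t, x) $ 1), B (t, x) $ 3]" if "t \<in> {0..1}" "x \<in> topspace X" for t x
      using nB[OF that] by (simp add: h_def w_def sgn_of_unit)
  qed (use ends eA eB in auto)
qed

text \<open>\<open>A\<close> and \<open>B\<close> follow the path \<open>s: 1 \<rightarrow> 0\<close>, \<open>t: 0 \<rightarrow> 1\<close>, \<open>s: 0 \<rightarrow> 1\<close> along three
  sides of the square, so that \<open>B\<close> can be contracted through the square to the fourth one.\<close>

lemma homotopic_rel_ends_const: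
  fixes a :: "real \<times> 'x \<Rightarrow> real^3" and b :: "real \<times> real \<times> 'x \<Rightarrow> real^3"
  assumes ca: "continuous_map (prod_topology unit_interval X) euclidean a"
    and cb: "continuous_map (prod_topology unit_interval (prod_topology unit_interval X)) euclidean b"
    and na: "\<And>t x. \<lbrakk>t \<in> {0..1}; x \<in> topspace X\<rbrakk> \<Longrightarrow> norm (a (t, x)) = 1"
    and nb: "\<And>s t x. \<lbrakk>s \<in> {0..1}; t \<in> {0..1}; x \<in> topspace X\<rbrakk> \<Longrightarrow> norm (b (s, t, x)) = 1"
    and ea: "\<And>x. x \<in> topspace X \<Longrightarrow> a (0, x) = axis 1 1 \<and> a (1, x) = axis 1 1"
    and b1: "\<And>t x. \<lbrakk>t \<in> {0..1}; x \<in> topspace X\<rbrakk> \<Longrightarrow> b (1, t, x) = axis 2 1"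
    and eb: "\<And>s t x. \<lbrakk>s \<in> {0..1}; t \<in> {0, 1}; x \<in> topspace X\<rbrakk> \<Longrightarrow>
               axis 1 1 \<noteq> b (s, t, x) \<and> axis 1 1 \<noteq> - b (s, t, x)"
    and ab: "\<And>t x. \<lbrakk>t \<in> {0..1}; x \<in> topspace X\<rbrakk> \<Longrightarrow> a (t, x) \<noteq> b (0, t, x) \<and> a (t, x) \<noteq> - b (0, t, x)"
  shows "homotopic_rel_ends X a (\<lambda>z. axis 1 1)"
proof -
  \<comment> \<open>One third of the unit interval for each side of the square: \<open>S\<close>
    falls from 1 to 0, then \<open>T\<close> rises from 0 to 1, then \<open>S\<close> returns to
    1.\<close>
  define T where "T u = max 0 (min 1 (3 * u - 1))" for u :: real
  define S where "S u = max (max 0 (1 - 3 * u)) (3 * u - 2)" for u :: real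
  let ?Z = "prod_topology unit_interval X" and ?Y = "prod_topology unit_interval (prod_topology unit_interval X)"
  have cT: "continuous_on UNIV T" and cS: "continuous_on UNIV S"
    unfolding T_def S_def by (intro continuous_intros)+
  have T01: "T u \<in> {0..1}" for u by (auto simp: T_def)
  have S01: "S u \<in> {0..1}" if "u \<in> {0..1}" for u using that by (auto simp: S_def)
  \<comment> \<open>The reason why \<open>A\<close> and \<open>B\<close> never meet: on the outer
    thirds \<open>T u\<close> is an end value, where \<open>a\<close> is the first axis and
    \<open>eb\<close> applies; on the middle third \<open>S u = 0\<close> and \<open>ab\<close>
    applies.\<close>
  have TS: "(T u \<in> {0, 1}) \<or> S u = 0" for u
    by (auto simp: T_def S_def max_def min_def)
  define A where "A z = a (T (fst z), snd z)" for z
  define B where "B z = b (S (fst z), T (fst z), snd z)" for z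
  have cTf: "continuous_map ?Z unit_interval (\<lambda>z. T (fst z))"
    using T01 by (intro cm_into_interval cm_compose_on[OF cm_fst_real cT]) auto
  have cSf: "continuous_map ?Z unit_interval (\<lambda>z. S (fst z))"
    using S01 by (intro cm_into_interval cm_compose_on[OF cm_fst_real cS]) auto
  have cA: "continuous_map ?Z euclidean A"
    unfolding A_def by (rule cm_compose[OF cm_pair[OF cTf continuous_map_snd] ca])
  have cB: "continuous_map ?Z euclidean B"
    unfolding B_def by (rule cm_compose[OF cm_pair[OF cSf cm_pair[OF cTf continuous_map_snd]] cb])
  have c2: "continuous_map ?Y X (\<lambda>z. snd (snd z))"
    by (rule cm_compose[OF continuous_map_snd continuous_map_snd])
  have c1: "continuous_map ?Y euclideanreal (\<lambda>z. fst (snd z))"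
    by (rule cm_of_interval) (rule cm_compose[OF continuous_map_snd continuous_map_fst])
  \<comment> \<open>\<open>T\<close> fixes 0 and 1, so the affine path from the identity to
    \<open>T\<close> carries \<open>a\<close> to \<open>A\<close> without moving the ends.\<close>
  have 1: "homotopic_rel_ends X a A"
  proof (rule homotopic_rel_endsI[of X "\<lambda>z. a ((1 - fst z) * fst (snd z) + fst z * T (fst (snd z)), snd (snd z))"])
    have I: "(1 - r) * t + r * T t \<in> {0..1}" if "r \<in> {0..1}" "t \<in> {0..1}" for r t
      using convexD[of "{0..1}" t "T t" "1 - r" r] that T01[of t] by simp
    show "continuous_map ?Y euclidean (\<lambda>z. a ((1 - fst z) * fst (snd z) + fst z * T (fst (snd z)), snd (snd z)))"
      by (rule cm_compose[OF cm_pair[OF _ c2] ca], rule cm_into_interval)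
        (use I in \<open>auto intro!: continuous_intros c1 cm_fst_real cm_compose_on[OF c1 cT]\<close>)
    show "norm (a ((1 - fst (r, t, x)) * fst (snd (r, t, x)) + fst (r, t, x) * T (fst (snd (r, t, x))), snd (snd (r, t, x)))) = 1"
      if "r \<in> {0..1}" "t \<in> {0..1}" "x \<in> topspace X" for r t x
      using I[OF that(1,2)] na that by simp
  qed (use ea in \<open>auto simp: A_def T_def\<close>)
  have 2: "homotopic_rel_ends X A (\<lambda>z. vector [B z $ 2, - (B z $ 1), B z $ 3])"
  proof (rule homotopic_rel_ends_rotate[OF cA cB])
    show "norm (A (t, x)) = 1" if "t \<in> {0..1}" "x \<in> topspace X" for t x
      using na T01 that by (simp add: A_def)
    show "norm (B (t, x)) = 1" if "t \<in> {0..1}" "x \<in> topspace X" for t x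
      using nb T01 S01 that by (simp add: B_def)
    show "A (t, x) \<noteq> B (t, x) \<and> A (t, x) \<noteq> - B (t, x)" if "t \<in> {0..1}" "x \<in> topspace X" for t x
    proof (cases "S t = 0")
      case True
      then show ?thesis using ab[of "T t" x] T01 that by (simp add: A_def B_def)
    next
      case False
      then have "T t \<in> {0, 1}" using TS[of t] by blast
      then show ?thesis
        using eb[OF S01[OF that(1)], of "T t" x] ea that by (auto simp: A_def B_def)
    qed
    show "A (0, x) = axis 1 1 \<and> A (1, x) = axis 1 1" if "x \<in> topspace X" for x
      using ea that by (simp add: A_def T_def)
    show "B (0, x) = axis 2 1 \<and> B (1, x) = axis 2 1" if "x \<in> topspace X" for x
      using b1 that by (simp add: B_def T_def S_def)
  qed
  have 3: "homotopic_rel_ends X (\<lambda>z. vector [B z $ 2, - (B z $ 1), B z $ 3]) (\<lambda>z. axis 1 1)"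
  proof -
    \<comment> \<open>Raising \<open>S\<close> to its maximum with the homotopy parameter pushes the
      three sides across the square to \<open>s = 1\<close>, where \<open>b\<close> is constant. At
      both ends \<open>S\<close> is already 1, so they do not move.\<close>
    define g where "g z = b (max (S (fst (snd z))) (fst z), T (fst (snd z)), snd (snd z))" for z
    have cg: "continuous_map ?Y euclidean g"
      unfolding g_def
      using S01 T01
      by (intro cm_compose[OF cm_pair[OF _ cm_pair[OF _ c2]] cb] cm_into_interval)
        (fastforce intro!: continuous_intros cm_compose_on[OF c1 cT] cm_compose_on[OF c1 cS] cm_fst_real simp: max_def)+
    have n: "norm (vector [v $ 2, - (v $ 1), v $ 3] :: real^3) = norm v" for v :: "real^3"
      by (simp add: norm_eq_sqrt_inner inner_vec_def sum_3 add.commute)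
    have e: "vector [v $ 2, - (v $ 1), v $ 3] = (axis 1 1 :: real^3)" if "v = axis 2 1" for v :: "real^3"
      using that by (simp add: vec_eq_iff forall_3 axis_def)
    show ?thesis
    proof (rule homotopic_rel_endsI[of X "\<lambda>z. vector [g z $ 2, - (g z $ 1), g z $ 3]"])
      show "continuous_map ?Y euclidean (\<lambda>z. vector [g z $ 2, - (g z $ 1), g z $ 3] :: real^3)"
        by (intro cm_vec3 continuous_intros cm_nth[OF cg])
      show "norm (vector [g (r, t, x) $ 2, - (g (r, t, x) $ 1), g (r, t, x) $ 3] :: real^3) = 1"
        if "r \<in> {0..1}" "t \<in> {0..1}" "x \<in> topspace X" for r t x
      proof -
        have "max (S t) r \<in> {0..1}" using S01[of t] that by (auto simp: max_def)
        then show ?thesis using nb[OF _ T01 that(3)] by (simp add: n g_def)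
      qed
      show "vector [g (1, t, x) $ 2, - (g (1, t, x) $ 1), g (1, t, x) $ 3] = (axis 1 1 :: real^3)"
        if "t \<in> {0..1}" "x \<in> topspace X" for t x
        using b1[OF T01 that(2), of t] S01[OF that(1)] by (intro e) (simp add: g_def max_absorb2)
      show "vector [g (0, t, x) $ 2, - (g (0, t, x) $ 1), g (0, t, x) $ 3] = (vector [B (t, x) $ 2, - (B (t, x) $ 1), B (t, x) $ 3] :: real^3)"
        if "t \<in> {0..1}" "x \<in> topspace X" for t x
        using S01[OF that(1)] by (simp add: g_def B_def max_absorb1)
    qed (use b1 in \<open>auto simp: g_def S_def T_def max_def vec_eq_iff forall_3 axis_def\<close>)
  qed
  show ?thesis by (rule homotopic_with_trans[OF homotopic_with_trans[OF 1 2] 3])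
qed

section \<open>Unit sections of complex line bundles\<close>

text \<open>\<open>U\<close> and the complement of \<open>C\<close> are open and cover the space. On
  their overlap \<mu> is zero, so the two continuous formulas paste. This gives sense to a cutoff
  times a function that is continuous only on \<open>U\<close>.\<close>

lemma cm_extend_zero:
  fixes g :: "'y \<Rightarrow> 'b::real_normed_vector"
  assumes U: "openin Y U" and C: "closedin Y C" "C \<subseteq> U"
    and mu: "continuous_map Y euclideanreal \<mu>" "\<And>y. y \<in> topspace Y - C \<Longrightarrow> \<mu> y = 0"
    and g: "continuous_map (subtopology Y U) euclidean g"
    and h: "\<And>y. y \<in> U \<Longrightarrow> h y = \<mu> y *\<^sub>R g y" "\<And>y. y \<in> topspace Y - C \<Longrightarrow> h y = 0"
  shows "continuous_map Y euclidean h"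
proof (rule pasting_lemma[where I = UNIV and T = "\<lambda>b. if b then U else topspace Y - C"
        and f = "\<lambda>b. if b then (\<lambda>y. \<mu> y *\<^sub>R g y) else (\<lambda>y. 0)"])
  show "openin Y (if b then U else topspace Y - C)" for b
    using U C by auto
  show "continuous_map (subtopology Y (if b then U else topspace Y - C)) euclidean
          (if b then (\<lambda>y. \<mu> y *\<^sub>R g y) else (\<lambda>y. 0))" for b
    using cm_scaleR[OF continuous_map_from_subtopology[OF mu(1)] g] by simp
  show "\<exists>b. b \<in> UNIV \<and> y \<in> (if b then U else topspace Y - C) \<and>
      h y = (if b then \<lambda>y. \<mu> y *\<^sub>R g y else (\<lambda>y. 0)) y" if "y \<in> topspace Y" for y
  proof (cases "y \<in> U")
    case True
    then show ?thesis using h(1) by (intro exI[of _ True]) auto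
  next
    case False
    then show ?thesis using h(2) that C by (intro exI[of _ False]) auto
  qed
qed (use mu(2) in \<open>auto split: if_splits\<close>)

text \<open>Uniform continuity without a metric on \<open>X\<close>: the set where \<open>h\<close>
  is at least \<open>e\<close> is compact and misses the diagonal, so its image under the difference
  of the two parameters is a compact set that omits 0.\<close>

lemma compact_uniform_small:
  fixes h :: "'x \<times> real \<times> real \<Rightarrow> real"
  assumes X: "compact_space X"
    and h: "continuous_map (prod_topology X (prod_topology unit_interval unit_interval)) euclideanreal h"
    and h0: "\<And>x s. \<lbrakk>x \<in> topspace X; s \<in> {0..1}\<rbrakk> \<Longrightarrow> h (x, s, s) = 0"
    and e: "e > 0"
  obtains d where "d > 0" "\<And>x s t. \<lbrakk>x \<in> topspace X; s \<in> {0..1}; t \<in> {0..1}; \<bar>s - t\<bar> < d\<rbrakk> \<Longrightarrow> h (x, s, t) < e"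
proof -
  let ?P = "prod_topology X (prod_topology unit_interval unit_interval)"
  define K where "K = {p \<in> topspace ?P. h p \<in> {e..}}"
  have "compact_space unit_interval" by (simp add: compact_space_subtopology)
  then have "compact_space ?P"
    using X by (intro iffD2[OF compact_space_prod_topology] disjI2 conjI)
  moreover have "closedin ?P K"
    unfolding K_def by (rule closedin_continuous_map_preimage[OF h]) auto
  ultimately have "compactin ?P K"
    by (simp add: closedin_compact_space)
  moreover have "continuous_map ?P euclideanreal (\<lambda>p. fst (snd p) - snd (snd p))"
    by (intro continuous_intros cm_of_interval cm_compose[OF continuous_map_snd continuous_map_fst]
        cm_compose[OF continuous_map_snd continuous_map_snd])
  ultimately have "compact ((\<lambda>p. fst (snd p) - snd (snd p)) ` K)"
    using image_compactin by fastforce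
  then have op: "open (- ((\<lambda>p. fst (snd p) - snd (snd p)) ` K))"
    using compact_imp_closed by blast
  have "0 \<notin> (\<lambda>p. fst (snd p) - snd (snd p)) ` K"
    using h0 e by (force simp: K_def)
  then obtain d where d: "d > 0" "ball 0 d \<subseteq> - ((\<lambda>p. fst (snd p) - snd (snd p)) ` K)"
    using op openE by blast
  show ?thesis
  proof (rule that[OF d(1)])
    fix x s t assume *: "x \<in> topspace X" "s \<in> {0..1}" "t \<in> {0..1::real}" "\<bar>s - t\<bar> < d"
    then have "s - t \<notin> (\<lambda>p. fst (snd p) - snd (snd p)) ` K"
      using d(2) by (auto simp: subset_iff)
    then have "(x, s, t) \<notin> K" by force
    then show "h (x, s, t) < e" using * by (auto simp: K_def)
  qed
qed

text \<open>Transport along the first coordinate by small steps: if the idempotents \<open>Pr\<close> at \<open>s\<close> and \<open>s'\<close>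
  differ by less than 1, the one at \<open>s'\<close> does not annihilate any nonzero vector fixed by that at \<open>s\<close>.\<close>

lemma idempotent_transport:
  fixes Pr :: "'d \<Rightarrow> 'd \<Rightarrow> real \<times> 'x \<Rightarrow> complex" and v :: "'d \<Rightarrow> 'x \<Rightarrow> complex"
  assumes X: "compact_space X" and D: "finite D"
    and cP: "\<And>d e. \<lbrakk>d \<in> D; e \<in> D\<rbrakk> \<Longrightarrow> continuous_map (prod_topology unit_interval X) euclidean (Pr d e)"
    and idem: "\<And>s x d f. \<lbrakk>s \<in> {0..1}; x \<in> topspace X; d \<in> D; f \<in> D\<rbrakk> \<Longrightarrow>
                 (\<Sum>e\<in>D. Pr d e (s, x) * Pr e f (s, x)) = Pr d f (s, x)"
    and cv: "\<And>d. d \<in> D \<Longrightarrow> continuous_map X euclidean (v d)"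
    and fv: "\<And>x d. \<lbrakk>x \<in> topspace X; d \<in> D\<rbrakk> \<Longrightarrow> (\<Sum>e\<in>D. Pr d e (1, x) * v e x) = v d x"
    and nv: "\<And>x. x \<in> topspace X \<Longrightarrow> \<exists>d\<in>D. v d x \<noteq> 0"
  obtains w :: "'d \<Rightarrow> real \<times> 'x \<Rightarrow> complex" where
    "\<And>d. d \<in> D \<Longrightarrow> continuous_map (prod_topology unit_interval X) euclidean (w d)"
    "\<And>s x d. \<lbrakk>s \<in> {0..1}; x \<in> topspace X; d \<in> D\<rbrakk> \<Longrightarrow> (\<Sum>e\<in>D. Pr d e (s, x) * w e (s, x)) = w d (s, x)"
    "\<And>s x. \<lbrakk>s \<in> {0..1}; x \<in> topspace X\<rbrakk> \<Longrightarrow> \<exists>d\<in>D. w d (s, x) \<noteq> 0"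
    "\<And>x d. \<lbrakk>x \<in> topspace X; d \<in> D\<rbrakk> \<Longrightarrow> w d (1, x) = v d x"
proof -
  let ?Z = "prod_topology unit_interval X"
  let ?P = "prod_topology X (prod_topology unit_interval unit_interval)"
  \<comment> \<open>A bound for the operator norm of the difference of two idempotents, with respect
    to the sum norm on vectors that appears in \<open>keep\<close>.\<close>
  define h where "h p = (\<Sum>d\<in>D. \<Sum>e\<in>D. norm (Pr d e (fst (snd p), fst p) - Pr d e (snd (snd p), fst p)))" for p
  have "continuous_map ?P euclideanreal h"
    unfolding h_def using D
    by (intro continuous_intros cm_compose[OF cm_pair cP] continuous_map_fst
        cm_compose[OF continuous_map_snd continuous_map_fst] cm_compose[OF continuous_map_snd continuous_map_snd])
  then obtain \<delta>0 where \<delta>0: "\<delta>0 > 0"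
    "\<And>x s t. \<lbrakk>x \<in> topspace X; s \<in> {0..1}; t \<in> {0..1}; \<bar>s - t\<bar> < \<delta>0\<rbrakk> \<Longrightarrow> h (x, s, t) < 1"
    using compact_uniform_small[OF X, of h 1] by (auto simp: h_def)
  define \<delta> where "\<delta> = \<delta>0 / 2"
  have \<delta>: "\<delta> > 0" "\<delta> < \<delta>0" using \<delta>0(1) by (auto simp: \<delta>_def)
  \<comment> \<open>The parameter reached after \<open>n\<close> steps of length \<delta> down from
    1, stopped at \<open>s\<close>. As a maximum it is continuous in \<open>s\<close>, so the same
    number of steps can be used for every \<open>s\<close>.\<close>
  define c where "c n s = max s (1 - real n * \<delta>)" for n s
  have c01: "c n s \<in> {0..1}" if "s \<in> {0..1}" for n s
    using that \<delta>(1) by (auto simp: c_def le_max_iff_disj)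
  have cstep: "\<bar>c n s - c (Suc n) s\<bar> < \<delta>0" for n s
    using \<delta> by (auto simp: c_def max_def algebra_simps)
  have cc: "continuous_map ?Z unit_interval (\<lambda>z. c n (fst z))" for n
    unfolding c_def
    by (rule cm_into_interval) (use c01 in \<open>auto intro!: continuous_intros cm_fst_real simp: c_def\<close>)
  have keep: "\<exists>d\<in>D. (\<Sum>e\<in>D. Pr d e (t, x) * u e) \<noteq> 0"
    if x: "x \<in> topspace X" and st: "s \<in> {0..1}" "t \<in> {0..1}" "\<bar>s - t\<bar> < \<delta>0"
      and fu: "\<And>d. d \<in> D \<Longrightarrow> (\<Sum>e\<in>D. Pr d e (s, x) * u e) = u d" and nu: "\<exists>d\<in>D. u d \<noteq> 0"
    for x s t u
  proof (rule ccontr)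
    assume "\<not> ?thesis"
    \<comment> \<open>A vector that is fixed at \<open>s\<close> and annihilated at \<open>t\<close>
      equals its image under the difference of the idempotents, which strictly shrinks the norm of a
      nonzero vector.\<close>
    then have u: "u d = (\<Sum>e\<in>D. (Pr d e (s, x) - Pr d e (t, x)) * u e)" if "d \<in> D" for d
      using fu[OF that] that by (simp add: left_diff_distrib sum_subtractf)
    let ?N = "\<Sum>d\<in>D. norm (u d)"
    have N: "norm (u d) \<le> ?N" if "d \<in> D" for d
      using member_le_sum[of d D "\<lambda>d. norm (u d)"] D that by simp
    have pos: "?N > 0"
      using nu D by (auto intro: sum_pos2)
    have "?N = (\<Sum>d\<in>D. norm (\<Sum>e\<in>D. (Pr d e (s, x) - Pr d e (t, x)) * u e))"
      using u by (intro sum.cong) auto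
    also have "\<dots> \<le> (\<Sum>d\<in>D. \<Sum>e\<in>D. norm (Pr d e (s, x) - Pr d e (t, x)) * ?N)"
      by (intro sum_mono order_trans[OF norm_sum]) (auto simp: norm_mult intro!: mult_left_mono N)
    also have "\<dots> = h (x, s, t) * ?N"
      by (simp add: h_def sum_distrib_right)
    also have "\<dots> < ?N"
      using \<delta>0(2)[OF x st] pos by simp
    finally show False by simp
  qed
  \<comment> \<open>Each step projects onto the range of the idempotent at the next parameter. For
    \<open>s = 1\<close> the parameter never moves, so all projections fix \<open>v\<close>.\<close>
  define W where "W = rec_nat (\<lambda>d z. v d (snd z)) (\<lambda>n w d z. \<Sum>e\<in>D. Pr d e (c (Suc n) (fst z), snd z) * w e z)"
  have W0: "W 0 d z = v d (snd z)" and WS: "W (Suc n) d z = (\<Sum>e\<in>D. Pr d e (c (Suc n) (fst z), snd z) * W n e z)" for n d z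
    by (simp_all add: W_def)
  have cm_mult: "continuous_map ?Z euclidean (\<lambda>z. f z * g z)"
    if "continuous_map ?Z euclidean f" "continuous_map ?Z euclidean g" for f g :: "real \<times> 'x \<Rightarrow> complex"
    using that by (simp add: continuous_map_atin tendsto_mult)
  have cW: "continuous_map ?Z euclidean (W n d)" if "d \<in> D" for n d
    using that
  proof (induction n arbitrary: d)
    case 0
    have "continuous_map ?Z euclidean (\<lambda>z. v d (snd z))"
      by (rule cm_compose[OF continuous_map_snd cv[OF 0]])
    then show ?case by (simp add: W0[abs_def])
  next
    case (Suc n)
    have "continuous_map ?Z euclidean (\<lambda>z. \<Sum>e\<in>D. Pr d e (c (Suc n) (fst z), snd z) * W n e z)"
      using D Suc by (intro continuous_map_sum cm_mult cm_compose[OF cm_pair[OF cc continuous_map_snd] cP])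
    then show ?case by (simp add: WS[abs_def])
  qed
  have inv: "(\<forall>d\<in>D. (\<Sum>e\<in>D. Pr d e (c n s, x) * W n e (s, x)) = W n d (s, x)) \<and> (\<exists>d\<in>D. W n d (s, x) \<noteq> 0)"
    if sx: "s \<in> {0..1}" "x \<in> topspace X" for n s x
  proof (induction n)
    case 0
    have "c 0 s = 1" using sx(1) by (simp add: c_def max_def)
    then show ?case using fv nv sx by (simp add: W0)
  next
    case (Suc n)
    have "(\<Sum>e\<in>D. Pr d e (c (Suc n) s, x) * W (Suc n) e (s, x)) = W (Suc n) d (s, x)" if d: "d \<in> D" for d
    proof -
      have "(\<Sum>e\<in>D. Pr d e (c (Suc n) s, x) * W (Suc n) e (s, x)) =
          (\<Sum>f\<in>D. (\<Sum>e\<in>D. Pr d e (c (Suc n) s, x) * Pr e f (c (Suc n) s, x)) * W n f (s, x))"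
        unfolding WS sum_distrib_left sum_distrib_right fst_conv snd_conv
        by (subst sum.swap) (simp add: mult.assoc)
      then show ?thesis
        using idem[OF c01[OF sx(1)] sx(2) d] by (simp add: WS)
    qed
    moreover have "\<exists>d\<in>D. W (Suc n) d (s, x) \<noteq> 0"
      using keep[OF sx(2) c01[OF sx(1)] c01[OF sx(1)] cstep, of n "\<lambda>e. W n e (s, x)"] Suc by (simp add: WS)
    ultimately show ?case by blast
  qed
  have end1: "W n d (1, x) = v d x" if "x \<in> topspace X" "d \<in> D" for n d x
    using that(2)
  proof (induction n arbitrary: d)
    case (Suc n)
    have "c (Suc n) 1 = 1" using \<delta>(1) by (simp add: c_def)
    then show ?case using Suc fv[OF that(1) Suc.prems] by (simp add: WS)
  qed (simp add: W0)
  \<comment> \<open>So many steps cover the whole interval, hence after them every parameter has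
    arrived at \<open>s\<close> itself.\<close>
  obtain N where N: "1 < real N * \<delta>"
    using reals_Archimedean3[OF \<delta>(1)] by blast
  have cN: "c N s = s" if "s \<in> {0..1}" for s
    using that N by (simp add: c_def max_def)
  show ?thesis
    by (rule that[of "W N"]) (use cW inv[of _ _ N] end1 cN in auto)
qed

text \<open>Weights \<mu> whose squares sum to 1 turn the cocycle \<open>z\<close> over a finite
  cover into a matrix with entries \<open>\<mu> d * \<mu> e * z d e\<close>. The cocycle relation
  makes it idempotent, and its range is the line bundle embedded in a trivial bundle. The given
  section becomes the vector with entries \<open>\<mu> d * \<zeta> d\<close>, which is transported
  there, read back in the trivializations and normalized.\<close>

lemma extend_unit_section:
  fixes U :: "'i \<Rightarrow> (real \<times> 'x) set" and z :: "'i \<Rightarrow> 'i \<Rightarrow> real \<times> 'x \<Rightarrow> complex" and \<zeta> :: "'i \<Rightarrow> 'x \<Rightarrow> complex"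
  assumes X: "compact_space X" "Hausdorff_space X"
    and U: "\<And>i. openin (prod_topology unit_interval X) (U i)"
    and cover: "\<And>q. q \<in> topspace (prod_topology unit_interval X) \<Longrightarrow> \<exists>i. q \<in> U i"
    and cz: "\<And>i j. continuous_map (subtopology (prod_topology unit_interval X) (U i \<inter> U j)) euclidean (z i j)"
    and nz: "\<And>i j q. q \<in> U i \<inter> U j \<Longrightarrow> norm (z i j q) = 1"
    and zz: "\<And>i j k q. q \<in> U i \<inter> U j \<inter> U k \<Longrightarrow> z i j q * z j k q = z i k q"
    and c\<zeta>: "\<And>i. continuous_map (subtopology X {x. (1, x) \<in> U i}) euclidean (\<zeta> i)"
    and n\<zeta>: "\<And>i x. (1, x) \<in> U i \<Longrightarrow> norm (\<zeta> i x) = 1"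
    and z\<zeta>: "\<And>i j x. (1, x) \<in> U i \<inter> U j \<Longrightarrow> \<zeta> i x = z i j (1, x) * \<zeta> j x"
  obtains \<eta> :: "'i \<Rightarrow> real \<times> 'x \<Rightarrow> complex" where
    "\<And>i. continuous_map (subtopology (prod_topology unit_interval X) (U i)) euclidean (\<eta> i)"
    "\<And>i q. q \<in> U i \<Longrightarrow> norm (\<eta> i q) = 1"
    "\<And>i j q. q \<in> U i \<inter> U j \<Longrightarrow> \<eta> i q = z i j q * \<eta> j q"
    "\<And>i x. (1, x) \<in> U i \<Longrightarrow> \<eta> i (1, x) = \<zeta> i x"
proof -
  let ?Q = "prod_topology unit_interval X"
  have cpt: "compact_space ?Q"
    using X by (simp add: compact_space_prod_topology compact_space_subtopology)
  have "Hausdorff_space unit_interval" by (simp add: Hausdorff_space_subtopology)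
  then have "Hausdorff_space ?Q"
    using X by (simp add: Hausdorff_space_prod_topology)
  then have creg: "completely_regular_space ?Q"
    using cpt by (simp add: compact_Hausdorff_or_regular_imp_normal_space normal_imp_completely_regular_space)
  \<comment> \<open>The sublevel sets of these functions at 1/2 yield open sets \<open>V q\<close>
    for a finite subcover and closed sets \<open>C q\<close> that still lie inside a trivializing
    set; the weights are supported in the latter.\<close>
  have "\<exists>i f. q \<in> U i \<and> continuous_map ?Q euclideanreal f \<and> f q = 0 \<and> f ` (topspace ?Q - U i) \<subseteq> {1}"
    if "q \<in> topspace ?Q" for q
    using cover[OF that] U creg unfolding completely_regular_space_alt' by metis
  then obtain ix f where ix: "\<And>q. q \<in> topspace ?Q \<Longrightarrow> q \<in> U (ix q)"
    and f: "\<And>q. q \<in> topspace ?Q \<Longrightarrow> continuous_map ?Q euclideanreal (f q)"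
    and fq: "\<And>q. q \<in> topspace ?Q \<Longrightarrow> f q q = 0"
    and f1: "\<And>q. q \<in> topspace ?Q \<Longrightarrow> f q ` (topspace ?Q - U (ix q)) \<subseteq> {1}"
    by metis
  define V where "V q = {p \<in> topspace ?Q. f q p \<in> {..<1/2}}" for q
  have "openin ?Q (V q)" if "q \<in> topspace ?Q" for q
    unfolding V_def by (rule openin_continuous_map_preimage[OF f[OF that]]) auto
  moreover have "topspace ?Q \<subseteq> \<Union> (V ` topspace ?Q)"
    using fq by (force simp: V_def)
  ultimately have "\<exists>\<F>. finite \<F> \<and> \<F> \<subseteq> V ` topspace ?Q \<and> topspace ?Q \<subseteq> \<Union> \<F>"
    using cpt by (fastforce simp: compact_space_alt)
  then obtain D where D: "finite D" "D \<subseteq> topspace ?Q" "topspace ?Q \<subseteq> (\<Union>d\<in>D. V d)"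
    by (metis finite_subset_image)
  define C where "C d = {p \<in> topspace ?Q. f d p \<in> {..1/2}}" for d
  have C: "closedin ?Q (C d)" if "d \<in> D" for d
    unfolding C_def using D that by (intro closedin_continuous_map_preimage[OF f]) auto
  have CU: "C d \<subseteq> U (ix d)" if "d \<in> D" for d
    using f1[of d] D(2) that by (force simp: C_def)
  define lam where "lam d q = max 0 (1/2 - f d q)" for d q
  define \<sigma> where "\<sigma> q = sqrt (\<Sum>d\<in>D. (lam d q)\<^sup>2)" for q
  define \<mu> where "\<mu> d q = lam d q / \<sigma> q" for d q
  have clam: "continuous_map ?Q euclideanreal (lam d)" if "d \<in> D" for d
    unfolding lam_def using D that by (intro continuous_intros f) auto
  have pos: "(\<Sum>d\<in>D. (lam d q)\<^sup>2) > 0" if q: "q \<in> topspace ?Q" for q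
  proof -
    obtain d where d: "d \<in> D" "q \<in> V d" using D q by blast
    then have "lam d q > 0" by (auto simp: V_def lam_def)
    then show ?thesis using d D by (intro sum_pos2[of D d]) auto
  qed
  have c\<mu>: "continuous_map ?Q euclideanreal (\<mu> d)" if "d \<in> D" for d
    unfolding \<mu>_def \<sigma>_def
    by (intro continuous_intros clam that D cm_compose_on[of _ "\<lambda>q. \<Sum>d\<in>D. (lam d q)\<^sup>2" UNIV sqrt])
      (use pos in \<open>auto simp: less_imp_neq[symmetric]\<close>)
  have \<mu>0: "\<mu> d q = 0" if "d \<in> D" "q \<in> topspace ?Q - C d" for d q
    using that by (auto simp: \<mu>_def lam_def C_def)
  have \<mu>U: "q \<in> U (ix d)" if "d \<in> D" "q \<in> topspace ?Q" "\<mu> d q \<noteq> 0" for d q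
    using \<mu>0[of d q] CU[of d] that by blast
  have \<mu>1: "(\<Sum>d\<in>D. (\<mu> d q)\<^sup>2) = 1" if "q \<in> topspace ?Q" for q
    using pos[OF that] by (simp add: \<mu>_def \<sigma>_def power_divide flip: sum_divide_distrib)
  have Usub: "U i \<subseteq> topspace ?Q" for i
    using U openin_subset by blast
  define Pr where "Pr d e q = (\<mu> d q * \<mu> e q) *\<^sub>R z (ix d) (ix e) q" for d e q
  have cPr: "continuous_map ?Q euclidean (Pr d e)" if "d \<in> D" "e \<in> D" for d e
  proof (rule cm_extend_zero[where U = "U (ix d) \<inter> U (ix e)" and C = "C d \<inter> C e" and \<mu> = "\<lambda>q. \<mu> d q * \<mu> e q" and g = "z (ix d) (ix e)"])
    show "openin ?Q (U (ix d) \<inter> U (ix e))" using U by blast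
    show "closedin ?Q (C d \<inter> C e)" using C that by blast
    show "C d \<inter> C e \<subseteq> U (ix d) \<inter> U (ix e)" using CU that by blast
    show "continuous_map ?Q euclideanreal (\<lambda>q. \<mu> d q * \<mu> e q)" using that by (intro continuous_intros c\<mu>)
    show "\<mu> d q * \<mu> e q = 0" if "q \<in> topspace ?Q - C d \<inter> C e" for q
      using \<mu>0 that \<open>d \<in> D\<close> \<open>e \<in> D\<close> by (metis DiffD1 DiffD2 DiffI IntI mult_eq_0_iff)
    then show "Pr d e q = 0" if "q \<in> topspace ?Q - C d \<inter> C e" for q
      using that by (simp only: Pr_def) simp
  qed (auto simp: Pr_def cz)
  have idem: "(\<Sum>e\<in>D. Pr d e q * Pr e g q) = Pr d g q" if "q \<in> topspace ?Q" "d \<in> D" "g \<in> D" for q d g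
  proof -
    have "Pr d e q * Pr e g q = (\<mu> e q)\<^sup>2 *\<^sub>R Pr d g q" if e: "e \<in> D" for e
    proof (cases "\<mu> d q = 0 \<or> \<mu> e q = 0 \<or> \<mu> g q = 0")
      case False
      then have "z (ix d) (ix e) q * z (ix e) (ix g) q = z (ix d) (ix g) q"
        using \<mu>U \<open>q \<in> topspace ?Q\<close> \<open>d \<in> D\<close> \<open>g \<in> D\<close> e by (intro zz) auto
      then have "(\<mu> d q * \<mu> e q * (\<mu> e q * \<mu> g q)) *\<^sub>R (z (ix d) (ix e) q * z (ix e) (ix g) q) = (\<mu> e q)\<^sup>2 *\<^sub>R (\<mu> d q * \<mu> g q) *\<^sub>R z (ix d) (ix g) q"
        by (simp add: power2_eq_square mult_ac)
      then show ?thesis by (simp add: Pr_def mult_ac)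
    qed (auto simp: Pr_def)
    then have "(\<Sum>e\<in>D. Pr d e q * Pr e g q) = (\<Sum>e\<in>D. (\<mu> e q)\<^sup>2) *\<^sub>R Pr d g q"
      by (simp add: scaleR_sum_left)
    then show ?thesis using \<mu>1[OF that(1)] by simp
  qed
  define v where "v d x = \<mu> d (1, x) *\<^sub>R \<zeta> (ix d) x" for d x
  have c1: "continuous_map X ?Q (\<lambda>x. (1, x))"
    by (intro cm_pair) (auto simp: continuous_map_in_subtopology)
  have top1: "(1, x) \<in> topspace ?Q" if "x \<in> topspace X" for x using that by simp
  have cv: "continuous_map X euclidean (v d)" if "d \<in> D" for d
  proof (rule cm_extend_zero[where U = "{x \<in> topspace X. (1, x) \<in> U (ix d)}" and C = "{x \<in> topspace X. (1, x) \<in> C d}" and \<mu> = "\<lambda>x. \<mu> d (1, x)" and g = "\<zeta> (ix d)"])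
    show "openin X {x \<in> topspace X. (1, x) \<in> U (ix d)}"
      using openin_continuous_map_preimage[OF c1 U] by simp
    show "closedin X {x \<in> topspace X. (1, x) \<in> C d}"
      using closedin_continuous_map_preimage[OF c1 C[OF that]] by simp
    show "continuous_map X euclideanreal (\<lambda>x. \<mu> d (1, x))"
      using cm_compose[OF c1 c\<mu>[OF that]] by simp
    show "continuous_map (subtopology X {x \<in> topspace X. (1, x) \<in> U (ix d)}) euclidean (\<zeta> (ix d))"
      using c\<zeta>[of "ix d"] by (rule continuous_map_from_subtopology_mono) auto
  qed (use CU[OF that] \<mu>0[OF that] in \<open>auto simp: v_def\<close>)
  have fv: "(\<Sum>e\<in>D. Pr d e (1, x) * v e x) = v d x" if "x \<in> topspace X" "d \<in> D" for x d
  proof -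
    have "Pr d e (1, x) * v e x = (\<mu> e (1, x))\<^sup>2 *\<^sub>R v d x" if e: "e \<in> D" for e
    proof (cases "\<mu> d (1, x) = 0 \<or> \<mu> e (1, x) = 0")
      case False
      then have "\<zeta> (ix d) x = z (ix d) (ix e) (1, x) * \<zeta> (ix e) x"
        using \<mu>U[OF _ top1] that \<open>x \<in> topspace X\<close> \<open>d \<in> D\<close> by (intro z\<zeta>) auto
      then show ?thesis by (simp add: Pr_def v_def power2_eq_square mult_ac)
    qed (auto simp: Pr_def v_def)
    then have "(\<Sum>e\<in>D. Pr d e (1, x) * v e x) = (\<Sum>e\<in>D. (\<mu> e (1, x))\<^sup>2) *\<^sub>R v d x"
      by (simp add: scaleR_sum_left)
    then show ?thesis using \<mu>1[OF top1[OF that(1)]] by simp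
  qed
  have \<mu>ex: "\<exists>d\<in>D. \<mu> d q \<noteq> 0" if "q \<in> topspace ?Q" for q
    using \<mu>1[OF that] by (force intro: ccontr)
  have nv: "\<exists>d\<in>D. v d x \<noteq> 0" if x: "x \<in> topspace X" for x
  proof -
    obtain d where d: "d \<in> D" "\<mu> d (1, x) \<noteq> 0" using \<mu>ex[OF top1[OF x]] by blast
    then have "norm (\<zeta> (ix d) x) = 1" using \<mu>U[OF d(1) top1[OF x] d(2)] n\<zeta> by blast
    then show ?thesis using d by (intro bexI[of _ d]) (auto simp: v_def)
  qed
  obtain w where cw: "\<And>d. d \<in> D \<Longrightarrow> continuous_map ?Q euclidean (w d)"
    and fw: "\<And>s x d. \<lbrakk>s \<in> {0..1}; x \<in> topspace X; d \<in> D\<rbrakk> \<Longrightarrow> (\<Sum>e\<in>D. Pr d e (s, x) * w e (s, x)) = w d (s, x)"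
    and nw: "\<And>s x. \<lbrakk>s \<in> {0..1}; x \<in> topspace X\<rbrakk> \<Longrightarrow> \<exists>d\<in>D. w d (s, x) \<noteq> 0"
    and w1: "\<And>x d. \<lbrakk>x \<in> topspace X; d \<in> D\<rbrakk> \<Longrightarrow> w d (1, x) = v d x"
    using idempotent_transport[OF X(1) D(1), of Pr v] cPr idem cv fv nv by auto
  \<comment> \<open>The transported vector read in the trivialization \<open>i\<close>. Since
    \<open>w\<close> lies in the range of the idempotent, it is recovered from \<theta> by
    \<open>w\<theta>\<close>, and therefore \<theta> vanishes nowhere.\<close>
  define \<theta> where "\<theta> i q = (\<Sum>e\<in>D. (if q \<in> U (ix e) then \<mu> e q *\<^sub>R z i (ix e) q else 0) * w e q)" for i q
  have z\<theta>: "\<theta> i q = z i j q * \<theta> j q" if "q \<in> U i \<inter> U j" for i j q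
    unfolding \<theta>_def sum_distrib_left
  proof (rule sum.cong[OF refl])
    fix e assume "e \<in> D"
    show "(if q \<in> U (ix e) then \<mu> e q *\<^sub>R z i (ix e) q else 0) * w e q =
      z i j q * ((if q \<in> U (ix e) then \<mu> e q *\<^sub>R z j (ix e) q else 0) * w e q)"
      using zz[of q i j "ix e"] that by (auto simp flip: mult.assoc)
  qed
  have w\<theta>: "w d q = \<mu> d q *\<^sub>R \<theta> (ix d) q" if "d \<in> D" "q \<in> topspace ?Q" for d q
  proof -
    have "w d q = (\<Sum>e\<in>D. Pr d e q * w e q)"
      using fw[of "fst q" "snd q" d] that by (cases q) simp
    also have "\<dots> = (\<Sum>e\<in>D. \<mu> d q *\<^sub>R ((if q \<in> U (ix e) then \<mu> e q *\<^sub>R z (ix d) (ix e) q else 0) * w e q))"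
      using \<mu>U[OF _ that(2)] by (intro sum.cong) (auto simp: Pr_def)
    finally show ?thesis by (simp add: \<theta>_def scaleR_right.sum)
  qed
  have n\<theta>: "\<theta> i q \<noteq> 0" if "q \<in> U i" for i q
  proof -
    have q: "q \<in> topspace ?Q" using that Usub by blast
    then obtain d where d: "d \<in> D" "w d q \<noteq> 0" using nw[of "fst q" "snd q"] by (cases q) auto
    then have "\<mu> d q \<noteq> 0" "\<theta> (ix d) q \<noteq> 0" using w\<theta>[OF d(1) q] by auto
    moreover from this have "q \<in> U (ix d)" using \<mu>U d q by blast
    ultimately show ?thesis using z\<theta>[of q "ix d" i] that by auto
  qed
  have c\<theta>: "continuous_map (subtopology ?Q (U i)) euclidean (\<theta> i)" for i
  proof -
    have "continuous_map (subtopology ?Q (U i)) euclidean (\<lambda>q. (if q \<in> U (ix e) then \<mu> e q *\<^sub>R z i (ix e) q else 0))" if e: "e \<in> D" for e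
    proof (rule cm_extend_zero[where U = "U i \<inter> U (ix e)" and C = "U i \<inter> C e" and \<mu> = "\<mu> e" and g = "z i (ix e)"])
      show "openin (subtopology ?Q (U i)) (U i \<inter> U (ix e))"
        using U openin_subtopology_Int2 by blast
      show "closedin (subtopology ?Q (U i)) (U i \<inter> C e)"
        using C[OF e] by (metis Int_commute closedin_subtopology)
      show "continuous_map (subtopology (subtopology ?Q (U i)) (U i \<inter> U (ix e))) euclidean (z i (ix e))"
        using cz[of i "ix e"] by (simp add: subtopology_subtopology)
    qed (use CU[OF e] \<mu>0[OF e] e in \<open>auto intro!: continuous_map_from_subtopology c\<mu>\<close>)
    note 1 = this
    have 2: "continuous_map (subtopology ?Q (U i)) euclidean (\<lambda>z. f z * g z)"
      if "continuous_map (subtopology ?Q (U i)) euclidean f" "continuous_map (subtopology ?Q (U i)) euclidean g"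
      for f g :: "real \<times> 'x \<Rightarrow> complex"
      using that by (simp add: continuous_map_atin tendsto_mult)
    show ?thesis
      unfolding \<theta>_def
    proof (rule continuous_map_sum[OF D(1)])
      fix e assume e: "e \<in> D"
      show "continuous_map (subtopology ?Q (U i)) euclidean
          (\<lambda>q. (if q \<in> U (ix e) then \<mu> e q *\<^sub>R z i (ix e) q else 0) * w e q)"
        by (rule 2[OF 1[OF e] continuous_map_from_subtopology[OF cw[OF e]]])
    qed
  qed
  show ?thesis
  proof (rule that[of "\<lambda>i q. sgn (\<theta> i q)"])
    show "continuous_map (subtopology ?Q (U i)) euclidean (\<lambda>q. sgn (\<theta> i q))" for i
      using n\<theta> by (intro cm_sgn c\<theta>) auto
    show "norm (sgn (\<theta> i q)) = 1" if "q \<in> U i" for i q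
      using n\<theta>[OF that] by (simp add: norm_sgn)
    show "sgn (\<theta> i q) = z i j q * sgn (\<theta> j q)" if "q \<in> U i \<inter> U j" for i j q
      using z\<theta>[OF that] nz[OF that] by (simp add: sgn_mult sgn_of_unit)
    show "sgn (\<theta> i (1, x)) = \<zeta> i x" if i: "(1, x) \<in> U i" for i x
    proof -
      have x: "x \<in> topspace X" using i Usub by force
      have "\<theta> i (1, x) = (\<Sum>e\<in>D. (\<mu> e (1, x))\<^sup>2 *\<^sub>R \<zeta> i x)"
        unfolding \<theta>_def
      proof (rule sum.cong[OF refl])
        fix e assume e: "e \<in> D"
        show "(if (1, x) \<in> U (ix e) then \<mu> e (1, x) *\<^sub>R z i (ix e) (1, x) else 0) * w e (1, x) = (\<mu> e (1, x))\<^sup>2 *\<^sub>R \<zeta> i x"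
          using \<mu>U[OF e top1[OF x]] z\<zeta>[of x i "ix e"] i w1[OF x e]
          by (auto simp: v_def power2_eq_square)
      qed
      then have "\<theta> i (1, x) = \<zeta> i x"
        using \<mu>1[OF top1[OF x]] by (simp flip: scaleR_sum_left)
      then show ?thesis using n\<zeta>[OF i] by (simp add: sgn_of_unit)
    qed
  qed
qed

section \<open>Skew-adjoint complex structures on a four-dimensional space\<close>

type_synonym endo = "real^4 \<Rightarrow> real^4"

abbreviation trace_of :: "endo \<Rightarrow> real" where
  "trace_of A \<equiv> trace (matrix A)"

lemma trace_of_comp_commute:
  assumes "linear A" "linear B"
  shows "trace_of (A \<circ> B) = trace_of (B \<circ> A)"
  unfolding matrix_compose[OF assms(2,1)] matrix_compose[OF assms] by (rule trace_mul_sym)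

lemma trace_of_add: "trace_of (\<lambda>u. A u + B u) = trace_of A + trace_of B"
  by (simp add: trace_def matrix_def sum.distrib)

lemma trace_of_scaleR: "trace_of (\<lambda>u. c *\<^sub>R A u) = c * trace_of A"
  by (simp add: trace_def matrix_def sum_distrib_left)

lemma trace_of_id: "trace_of (\<lambda>u. u) = 4"
  by (simp add: trace_def matrix_def sum_4)

lemma endo_inner_trace: "endo_inner A B = - trace_of (\<lambda>u. A (B u)) / 4"
  by (simp add: endo_inner_def o_def)

lemma endo_inner_commute:
  assumes "linear A" "linear B"
  shows "endo_inner A B = endo_inner B A"
  using trace_of_comp_commute[OF assms] by (simp add: endo_inner_def)

lemma endo_inner_add_left: "endo_inner (\<lambda>u. A u + B u) C = endo_inner A C + endo_inner B C"
  using trace_of_add[of "\<lambda>u. A (C u)" "\<lambda>u. B (C u)"] by (simp add: endo_inner_trace field_simps)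

lemma endo_inner_scaleR_left: "endo_inner (\<lambda>u. c *\<^sub>R A u) C = c * endo_inner A C"
  using trace_of_scaleR[of c "\<lambda>u. A (C u)"] by (simp add: endo_inner_trace)

lemma endo_inner_components:
  assumes "linear A" "linear B"
  shows "endo_inner A B = - (\<Sum>i\<in>UNIV. \<Sum>j\<in>UNIV. A (axis j 1) $ i * B (axis i 1) $ j) / 4"
  unfolding endo_inner_def matrix_compose[OF assms(2,1)] by (simp add: trace_def matrix_matrix_mult_def matrix_def)

text \<open>Cyclicity of the trace. Components in two charts are conjugate by the transition map, so
  this is the chart independence of the inner product of endomorphism fields.\<close>

lemma endo_inner_conjugate:
  assumes "linear A" "linear B" "linear D" "linear D'" "\<And>u. D' (D u) = u"
  shows "endo_inner (\<lambda>u. D (A (D' u))) (\<lambda>u. D (B (D' u))) = endo_inner A B"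
proof -
  have "trace_of (D \<circ> (A \<circ> B \<circ> D')) = trace_of ((A \<circ> B \<circ> D') \<circ> D)"
    using assms by (intro trace_of_comp_commute linear_compose) auto
  moreover have "(A \<circ> B \<circ> D') \<circ> D = A \<circ> B" using assms(5) by auto
  moreover have "D \<circ> (A \<circ> B \<circ> D') = (\<lambda>u. D (A (D' u))) \<circ> (\<lambda>u. D (B (D' u)))"
    using assms(5) by auto
  ultimately show ?thesis by (simp add: endo_inner_def)
qed

text \<open>The composition \<open>B \<circ> A \<circ> B\<close> equals \<open>A\<close>, while by
  cyclicity it has the trace of \<open>A \<circ> B \<circ> B\<close>, which is minus
  \<open>A\<close>.\<close>

lemma trace_of_anticommute:
  assumes "linear A" "linear B" "\<And>u. B (B u) = - u" "\<And>u. A (B u) = - B (A u)"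
  shows "trace_of A = 0"
proof -
  have "trace_of ((A \<circ> B) \<circ> B) = trace_of (B \<circ> (A \<circ> B))"
    using assms by (intro trace_of_comp_commute linear_compose) auto
  moreover have "(A \<circ> B) \<circ> B = (\<lambda>u. (-1) *\<^sub>R A u)"
    using assms by (auto simp: linear_neg)
  moreover have "B \<circ> (A \<circ> B) = A"
    using assms by (auto simp: linear_neg)
  ultimately show ?thesis using trace_of_scaleR[of "-1" A] by simp
qed

text \<open>\<open>I\<close>, \<open>E\<close> and \<open>I \<circ> E\<close> satisfy the relations
  of the quaternion units, so that \<open>quat_comb I E v\<close> below is the action of the
  imaginary quaternion with coordinates \<open>v\<close>.\<close>

definition quat_units :: "endo \<Rightarrow> endo \<Rightarrow> bool" where
  "quat_units I E \<longleftrightarrow> linear I \<and> linear E \<and> (\<forall>u. I (I u) = - u) \<and> (\<forall>u. E (E u) = - u) \<and> (\<forall>u. E (I u) = - I (E u))"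

definition quat_comb :: "endo \<Rightarrow> endo \<Rightarrow> real^3 \<Rightarrow> endo" where
  "quat_comb I E v = (\<lambda>u. v $ 1 *\<^sub>R I u + v $ 2 *\<^sub>R E u + v $ 3 *\<^sub>R I (E u))"

lemma linear_quat_comb:
  assumes "quat_units I E"
  shows "linear (quat_comb I E v)"
proof -
  have "linear I" "linear E" using assms by (auto simp: quat_units_def)
  then show ?thesis
    using linear_compose[of E I]
    by (simp add: quat_comb_def o_def linear_compose_add linear_compose_scale_right)
qed

text \<open>The product rule of imaginary quaternions. It makes unit vectors into complex structures
  and translates composition into \<open>cross3\<close>.\<close>

lemma quat_comb_comp:
  assumes "quat_units I E"
  shows "quat_comb I E v (quat_comb I E w u) = - (v \<bullet> w) *\<^sub>R u + quat_comb I E (cross3 v w) u"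
proof -
  have l: "linear I" "linear E" and r: "\<And>u. I (I u) = - u" "\<And>u. E (E u) = - u" "\<And>u. E (I u) = - I (E u)"
    using assms by (auto simp: quat_units_def)
  have "quat_comb I E v (quat_comb I E w u) =
    v $ 1 *\<^sub>R (w $ 1 *\<^sub>R (- u) + w $ 2 *\<^sub>R I (E u) + w $ 3 *\<^sub>R (- E u)) +
    v $ 2 *\<^sub>R (w $ 1 *\<^sub>R (- I (E u)) + w $ 2 *\<^sub>R (- u) + w $ 3 *\<^sub>R I u) +
    v $ 3 *\<^sub>R (w $ 1 *\<^sub>R E u + w $ 2 *\<^sub>R (- I u) + w $ 3 *\<^sub>R (- u))"
    unfolding quat_comb_def
    by (simp add: linear_add[OF l(1)] linear_add[OF l(2)] linear_cmul[OF l(1)] linear_cmul[OF l(2)]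
        linear_neg[OF l(1)] linear_neg[OF l(2)] linear_diff[OF l(1)] linear_diff[OF l(2)] r)
  also have "\<dots> = - (v \<bullet> w) *\<^sub>R u + quat_comb I E (cross3 v w) u"
    by (simp add: quat_comb_def cross3_def inner_vec_def sum_3 vec_eq_iff) (simp add: algebra_simps)
  finally show ?thesis .
qed

lemma trace_of_quat_comb:
  assumes "quat_units I E"
  shows "trace_of (quat_comb I E x) = 0"
proof -
  have q: "linear I" "linear E" "\<And>u. I (I u) = - u" "\<And>u. E (E u) = - u" "\<And>u. E (I u) = - I (E u)"
    using assms by (auto simp: quat_units_def)
  have t: "trace_of I = 0" "trace_of E = 0" "trace_of (\<lambda>u. I (E u)) = 0"
    using q linear_compose[OF q(2,1)] by (auto intro!: trace_of_anticommute[of _ I] trace_of_anticommute[of I E] simp: o_def linear_neg)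
  show ?thesis
    unfolding quat_comb_def by (simp add: trace_of_add trace_of_scaleR t)
qed

text \<open>In the product only the scalar part has a trace, namely 4 times its coefficient, which
  the factor in \<open>endo_inner\<close> cancels. Questions about structures thus become questions
  about vectors in three-space.\<close>

lemma endo_inner_quat_comb:
  assumes "quat_units I E"
  shows "endo_inner (quat_comb I E v) (quat_comb I E w) = v \<bullet> w"
  unfolding endo_inner_trace quat_comb_comp[OF assms] trace_of_add trace_of_scaleR trace_of_id
  by (simp add: trace_of_quat_comb[OF assms])

lemma quat_comb_axis:
  "quat_comb I E (axis 1 1) = I" "quat_comb I E (axis 2 1) = E" "quat_comb I E (axis 3 1) = (\<lambda>u. I (E u))"
  by (auto simp: quat_comb_def axis_def)

lemma quat_comb_scaleR: "quat_comb I E (c *\<^sub>R v) u = c *\<^sub>R quat_comb I E v u"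
  by (simp add: quat_comb_def scaleR_add_right)

lemma quat_comb_coords:
  assumes "quat_units I E"
  shows "v = vector [endo_inner (quat_comb I E v) I, endo_inner (quat_comb I E v) E, endo_inner (quat_comb I E v) (\<lambda>u. I (E u))]"
proof -
  have "endo_inner (quat_comb I E v) I = v $ 1" "endo_inner (quat_comb I E v) E = v $ 2"
    "endo_inner (quat_comb I E v) (\<lambda>u. I (E u)) = v $ 3"
    using endo_inner_quat_comb[OF assms, of v "axis 1 1"] endo_inner_quat_comb[OF assms, of v "axis 2 1"]
      endo_inner_quat_comb[OF assms, of v "axis 3 1"]
    by (simp_all only: quat_comb_axis) (simp_all add: inner_axis)
  then show ?thesis by (simp add: vec_eq_iff forall_3)
qed

text \<open>The counterpart of \<open>frame_coords\<close> on coordinate vectors, with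
  \<open>cross3 k a\<close> in place of \<open>K \<circ> J\<close>.\<close>

definition sphere_coords :: "real^3 \<Rightarrow> real^3 \<Rightarrow> real^3 \<Rightarrow> real^3" where
  "sphere_coords a c v = (let k = sgn (c - (c \<bullet> a) *\<^sub>R a) in vector [v \<bullet> a, v \<bullet> k, v \<bullet> cross3 k a])"

text \<open>The scalar part of \<open>K \<circ> J\<close> pairs to zero with every quaternionic
  combination, because these are trace-free; what remains of the composition has coordinates
  \<open>cross3 k a\<close>.\<close>

lemma frame_coords_quat_comb:
  assumes q: "quat_units I E"
  shows "frame_coords (quat_comb I E a) (quat_comb I E c) (quat_comb I E v) = sphere_coords a c v"
proof -
  let ?Q = "quat_comb I E" and ?k = "sgn (c - (c \<bullet> a) *\<^sub>R a)"
  have P: "(\<lambda>u. ?Q c u - (c \<bullet> a) *\<^sub>R ?Q a u) = ?Q (c - (c \<bullet> a) *\<^sub>R a)"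
    by (auto simp: quat_comb_def algebra_simps)
  have K: "(\<lambda>u. (1 / sqrt (w \<bullet> w)) *\<^sub>R ?Q w u) = ?Q (sgn w)" for w
    unfolding sgn_div_norm quat_comb_scaleR by (simp add: norm_eq_sqrt_inner inverse_eq_divide)
  have KJ: "endo_inner (?Q v) (?Q k \<circ> ?Q a) = v \<bullet> cross3 k a" for k
  proof -
    have "?Q k \<circ> ?Q a = (\<lambda>u. (- (k \<bullet> a)) *\<^sub>R u + ?Q (cross3 k a) u)"
      by (auto simp: quat_comb_comp[OF q])
    moreover have "endo_inner (?Q v) (\<lambda>u. (- (k \<bullet> a)) *\<^sub>R u + ?Q (cross3 k a) u) =
        endo_inner (\<lambda>u. (- (k \<bullet> a)) *\<^sub>R u + ?Q (cross3 k a) u) (?Q v)"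
      by (intro endo_inner_commute linear_quat_comb[OF q] linear_compose_add linear_compose_scale_right linear_ident)
    moreover have "endo_inner (\<lambda>u. u) (?Q v) = 0"
    proof -
      have "trace_of I = 0" "trace_of E = 0" "trace_of (\<lambda>u. I (E u)) = 0"
        using trace_of_quat_comb[OF q, of "axis 1 1"] trace_of_quat_comb[OF q, of "axis 2 1"] trace_of_quat_comb[OF q, of "axis 3 1"]
        by (simp_all add: quat_comb_axis)
      then show ?thesis by (simp add: endo_inner_trace trace_of_quat_comb[OF q])
    qed
    ultimately show ?thesis
      by (simp only: endo_inner_add_left endo_inner_scaleR_left endo_inner_quat_comb[OF q]) (simp add: inner_commute)
  qed
  have 1: "endo_inner (?Q (c - (c \<bullet> a) *\<^sub>R a)) (?Q (c - (c \<bullet> a) *\<^sub>R a)) = (c - (c \<bullet> a) *\<^sub>R a) \<bullet> (c - (c \<bullet> a) *\<^sub>R a)"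
    by (rule endo_inner_quat_comb[OF q])
  show ?thesis
    unfolding frame_coords_def sphere_coords_def Let_def endo_inner_quat_comb[OF q, of c a] P 1 K KJ endo_inner_quat_comb[OF q] ..
qed

lemma norm_sphere_coords:
  assumes a: "norm a = 1" and v: "norm v = 1" and ne: "c - (c \<bullet> a) *\<^sub>R a \<noteq> 0"
  shows "norm (sphere_coords a c v) = 1"
proof -
  define k where "k = sgn (c - (c \<bullet> a) *\<^sub>R a)"
  have aa: "a \<bullet> a = 1" and vv: "v \<bullet> v = 1" using a v norm_eq_1 by blast+
  have kk: "k \<bullet> k = 1" using ne norm_sgn[of "c - (c \<bullet> a) *\<^sub>R a"] norm_eq_1[of k] by (simp add: k_def)
  have ka: "k \<bullet> a = 0" using aa by (simp add: k_def sgn_div_norm inner_diff_left)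
  have "(v \<bullet> a)\<^sup>2 + (v \<bullet> k)\<^sup>2 + (v \<bullet> cross3 k a)\<^sup>2 = v \<bullet> v"
  proof -
    define p q r where "p = v \<bullet> a" "q = v \<bullet> k" "r = v \<bullet> cross3 k a"
    \<comment> \<open>The Gram determinant of \<open>v\<close>, \<open>k\<close>, \<open>a\<close>
      is the square of their triple product; for orthonormal \<open>k\<close> and \<open>a\<close>
      this becomes Parseval's identity.\<close>
    have "(v \<bullet> v) * ((k \<bullet> k) * (a \<bullet> a) - (k \<bullet> a)\<^sup>2) =
        (v \<bullet> a)\<^sup>2 * (k \<bullet> k) + (v \<bullet> k)\<^sup>2 * (a \<bullet> a) - 2 * (v \<bullet> a) * (v \<bullet> k) * (k \<bullet> a) + (v \<bullet> cross3 k a)\<^sup>2"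
      by (simp add: cross3_def inner_vec_def sum_3) algebra
    then show ?thesis using aa kk ka by simp
  qed
  then show ?thesis
    unfolding sphere_coords_def Let_def k_def[symmetric] norm_eq_1 inner_vec_def[of "vector _"] sum_3
    using vv by (simp add: power2_eq_square)
qed

lemma sphere_coords_self:
  assumes "norm a = 1"
  shows "sphere_coords a c a = axis 1 1"
proof -
  have "a \<bullet> a = 1" using assms norm_eq_1 by blast
  moreover have "a \<bullet> cross3 k a = 0" for k using dot_cross_self by (simp add: inner_commute)
  ultimately show ?thesis
    by (simp add: sphere_coords_def Let_def vec_eq_iff forall_3 axis_def sgn_div_norm inner_diff_right inner_commute)
qed

section \<open>Antilinear skew endomorphisms of a hermitian space\<close>

locale hermitian =
  fixes g :: "real^4 \<Rightarrow> real^4 \<Rightarrow> real" and J :: endo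
  assumes bil: "bilinear g" and sym: "g u v = g v u" and pos: "u \<noteq> 0 \<Longrightarrow> g u u > 0"
    and linJ: "linear J" and JJ: "J (J u) = - u" and skewJ: "g (J u) v = - g u (J v)"
begin

lemmas g_simps = bilinear_ladd[OF bil] bilinear_radd[OF bil] bilinear_lmul[OF bil] bilinear_rmul[OF bil]
  bilinear_lneg[OF bil] bilinear_rneg[OF bil] bilinear_lzero[OF bil] bilinear_rzero[OF bil]
  bilinear_lsub[OF bil] bilinear_rsub[OF bil]

lemmas J_simps = linear_add[OF linJ] linear_cmul[OF linJ] linear_neg[OF linJ] linear_0[OF linJ] linear_diff[OF linJ] JJ

lemma gJJ: "g (J u) (J v) = g u v"
  by (simp add: skewJ JJ g_simps)

lemma gJ_self: "g u (J u) = 0" "g (J u) u = 0"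
  using skewJ[of u u] sym[of "J u" u] by auto

lemma g_eq_0: "g u u = 0 \<longleftrightarrow> u = 0"
  using pos[of u] by (cases "u = 0") (auto simp: g_simps)

text \<open>Pairing with \<open>w i\<close> shows that the combinations of the \<open>w i\<close>
  are independent; being four, they span, and the same pairing gives the coefficients.\<close>

lemma orthogonal_expansion:
  fixes w :: "4 \<Rightarrow> real^4"
  assumes "\<And>i. w i \<noteq> 0" and "\<And>i j. i \<noteq> j \<Longrightarrow> g (w i) (w j) = 0"
  shows "u = (\<Sum>i\<in>UNIV. (g u (w i) / g (w i) (w i)) *\<^sub>R w i)"
proof -
  define P where "P x = (\<Sum>i\<in>UNIV. x $ i *\<^sub>R w i)" for x :: "real^4"
  have lin: "linear P"
    by (auto simp: linear_iff P_def sum.distrib scaleR_add_left scaleR_sum_right)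
  have gP: "g (P x) (w i) = x $ i * g (w i) (w i)" for x i
  proof -
    have "g (P x) (w i) = (\<Sum>j\<in>UNIV. x $ j * g (w j) (w i))"
      by (simp add: P_def sum_4 g_simps)
    also have "\<dots> = (\<Sum>j\<in>UNIV. if j = i then x $ i * g (w i) (w i) else 0)"
      using assms(2) by (intro sum.cong) auto
    finally show ?thesis by simp
  qed
  have "inj P"
    unfolding linear_injective_0[OF lin]
  proof (intro allI impI)
    fix x assume "P x = 0"
    then have "x $ i = 0" for i using gP[of x i] assms(1)[of i] by (simp add: g_simps g_eq_0)
    then show "x = 0" by (simp add: vec_eq_iff)
  qed
  then have "surj P" by (intro linear_injective_imp_surjective[OF lin]) auto
  then obtain x where x: "u = P x" by blast
  have "x $ i = g u (w i) / g (w i) (w i)" for i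
    using gP[of x i] assms(1)[of i] by (simp add: x g_eq_0)
  moreover have "u = (\<Sum>i\<in>UNIV. x $ i *\<^sub>R w i)" by (simp add: x P_def)
  ultimately show ?thesis by presburger
qed

text \<open>In dimension four these are the elements orthogonal to \<open>J\<close> in the
  rank-three fibre of the twistor bundle: a plane in which composition with \<open>J\<close> is
  rotation by a right angle, hence a complex line.\<close>

definition antilinear_skew :: "endo \<Rightarrow> bool" where
  "antilinear_skew A \<longleftrightarrow> linear A \<and> (\<forall>u v. g (A u) v = - g u (A v)) \<and> (\<forall>u. A (J u) = - J (A u))"

lemma antilinear_skewD:
  assumes "antilinear_skew A"
  shows "linear A" "g (A u) v = - g u (A v)" "A (J u) = - J (A u)" "g u (A u) = 0" "g (A u) u = 0"
    "g u (J (A u)) = 0" "g (J u) (A u) = 0" "g (A u) (J u) = 0"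
proof -
  have *: "linear A" "g (A u) v = - g u (A v)" "A (J u) = - J (A u)" for u v
    using assms by (auto simp: antilinear_skew_def)
  show "linear A" "g (A u) v = - g u (A v)" "A (J u) = - J (A u)" by (fact *)+
  show 0: "g u (A u) = 0" "g (A u) u = 0" using *(2)[of u u] sym[of "A u" u] by auto
  have "g (A u) (J u) = - g u (A (J u))" by (rule *(2))
  also have "\<dots> = g u (J (A u))" by (simp add: *(3) g_simps)
  also have "\<dots> = - g (J u) (A u)" by (simp add: skewJ)
  finally show "g u (J (A u)) = 0" "g (J u) (A u) = 0" "g (A u) (J u) = 0"
    using sym[of "A u" "J u"] skewJ[of u "A u"] by auto
qed

lemma antilinear_skew_add: "antilinear_skew A \<Longrightarrow> antilinear_skew B \<Longrightarrow> antilinear_skew (\<lambda>u. A u + B u)"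
  by (auto simp: antilinear_skew_def g_simps J_simps linear_compose_add)

lemma antilinear_skew_scaleR: "antilinear_skew A \<Longrightarrow> antilinear_skew (\<lambda>u. c *\<^sub>R A u)"
  by (auto simp: antilinear_skew_def g_simps J_simps linear_compose_scale_right)

lemma antilinear_skew_J: "antilinear_skew A \<Longrightarrow> antilinear_skew (\<lambda>u. J (A u))"
  using linear_compose[OF _ linJ, of A] by (auto simp: antilinear_skew_def g_simps J_simps skewJ o_def linear_neg)

text \<open>If \<open>A v\<close> is nonzero, then \<open>v\<close>, \<open>J v\<close>,
  \<open>A v\<close>, \<open>J (A v)\<close> is an orthogonal basis, since skewness and
  antilinearity annihilate all mixed products. On this basis the square of \<open>A\<close> is
  multiplication by \<open>- (g w w / g v v)\<close> with \<open>w = A v\<close>, and the trace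
  identifies the constant.\<close>

lemma antilinear_skew_square:
  assumes A: "antilinear_skew A"
  shows "A (A u) = - endo_inner A A *\<^sub>R u"
    and "endo_inner A A \<ge> 0"
    and "v \<noteq> 0 \<Longrightarrow> A v \<noteq> 0 \<Longrightarrow> endo_inner A A > 0"
proof -
  note D = antilinear_skewD[OF A]
  have "\<exists>c\<ge>0. (\<forall>u. A (A u) = - c *\<^sub>R u) \<and> ((\<exists>v. A v \<noteq> 0) \<longrightarrow> c > 0)"
  proof (cases "\<exists>v. A v \<noteq> 0")
    case False
    then show ?thesis by (intro exI[of _ 0]) (auto simp: linear_0)
  next
    case True
    then obtain v where v: "A v \<noteq> 0" by blast
    then have v0: "v \<noteq> 0" using linear_0[OF D(1)] by auto
    define w where "w = A v"
    define b :: "4 \<Rightarrow> real^4" where "b i = (if i = 1 then v else if i = 2 then J v else if i = 3 then w else J w)" for i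
    have J0: "J x \<noteq> 0" if "x \<noteq> 0" for x using that JJ[of x] linear_0[OF linJ] by (metis neg_equal_0_iff_equal)
    have n: "b i \<noteq> 0" for i using v0 v J0 by (auto simp: b_def w_def)
    have gvw: "g v w = 0" "g v (J w) = 0" "g (J v) w = 0" "g (J v) (J w) = 0" "g w v = 0" "g w (J v) = 0" "g (J w) v = 0" "g (J w) (J v) = 0"
      using D(4-8)[of v] by (simp_all add: w_def gJJ sym[of "J (A v)" v])
    have o: "g (b i) (b j) = 0" if "i \<noteq> j" for i j
      using that gvw gJ_self[of v] gJ_self[of w] exhaust_4[of i] exhaust_4[of j] by (auto simp: b_def)
    have ex: "x = (g x v / g v v) *\<^sub>R v + (g x (J v) / g v v) *\<^sub>R J v + (g x w / g w w) *\<^sub>R w + (g x (J w) / g w w) *\<^sub>R J w" for x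
      using orthogonal_expansion[of b x, OF n o] by (simp add: sum_4 b_def gJJ)
    define c where "c = g w w / g v v"
    have c: "c > 0" using pos v v0 by (simp add: c_def w_def)
    have "g (A w) (J w) = 0" "g (A w) w = 0" using D(5,8)[of w] by auto
    moreover have "g (A w) v = - g w w" by (simp add: D(2) w_def)
    moreover have "g (A w) (J v) = 0" using gJ_self[of w] by (simp add: D(2,3) w_def[symmetric] g_simps)
    ultimately have Aw: "A w = - c *\<^sub>R v" using ex[of "A w"] by (simp add: c_def)
    have AA: "A (A v) = - c *\<^sub>R v" "A (A (J v)) = - c *\<^sub>R J v" "A (A w) = - c *\<^sub>R w" "A (A (J w)) = - c *\<^sub>R J w"
      using Aw by (simp_all add: D(3) J_simps linear_neg[OF D(1)] linear_cmul[OF D(1)] flip: w_def)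
    have "A (A x) = - c *\<^sub>R x" for x
    proof -
      define p q r s where "p = g x v / g v v" "q = g x (J v) / g v v" "r = g x w / g w w" "s = g x (J w) / g w w"
      have x: "x = p *\<^sub>R v + q *\<^sub>R J v + r *\<^sub>R w + s *\<^sub>R J w" using ex[of x] by (simp add: p_q_r_s_def)
      show ?thesis unfolding x
        by (simp only: linear_add[OF D(1)] linear_cmul[OF D(1)] AA) (simp add: algebra_simps)
    qed
    then show ?thesis using c by (intro exI[of _ c]) auto
  qed
  then obtain c where c: "c \<ge> 0" "\<And>u. A (A u) = - c *\<^sub>R u" "(\<exists>v. A v \<noteq> 0) \<Longrightarrow> c > 0" by blast
  have "endo_inner A A = c"
    using trace_of_scaleR[of "-c" "\<lambda>u. u"] by (simp add: endo_inner_trace c(2) trace_of_id)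
  then show "A (A u) = - endo_inner A A *\<^sub>R u" "endo_inner A A \<ge> 0" "v \<noteq> 0 \<Longrightarrow> A v \<noteq> 0 \<Longrightarrow> endo_inner A A > 0"
    using c by auto
qed

text \<open>The square formula for \<open>A + B\<close>, minus those for \<open>A\<close> and for
  \<open>B\<close>. Orthogonal elements therefore anticommute.\<close>

lemma antilinear_skew_polarize:
  assumes A: "antilinear_skew A" and B: "antilinear_skew B"
  shows "A (B u) + B (A u) = - (2 * endo_inner A B) *\<^sub>R u"
proof -
  note l = antilinear_skewD(1)[OF A] antilinear_skewD(1)[OF B]
  have ls: "linear (\<lambda>u. A u + B u)" using l by (intro linear_compose_add)
  have e: "endo_inner (\<lambda>u. A u + B u) (\<lambda>u. A u + B u) = endo_inner A A + 2 * endo_inner A B + endo_inner B B"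
    using endo_inner_commute[OF l(1) ls] endo_inner_commute[OF l(2) ls] endo_inner_commute[OF l]
    by (simp add: endo_inner_add_left)
  have "A (A u) + A (B u) + (B (A u) + B (B u)) = - endo_inner (\<lambda>u. A u + B u) (\<lambda>u. A u + B u) *\<^sub>R u"
    using antilinear_skew_square(1)[OF antilinear_skew_add[OF A B], of u] by (simp add: linear_add[OF l(1)] linear_add[OF l(2)])
  then have "A (B u) + B (A u) = - endo_inner (\<lambda>u. A u + B u) (\<lambda>u. A u + B u) *\<^sub>R u - A (A u) - B (B u)"
    by (simp add: algebra_simps)
  then show ?thesis
    unfolding antilinear_skew_square(1)[OF A] antilinear_skew_square(1)[OF B] e by (simp add: algebra_simps)
qed

text \<open>A rotation-invariant way of writing the antilinear skew part of \<open>a \<and> b\<close>.\<close>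

definition skew_of :: "real^4 \<Rightarrow> real^4 \<Rightarrow> endo" where
  "skew_of a b x = g a x *\<^sub>R b - g b x *\<^sub>R a - g (J a) x *\<^sub>R J b + g (J b) x *\<^sub>R J a"

lemma antilinear_skew_skew_of: "antilinear_skew (skew_of a b)"
  unfolding antilinear_skew_def
proof (intro conjI allI)
  show "linear (skew_of a b)"
    by (auto simp: linear_iff skew_of_def g_simps J_simps algebra_simps)
  fix u v
  show "g (skew_of a b u) v = - g u (skew_of a b v)"
    by (simp add: skew_of_def g_simps sym[of u a] sym[of u b] sym[of u "J a"] sym[of u "J b"])
  have "g a (J u) = - g (J a) u" "g b (J u) = - g (J b) u"
    by (simp_all add: skewJ)
  then show "skew_of a b (J u) = - J (skew_of a b u)"
    by (simp add: skew_of_def J_simps gJJ)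
qed

text \<open>If all of these vanished, every coordinate vector would lie in the span of
  \<open>a\<close> and \<open>J a\<close>, whose dimension is at most 2. The nonzero element is the
  seed of the local frames.\<close>

lemma exists_skew_of_nonzero: "\<exists>i. skew_of (axis 1 1) (axis i 1) (axis 1 1) \<noteq> 0"
proof (rule ccontr)
  assume *: "\<not> ?thesis"
  define a :: "real^4" where "a = axis 1 1"
  have a: "g a a > 0" using pos[of a] by (simp add: a_def)
  have "axis i 1 \<in> span {a, J a}" for i
  proof -
    have "skew_of a (axis i 1) a = 0" using * by (simp add: a_def)
    then have "g a a *\<^sub>R axis i 1 = g (axis i 1) a *\<^sub>R a - g (J (axis i 1)) a *\<^sub>R J a"
      by (simp add: skew_of_def gJ_self algebra_simps)
    then have "g a a *\<^sub>R (axis i 1 :: real^4) \<in> span {a, J a}"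
      by (simp add: span_base span_mul span_diff)
    then have "(1 / g a a) *\<^sub>R g a a *\<^sub>R (axis i 1 :: real^4) \<in> span {a, J a}" by (rule span_mul)
    then show ?thesis using a by simp
  qed
  then have "Basis \<subseteq> span {a, J a}" by (auto simp: Basis_vec_def)
  then have "span Basis \<subseteq> span {a, J a}" using span_minimal subspace_span by blast
  then have "dim (UNIV :: (real^4) set) \<le> card {a, J a}"
    by (intro dim_le_card) auto
  also have "\<dots> \<le> 2" by (simp add: card_insert_if)
  finally show False by simp
qed

lemma antilinear_skew_normalize:
  assumes A: "antilinear_skew A" and v: "A v \<noteq> 0"
  defines "E \<equiv> \<lambda>u. (1 / sqrt (endo_inner A A)) *\<^sub>R A u"
  shows "antilinear_skew E" "E (E u) = - u"
proof -
  have "v \<noteq> 0" using v linear_0[OF antilinear_skewD(1)[OF A]] by auto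
  then have p: "endo_inner A A > 0" using antilinear_skew_square(3)[OF A] v by blast
  show "antilinear_skew E" unfolding E_def by (rule antilinear_skew_scaleR[OF A])
  have "E (E u) = (1 / sqrt (endo_inner A A))\<^sup>2 *\<^sub>R A (A u)"
    by (simp add: E_def linear_cmul[OF antilinear_skewD(1)[OF A]] power2_eq_square)
  then show "E (E u) = - u"
    using p by (simp add: antilinear_skew_square(1)[OF A] power_divide)
qed

end

section \<open>Quaternionic frames: oriented planes and self-dual parts of two-forms\<close>

locale hermitian_frame = hermitian +
  fixes E :: endo
  assumes E: "antilinear_skew E" and EE: "E (E u) = - u"
begin

lemmas linE = antilinear_skewD(1)[OF E]
lemmas skewE = antilinear_skewD(2)[OF E]
lemmas EJ = antilinear_skewD(3)[OF E]
lemmas E_simps = linear_add[OF linE] linear_cmul[OF linE] linear_neg[OF linE] linear_0[OF linE] linear_diff[OF linE] EE EJ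

lemma quat_units: "quat_units J E"
  by (simp add: quat_units_def linJ linE JJ EE EJ)

lemma gEE: "g (E u) (E v) = g u v"
  by (simp add: skewE EE g_simps)

text \<open>\<open>J\<close> and \<open>E\<close> are isometries and anticommute, so
  \<open>u\<close>, \<open>J u\<close>, \<open>E u\<close>, \<open>J (E u)\<close> are orthogonal
  and equally long.\<close>

lemma frame_expansion:
  assumes u: "u \<noteq> 0"
  shows "x = (g x u / g u u) *\<^sub>R u + (g x (J u) / g u u) *\<^sub>R J u + (g x (E u) / g u u) *\<^sub>R E u + (g x (J (E u)) / g u u) *\<^sub>R J (E u)"
proof -
  define b :: "4 \<Rightarrow> real^4" where "b i = (if i = 1 then u else if i = 2 then J u else if i = 3 then E u else J (E u))" for i
  have bb: "g (b i) (b i) = g u u" for i by (simp add: b_def gJJ gEE)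
  then have n: "b i \<noteq> 0" for i using pos[OF u] by (metis g_eq_0 less_irrefl)
  have 1: "g u (E u) = 0" "g u (J (E u)) = 0" "g (J u) (E u) = 0" "g (J u) (J (E u)) = 0"
    using antilinear_skewD(4-8)[OF E, of u] by (simp_all add: gJJ)
  have "g (b i) (b j) = 0" if "i \<noteq> j" for i j
    using that 1 1[THEN trans[OF sym]] gJ_self[of u] gJ_self[of "E u"] exhaust_4[of i] exhaust_4[of j]
    by (auto simp: b_def)
  from orthogonal_expansion[of b x, OF n this] show ?thesis
    by (simp add: sum_4 bb) (simp add: b_def)
qed

lemma g_expansion:
  "g u u * g x x = (g x u)\<^sup>2 + (g x (J u))\<^sup>2 + (g x (E u))\<^sup>2 + (g x (J (E u)))\<^sup>2"
proof (cases "u = 0")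
  case True
  then show ?thesis by (simp add: g_simps J_simps E_simps)
next
  case False
  define p q r s where "p = g x u" "q = g x (J u)" "r = g x (E u)" "s = g x (J (E u))"
  have "g x x = g x ((p / g u u) *\<^sub>R u + (q / g u u) *\<^sub>R J u + (r / g u u) *\<^sub>R E u + (s / g u u) *\<^sub>R J (E u))"
    using frame_expansion[OF False, of x] by (simp add: p_q_r_s_def)
  also have "\<dots> = (p\<^sup>2 + q\<^sup>2 + r\<^sup>2 + s\<^sup>2) / g u u"
    by (simp add: g_simps power2_eq_square add_divide_distrib flip: p_q_r_s_def)
  finally show ?thesis using pos[OF False] by (simp add: p_q_r_s_def field_simps)
qed

text \<open>The remainder \<open>D\<close> is orthogonal to \<open>E\<close> and to
  \<open>J \<circ> E\<close>, hence anticommutes with both by polarization. But it also anticommutes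
  with \<open>J\<close>, so it commutes with \<open>J \<circ> E\<close> as well, which leaves only
  zero.\<close>

lemma antilinear_skew_expansion:
  assumes A: "antilinear_skew A"
  shows "A u = endo_inner A E *\<^sub>R E u + endo_inner A (\<lambda>u. J (E u)) *\<^sub>R J (E u)"
proof -
  define x y where "x = endo_inner A E" "y = endo_inner A (\<lambda>u. J (E u))"
  define D where "D u = A u + (- x) *\<^sub>R E u + (- y) *\<^sub>R J (E u)" for u
  note JE = antilinear_skew_J[OF E]
  have D: "antilinear_skew D"
    unfolding D_def by (intro antilinear_skew_add antilinear_skew_scaleR A E JE)
  have e: "endo_inner D B = endo_inner A B + (- x) * endo_inner E B + (- y) * endo_inner (\<lambda>u. J (E u)) B" for B
    unfolding D_def endo_inner_add_left endo_inner_scaleR_left ..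
  have o: "endo_inner E E = 1" "endo_inner (\<lambda>u. J (E u)) E = 0" "endo_inner E (\<lambda>u. J (E u)) = 0" "endo_inner (\<lambda>u. J (E u)) (\<lambda>u. J (E u)) = 1"
    using endo_inner_quat_comb[OF quat_units, of "axis 2 1" "axis 2 1"] endo_inner_quat_comb[OF quat_units, of "axis 3 1" "axis 2 1"]
      endo_inner_quat_comb[OF quat_units, of "axis 2 1" "axis 3 1"] endo_inner_quat_comb[OF quat_units, of "axis 3 1" "axis 3 1"]
    by (simp_all add: quat_comb_axis inner_axis_axis)
  have DE: "D (E u) = - E (D u)" "D (J (E u)) = - J (E (D u))" for u
    using antilinear_skew_polarize[OF D E, of u] antilinear_skew_polarize[OF D JE, of u]
    by (simp_all add: e o x_y_def eq_neg_iff_add_eq_0)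
  have "J (E (D u)) = - J (E (D u))"
    using DE(2)[of u] by (simp add: antilinear_skewD(3)[OF D] DE(1) J_simps)
  then have "J (E (D u)) = 0" by (simp add: vec_eq_iff)
  then have "J (J (E (D u))) = 0" by (simp only: linear_0[OF linJ])
  then have "E (E (D u)) = 0" by (simp add: JJ linear_0[OF linE])
  then have "D u = 0" by (simp add: EE)
  then show ?thesis by (simp add: D_def x_y_def algebra_simps)
qed

text \<open>The coordinates, up to a positive factor, of the rotation of the plane spanned by \<open>u\<close> and \<open>v\<close>
  that sends \<open>u\<close> towards \<open>v\<close>.\<close>

definition plane_vec :: "real^4 \<Rightarrow> real^4 \<Rightarrow> real^3" where
  "plane_vec u v = vector [g (J u) v, g (E u) v, g (J (E u)) v]"

lemma plane_vec_expansion: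
  assumes "u \<noteq> 0"
  shows "g u u *\<^sub>R v = g u v *\<^sub>R u + quat_comb J E (plane_vec u v) u"
proof -
  have "g u u *\<^sub>R v = g u u *\<^sub>R ((g v u / g u u) *\<^sub>R u + (g v (J u) / g u u) *\<^sub>R J u + (g v (E u) / g u u) *\<^sub>R E u + (g v (J (E u)) / g u u) *\<^sub>R J (E u))"
    using frame_expansion[OF assms, of v] by simp
  then show ?thesis
    unfolding sym[of v] using pos[OF assms] by (simp add: plane_vec_def quat_comb_def scaleR_add_right)
qed

lemma plane_vec_nonzero:
  assumes "u \<noteq> 0" and "\<And>c. v \<noteq> c *\<^sub>R u"
  shows "plane_vec u v \<noteq> 0"
proof
  assume "plane_vec u v = 0"
  then have "g u u *\<^sub>R v = g u v *\<^sub>R u"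
    using plane_vec_expansion[OF assms(1), of v] by (simp add: quat_comb_def)
  then have "(1 / g u u) *\<^sub>R g u u *\<^sub>R v = (1 / g u u) *\<^sub>R g u v *\<^sub>R u" by simp
  then show False using pos[OF assms(1)] assms(2)[of "g u v / g u u"] by simp
qed

text \<open>Each coordinate is an alternating bilinear form in \<open>u\<close> and
  \<open>v\<close>, because \<open>J\<close>, \<open>E\<close> and \<open>J \<circ> E\<close> are
  skew. The direction of \<open>plane_vec\<close> therefore depends only on the oriented
  plane.\<close>

lemma plane_vec_linear_comb:
  "plane_vec (a *\<^sub>R u + b *\<^sub>R v) (c *\<^sub>R u + d *\<^sub>R v) = (a * d - b * c) *\<^sub>R plane_vec u v"
proof -
  have s: "g (E x) y = - g (E y) x" "g (J x) y = - g (J y) x" "g (J (E x)) y = - g (J (E y)) x" for x y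
    using antilinear_skewD(2)[OF E] antilinear_skewD(2)[OF antilinear_skew_J[OF E]] skewJ sym by metis+
  have 0: "g (E x) x = 0" "g (J x) x = 0" "g (J (E x)) x = 0" for x
    using s[of x x] by simp_all
  have "vector [x, y, z] = (k *\<^sub>R vector [x', y', z'] :: real^3) \<longleftrightarrow> x = k * x' \<and> y = k * y' \<and> z = k * z'" for x y z k x' y' z'
    by (simp add: vec_eq_iff forall_3)
  then show ?thesis
    unfolding plane_vec_def using 0 s(1)[of v u] s(2)[of v u] s(3)[of v u]
    by (simp add: g_simps J_simps E_simps) (simp add: algebra_simps)
qed

text \<open>By \<open>plane_vec_expansion\<close> the combination with coordinates
  \<open>plane_vec u v\<close> sends \<open>u\<close> to
  \<open>g u u *\<^sub>R v - g u v *\<^sub>R u\<close>. This invariance of the plane is what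
  conflicts with taming a form that vanishes on it.\<close>

lemma quat_comb_in_plane:
  assumes u: "u \<noteq> 0" and n: "plane_vec u v \<noteq> 0" and a: "a = sgn (plane_vec u v) \<or> a = - sgn (plane_vec u v)"
  obtains b c where "quat_comb J E a u = b *\<^sub>R u + c *\<^sub>R v"
proof -
  define k where "k = norm (plane_vec u v)"
  have "a = (1 / k) *\<^sub>R plane_vec u v \<or> a = (- (1 / k)) *\<^sub>R plane_vec u v"
    using a by (simp add: k_def sgn_div_norm inverse_eq_divide)
  then obtain s where s: "a = s *\<^sub>R plane_vec u v" by blast
  have "quat_comb J E a u = s *\<^sub>R (g u u *\<^sub>R v - g u v *\<^sub>R u)"
    using plane_vec_expansion[OF u, of v] by (simp add: s quat_comb_scaleR)
  also have "\<dots> = (- s * g u v) *\<^sub>R u + (s * g u u) *\<^sub>R v" by (simp add: algebra_simps)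
  finally show ?thesis by (rule that)
qed

text \<open>Up to a positive factor, the coordinates of the self-dual part of \<open>\<tau>\<close>.\<close>

definition form_vec :: "(real^4 \<Rightarrow> real^4 \<Rightarrow> real) \<Rightarrow> real^4 \<Rightarrow> real^3" where
  "form_vec \<tau> e = vector [\<tau> e (J e) + \<tau> (E e) (J (E e)), \<tau> e (E e) - \<tau> (J e) (J (E e)), \<tau> e (J (E e)) + \<tau> (J e) (E e)]"

text \<open>The Pfaffian of \<tau> in the basis \<open>e\<close>, \<open>J e\<close>,
  \<open>E e\<close>, \<open>J (E e)\<close>, that is, half its wedge square there.\<close>

definition frame_pfaffian :: "(real^4 \<Rightarrow> real^4 \<Rightarrow> real) \<Rightarrow> real^4 \<Rightarrow> real" where
  "frame_pfaffian \<tau> e = \<tau> e (J e) * \<tau> (E e) (J (E e)) - \<tau> e (E e) * \<tau> (J e) (J (E e)) + \<tau> e (J (E e)) * \<tau> (J e) (E e)"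

context
  fixes \<tau> :: "real^4 \<Rightarrow> real^4 \<Rightarrow> real"
  assumes bt: "bilinear \<tau>" and at: "\<And>u. \<tau> u u = 0"
begin

lemmas t_simps = bilinear_ladd[OF bt] bilinear_radd[OF bt] bilinear_lmul[OF bt] bilinear_rmul[OF bt]
  bilinear_lneg[OF bt] bilinear_rneg[OF bt] bilinear_lzero[OF bt] bilinear_rzero[OF bt]
  bilinear_lsub[OF bt] bilinear_rsub[OF bt]

lemma t_skew: "\<tau> u v = - \<tau> v u"
  using at[of "u + v"] at[of u] at[of v] by (simp add: t_simps)

text \<open>The linear map that takes the quaternionic basis at \<open>e\<close> to the one at
  \<open>u\<close> commutes with \<open>J\<close> and \<open>E\<close>. It is conformal and only
  rescales the self-dual bivectors paired with \<tau>. The proof expands both bases and compares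
  polynomials in the coefficients.\<close>

lemma form_vec_change:
  assumes e: "e \<noteq> 0"
  shows "form_vec \<tau> u = (g u u / g e e) *\<^sub>R form_vec \<tau> e"
proof -
  define p q r s where "p = g u e / g e e" "q = g u (J e) / g e e" "r = g u (E e) / g e e" "s = g u (J (E e)) / g e e"
  have u: "u = p *\<^sub>R e + q *\<^sub>R J e + r *\<^sub>R E e + s *\<^sub>R J (E e)"
    using frame_expansion[OF e, of u] by (simp add: p_q_r_s_def)
  have n: "g u u / g e e = p\<^sup>2 + q\<^sup>2 + r\<^sup>2 + s\<^sup>2"
    using g_expansion[of e u] pos[OF e] by (simp add: p_q_r_s_def power_divide field_simps power2_eq_square)
  have 1: "J u = (- q) *\<^sub>R e + p *\<^sub>R J e + (- s) *\<^sub>R E e + r *\<^sub>R J (E e)"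
    unfolding u by (simp add: J_simps)
  have 2: "E u = (- r) *\<^sub>R e + s *\<^sub>R J e + p *\<^sub>R E e + (- q) *\<^sub>R J (E e)"
    unfolding u by (simp add: J_simps E_simps)
  have 3: "J (E u) = (- s) *\<^sub>R e + (- r) *\<^sub>R J e + q *\<^sub>R E e + p *\<^sub>R J (E e)"
    unfolding 2 by (simp add: J_simps)
  have sk: "\<tau> (J e) e = - \<tau> e (J e)" "\<tau> (E e) e = - \<tau> e (E e)" "\<tau> (J (E e)) e = - \<tau> e (J (E e))"
    "\<tau> (E e) (J e) = - \<tau> (J e) (E e)" "\<tau> (J (E e)) (J e) = - \<tau> (J e) (J (E e))" "\<tau> (J (E e)) (E e) = - \<tau> (E e) (J (E e))"
    by (rule t_skew)+
  have bil4: "\<tau> (a *\<^sub>R e + b *\<^sub>R J e + c *\<^sub>R E e + d *\<^sub>R J (E e)) (a' *\<^sub>R e + b' *\<^sub>R J e + c' *\<^sub>R E e + d' *\<^sub>R J (E e)) =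
      (a * b' - b * a') * \<tau> e (J e) + (a * c' - c * a') * \<tau> e (E e) + (a * d' - d * a') * \<tau> e (J (E e)) +
      (b * c' - c * b') * \<tau> (J e) (E e) + (b * d' - d * b') * \<tau> (J e) (J (E e)) + (c * d' - d * c') * \<tau> (E e) (J (E e))" for a b c d a' b' c' d'
    by (simp add: t_simps at sk) (simp add: algebra_simps)
  define t12 t13 t14 t23 t24 t34 where "t12 = \<tau> e (J e)" "t13 = \<tau> e (E e)" "t14 = \<tau> e (J (E e))"
    "t23 = \<tau> (J e) (E e)" "t24 = \<tau> (J e) (J (E e))" "t34 = \<tau> (E e) (J (E e))"
  note t = t12_t13_t14_t23_t24_t34_def
  have "\<tau> u (J u) + \<tau> (E u) (J (E u)) = (p\<^sup>2 + q\<^sup>2 + r\<^sup>2 + s\<^sup>2) * (t12 + t34)"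
    unfolding 3 unfolding 1 2 unfolding u bil4 t[symmetric] by algebra
  moreover have "\<tau> u (E u) - \<tau> (J u) (J (E u)) = (p\<^sup>2 + q\<^sup>2 + r\<^sup>2 + s\<^sup>2) * (t13 - t24)"
    unfolding 3 unfolding 1 2 unfolding u bil4 t[symmetric] by algebra
  moreover have "\<tau> u (J (E u)) + \<tau> (J u) (E u) = (p\<^sup>2 + q\<^sup>2 + r\<^sup>2 + s\<^sup>2) * (t14 + t23)"
    unfolding 3 unfolding 1 2 unfolding u bil4 t[symmetric] by algebra
  ultimately show ?thesis
    unfolding n by (simp add: form_vec_def vec_eq_iff forall_3 flip: t)
qed

text \<open>Up to a factor the combination is the self-dual part of the endomorphism that represents
  \<tau>. It commutes with the anti-self-dual part, hence with the whole endomorphism, and is skew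
  for \<open>g\<close>; so it is skew for \<tau>.\<close>

lemma form_vec_skew:
  assumes e: "e \<noteq> 0"
  shows "\<tau> (quat_comb J E (form_vec \<tau> e) u) v = - \<tau> u (quat_comb J E (form_vec \<tau> e) v)"
proof (cases "u = 0")
  case True
  then show ?thesis by (simp add: quat_comb_def J_simps E_simps t_simps)
next
  case False
  have pu: "g e e / g u u \<noteq> 0" using pos[OF e] pos[OF False] by simp
  define n where "n = form_vec \<tau> u"
  define S where "S v = \<tau> (quat_comb J E n u) v + \<tau> u (quat_comb J E n v)" for v
  have "linear (quat_comb J E n)" by (rule linear_quat_comb[OF quat_units])
  then have S: "S (a *\<^sub>R x + b *\<^sub>R y + c *\<^sub>R z + d *\<^sub>R w) = a * S x + b * S y + c * S z + d * S w" for a b c d x y z w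
    by (simp add: S_def t_simps linear_add linear_cmul algebra_simps)
  have n3: "n $ 1 = \<tau> u (J u) + \<tau> (E u) (J (E u))" "n $ 2 = \<tau> u (E u) - \<tau> (J u) (J (E u))" "n $ 3 = \<tau> u (J (E u)) + \<tau> (J u) (E u)"
    by (simp_all add: n_def form_vec_def)
  have sk: "\<tau> (J u) u = - \<tau> u (J u)" "\<tau> (E u) u = - \<tau> u (E u)" "\<tau> (J (E u)) u = - \<tau> u (J (E u))"
    "\<tau> (E u) (J u) = - \<tau> (J u) (E u)" "\<tau> (J (E u)) (J u) = - \<tau> (J u) (J (E u))" "\<tau> (J (E u)) (E u) = - \<tau> (E u) (J (E u))"
    by (rule t_skew)+
  \<comment> \<open>After moving the base vector from \<open>e\<close> to \<open>u\<close>, the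
    claim is linear in \<open>v\<close> and only has to be checked on the quaternionic basis at
    \<open>u\<close>.\<close>
  have "S u = 0" "S (J u) = 0" "S (E u) = 0" "S (J (E u)) = 0"
    by (simp_all add: S_def quat_comb_def t_simps J_simps E_simps at sk n3) (simp_all add: algebra_simps)
  then have "S v = 0" for v
    by (subst frame_expansion[OF False, of v]) (simp add: S)
  then have "\<tau> (quat_comb J E n u) v = - \<tau> u (quat_comb J E n v)" by (simp add: S_def add_eq_0_iff)
  moreover have "form_vec \<tau> e = (g e e / g u u) *\<^sub>R n" unfolding n_def by (rule form_vec_change[OF False])
  ultimately show ?thesis by (simp add: quat_comb_scaleR t_simps)
qed

text \<open>With base vector \<open>u\<close> itself the value is a sum of three squares plus the
  Pfaffian; so the orientation is exactly what guarantees positivity.\<close>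

lemma form_vec_positive:
  assumes pf: "frame_pfaffian \<tau> u > 0" and u: "u \<noteq> 0" and e: "e \<noteq> 0"
  shows "\<tau> u (quat_comb J E (form_vec \<tau> e) u) > 0"
proof -
  define x y z where "x = \<tau> u (J u)" "y = \<tau> u (E u)" "z = \<tau> u (J (E u))"
  have "\<tau> u (quat_comb J E (form_vec \<tau> u) u) = x\<^sup>2 + y\<^sup>2 + z\<^sup>2 + frame_pfaffian \<tau> u"
    by (simp add: quat_comb_def form_vec_def frame_pfaffian_def t_simps power2_eq_square algebra_simps flip: x_y_z_def)
  then have "\<tau> u (quat_comb J E (form_vec \<tau> u) u) > 0" using pf by (simp add: add_nonneg_pos)
  moreover have "form_vec \<tau> e = (g e e / g u u) *\<^sub>R form_vec \<tau> u" by (rule form_vec_change[OF u])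
  ultimately show ?thesis using pos[OF u] pos[OF e] by (simp add: quat_comb_scaleR t_simps)
qed

text \<open>Uniqueness: the part \<open>Y\<close> of a second candidate \<open>J'\<close> that anticommutes with the first one \<open>I\<close>
  satisfies \<open>\<tau> (Y u) (I (Y u)) \<le> 0\<close>, hence vanishes; then \<open>J' - I\<close> maps into the kernel of \<open>J' + I\<close>,
  on which \<open>\<tau> w ((J' + I) w) > 0\<close> fails.\<close>

lemma associated_acs_unique:
  assumes I: "hermitian g I" "compatible \<tau> I"
    and J': "linear J'" "\<And>u. J' (J' u) = - u" "\<And>u v. g (J' u) v = - g u (J' v)" "compatible \<tau> J'"
  shows "J' = I"
proof -
  interpret I: hermitian g I by (rule I)
  have skewI: "\<tau> (I u) v = - \<tau> u (I v)" for u v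
    using I(2) I.JJ[of u] by (metis (no_types) compatible_def I.JJ bilinear_rneg[OF bt] add.inverse_inverse)
  have skewJ': "\<tau> (J' u) v = - \<tau> u (J' v)" for u v
    using J'(4) J'(2) by (metis (no_types) compatible_def bilinear_rneg[OF bt] add.inverse_inverse)
  note lin = linear_add[OF J'(1)] linear_neg[OF J'(1)] linear_cmul[OF J'(1)] linear_diff[OF J'(1)] J'(2)
  \<comment> \<open>Twice the part of \<open>J'\<close> that anticommutes with
    \<open>I\<close>.\<close>
  define Y where "Y u = J' u + I (J' (I u))" for u
  have linY: "linear Y" by (auto simp: linear_iff Y_def lin I.J_simps algebra_simps)
  have Y: "I.antilinear_skew Y"
    unfolding I.antilinear_skew_def
    using linY by (auto simp: Y_def lin I.J_simps I.g_simps J'(3) I.skewJ)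
  have tY: "\<tau> (Y u) v = - \<tau> u (Y v)" for u v
    by (simp add: Y_def t_simps skewI skewJ')
  have Y0: "Y u = 0" for u
  proof (rule ccontr)
    assume n: "Y u \<noteq> 0"
    then have u: "u \<noteq> 0" using linear_0[OF linY] by auto
    have "\<tau> (Y u) (I (Y u)) = \<tau> (Y (Y u)) (I u)"
    proof -
      have "\<tau> (Y u) (I (Y u)) = - \<tau> (Y u) (Y (I u))"
        using I.antilinear_skewD(3)[OF Y, of u] by (simp add: t_simps)
      also have "\<dots> = \<tau> (Y (Y u)) (I u)" by (simp add: tY)
      finally show ?thesis .
    qed
    also have "\<dots> = - endo_inner Y Y * \<tau> u (I u)"
      unfolding I.antilinear_skew_square(1)[OF Y] by (simp add: t_simps)
    finally have "\<tau> (Y u) (I (Y u)) \<le> 0"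
      using I(2) u I.antilinear_skew_square(2)[OF Y] by (simp add: compatible_def less_imp_le)
    then show False using I(2) n by (auto simp: compatible_def not_less[symmetric])
  qed
  have com: "I (J' u) = J' (I u)" for u
    using Y0[of "I u"] by (simp add: Y_def I.J_simps lin)
  show ?thesis
  proof
    fix u
    define w where "w = J' u - I u"
    have "J' w + I w = 0" by (simp add: w_def lin I.J_simps com)
    then have "\<tau> w (J' w) + \<tau> w (I w) = 0" by (simp add: t_simps flip: bilinear_radd[OF bt])
    then have "w = 0" using I(2) J'(4) by (metis add_pos_pos compatible_def less_irrefl)
    then show "J' u = I u" by (simp add: w_def)
  qed
qed

text \<open>The normalized self-dual part of \<tau> is a unit imaginary quaternion, hence a skew
  complex structure; it is skew for \<tau> and positive, and uniqueness resolves the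
  \<open>THE\<close>. The explicit formula replaces the polar decomposition and shows continuity in
  \<tau>.\<close>

lemma associated_acs_eq:
  assumes pf: "\<And>u. u \<noteq> 0 \<Longrightarrow> frame_pfaffian \<tau> u > 0" and e: "e \<noteq> 0"
  defines "I \<equiv> quat_comb J E (sgn (form_vec \<tau> e))"
  shows "form_vec \<tau> e \<noteq> 0" "associated_acs g \<tau> = I" "compatible \<tau> I" "hermitian g I"
proof -
  show n: "form_vec \<tau> e \<noteq> 0"
    using form_vec_positive[OF pf[OF e] e e] by (auto simp: quat_comb_def t_simps)
  have lin: "linear I" unfolding I_def by (rule linear_quat_comb[OF quat_units])
  have II: "I (I u) = - u" for u
    using n norm_sgn[of "form_vec \<tau> e"] unfolding I_def quat_comb_comp[OF quat_units]
    by (simp add: quat_comb_def dot_square_norm)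
  have IS: "I u = (1 / norm (form_vec \<tau> e)) *\<^sub>R quat_comb J E (form_vec \<tau> e) u" for u
    unfolding I_def sgn_div_norm quat_comb_scaleR by (simp add: inverse_eq_divide)
  have skew: "g (I u) v = - g u (I v)" for u v
    using antilinear_skewD(2)[OF E, of u v] antilinear_skewD(2)[OF antilinear_skew_J[OF E], of u v] skewJ[of u v]
    by (simp add: I_def quat_comb_def g_simps)
  show herm: "hermitian g I" by (rule hermitian.intro[OF bil sym pos lin II skew])
  have tI: "\<tau> (I u) v = - \<tau> u (I v)" for u v
    using form_vec_skew[OF e, of u v] by (simp add: IS t_simps)
  show comp: "compatible \<tau> I"
    using form_vec_positive[OF pf _ e] n unfolding compatible_def
    by (auto simp: tI II t_simps) (simp add: IS t_simps)
  show "associated_acs g \<tau> = I"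
    unfolding associated_acs_def
  proof (rule the_equality)
    show "linear I \<and> (\<forall>u. I (I u) = - u) \<and> (\<forall>u v. g (I u) v = - g u (I v)) \<and> compatible \<tau> I"
      using lin II skew comp by blast
    show "J' = I" if "linear J' \<and> (\<forall>u. J' (J' u) = - u) \<and> (\<forall>u v. g (J' u) v = - g u (J' v)) \<and> compatible \<tau> J'" for J'
      using associated_acs_unique[OF herm comp] that by blast
  qed
qed

end

end

text \<open>The factor is the determinant of \<open>P\<close>.\<close>

lemma wedge_square_pullback:
  assumes "linear P"
  obtains d where "\<And>\<tau>. bilinear \<tau> \<Longrightarrow> (\<And>u. \<tau> u u = 0) \<Longrightarrow>
    wedge_square (\<lambda>u v. \<tau> (P u) (P v)) = d * wedge_square \<tau>"
proof -
  define p where "p i j = P (axis j 1) $ i" for i j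
  \<comment> \<open>The Laplace expansion along the first two columns, so that the claim is a
    polynomial identity in the entries of \<open>P\<close> and the components of \<tau>.\<close>
  define d where "d = (p 1 1 * p 2 2 - p 1 2 * p 2 1) * (p 3 3 * p 4 4 - p 3 4 * p 4 3)
    - (p 1 1 * p 3 2 - p 1 2 * p 3 1) * (p 2 3 * p 4 4 - p 2 4 * p 4 3)
    + (p 1 1 * p 4 2 - p 1 2 * p 4 1) * (p 2 3 * p 3 4 - p 2 4 * p 3 3)
    + (p 2 1 * p 3 2 - p 2 2 * p 3 1) * (p 1 3 * p 4 4 - p 1 4 * p 4 3)
    - (p 2 1 * p 4 2 - p 2 2 * p 4 1) * (p 1 3 * p 3 4 - p 1 4 * p 3 3)
    + (p 3 1 * p 4 2 - p 3 2 * p 4 1) * (p 1 3 * p 2 4 - p 1 4 * p 2 3)"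
  have "wedge_square (\<lambda>u v. \<tau> (P u) (P v)) = d * wedge_square \<tau>"
    if b: "bilinear \<tau>" and a: "\<And>u. \<tau> u u = 0" for \<tau>
  proof -
    note simps = bilinear_ladd[OF b] bilinear_radd[OF b] bilinear_lmul[OF b] bilinear_rmul[OF b]
    have skew: "\<tau> u v = - \<tau> v u" for u v
      using a[of "u + v"] a[of u] a[of v] by (simp add: simps)
    define t where "t i j = \<tau> (axis i 1) (axis j 1)" for i j
    have P: "P (axis j 1) = p 1 j *\<^sub>R axis 1 1 + p 2 j *\<^sub>R axis 2 1 + p 3 j *\<^sub>R axis 3 1 + p 4 j *\<^sub>R axis 4 1" for j
      by (simp add: vec_eq_iff forall_4 p_def axis_def)
    have sk: "t 2 1 = - t 1 2" "t 3 1 = - t 1 3" "t 4 1 = - t 1 4" "t 3 2 = - t 2 3" "t 4 2 = - t 2 4" "t 4 3 = - t 3 4"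
      unfolding t_def by (rule skew)+
    have PP: "\<tau> (P (axis i 1)) (P (axis j 1)) =
      (p 1 i * p 2 j - p 2 i * p 1 j) * t 1 2 + (p 1 i * p 3 j - p 3 i * p 1 j) * t 1 3 + (p 1 i * p 4 j - p 4 i * p 1 j) * t 1 4 +
      (p 2 i * p 3 j - p 3 i * p 2 j) * t 2 3 + (p 2 i * p 4 j - p 4 i * p 2 j) * t 2 4 + (p 3 i * p 4 j - p 4 i * p 3 j) * t 3 4" for i j
      unfolding P by (simp add: simps a flip: t_def) (simp add: sk algebra_simps)
    show ?thesis
      unfolding wedge_square_def Let_def PP d_def t_def[symmetric] by algebra
  qed
  then show ?thesis by (rule that)
qed

context hermitian_frame
begin

text \<open>Evaluating both forms in the quaternionic basis at \<open>u\<close> scales their wedge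
  squares by the same determinant \<open>d\<close>. For the fundamental form
  \<open>g (J u) v\<close> the outcome is known to be positive, so equal orientation gives the sign
  for \<tau>.\<close>

lemma frame_pfaffian_positive:
  assumes t: "bilinear \<tau>" "\<And>u. \<tau> u u = 0" and o: "wedge_square (\<lambda>u v. g (J u) v) * wedge_square \<tau> > 0" and u: "u \<noteq> 0"
  shows "frame_pfaffian \<tau> u > 0"
proof -
  define P :: endo where "P x = x $ 1 *\<^sub>R u + x $ 2 *\<^sub>R J u + x $ 3 *\<^sub>R E u + x $ 4 *\<^sub>R J (E u)" for x
  have "linear P" by (auto simp: linear_iff P_def algebra_simps)
  then obtain d where d: "\<And>\<tau>. bilinear \<tau> \<Longrightarrow> (\<And>u. \<tau> u u = 0) \<Longrightarrow> wedge_square (\<lambda>u v. \<tau> (P u) (P v)) = d * wedge_square \<tau>"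
    using wedge_square_pullback by blast
  have Px: "P (axis 1 1) = u" "P (axis 2 1) = J u" "P (axis 3 1) = E u" "P (axis 4 1) = J (E u)"
    by (simp_all add: P_def axis_def)
  have pf: "wedge_square (\<lambda>u v. \<sigma> (P u) (P v)) = 2 * frame_pfaffian \<sigma> u" for \<sigma>
    by (simp add: wedge_square_def Let_def frame_pfaffian_def Px)
  have b: "bilinear (\<lambda>u v. g (J u) v)"
    using bil linJ by (auto simp: bilinear_def linear_iff g_simps J_simps)
  have "frame_pfaffian (\<lambda>u v. g (J u) v) u = (g u u)\<^sup>2"
    using antilinear_skewD(4-8)[OF E, of u] gJ_self[of u] gJ_self[of "E u"]
    by (simp add: frame_pfaffian_def gJJ gEE J_simps g_simps power2_eq_square)
  then have 1: "2 * (g u u)\<^sup>2 = d * wedge_square (\<lambda>u v. g (J u) v)"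
    using d[OF b] gJ_self pf[of "\<lambda>u v. g (J u) v"] by simp
  have 2: "2 * frame_pfaffian \<tau> u = d * wedge_square \<tau>"
    using d[OF t] pf[of \<tau>] by simp
  have "d \<noteq> 0" using 1 pos[OF u] by auto
  then have "d * d > 0" by (auto simp: zero_less_mult_iff linorder_neq_iff)
  then have "d * d * (wedge_square (\<lambda>u v. g (J u) v) * wedge_square \<tau>) > 0"
    by (rule mult_pos_pos[OF _ o])
  then have "(2 * (g u u)\<^sup>2) * (2 * frame_pfaffian \<tau> u) > 0" unfolding 1 2 by (simp add: mult_ac)
  then show ?thesis using pos[OF u] by (simp add: zero_less_mult_iff)
qed

end

section \<open>Manifolds, charts and tensor fields\<close>

lemma cm_local:
  assumes "\<And>x. x \<in> topspace X \<Longrightarrow> \<exists>W h. openin X W \<and> x \<in> W \<and> continuous_map (subtopology X W) Y h \<and> (\<forall>y\<in>W. f y = h y)"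
  shows "continuous_map X Y f"
proof -
  obtain W h where Wh: "\<And>x. x \<in> topspace X \<Longrightarrow> openin X (W x) \<and> x \<in> W x \<and> continuous_map (subtopology X (W x)) Y (h x) \<and> (\<forall>y\<in>W x. f y = h x y)"
    using assms by metis
  show ?thesis
  proof (rule pasting_lemma[where I = "topspace X" and T = W and f = h])
    show "h i y = h j y" if "i \<in> topspace X" "j \<in> topspace X" "y \<in> topspace X \<inter> W i \<inter> W j" for i j y
      using Wh[OF that(1)] Wh[OF that(2)] that(3) by (metis IntD1 IntD2)
  qed (use Wh in blast)+
qed

lemma cm_det:
  fixes A :: "'x \<Rightarrow> real^'n^'n"
  assumes "\<And>i j. continuous_map X euclideanreal (\<lambda>x. A x $ i $ j)"
  shows "continuous_map X euclideanreal (\<lambda>x. det (A x))"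
proof -
  have "continuous_map X euclideanreal (\<lambda>x. \<Prod>i\<in>UNIV. A x $ i $ p i)" for p
    by (rule continuous_map_prod) (auto intro: assms)
  then show ?thesis
    unfolding det_def by (intro continuous_map_sum continuous_map_real_mult_left) auto
qed

lemma cm_component_wise:
  fixes f :: "'x \<Rightarrow> real^'n"
  assumes "\<And>i. continuous_map X euclideanreal (\<lambda>x. f x $ i)"
  shows "continuous_map X euclidean f"
proof -
  have "(\<lambda>x. \<Sum>i\<in>UNIV. f x $ i *\<^sub>R axis i 1) = f"
    using basis_expansion[of "f _"] by (simp add: scalar_mult_eq_scaleR)
  moreover have "continuous_map X euclidean (\<lambda>x. \<Sum>i\<in>UNIV. f x $ i *\<^sub>R (axis i 1 :: real^'n))"
    by (intro continuous_map_sum cm_scaleR assms) auto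
  ultimately show ?thesis by simp
qed

text \<open>Cramer's rule writes the inverse as a quotient of determinants in entries that are
  continuous.\<close>

lemma cm_linear_inverse:
  fixes A B :: "'x \<Rightarrow> real^'n \<Rightarrow> real^'n"
  assumes A: "\<And>x. x \<in> topspace X \<Longrightarrow> linear (A x)"
    and AB: "\<And>x u. x \<in> topspace X \<Longrightarrow> A x (B x u) = u" "\<And>x u. x \<in> topspace X \<Longrightarrow> B x (A x u) = u"
    and cA: "\<And>u. continuous_map X euclidean (\<lambda>x. A x u)"
  shows "continuous_map X euclidean (\<lambda>x. B x u)"
proof -
  have d: "det (matrix (A x)) \<noteq> 0" if "x \<in> topspace X" for x
    using AB(2)[OF that] A[OF that] by (metis det_nz_iff_inj inj_on_inverseI)
  have ent: "continuous_map X euclideanreal (\<lambda>x. matrix (A x) $ i $ j)" for i j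
    unfolding matrix_def by (simp add: cm_nth[OF cA])
  define C where "C x = (\<chi> k. det (\<chi> i j. if j = k then u $ i else matrix (A x) $ i $ j) / det (matrix (A x)))" for x
  have "continuous_map X euclidean C"
  proof (rule cm_component_wise)
    fix k
    have "continuous_map X euclideanreal (\<lambda>x. det (\<chi> i j. if j = k then u $ i else matrix (A x) $ i $ j))"
      by (rule cm_det) (use ent in auto)
    then show "continuous_map X euclideanreal (\<lambda>x. C x $ k)"
      unfolding C_def by (simp add: continuous_map_real_divide cm_det ent d)
  qed
  moreover have "C x = B x u" if "x \<in> topspace X" for x
    using cramer[OF d[OF that], of "B x u" u] A[OF that] AB(1)[OF that]
    by (simp add: C_def matrix_works)
  ultimately show ?thesis by (rule continuous_map_eq)
qed

lemma smooth_on_local: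
  fixes f :: "'a::real_normed_vector \<Rightarrow> 'b::real_normed_vector"
  assumes "smooth_on S f" "x \<in> S"
  obtains U g where "open U" "x \<in> U" "\<And>y. y \<in> S \<inter> U \<Longrightarrow> g y = f y" "continuous_on U g"
    "\<And>y. y \<in> U \<Longrightarrow> (g has_derivative frechet_derivative g (at y)) (at y)"
    "\<And>v. continuous_on U (\<lambda>y. frechet_derivative g (at y) v)"
proof -
  obtain U g where U: "open U" "x \<in> U" "\<And>n. Ck_on n U g" "\<forall>y\<in>S \<inter> U. g y = f y"
    using assms unfolding smooth_on_def by blast
  show ?thesis
    using U(1,2,4) U(3)[of 0] U(3)[of "Suc 0"] by (intro that[of U g]) (auto simp: frechet_derivative_works)
qed

lemma smooth_on_continuous:
  assumes "smooth_on S f"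
  shows "continuous_on S f"
  unfolding continuous_on_eq_continuous_within
proof
  fix x assume x: "x \<in> S"
  obtain U g where U: "open U" "x \<in> U" "\<And>y. y \<in> S \<inter> U \<Longrightarrow> g y = f y" "continuous_on U g"
    using smooth_on_local[OF assms x] by metis
  have "continuous_on (S \<inter> U) f"
    using U(3,4) continuous_on_subset[of U g "S \<inter> U"] continuous_on_cong[of "S \<inter> U" "S \<inter> U" g f] by auto
  then have "continuous (at x within S \<inter> U) f"
    using x U(2) by (simp add: continuous_on_eq_continuous_within)
  moreover have "at x within S \<inter> U = at x within S"
    by (rule at_within_nhd[OF U(2,1)]) auto
  ultimately show "continuous (at x within S) f" by (simp add: continuous_within)
qed

text \<open>Smoothness is defined through local extensions; on an open set these coincide with
  \<open>f\<close> near each point and so have the same derivative there.\<close>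

lemma smooth_on_open_derivative:
  assumes "smooth_on S f" "open S"
  shows "\<And>x. x \<in> S \<Longrightarrow> (f has_derivative frechet_derivative f (at x)) (at x)"
    and "continuous_on S (\<lambda>x. frechet_derivative f (at x) v)"
proof -
  have *: "\<exists>U g. open U \<and> x \<in> U \<and> U \<subseteq> S \<and> continuous_on U (\<lambda>y. frechet_derivative g (at y) v) \<and>
      (\<forall>y\<in>U. (f has_derivative frechet_derivative g (at y)) (at y) \<and> frechet_derivative f (at y) = frechet_derivative g (at y))"
    if xS: "x \<in> S" for x v
  proof -
    obtain U g where U: "open U" "x \<in> U" "\<And>y. y \<in> S \<inter> U \<Longrightarrow> g y = f y"
      "\<And>y. y \<in> U \<Longrightarrow> (g has_derivative frechet_derivative g (at y)) (at y)"
      "\<And>v. continuous_on U (\<lambda>y. frechet_derivative g (at y) v)"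
      using smooth_on_local[OF assms(1) xS] by metis
    have d: "(f has_derivative frechet_derivative g (at y)) (at y)" if "y \<in> S \<inter> U" for y
      using has_derivative_transform_within_open[OF U(4), of y "S \<inter> U" f] U(1,3) assms(2) that by auto
    then have "frechet_derivative f (at y) = frechet_derivative g (at y)" if "y \<in> S \<inter> U" for y
      using frechet_derivative_at that by metis
    then show ?thesis
      using U(1,2) d assms(2) xS by (intro exI[of _ "S \<inter> U"] exI[of _ g]) (auto intro: continuous_on_subset[OF U(5)])
  qed
  show "(f has_derivative frechet_derivative f (at x)) (at x)" if "x \<in> S" for x
    using *[OF that] by (metis frechet_derivative_at)
  show "continuous_on S (\<lambda>x. frechet_derivative f (at x) v)"
  proof (subst continuous_on_eq_continuous_at[OF assms(2)], intro ballI)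
    fix x assume "x \<in> S"
    then obtain U g where U: "open U" "x \<in> U" "continuous_on U (\<lambda>y. frechet_derivative g (at y) v)"
      "\<forall>y\<in>U. frechet_derivative f (at y) = frechet_derivative g (at y)"
      using * by metis
    then have "continuous_on U (\<lambda>y. frechet_derivative f (at y) v)"
      using continuous_on_cong[of U U "\<lambda>y. frechet_derivative f (at y) v" "\<lambda>y. frechet_derivative g (at y) v"] by auto
    then show "isCont (\<lambda>x. frechet_derivative f (at x) v) x"
      using U(1,2) by (meson continuous_on_eq_continuous_at)
  qed
qed

section \<open>Charts, transition maps and curves\<close>

locale smooth_manifold =
  fixes M :: "'a smooth_space"
  assumes smooth_4_manifold: "smooth_4_manifold M"
begin

lemma Hausdorff: "Hausdorff_space (mtop M)"
  using smooth_4_manifold by (simp add: smooth_4_manifold_def)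

lemma ex_chart: "p \<in> pts M \<Longrightarrow> \<exists>k. k \<in> charts_at M p"
  using smooth_4_manifold unfolding smooth_4_manifold_def charts_at_def by blast

lemma charts_atD: "k \<in> charts_at M p \<Longrightarrow> k \<in> atlas M" "k \<in> charts_at M p \<Longrightarrow> p \<in> fst k"
  by (auto simp: charts_at_def)

lemma chart:
  assumes "k \<in> atlas M"
  shows "openin (mtop M) (fst k)" "open (snd k ` fst k)" "fst k \<subseteq> pts M"
    "continuous_map (subtopology (mtop M) (fst k)) euclidean (snd k)"
    "p \<in> fst k \<Longrightarrow> chart_inv k (snd k p) = p"
    "x \<in> snd k ` fst k \<Longrightarrow> chart_inv k x \<in> fst k"
    "x \<in> snd k ` fst k \<Longrightarrow> snd k (chart_inv k x) = x"
    "continuous_map (top_of_set (snd k ` fst k)) (mtop M) (chart_inv k)"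
    "openin (mtop M) V \<Longrightarrow> V \<subseteq> fst k \<Longrightarrow> open (snd k ` V)"
proof -
  have c: "chart_on (mtop M) k"
    using smooth_4_manifold assms unfolding smooth_4_manifold_def by blast
  then show o: "openin (mtop M) (fst k)" "open (snd k ` fst k)" by (auto simp: chart_on_def)
  then show sub: "fst k \<subseteq> pts M" using openin_subset by blast
  have h: "homeomorphic_map (subtopology (mtop M) (fst k)) (top_of_set (snd k ` fst k)) (snd k)"
    using c by (simp add: chart_on_def)
  show "continuous_map (subtopology (mtop M) (fst k)) euclidean (snd k)"
    using homeomorphic_imp_continuous_map[OF h] by (simp add: continuous_map_in_subtopology)
  have inj: "inj_on (snd k) (fst k)"
    using homeomorphic_imp_injective_map[OF h] sub by (simp add: inf_absorb2)
  then show 1: "p \<in> fst k \<Longrightarrow> chart_inv k (snd k p) = p" for p by (simp add: chart_inv_def)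
  then show 2: "x \<in> snd k ` fst k \<Longrightarrow> chart_inv k x \<in> fst k" "x \<in> snd k ` fst k \<Longrightarrow> snd k (chart_inv k x) = x" for x
    by auto
  obtain g where g: "homeomorphic_maps (subtopology (mtop M) (fst k)) (top_of_set (snd k ` fst k)) (snd k) g"
    using h homeomorphic_map_maps by blast
  then have cg: "continuous_map (top_of_set (snd k ` fst k)) (subtopology (mtop M) (fst k)) g"
    and gk: "\<And>p. p \<in> fst k \<Longrightarrow> g (snd k p) = p"
    using sub by (auto simp: homeomorphic_maps_def)
  have "continuous_map (top_of_set (snd k ` fst k)) (mtop M) g"
    using cg by (simp add: continuous_map_in_subtopology)
  then show "continuous_map (top_of_set (snd k ` fst k)) (mtop M) (chart_inv k)"
    by (rule continuous_map_eq) (use gk 1 in auto)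
  show "open (snd k ` V)" if "openin (mtop M) V" "V \<subseteq> fst k"
  proof -
    have "openin (subtopology (mtop M) (fst k)) V"
      using that unfolding openin_subtopology by blast
    then have "openin (top_of_set (snd k ` fst k)) (snd k ` V)"
      using homeomorphic_imp_open_map[OF h] by (simp add: open_map_def)
    then show ?thesis using o(2) by (metis openin_open_eq)
  qed
qed

lemma has_derivative_comp_charts:
  assumes k: "k \<in> atlas M" and l: "l \<in> atlas M" and V: "openin (mtop M) V" "p \<in> V" "V \<subseteq> fst k" "f ` V \<subseteq> fst l"
    and A: "((\<lambda>x. snd l (f (chart_inv k x))) has_derivative A) (at (snd k p))"
    and B: "((\<lambda>x. h (chart_inv l x)) has_derivative B) (at (snd l (f p)))"
  shows "((\<lambda>x. h (f (chart_inv k x))) has_derivative (\<lambda>u. B (A u))) (at (snd k p))"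
proof (rule has_derivative_transform_within_open)
  have p: "chart_inv k (snd k p) = p" using V chart(5)[OF k] by blast
  show "((\<lambda>x. h (chart_inv l (snd l (f (chart_inv k x))))) has_derivative (\<lambda>u. B (A u))) (at (snd k p))"
    using diff_chain_at[OF A, of "\<lambda>x. h (chart_inv l x)" B] B by (simp add: o_def p)
  show "open (snd k ` V)" by (rule chart(9)[OF k V(1,3)])
  show "snd k p \<in> snd k ` V" using V by blast
  show "h (chart_inv l (snd l (f (chart_inv k x)))) = h (f (chart_inv k x))" if x: "x \<in> snd k ` V" for x
  proof -
    obtain y where y: "y \<in> V" "x = snd k y" using x by blast
    then have "chart_inv k x = y" "f y \<in> fst l" using V(3,4) chart(5)[OF k] by auto
    then show ?thesis using chart(5)[OF l] by simp
  qed
qed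

lemma transition_has_derivative:
  assumes k: "k \<in> charts_at M p" and l: "l \<in> charts_at M p"
  shows "((\<lambda>x. snd l (id (chart_inv k x))) has_derivative tderiv id k l p) (at (snd k p))"
    and "continuous_map (subtopology (mtop M) (fst k \<inter> fst l)) euclidean (\<lambda>p. tderiv id k l p u)"
proof -
  have ka: "k \<in> atlas M" "p \<in> fst k" and la: "l \<in> atlas M" "p \<in> fst l" using k l by (auto simp: charts_at_def)
  have s: "smooth_on (snd k ` (fst k \<inter> fst l)) (\<lambda>x. snd l (id (chart_inv k x)))"
    using smooth_4_manifold ka la unfolding smooth_4_manifold_def charts_compatible_def id_apply by blast
  have o: "open (snd k ` (fst k \<inter> fst l))"
    using chart(1)[OF ka(1)] chart(1)[OF la(1)] by (intro chart(9)[OF ka(1)]) auto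
  show "((\<lambda>x. snd l (id (chart_inv k x))) has_derivative tderiv id k l p) (at (snd k p))"
    unfolding tderiv_def by (rule smooth_on_open_derivative(1)[OF s o]) (use ka la in auto)
  have c: "continuous_map (subtopology (mtop M) (fst k \<inter> fst l)) euclidean (snd k)"
    using chart(4)[OF ka(1)] by (rule continuous_map_from_subtopology_mono) auto
  show "continuous_map (subtopology (mtop M) (fst k \<inter> fst l)) euclidean (\<lambda>p. tderiv id k l p u)"
    unfolding tderiv_def
    by (rule cm_compose_on[OF c smooth_on_open_derivative(2)[OF s o]]) auto
qed

lemma linear_transition: "\<lbrakk>k \<in> charts_at M p; l \<in> charts_at M p\<rbrakk> \<Longrightarrow> linear (tderiv id k l p)"
  using transition_has_derivative(1) has_derivative_linear by blast

lemma transition_comp: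
  assumes k: "k \<in> charts_at M p" and l: "l \<in> charts_at M p" and m: "m \<in> charts_at M p"
  shows "tderiv id l m p (tderiv id k l p u) = tderiv id k m p u"
proof -
  have "((\<lambda>x. snd m (chart_inv k x)) has_derivative (\<lambda>u. tderiv id l m p (tderiv id k l p u))) (at (snd k p))"
  proof (rule has_derivative_comp_charts[where f = id and V = "fst k \<inter> fst l" and l = l and h = "snd m"
        and A = "tderiv id k l p" and B = "tderiv id l m p", simplified id_apply])
    show "openin (mtop M) (fst k \<inter> fst l)"
      using chart(1)[OF charts_atD(1)[OF k]] chart(1)[OF charts_atD(1)[OF l]] by (rule openin_Int)
  qed (use k l transition_has_derivative(1)[OF k l] transition_has_derivative(1)[OF l m] in \<open>auto simp: charts_at_def\<close>)
  from frechet_derivative_at[OF this] show ?thesis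
    unfolding tderiv_def[of id k m] id_apply by metis
qed

lemma transition_self:
  assumes k: "k \<in> charts_at M p"
  shows "tderiv id k k p u = u"
proof -
  have ka: "k \<in> atlas M" "p \<in> fst k" using k by (auto simp: charts_at_def)
  have "((\<lambda>x. snd k (id (chart_inv k x))) has_derivative (\<lambda>x. x)) (at (snd k p))"
    by (rule has_derivative_transform_within_open[OF has_derivative_ident chart(2)[OF ka(1)]])
      (use ka chart(7)[OF ka(1)] in auto)
  then show ?thesis unfolding tderiv_def using frechet_derivative_at by metis
qed

lemma transition_inverse:
  "\<lbrakk>k \<in> charts_at M p; l \<in> charts_at M p\<rbrakk> \<Longrightarrow> tderiv id l k p (tderiv id k l p u) = u"
  using transition_comp transition_self by metis

lemma curve_map:
  assumes k: "k \<in> atlas M" and g: "\<gamma> 0 \<in> fst k" "\<forall>\<^sub>F r in nhds 0. \<gamma> r \<in> fst k"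
    and v: "((\<lambda>r. snd k (\<gamma> r)) has_vector_derivative v) (at 0)"
    and A: "((\<lambda>x. h (chart_inv k x)) has_derivative A) (at (snd k (\<gamma> 0)))"
  shows "((\<lambda>r. h (\<gamma> r)) has_vector_derivative A v) (at (0::real))"
proof -
  have 1: "((\<lambda>r. h (chart_inv k (snd k (\<gamma> r)))) has_vector_derivative A v) (at 0)"
    using vector_derivative_diff_chain_within[OF v, of "\<lambda>x. h (chart_inv k x)" A] has_derivative_at_withinI[OF A]
    by (simp add: o_def)
  obtain S where "open S" "0 \<in> S" "\<And>r. r \<in> S \<Longrightarrow> \<gamma> r \<in> fst k"
    using g(2) unfolding eventually_nhds by blast
  then show ?thesis
    by (intro has_vector_derivative_transform_within_open[OF 1, of S]) (simp_all add: chart(5)[OF k])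
qed

lemma curve_eventually_in:
  assumes k: "k \<in> atlas M" and g: "\<gamma> 0 \<in> fst k" "\<forall>\<^sub>F r in nhds 0. \<gamma> r \<in> fst k"
    and v: "((\<lambda>r. snd k (\<gamma> r)) has_vector_derivative v) (at 0)" and V: "openin (mtop M) V" "\<gamma> 0 \<in> V"
  shows "\<forall>\<^sub>F r in nhds (0::real). \<gamma> r \<in> V"
proof -
  have "isCont (\<lambda>r. snd k (\<gamma> r)) 0" using v has_vector_derivative_continuous by blast
  moreover have "open (snd k ` (fst k \<inter> V))"
    using chart(1)[OF k] V by (intro chart(9)[OF k]) auto
  ultimately have "\<forall>\<^sub>F r in nhds 0. snd k (\<gamma> r) \<in> snd k ` (fst k \<inter> V)"
    using g(1) V(2) topological_tendstoD[OF iffD1[OF tendsto_at_iff_tendsto_nhds[of "\<lambda>r. snd k (\<gamma> r)" 0]]]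
    unfolding isCont_def by blast
  then show ?thesis using g(2)
    by eventually_elim (metis (no_types, lifting) Int_iff chart(5)[OF k] imageE)
qed

end

lemma cm_linear_apply:
  fixes A :: "'x \<Rightarrow> real^'n \<Rightarrow> real^'m"
  assumes "\<And>x. x \<in> topspace X \<Longrightarrow> linear (A x)" "\<And>u. continuous_map X euclidean (\<lambda>x. A x u)"
    and "continuous_map X euclidean v"
  shows "continuous_map X euclidean (\<lambda>x. A x (v x))"
proof (rule continuous_map_eq)
  show "continuous_map X euclidean (\<lambda>x. \<Sum>i\<in>UNIV. v x $ i *\<^sub>R A x (axis i 1))"
    by (intro continuous_map_sum cm_scaleR cm_nth assms) auto
  show "(\<Sum>i\<in>UNIV. v x $ i *\<^sub>R A x (axis i 1)) = A x (v x)" if "x \<in> topspace X" for x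
  proof -
    have "A x (v x) = A x (\<Sum>i\<in>UNIV. v x $ i *\<^sub>R axis i 1)"
      using basis_expansion[of "v x"] by (simp add: scalar_mult_eq_scaleR)
    then show ?thesis using assms(1)[OF that] by (simp add: linear_sum linear_cmul)
  qed
qed

lemma cm_bilinear_apply:
  fixes b :: "'x \<Rightarrow> real^'n \<Rightarrow> real^'n \<Rightarrow> real"
  assumes b: "\<And>x. x \<in> topspace X \<Longrightarrow> bilinear (b x)" and cb: "\<And>u v. continuous_map X euclideanreal (\<lambda>x. b x u v)"
    and "continuous_map X euclidean v" "continuous_map X euclidean w"
  shows "continuous_map X euclideanreal (\<lambda>x. b x (v x) (w x))"
proof (rule continuous_map_eq)
  show "continuous_map X euclidean (\<lambda>x. \<Sum>i\<in>UNIV. \<Sum>j\<in>UNIV. v x $ i * w x $ j * b x (axis i 1) (axis j 1))"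
    by (intro continuous_map_sum continuous_map_real_mult cm_nth assms) auto
  show "(\<Sum>i\<in>UNIV. \<Sum>j\<in>UNIV. v x $ i * w x $ j * b x (axis i 1) (axis j 1)) = b x (v x) (w x)" if "x \<in> topspace X" for x
  proof -
    have l: "linear (\<lambda>u. b x u y)" "linear (b x y)" for y using b[OF that] by (auto simp: bilinear_def)
    have "b x (v x) (w x) = b x (\<Sum>i\<in>UNIV. v x $ i *\<^sub>R axis i 1) (\<Sum>i\<in>UNIV. w x $ i *\<^sub>R axis i 1)"
      using basis_expansion[of "v x"] basis_expansion[of "w x"] by (simp add: scalar_mult_eq_scaleR)
    also have "\<dots> = (\<Sum>i\<in>UNIV. v x $ i * (\<Sum>j\<in>UNIV. w x $ j * b x (axis i 1) (axis j 1)))"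
      by (simp add: linear_sum[OF l(1)] linear_cmul[OF l(1)]) (simp add: linear_sum[OF l(2)] linear_cmul[OF l(2)])
    finally show ?thesis by (simp add: sum_distrib_left mult.assoc)
  qed
qed

lemma cm_endo_inner:
  assumes "\<And>x. x \<in> topspace X \<Longrightarrow> linear (A x)" "\<And>u. continuous_map X euclidean (\<lambda>x. A x u)"
    and "\<And>x. x \<in> topspace X \<Longrightarrow> linear (B x)" "\<And>u. continuous_map X euclidean (\<lambda>x. B x u)"
  shows "continuous_map X euclideanreal (\<lambda>x. endo_inner (A x) (B x))"
proof (rule continuous_map_eq)
  have "continuous_map X euclideanreal (\<lambda>x. \<Sum>i\<in>UNIV. \<Sum>j\<in>UNIV. A x (axis j 1) $ i * B x (axis i 1) $ j)"
    by (intro continuous_map_sum continuous_map_real_mult cm_nth assms) auto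
  then show "continuous_map X euclideanreal (\<lambda>x. - (\<Sum>i\<in>UNIV. \<Sum>j\<in>UNIV. A x (axis j 1) $ i * B x (axis i 1) $ j) / 4)"
    by (intro continuous_map_real_divide continuous_map_minus) auto
qed (simp add: endo_inner_components assms)

section \<open>Tensor fields along a continuous map\<close>

context smooth_manifold
begin

definition chart_of :: "'a \<Rightarrow> 'a chart" where
  "chart_of p = (SOME k. k \<in> charts_at M p)"

lemma chart_of: "p \<in> pts M \<Longrightarrow> chart_of p \<in> charts_at M p"
  using ex_chart[of p] unfolding chart_of_def by (rule someI_ex)

text \<open>The four kinds of fields share one encoding: components in all charts, related by the
  transition maps and continuous on each chart domain. They live along a map \<open>f\<close> from a
  space \<open>Q\<close>, since those needed are defined over a cylinder or a family of cylinders
  rather than on \<open>M\<close>.\<close>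

definition scalar_field :: "'q topology \<Rightarrow> ('q \<Rightarrow> 'a) \<Rightarrow> 'q set \<Rightarrow> ('a chart \<Rightarrow> 'q \<Rightarrow> real) \<Rightarrow> bool" where
  "scalar_field Q f V s \<longleftrightarrow>
     (\<forall>q\<in>V. \<forall>k\<in>charts_at M (f q). \<forall>l\<in>charts_at M (f q). s k q = s l q) \<and>
     (\<forall>k\<in>atlas M. continuous_map (subtopology Q {q \<in> V. f q \<in> fst k}) euclideanreal (s k))"

definition vector_field :: "'q topology \<Rightarrow> ('q \<Rightarrow> 'a) \<Rightarrow> 'q set \<Rightarrow> ('a chart \<Rightarrow> 'q \<Rightarrow> real^4) \<Rightarrow> bool" where
  "vector_field Q f V v \<longleftrightarrow>
     (\<forall>q\<in>V. \<forall>k\<in>charts_at M (f q). \<forall>l\<in>charts_at M (f q). tderiv id k l (f q) (v k q) = v l q) \<and>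
     (\<forall>k\<in>atlas M. continuous_map (subtopology Q {q \<in> V. f q \<in> fst k}) euclidean (v k))"

definition endo_field_along :: "'q topology \<Rightarrow> ('q \<Rightarrow> 'a) \<Rightarrow> 'q set \<Rightarrow> ('a chart \<Rightarrow> 'q \<Rightarrow> endo) \<Rightarrow> bool" where
  "endo_field_along Q f V A \<longleftrightarrow>
     (\<forall>q\<in>V. \<forall>k\<in>charts_at M (f q). linear (A k q)) \<and>
     (\<forall>q\<in>V. \<forall>k\<in>charts_at M (f q). \<forall>l\<in>charts_at M (f q). \<forall>u.
        tderiv id k l (f q) (A k q u) = A l q (tderiv id k l (f q) u)) \<and>
     (\<forall>k\<in>atlas M. \<forall>u. continuous_map (subtopology Q {q \<in> V. f q \<in> fst k}) euclidean (\<lambda>q. A k q u))"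

definition form_field :: "'q topology \<Rightarrow> ('q \<Rightarrow> 'a) \<Rightarrow> 'q set \<Rightarrow> ('a chart \<Rightarrow> 'q \<Rightarrow> real^4 \<Rightarrow> real^4 \<Rightarrow> real) \<Rightarrow> bool" where
  "form_field Q f V \<tau> \<longleftrightarrow>
     (\<forall>q\<in>V. \<forall>k\<in>charts_at M (f q). bilinear (\<tau> k q)) \<and>
     (\<forall>q\<in>V. \<forall>k\<in>charts_at M (f q). \<forall>l\<in>charts_at M (f q). \<forall>u v.
        \<tau> k q u v = \<tau> l q (tderiv id k l (f q) u) (tderiv id k l (f q) v)) \<and>
     (\<forall>k\<in>atlas M. \<forall>u v. continuous_map (subtopology Q {q \<in> V. f q \<in> fst k}) euclideanreal (\<lambda>q. \<tau> k q u v))"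

lemma topspace_fieldD: "q \<in> topspace (subtopology Q {q \<in> V. f q \<in> fst k}) \<Longrightarrow> k \<in> atlas M \<Longrightarrow> q \<in> V \<and> k \<in> charts_at M (f q)"
  by (auto simp: charts_at_def)

text \<open>The choice \<open>chart_of\<close> jumps from point to point, but the value does not
  depend on the chart, so near each point one fixed chart may be used.\<close>

lemma scalar_field_continuous:
  assumes f: "continuous_map Q (mtop M) f" and V: "V \<subseteq> topspace Q" and s: "scalar_field Q f V s"
  shows "continuous_map (subtopology Q V) euclideanreal (\<lambda>q. s (chart_of (f q)) q)"
proof (rule cm_local)
  fix q assume "q \<in> topspace (subtopology Q V)"
  then have q: "q \<in> V" "q \<in> topspace Q" by auto
  then have fq: "f q' \<in> pts M" if "q' \<in> V" for q'
    using continuous_map_image_subset_topspace[OF f] V that by blast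
  define k where "k = chart_of (f q)"
  have k: "k \<in> charts_at M (f q)" unfolding k_def by (rule chart_of[OF fq[OF q(1)]])
  let ?W = "{q \<in> V. f q \<in> fst k}"
  have "openin Q {q \<in> topspace Q. f q \<in> fst k}"
    using k by (intro openin_continuous_map_preimage[OF f] chart(1)) (auto simp: charts_at_def)
  moreover have "?W = {q \<in> topspace Q. f q \<in> fst k} \<inter> V" using V by auto
  ultimately have "openin (subtopology Q V) ?W" unfolding openin_subtopology by blast
  moreover have "subtopology (subtopology Q V) ?W = subtopology Q ?W"
  proof -
    have "V \<inter> ?W = ?W" by blast
    then show ?thesis by (simp add: subtopology_subtopology)
  qed
  moreover have "s (chart_of (f q')) q' = s k q'" if "q' \<in> ?W" for q'
  proof -
    have "k \<in> charts_at M (f q')" "chart_of (f q') \<in> charts_at M (f q')" "q' \<in> V"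
      using that chart_of[OF fq, of q'] charts_atD(1)[OF k] by (auto simp: charts_at_def)
    then show ?thesis using s unfolding scalar_field_def by blast
  qed
  moreover have "continuous_map (subtopology Q ?W) euclideanreal (s k)"
    using s charts_atD(1)[OF k] unfolding scalar_field_def by blast
  ultimately show "\<exists>W h. openin (subtopology Q V) W \<and> q \<in> W \<and> continuous_map (subtopology (subtopology Q V) W) euclideanreal h \<and>
      (\<forall>y\<in>W. s (chart_of (f y)) y = h y)"
    using q charts_atD(2)[OF k] by (intro exI[of _ ?W] exI[of _ "s k"]) simp
qed

lemma endo_field_alongD:
  assumes "endo_field_along Q f V A"
  shows "\<lbrakk>q \<in> V; k \<in> charts_at M (f q)\<rbrakk> \<Longrightarrow> linear (A k q)"
    and "\<lbrakk>q \<in> V; k \<in> charts_at M (f q); l \<in> charts_at M (f q)\<rbrakk> \<Longrightarrow>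
      tderiv id k l (f q) (A k q u) = A l q (tderiv id k l (f q) u)"
    and "k \<in> atlas M \<Longrightarrow> continuous_map (subtopology Q {q \<in> V. f q \<in> fst k}) euclidean (\<lambda>q. A k q u)"
    and "\<lbrakk>k \<in> atlas M; q \<in> topspace (subtopology Q {q \<in> V. f q \<in> fst k})\<rbrakk> \<Longrightarrow> linear (A k q)"
  using assms unfolding endo_field_along_def by (blast dest: topspace_fieldD)+

lemma vector_fieldD:
  assumes "vector_field Q f V v"
  shows "\<lbrakk>q \<in> V; k \<in> charts_at M (f q); l \<in> charts_at M (f q)\<rbrakk> \<Longrightarrow> tderiv id k l (f q) (v k q) = v l q"
    and "k \<in> atlas M \<Longrightarrow> continuous_map (subtopology Q {q \<in> V. f q \<in> fst k}) euclidean (v k)"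
  using assms unfolding vector_field_def by blast+

lemma form_fieldD:
  assumes "form_field Q f V \<tau>"
  shows "\<lbrakk>q \<in> V; k \<in> charts_at M (f q)\<rbrakk> \<Longrightarrow> bilinear (\<tau> k q)"
    and "\<lbrakk>q \<in> V; k \<in> charts_at M (f q); l \<in> charts_at M (f q)\<rbrakk> \<Longrightarrow>
      \<tau> k q u v = \<tau> l q (tderiv id k l (f q) u) (tderiv id k l (f q) v)"
    and "k \<in> atlas M \<Longrightarrow> continuous_map (subtopology Q {q \<in> V. f q \<in> fst k}) euclideanreal (\<lambda>q. \<tau> k q u v)"
    and "\<lbrakk>k \<in> atlas M; q \<in> topspace (subtopology Q {q \<in> V. f q \<in> fst k})\<rbrakk> \<Longrightarrow> bilinear (\<tau> k q)"
  using assms unfolding form_field_def by (blast dest: topspace_fieldD)+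

lemma vector_field_apply:
  assumes A: "endo_field_along Q f V A" and v: "vector_field Q f V v"
  shows "vector_field Q f V (\<lambda>k q. A k q (v k q))"
  unfolding vector_field_def
proof (intro conjI ballI)
  show "tderiv id k l (f q) (A k q (v k q)) = A l q (v l q)"
    if "q \<in> V" "k \<in> charts_at M (f q)" "l \<in> charts_at M (f q)" for q k l
    by (simp only: endo_field_alongD(2)[OF A that] vector_fieldD(1)[OF v that])
  show "continuous_map (subtopology Q {q \<in> V. f q \<in> fst k}) euclidean (\<lambda>q. A k q (v k q))" if "k \<in> atlas M" for k
    by (rule cm_linear_apply[OF endo_field_alongD(4)[OF A that] endo_field_alongD(3)[OF A that] vector_fieldD(2)[OF v that]])
qed

lemma endo_field_comp:
  assumes A: "endo_field_along Q f V A" and B: "endo_field_along Q f V B"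
  shows "endo_field_along Q f V (\<lambda>k q u. A k q (B k q u))"
  unfolding endo_field_along_def
proof (intro conjI ballI allI)
  show "linear (\<lambda>u. A k q (B k q u))" if "q \<in> V" "k \<in> charts_at M (f q)" for q k
    using linear_compose[OF endo_field_alongD(1)[OF B that] endo_field_alongD(1)[OF A that]] by (simp add: o_def)
  show "tderiv id k l (f q) (A k q (B k q u)) = A l q (B l q (tderiv id k l (f q) u))"
    if "q \<in> V" "k \<in> charts_at M (f q)" "l \<in> charts_at M (f q)" for q k l u
    by (simp only: endo_field_alongD(2)[OF A that] endo_field_alongD(2)[OF B that])
  show "continuous_map (subtopology Q {q \<in> V. f q \<in> fst k}) euclidean (\<lambda>q. A k q (B k q u))" if "k \<in> atlas M" for k u
    by (rule cm_linear_apply[OF endo_field_alongD(4)[OF A that] endo_field_alongD(3)[OF A that] endo_field_alongD(3)[OF B that]])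
qed

lemma endo_field_add:
  assumes A: "endo_field_along Q f V A" and B: "endo_field_along Q f V B"
  shows "endo_field_along Q f V (\<lambda>k q u. A k q u + B k q u)"
  unfolding endo_field_along_def
proof (intro conjI ballI allI)
  show "linear (\<lambda>u. A k q u + B k q u)" if "q \<in> V" "k \<in> charts_at M (f q)" for q k
    by (rule linear_compose_add[OF endo_field_alongD(1)[OF A that] endo_field_alongD(1)[OF B that]])
  show "tderiv id k l (f q) (A k q u + B k q u) = A l q (tderiv id k l (f q) u) + B l q (tderiv id k l (f q) u)"
    if "q \<in> V" "k \<in> charts_at M (f q)" "l \<in> charts_at M (f q)" for q k l u
    by (simp only: linear_add[OF linear_transition[OF that(2,3)]] endo_field_alongD(2)[OF A that] endo_field_alongD(2)[OF B that])
  show "continuous_map (subtopology Q {q \<in> V. f q \<in> fst k}) euclidean (\<lambda>q. A k q u + B k q u)" if "k \<in> atlas M" for k u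
    by (rule continuous_map_add[OF endo_field_alongD(3)[OF A that] endo_field_alongD(3)[OF B that]])
qed

lemma endo_field_scaleR:
  assumes A: "endo_field_along Q f V A" and c: "continuous_map (subtopology Q V) euclideanreal c"
  shows "endo_field_along Q f V (\<lambda>k q u. c q *\<^sub>R A k q u)"
  unfolding endo_field_along_def
proof (intro conjI ballI allI)
  show "linear (\<lambda>u. c q *\<^sub>R A k q u)" if "q \<in> V" "k \<in> charts_at M (f q)" for q k
    by (rule linear_compose_scale_right[OF endo_field_alongD(1)[OF A that]])
  show "tderiv id k l (f q) (c q *\<^sub>R A k q u) = c q *\<^sub>R A l q (tderiv id k l (f q) u)"
    if "q \<in> V" "k \<in> charts_at M (f q)" "l \<in> charts_at M (f q)" for q k l u
    by (simp only: linear_cmul[OF linear_transition[OF that(2,3)]] endo_field_alongD(2)[OF A that])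
  have "continuous_map (subtopology Q {q \<in> V. f q \<in> fst k}) euclideanreal c" for k
    using c by (rule continuous_map_from_subtopology_mono) auto
  then show "continuous_map (subtopology Q {q \<in> V. f q \<in> fst k}) euclidean (\<lambda>q. c q *\<^sub>R A k q u)" if "k \<in> atlas M" for k u
    by (rule cm_scaleR[OF _ endo_field_alongD(3)[OF A that]])
qed

lemma form_field_scalar:
  assumes "form_field Q f V \<tau>" "vector_field Q f V v" "vector_field Q f V w"
  shows "scalar_field Q f V (\<lambda>k q. \<tau> k q (v k q) (w k q))"
  unfolding scalar_field_def
proof (intro conjI ballI)
  show "\<tau> k q (v k q) (w k q) = \<tau> l q (v l q) (w l q)" if "q \<in> V" "k \<in> charts_at M (f q)" "l \<in> charts_at M (f q)" for q k l
  proof -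
    have "\<tau> k q (v k q) (w k q) = \<tau> l q (tderiv id k l (f q) (v k q)) (tderiv id k l (f q) (w k q))"
      by (rule form_fieldD(2)[OF assms(1) that])
    then show ?thesis by (simp only: vector_fieldD(1)[OF assms(2) that] vector_fieldD(1)[OF assms(3) that])
  qed
  show "continuous_map (subtopology Q {q \<in> V. f q \<in> fst k}) euclideanreal (\<lambda>q. \<tau> k q (v k q) (w k q))" if "k \<in> atlas M" for k
    by (rule cm_bilinear_apply[OF form_fieldD(4)[OF assms(1) that] form_fieldD(3)[OF assms(1) that]
          vector_fieldD(2)[OF assms(2) that] vector_fieldD(2)[OF assms(3) that]])
qed

lemma endo_field_conjugate:
  assumes "endo_field_along Q f V A" "q \<in> V" "k \<in> charts_at M (f q)" "l \<in> charts_at M (f q)"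
  shows "A l q = (\<lambda>u. tderiv id k l (f q) (A k q (tderiv id l k (f q) u)))"
proof
  fix u
  have "tderiv id k l (f q) (A k q (tderiv id l k (f q) u)) = A l q (tderiv id k l (f q) (tderiv id l k (f q) u))"
    by (rule endo_field_alongD(2)[OF assms])
  then show "A l q u = tderiv id k l (f q) (A k q (tderiv id l k (f q) u))"
    using transition_inverse[OF assms(4,3)] by simp
qed

lemma endo_field_inner:
  assumes A: "endo_field_along Q f V A" and B: "endo_field_along Q f V B"
  shows "scalar_field Q f V (\<lambda>k q. endo_inner (A k q) (B k q))"
  unfolding scalar_field_def
proof (intro conjI ballI)
  show "endo_inner (A k q) (B k q) = endo_inner (A l q) (B l q)" if q: "q \<in> V" "k \<in> charts_at M (f q)" "l \<in> charts_at M (f q)" for q k l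
    unfolding endo_field_conjugate[OF A q] endo_field_conjugate[OF B q]
    by (rule endo_inner_conjugate[symmetric])
      (rule endo_field_alongD(1)[OF A q(1,2)] endo_field_alongD(1)[OF B q(1,2)] linear_transition[OF q(2,3)]
        linear_transition[OF q(3,2)] transition_inverse[OF q(2,3)])+
  show "continuous_map (subtopology Q {q \<in> V. f q \<in> fst k}) euclideanreal (\<lambda>q. endo_inner (A k q) (B k q))" if "k \<in> atlas M" for k
    by (rule cm_endo_inner[OF endo_field_alongD(4)[OF A that] endo_field_alongD(3)[OF A that]
          endo_field_alongD(4)[OF B that] endo_field_alongD(3)[OF B that]])
qed

lemma field_pullback:
  assumes h: "continuous_map (subtopology Q' V') Q h" "\<And>q. q \<in> V' \<Longrightarrow> h q \<in> V \<and> f' q = f (h q)" and V': "V' \<subseteq> topspace Q'"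
  shows "endo_field_along Q f V A \<Longrightarrow> endo_field_along Q' f' V' (\<lambda>k q. A k (h q))"
    and "form_field Q f V \<tau> \<Longrightarrow> form_field Q' f' V' (\<lambda>k q. \<tau> k (h q))"
    and "vector_field Q f V v \<Longrightarrow> vector_field Q' f' V' (\<lambda>k q. v k (h q))"
proof -
  have c: "continuous_map (subtopology Q' {q \<in> V'. f' q \<in> fst k}) (subtopology Q {q \<in> V. f q \<in> fst k}) h" for k
  proof (rule continuous_map_into_subtopology)
    show "continuous_map (subtopology Q' {q \<in> V'. f' q \<in> fst k}) Q h"
      using h(1) by (rule continuous_map_from_subtopology_mono) auto
  qed (use h(2) in auto)
  have V: "h q \<in> V" "f' q = f (h q)" if "q \<in> V'" for q using h(2)[OF that] by auto
  show "endo_field_along Q' f' V' (\<lambda>k q. A k (h q))" if A: "endo_field_along Q f V A"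
    unfolding endo_field_along_def
  proof (intro conjI ballI allI)
    show "continuous_map (subtopology Q' {q \<in> V'. f' q \<in> fst k}) euclidean (\<lambda>q. A k (h q) u)" if "k \<in> atlas M" for k u
      by (rule cm_compose[OF c endo_field_alongD(3)[OF A that]])
  qed (use V endo_field_alongD(1,2)[OF A] in simp_all)
  show "form_field Q' f' V' (\<lambda>k q. \<tau> k (h q))" if A: "form_field Q f V \<tau>"
    unfolding form_field_def
  proof (intro conjI ballI allI)
    show "continuous_map (subtopology Q' {q \<in> V'. f' q \<in> fst k}) euclideanreal (\<lambda>q. \<tau> k (h q) u v)" if "k \<in> atlas M" for k u v
      by (rule cm_compose[OF c form_fieldD(3)[OF A that]])
    show "\<tau> k (h q) u v = \<tau> l (h q) (tderiv id k l (f' q) u) (tderiv id k l (f' q) v)"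
      if "q \<in> V'" "k \<in> charts_at M (f' q)" "l \<in> charts_at M (f' q)" for q k l u v
      using that V[OF that(1)] form_fieldD(2)[OF A, of "h q" k l] by simp
  qed (use V form_fieldD(1)[OF A] in simp_all)
  show "vector_field Q' f' V' (\<lambda>k q. v k (h q))" if A: "vector_field Q f V v"
    unfolding vector_field_def
  proof (intro conjI ballI)
    show "continuous_map (subtopology Q' {q \<in> V'. f' q \<in> fst k}) euclidean (\<lambda>q. v k (h q))" if "k \<in> atlas M" for k
      by (rule cm_compose[OF c vector_fieldD(2)[OF A that]])
  qed (use V vector_fieldD(1)[OF A] in simp_all)
qed

lemma field_subset:
  assumes V: "V' \<subseteq> V" and VQ: "V \<subseteq> topspace Q"
  shows "endo_field_along Q f V A \<Longrightarrow> endo_field_along Q f V' A"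
    and "form_field Q f V \<tau> \<Longrightarrow> form_field Q f V' \<tau>"
    and "vector_field Q f V v \<Longrightarrow> vector_field Q f V' v"
proof -
  have c: "continuous_map (subtopology Q V') Q (\<lambda>q. q)" by (simp add: continuous_map_from_subtopology)
  have "V' \<subseteq> topspace Q" using V VQ by blast
  note * = field_pullback[OF c _ this, of V f f, simplified]
  show "endo_field_along Q f V A \<Longrightarrow> endo_field_along Q f V' A" "form_field Q f V \<tau> \<Longrightarrow> form_field Q f V' \<tau>"
    "vector_field Q f V v \<Longrightarrow> vector_field Q f V' v"
    using * V by auto
qed

end

lemma smooth_on_cong:
  assumes "smooth_on S f" "\<And>x. x \<in> S \<Longrightarrow> f x = h x"
  shows "smooth_on S h"
  unfolding smooth_on_def
proof
  fix x assume "x \<in> S"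
  then obtain U g where "open U" "x \<in> U" "\<forall>n. Ck_on n U g" "\<forall>y\<in>S \<inter> U. g y = f y"
    using assms(1) unfolding smooth_on_def by blast
  then show "\<exists>U g. open U \<and> x \<in> U \<and> (\<forall>n. Ck_on n U g) \<and> (\<forall>y\<in>S \<inter> U. g y = h y)"
    using assms(2) by (intro exI[of _ U] exI[of _ g]) simp
qed

section \<open>The given tensors as fields; differentials of smooth maps\<close>

context smooth_manifold
begin

lemma charts_at_pts: "k \<in> charts_at M p \<Longrightarrow> p \<in> pts M"
  using chart(3)[OF charts_atD(1)] charts_atD(2) by blast

lemma two_form_field:
  assumes \<tau>: "two_form_on M S \<tau>"
  shows "form_field (mtop M) (\<lambda>p. p) S \<tau>"
  unfolding form_field_def
proof (intro conjI ballI allI)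
  show "bilinear (\<tau> k p)" if "p \<in> S" "k \<in> charts_at M p" for p k
    using \<tau> that unfolding two_form_on_def by blast
  show "\<tau> k p u v = \<tau> l p (tderiv id k l p u) (tderiv id k l p v)" if "p \<in> S" "k \<in> charts_at M p" "l \<in> charts_at M p" for p k l u v
    using \<tau> that unfolding two_form_on_def by blast
  show "continuous_map (subtopology (mtop M) {p \<in> S. p \<in> fst k}) euclideanreal (\<lambda>p. \<tau> k p u v)" if k: "k \<in> atlas M" for k u v
  proof (rule continuous_map_eq)
    have "smooth_on (snd k ` (fst k \<inter> S)) (\<lambda>x. \<tau> k (chart_inv k x) u v)"
      using \<tau> k unfolding two_form_on_def by blast
    then have c: "continuous_on (snd k ` (fst k \<inter> S)) (\<lambda>x. \<tau> k (chart_inv k x) u v)"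
      by (rule smooth_on_continuous)
    have "continuous_map (subtopology (mtop M) {p \<in> S. p \<in> fst k}) euclidean (snd k)"
      using chart(4)[OF k] by (rule continuous_map_from_subtopology_mono) auto
    then show "continuous_map (subtopology (mtop M) {p \<in> S. p \<in> fst k}) euclideanreal (\<lambda>p. \<tau> k (chart_inv k (snd k p)) u v)"
      by (rule cm_compose_on[OF _ c]) auto
  qed (simp add: chart(5)[OF k])
qed

lemma two_form_alternating: "two_form_on M S \<tau> \<Longrightarrow> p \<in> S \<Longrightarrow> k \<in> charts_at M p \<Longrightarrow> \<tau> k p u u = 0"
  unfolding two_form_on_def by blast

lemma almost_complex_field:
  assumes J: "almost_complex M J"
  shows "endo_field_along (mtop M) (\<lambda>p. p) (pts M) J"
  unfolding endo_field_along_def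
proof (intro conjI ballI allI)
  show "linear (J k p)" if "p \<in> pts M" "k \<in> charts_at M p" for p k
    using J that unfolding almost_complex_def by blast
  show "tderiv id k l p (J k p u) = J l p (tderiv id k l p u)" if "p \<in> pts M" "k \<in> charts_at M p" "l \<in> charts_at M p" for p k l u
    using J that unfolding almost_complex_def by blast
  show "continuous_map (subtopology (mtop M) {p \<in> pts M. p \<in> fst k}) euclidean (\<lambda>p. J k p u)" if k: "k \<in> atlas M" for k u
  proof (rule continuous_map_eq)
    have "smooth_on (snd k ` fst k) (\<lambda>x. J k (chart_inv k x) u)"
      using J k unfolding almost_complex_def by blast
    then have c: "continuous_on (snd k ` fst k) (\<lambda>x. J k (chart_inv k x) u)"
      by (rule smooth_on_continuous)
    have "continuous_map (subtopology (mtop M) {p \<in> pts M. p \<in> fst k}) euclidean (snd k)"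
      using chart(4)[OF k] by (rule continuous_map_from_subtopology_mono) auto
    then show "continuous_map (subtopology (mtop M) {p \<in> pts M. p \<in> fst k}) euclidean (\<lambda>p. J k (chart_inv k (snd k p)) u)"
      by (rule cm_compose_on[OF _ c]) auto
  qed (simp add: chart(5)[OF k])
qed

lemma form_field_right:
  assumes t: "form_field Q f V \<tau>" and A: "endo_field_along Q f V A"
  shows "form_field Q f V (\<lambda>k q u v. \<tau> k q u (A k q v))"
  unfolding form_field_def
proof (intro conjI ballI allI)
  show "bilinear (\<lambda>u v. \<tau> k q u (A k q v))" if "q \<in> V" "k \<in> charts_at M (f q)" for q k
    using form_fieldD(1)[OF t that] endo_field_alongD(1)[OF A that] linear_compose[of "A k q"]
    by (auto simp: bilinear_def o_def)
  show "\<tau> k q u (A k q v) = \<tau> l q (tderiv id k l (f q) u) (A l q (tderiv id k l (f q) v))"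
    if "q \<in> V" "k \<in> charts_at M (f q)" "l \<in> charts_at M (f q)" for q k l u v
    using form_fieldD(2)[OF t that, of u "A k q v"] by (simp only: endo_field_alongD(2)[OF A that])
  show "continuous_map (subtopology Q {q \<in> V. f q \<in> fst k}) euclideanreal (\<lambda>q. \<tau> k q u (A k q v))" if "k \<in> atlas M" for k u v
    by (rule cm_bilinear_apply[OF form_fieldD(4)[OF t that] form_fieldD(3)[OF t that] continuous_map_canonical_const endo_field_alongD(3)[OF A that]])
qed

text \<open>A constant coordinate vector field of the chart \<open>l\<close>, expressed in all other
  charts. These are the raw material for the local frames.\<close>

lemma transported_vector_field:
  assumes l: "l \<in> atlas M"
  shows "vector_field (mtop M) (\<lambda>p. p) (fst l) (\<lambda>k p. tderiv id l k p u)"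
  unfolding vector_field_def
proof (intro conjI ballI)
  show "tderiv id k m p (tderiv id l k p u) = tderiv id l m p u" if "p \<in> fst l" "k \<in> charts_at M p" "m \<in> charts_at M p" for p k m
    using that l by (intro transition_comp) (auto simp: charts_at_def)
  show "continuous_map (subtopology (mtop M) {p \<in> fst l. p \<in> fst k}) euclidean (\<lambda>p. tderiv id l k p u)" if k: "k \<in> atlas M" for k
  proof (cases "fst l \<inter> fst k = {}")
    case True
    then have e: "{p \<in> fst l. p \<in> fst k} = {}" by blast
    show ?thesis unfolding e by simp
  next
    case False
    then obtain p where "p \<in> fst l \<inter> fst k" by blast
    then have "l \<in> charts_at M p" "k \<in> charts_at M p" using k l by (auto simp: charts_at_def)
    from transition_has_derivative(2)[OF this] show ?thesis by (simp add: Int_def)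
  qed
qed

lemma smooth_map_has_derivative:
  assumes f: "smooth_map M (pts M) f" and k: "k \<in> charts_at M p" and l: "l \<in> charts_at M (f p)"
  shows "((\<lambda>x. snd l (f (chart_inv k x))) has_derivative tderiv f k l p) (at (snd k p))"
    and "openin (mtop M) {q \<in> fst k. f q \<in> fst l}"
proof -
  have cf: "continuous_map (mtop M) (mtop M) f" using f by (simp add: smooth_map_def)
  have ka: "k \<in> atlas M" "p \<in> fst k" and la: "l \<in> atlas M" "f p \<in> fst l" using k l by (auto simp: charts_at_def)
  let ?V = "{q \<in> fst k. f q \<in> fst l}"
  have "openin (mtop M) {q \<in> pts M. f q \<in> fst l}"
    by (rule openin_continuous_map_preimage[OF cf chart(1)[OF la(1)]])
  then have "openin (mtop M) ({q \<in> pts M. f q \<in> fst l} \<inter> fst k)" using chart(1)[OF ka(1)] by (rule openin_Int)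
  moreover have "{q \<in> pts M. f q \<in> fst l} \<inter> fst k = ?V" using chart(3)[OF ka(1)] by blast
  ultimately show V: "openin (mtop M) ?V" by simp
  have e: "{q \<in> fst k \<inter> pts M. f q \<in> fst l} = ?V" using chart(3)[OF ka(1)] by blast
  have "smooth_on (snd k ` {q \<in> fst k \<inter> pts M. f q \<in> fst l}) (\<lambda>x. snd l (f (chart_inv k x)))"
    using f ka la unfolding smooth_map_def by blast
  then have "smooth_on (snd k ` ?V) (\<lambda>x. snd l (f (chart_inv k x)))" unfolding e .
  then show "((\<lambda>x. snd l (f (chart_inv k x))) has_derivative tderiv f k l p) (at (snd k p))"
    unfolding tderiv_def
    by (rule smooth_on_open_derivative(1)) (use ka la V in \<open>auto intro: chart(9)[OF ka(1)]\<close>)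
qed

lemma tderiv_comp:
  assumes f: "smooth_map M (pts M) f" and h: "smooth_map M (pts M) h"
    and k: "k \<in> charts_at M p" and l: "l \<in> charts_at M (f p)" and m: "m \<in> charts_at M (h (f p))"
  shows "((\<lambda>x. snd m (h (f (chart_inv k x)))) has_derivative (\<lambda>u. tderiv h l m (f p) (tderiv f k l p u))) (at (snd k p))"
  by (rule has_derivative_comp_charts[where V = "{q \<in> fst k. f q \<in> fst l}" and l = l and h = "\<lambda>y. snd m (h y)"
        and A = "tderiv f k l p" and B = "tderiv h l m (f p)"])
    (use k l smooth_map_has_derivative[OF f k l] smooth_map_has_derivative(1)[OF h l m] in \<open>auto simp: charts_at_def\<close>)

lemma smooth_map_id: "smooth_map M (pts M) id"
  unfolding smooth_map_def
proof (intro conjI ballI)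
  show "smooth_on (snd k ` {p \<in> fst k \<inter> pts M. id p \<in> fst l}) (\<lambda>x. snd l (id (chart_inv k x)))" if k: "k \<in> atlas M" and l: "l \<in> atlas M" for k l
  proof -
    have "{p \<in> fst k \<inter> pts M. id p \<in> fst l} = fst k \<inter> fst l" using chart(3)[OF k] by auto
    moreover have "smooth_on (snd k ` (fst k \<inter> fst l)) (\<lambda>x. snd l (chart_inv k x))"
      using smooth_4_manifold k l unfolding smooth_4_manifold_def charts_compatible_def by blast
    ultimately show ?thesis by simp
  qed
qed simp

lemma tderiv_eqI: "((\<lambda>x. snd l (f (chart_inv k x))) has_derivative A) (at (snd k p)) \<Longrightarrow> tderiv f k l p = A"
  unfolding tderiv_def by (rule frechet_derivative_at[symmetric])

lemma tderiv_transition: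
  assumes f: "smooth_map M (pts M) f" and k: "k \<in> charts_at M p" and l: "l \<in> charts_at M (f p)"
  shows "m \<in> charts_at M (f p) \<Longrightarrow> tderiv id l m (f p) (tderiv f k l p u) = tderiv f k m p u"
    and "m \<in> charts_at M p \<Longrightarrow> tderiv f m l p (tderiv id k m p u) = tderiv f k l p u"
proof -
  show "tderiv id l m (f p) (tderiv f k l p u) = tderiv f k m p u" if m: "m \<in> charts_at M (f p)"
    using tderiv_eqI[of m f k, OF tderiv_comp[OF f smooth_map_id k l, of m, unfolded id_apply, folded id_def]] m
    by (simp add: fun_eq_iff id_def)
  show "tderiv f m l p (tderiv id k m p u) = tderiv f k l p u" if m: "m \<in> charts_at M p"
    using tderiv_eqI[of l f k, OF tderiv_comp[OF smooth_map_id f k, of m l, unfolded id_apply, folded id_def]] m l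
    by (simp add: fun_eq_iff id_def)
qed

lemma linear_tderiv:
  assumes "smooth_map M (pts M) f" "k \<in> charts_at M p" "l \<in> charts_at M (f p)"
  shows "linear (tderiv f k l p)"
  using smooth_map_has_derivative(1)[OF assms] has_derivative_linear by blast

lemma tderiv_cong:
  assumes "\<And>q. q \<in> pts M \<Longrightarrow> f q = h q" "smooth_map M (pts M) f" "k \<in> charts_at M p" "l \<in> charts_at M (f p)"
  shows "tderiv h k l p = tderiv f k l p"
proof (rule tderiv_eqI)
  have ka: "k \<in> atlas M" "p \<in> fst k" using assms(3) by (auto simp: charts_at_def)
  show "((\<lambda>x. snd l (h (chart_inv k x))) has_derivative tderiv f k l p) (at (snd k p))"
  proof (rule has_derivative_transform_within_open[OF smooth_map_has_derivative(1)[OF assms(2-4)] chart(2)[OF ka(1)]])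
    show "snd l (f (chart_inv k x)) = snd l (h (chart_inv k x))" if "x \<in> snd k ` fst k" for x
      using assms(1) chart(6)[OF ka(1) that] chart(3)[OF ka(1)] by auto
  qed (use ka in simp)
qed

lemma smooth_map_cong:
  assumes "\<And>q. q \<in> pts M \<Longrightarrow> f q = h q" "smooth_map M (pts M) f"
  shows "smooth_map M (pts M) h"
proof -
  have "continuous_map (subtopology (mtop M) (pts M)) (mtop M) h"
    using assms by (intro continuous_map_eq[of _ _ f h]) (auto simp: smooth_map_def)
  moreover have "smooth_on (snd k ` {p \<in> fst k \<inter> pts M. h p \<in> fst l}) (\<lambda>x. snd l (h (chart_inv k x)))"
    if k: "k \<in> atlas M" and l: "l \<in> atlas M" for k l
  proof -
    have S: "{p \<in> fst k \<inter> pts M. h p \<in> fst l} = {p \<in> fst k \<inter> pts M. f p \<in> fst l}" using assms(1) by auto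
    have "smooth_on (snd k ` {p \<in> fst k \<inter> pts M. f p \<in> fst l}) (\<lambda>x. snd l (f (chart_inv k x)))"
      using assms(2) k l unfolding smooth_map_def by blast
    moreover have "snd l (f (chart_inv k x)) = snd l (h (chart_inv k x))" if "x \<in> snd k ` {p \<in> fst k \<inter> pts M. f p \<in> fst l}" for x
      using that assms(1) chart(5)[OF k] by auto
    ultimately show ?thesis unfolding S by (rule smooth_on_cong)
  qed
  ultimately show ?thesis unfolding smooth_map_def by blast
qed

lemma tderiv_inverse:
  assumes f: "smooth_map M (pts M) f" and h: "smooth_map M (pts M) h" and hf: "\<And>q. q \<in> pts M \<Longrightarrow> h (f q) = q"
    and k: "k \<in> charts_at M p" and l: "l \<in> charts_at M (f p)"
  shows "tderiv h l k (f p) (tderiv f k l p u) = u"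
proof -
  have p: "p \<in> pts M" by (rule charts_at_pts[OF k])
  have ka: "k \<in> atlas M" "p \<in> fst k" using k by (auto simp: charts_at_def)
  have "k \<in> charts_at M (h (f p))" using k hf[OF p] by simp
  from tderiv_comp[OF f h k l this]
  have "((\<lambda>x. snd k (id (chart_inv k x))) has_derivative (\<lambda>u. tderiv h l k (f p) (tderiv f k l p u))) (at (snd k p))"
  proof (rule has_derivative_transform_within_open[OF _ chart(2)[OF ka(1)]])
    show "snd k (h (f (chart_inv k x))) = snd k (id (chart_inv k x))" if "x \<in> snd k ` fst k" for x
      using hf chart(6)[OF ka(1) that] chart(3)[OF ka(1)] by auto
  qed (use ka in simp)
  from tderiv_eqI[OF this] show ?thesis using transition_self[OF k, of u] by (metis)
qed

text \<open>\<open>pullback\<close> evaluates \<tau> in an arbitrarily chosen target chart. Changing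
  that chart alters the differential and the components of \<tau> by the same transition map, so any
  chart gives the same value.\<close>

lemma pullback_chart:
  assumes f: "smooth_map M (pts M) f" and \<tau>: "two_form_on M S \<tau>" "f p \<in> S"
    and k: "k \<in> charts_at M p" and l: "l \<in> charts_at M (f p)"
  shows "pullback M f \<tau> k p u v = \<tau> l (f p) (tderiv f k l p u) (tderiv f k l p v)"
proof -
  define m where "m = (SOME m. m \<in> charts_at M (f p))"
  have m: "m \<in> charts_at M (f p)" using l unfolding m_def by (rule someI)
  have "\<tau> m (f p) (tderiv f k m p u) (tderiv f k m p v) = \<tau> l (f p) (tderiv f k l p u) (tderiv f k l p v)"
    using form_fieldD(2)[OF two_form_field[OF \<tau>(1)] \<tau>(2) m l] tderiv_transition(1)[OF f k m l] by simp
  then show ?thesis by (simp add: pullback_def Let_def flip: m_def)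
qed

end

section \<open>Local frames and associated almost complex structures\<close>

locale almost_hermitian = smooth_manifold M for M :: "'a smooth_space" +
  fixes \<omega> :: "'a two_form" and J :: "'a endo_field"
  assumes symplectic: "symplectic_on M (pts M) \<omega>" and acs: "compatible_acs M \<omega> J"
begin

abbreviation g where "g \<equiv> induced_metric \<omega> J"

lemma \<omega>_two_form: "two_form_on M (pts M) \<omega>"
  using symplectic by (simp add: symplectic_on_def)

lemma J_almost_complex: "almost_complex M J"
  using acs by (simp add: compatible_acs_def)

lemma at_chart:
  assumes k: "k \<in> charts_at M p"
  shows "bilinear (\<omega> k p)" "\<omega> k p u u = 0" "linear (J k p)" "J k p (J k p u) = - u" "compatible (\<omega> k p) (J k p)"
    "\<omega> k p (J k p u) (J k p v) = \<omega> k p u v" "g k p u v = \<omega> k p u (J k p v)" "g k p (J k p u) v = \<omega> k p u v"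
proof -
  have p: "p \<in> pts M" by (rule charts_at_pts[OF k])
  show b: "bilinear (\<omega> k p)" and "\<omega> k p u u = 0" for u
    using \<omega>_two_form p k unfolding two_form_on_def by blast+
  show "linear (J k p)" and "J k p (J k p u) = - u" for u
    using J_almost_complex p k unfolding almost_complex_def by blast+
  show c: "compatible (\<omega> k p) (J k p)"
    using acs p k unfolding compatible_acs_def by blast
  then show "\<omega> k p (J k p u) (J k p v) = \<omega> k p u v" by (simp add: compatible_def)
  show "g k p u v = \<omega> k p u (J k p v)" by (simp add: induced_metric_def)
  show "g k p (J k p u) v = \<omega> k p u v" using c by (simp add: induced_metric_def compatible_def)
qed

lemma hermitian:
  assumes k: "k \<in> charts_at M p"
  shows "hermitian (g k p) (J k p)"
proof -
  note a = at_chart[OF k]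
  have sk: "\<omega> k p u v = - \<omega> k p v u" for u v
    using a(2)[of "u + v"] a(2)[of u] a(2)[of v] by (simp add: bilinear_ladd[OF a(1)] bilinear_radd[OF a(1)])
  show ?thesis
  proof (rule hermitian.intro)
    show "bilinear (g k p)"
      using a(1,3) linear_compose[of "J k p"] by (auto simp: bilinear_def o_def induced_metric_def)
    show "g k p u v = g k p v u" for u v
    proof -
      have "g k p u v = \<omega> k p (J k p u) (J k p (J k p v))" by (simp only: a(6,7))
      also have "\<dots> = g k p v u" by (simp add: a(4,7) bilinear_rneg[OF a(1)] sk[of "J k p u"])
      finally show ?thesis .
    qed
    show "0 < g k p u u" if "u \<noteq> 0" for u
      using a(5) that by (simp add: induced_metric_def compatible_def)
    show "g k p (J k p u) v = - g k p u (J k p v)" for u v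
      by (simp add: a(8)) (simp add: a(4,7) bilinear_rneg[OF a(1)])
  qed (rule a)+
qed

lemma J_field: "endo_field_along (mtop M) (\<lambda>p. p) (pts M) J"
  by (rule almost_complex_field[OF J_almost_complex])

lemma g_field: "form_field (mtop M) (\<lambda>p. p) (pts M) g"
  using form_field_right[OF two_form_field[OF \<omega>_two_form] J_field] by (simp add: induced_metric_def[abs_def])

lemma skew_of_field:
  assumes V: "openin (mtop M) V" and a: "vector_field (mtop M) (\<lambda>p. p) V a" and b: "vector_field (mtop M) (\<lambda>p. p) V b"
  shows "endo_field_along (mtop M) (\<lambda>p. p) V (\<lambda>k p. hermitian.skew_of (g k p) (J k p) (a k p) (b k p))"
proof -
  have VM: "V \<subseteq> pts M" using V openin_subset by blast
  have gV: "form_field (mtop M) (\<lambda>p. p) V g" and JV: "endo_field_along (mtop M) (\<lambda>p. p) V J"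
    using field_subset(1,2)[OF VM] g_field J_field by blast+
  have Ja: "vector_field (mtop M) (\<lambda>p. p) V (\<lambda>k p. J k p (a k p))" and Jb: "vector_field (mtop M) (\<lambda>p. p) V (\<lambda>k p. J k p (b k p))"
    using vector_field_apply[OF JV] a b by blast+
  have sk: "hermitian.skew_of (g k p) (J k p) x y u = g k p x u *\<^sub>R y - g k p y u *\<^sub>R x - g k p (J k p x) u *\<^sub>R J k p y + g k p (J k p y) u *\<^sub>R J k p x"
    if "k \<in> charts_at M p" for k p x y u
    by (rule hermitian.skew_of_def[OF hermitian[OF that]])
  show ?thesis
    unfolding endo_field_along_def
  proof (intro conjI ballI allI)
    show "linear (hermitian.skew_of (g k p) (J k p) (a k p) (b k p))" if "p \<in> V" "k \<in> charts_at M p" for p k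
      using hermitian.antilinear_skew_skew_of[OF hermitian[OF that(2)]] hermitian.antilinear_skewD(1)[OF hermitian[OF that(2)]] by blast
    show "tderiv id k l p (hermitian.skew_of (g k p) (J k p) (a k p) (b k p) u) =
        hermitian.skew_of (g l p) (J l p) (a l p) (b l p) (tderiv id k l p u)"
      if that: "p \<in> V" "k \<in> charts_at M p" "l \<in> charts_at M p" for p k l u
    proof -
      let ?D = "tderiv id k l p"
      have D: "linear ?D" by (rule linear_transition[OF that(2,3)])
      have "?D (hermitian.skew_of (g k p) (J k p) (a k p) (b k p) u) =
          g k p (a k p) u *\<^sub>R ?D (b k p) - g k p (b k p) u *\<^sub>R ?D (a k p) - g k p (J k p (a k p)) u *\<^sub>R ?D (J k p (b k p)) + g k p (J k p (b k p)) u *\<^sub>R ?D (J k p (a k p))"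
        by (simp only: sk[OF that(2)] linear_add[OF D] linear_diff[OF D] linear_cmul[OF D])
      also have "\<dots> = hermitian.skew_of (g l p) (J l p) (a l p) (b l p) (?D u)"
        by (simp only: sk[OF that(3)] form_fieldD(2)[OF gV that] vector_fieldD(1)[OF a that] vector_fieldD(1)[OF b that]
            vector_fieldD(1)[OF Ja that] vector_fieldD(1)[OF Jb that])
      finally show ?thesis .
    qed
    show "continuous_map (subtopology (mtop M) {p \<in> V. p \<in> fst k}) euclidean (\<lambda>p. hermitian.skew_of (g k p) (J k p) (a k p) (b k p) u)"
      if k: "k \<in> atlas M" for k u
    proof (rule continuous_map_eq)
      have gc: "continuous_map (subtopology (mtop M) {p \<in> V. p \<in> fst k}) euclideanreal (\<lambda>p. g k p (v k p) u)"
        if "vector_field (mtop M) (\<lambda>p. p) V v" for v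
        by (rule cm_bilinear_apply[OF form_fieldD(4)[OF gV k] form_fieldD(3)[OF gV k] vector_fieldD(2)[OF that k] continuous_map_canonical_const])
      show "continuous_map (subtopology (mtop M) {p \<in> V. p \<in> fst k}) euclidean (\<lambda>p. g k p (a k p) u *\<^sub>R b k p - g k p (b k p) u *\<^sub>R a k p
          - g k p (J k p (a k p)) u *\<^sub>R J k p (b k p) + g k p (J k p (b k p)) u *\<^sub>R J k p (a k p))"
        by (intro continuous_map_add continuous_map_diff cm_scaleR gc a b Ja Jb vector_fieldD(2)[OF a k]
            vector_fieldD(2)[OF b k] vector_fieldD(2)[OF Ja k] vector_fieldD(2)[OF Jb k])
    qed (use k in \<open>simp add: sk charts_at_def\<close>)
  qed
qed

text \<open>\<open>skew_of\<close>, applied to two constant coordinate fields that are chosen to be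
  good at \<open>p0\<close>, is nonzero there and hence nearby; a nonzero antilinear skew field can
  be normalized to a complex structure.\<close>

lemma local_frame:
  assumes p0: "p0 \<in> pts M"
  obtains U E where "openin (mtop M) U" "p0 \<in> U" "endo_field_along (mtop M) (\<lambda>p. p) U E"
    "\<And>p k. \<lbrakk>p \<in> U; k \<in> charts_at M p\<rbrakk> \<Longrightarrow> hermitian_frame (g k p) (J k p) (E k p)"
proof -
  obtain l where l: "l \<in> charts_at M p0" using ex_chart[OF p0] by blast
  note la = charts_atD[OF l]
  obtain i where i: "hermitian.skew_of (g l p0) (J l p0) (axis 1 1) (axis i 1) (axis 1 1) \<noteq> 0"
    using hermitian.exists_skew_of_nonzero[OF hermitian[OF l]] by blast
  define A where "A k p = hermitian.skew_of (g k p) (J k p) (tderiv id l k p (axis 1 1)) (tderiv id l k p (axis i 1))" for k p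
  have A: "endo_field_along (mtop M) (\<lambda>p. p) (fst l) A"
    unfolding A_def
    by (rule skew_of_field[OF chart(1)[OF la(1)] transported_vector_field[OF la(1)] transported_vector_field[OF la(1)]])
  define U where "U = {p \<in> topspace (subtopology (mtop M) (fst l)). A l p (axis 1 1) \<in> - {0}}"
  have "continuous_map (subtopology (mtop M) (fst l)) euclidean (\<lambda>p. A l p (axis 1 1))"
    using endo_field_alongD(3)[OF A la(1)] by simp
  then have "openin (subtopology (mtop M) (fst l)) U"
    unfolding U_def by (rule openin_continuous_map_preimage) auto
  then have oU: "openin (mtop M) U" using chart(1)[OF la(1)] by (rule openin_trans_full)
  have UV: "U \<subseteq> fst l" by (auto simp: U_def)
  have pU: "p0 \<in> U"
    using p0 la(2) i transition_self[OF l] by (simp add: U_def A_def)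
  \<comment> \<open>The normalizing factor must be a function of the point alone; \<open>ck\<close>
    shows that any other chart gives the same number.\<close>
  define c where "c p = 1 / sqrt (endo_inner (A (chart_of p) p) (A (chart_of p) p))" for p
  define E where "E k p u = c p *\<^sub>R A k p u" for k p u
  have AU: "endo_field_along (mtop M) (\<lambda>p. p) U A"
    by (rule field_subset(1)[OF UV chart(3)[OF la(1)] A])
  have sc: "scalar_field (mtop M) (\<lambda>p. p) U (\<lambda>k p. endo_inner (A k p) (A k p))"
    by (rule endo_field_inner[OF AU AU])
  have cont: "continuous_map (subtopology (mtop M) U) euclideanreal (\<lambda>p. endo_inner (A (chart_of p) p) (A (chart_of p) p))"
    by (rule scalar_field_continuous[OF _ _ sc]) (use oU openin_subset in auto)
  have ck: "c p = 1 / sqrt (endo_inner (A k p) (A k p))" if "p \<in> U" "k \<in> charts_at M p" for p k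
  proof -
    have "endo_inner (A k p) (A k p) = endo_inner (A (chart_of p) p) (A (chart_of p) p)"
      using sc that chart_of[OF charts_at_pts[OF that(2)]] unfolding scalar_field_def by blast
    then show ?thesis by (simp add: c_def)
  qed
  have skew: "hermitian.antilinear_skew (g k p) (J k p) (A k p)" if "k \<in> charts_at M p" for k p
    unfolding A_def by (rule hermitian.antilinear_skew_skew_of[OF hermitian[OF that]])
  have nz: "A k p (tderiv id l k p (axis 1 1)) \<noteq> 0" if p: "p \<in> U" and k: "k \<in> charts_at M p" for k p
  proof
    have lp: "l \<in> charts_at M p" using p UV la(1) by (auto simp: charts_at_def)
    assume "A k p (tderiv id l k p (axis 1 1)) = 0"
    then have "tderiv id l k p (A l p (axis 1 1)) = 0"
      using endo_field_alongD(2)[OF AU p lp k] by simp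
    then have "tderiv id k l p (tderiv id l k p (A l p (axis 1 1))) = tderiv id k l p 0" by simp
    then have "A l p (axis 1 1) = 0"
      using transition_inverse[OF lp k] linear_0[OF linear_transition[OF k lp]] by simp
    then show False using p by (simp add: U_def)
  qed
  have pos: "endo_inner (A k p) (A k p) > 0" if p: "p \<in> U" and k: "k \<in> charts_at M p" for k p
  proof -
    interpret hermitian "g k p" "J k p" by (rule hermitian[OF k])
    have "tderiv id l k p (axis 1 1) \<noteq> 0"
      using nz[OF p k] linear_0[OF antilinear_skewD(1)[OF skew[OF k]]] by auto
    then show ?thesis using antilinear_skew_square(3)[OF skew[OF k]] nz[OF p k] by blast
  qed
  show ?thesis
  proof (rule that[OF oU pU])
    show "endo_field_along (mtop M) (\<lambda>p. p) U E"
      unfolding E_def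
    proof (rule endo_field_scaleR[OF AU])
      have UM: "U \<subseteq> pts M" using oU openin_subset by blast
      have "0 < endo_inner (A (chart_of p) p) (A (chart_of p) p)" if "p \<in> U" for p
        using pos[OF that chart_of] UM that by blast
      then show "continuous_map (subtopology (mtop M) U) euclideanreal c"
        unfolding c_def
        by (intro continuous_map_real_divide cm_compose_on[OF cont, of UNIV sqrt] continuous_on_real_sqrt continuous_on_id)
          (auto simp: less_imp_neq[symmetric])
    qed
    show "hermitian_frame (g k p) (J k p) (E k p)" if p: "p \<in> U" and k: "k \<in> charts_at M p" for p k
    proof -
      interpret hermitian "g k p" "J k p" by (rule hermitian[OF k])
      have "E k p = (\<lambda>u. (1 / sqrt (endo_inner (A k p) (A k p))) *\<^sub>R A k p u)"
        by (simp add: E_def[abs_def] ck[OF p k])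
      then show ?thesis
        using antilinear_skew_normalize[OF skew[OF k] nz[OF p k]]
        by (intro hermitian_frame.intro hermitian_frame_axioms.intro hermitian_axioms) auto
    qed
  qed
qed

lemma acs_pointwise:
  assumes k: "k \<in> charts_at M p" and fr: "hermitian_frame (g k p) (J k p) E"
    and T: "bilinear T" "\<And>u. T u u = 0" and o: "wedge_square (\<omega> k p) * wedge_square T > 0" and e: "e \<noteq> 0"
  defines "I \<equiv> associated_acs (g k p) T" and "n \<equiv> hermitian_frame.form_vec (J k p) E T e"
  shows "n \<noteq> 0" "I = quat_comb (J k p) E (sgn n)" "compatible T I" "hermitian (g k p) I"
proof -
  interpret hermitian_frame "g k p" "J k p" E by (rule fr)
  have "(\<lambda>u v. g k p (J k p u) v) = \<omega> k p" using at_chart(8)[OF k] by (intro ext) simp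
  then have pf: "frame_pfaffian T u > 0" if "u \<noteq> 0" for u
    using frame_pfaffian_positive[OF T _ that] o by simp
  note a = associated_acs_eq[of T, OF T pf e]
  show "n \<noteq> 0" unfolding n_def by (rule a(1))
  show I: "I = quat_comb (J k p) E (sgn n)" unfolding I_def n_def by (rule a(2))
  show "compatible T I" unfolding I n_def by (rule a(3))
  show "hermitian (g k p) I" unfolding I n_def by (rule a(4))
qed

lemma acs_pointwise_ex:
  assumes k: "k \<in> charts_at M p" and T: "bilinear T" "\<And>u. T u u = 0" and o: "wedge_square (\<omega> k p) * wedge_square T > 0"
  shows "compatible T (associated_acs (g k p) T)" "hermitian (g k p) (associated_acs (g k p) T)"
proof -
  obtain U E where "p \<in> U" "\<And>p k. \<lbrakk>p \<in> U; k \<in> charts_at M p\<rbrakk> \<Longrightarrow> hermitian_frame (g k p) (J k p) (E k p)"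
    using local_frame[OF charts_at_pts[OF k]] by metis
  then have "hermitian_frame (g k p) (J k p) (E k p)" using k by blast
  from acs_pointwise(3,4)[OF k this T o, of "axis 1 1"]
  show "compatible T (associated_acs (g k p) T)" "hermitian (g k p) (associated_acs (g k p) T)" by auto
qed

lemma acs_unique:
  assumes k: "k \<in> charts_at M p" and T: "bilinear T" "\<And>u. T u u = 0" and o: "wedge_square (\<omega> k p) * wedge_square T > 0"
    and J': "linear J'" "\<And>u. J' (J' u) = - u" "\<And>u v. g k p (J' u) v = - g k p u (J' v)" "compatible T J'"
  shows "associated_acs (g k p) T = J'"
proof -
  obtain U E where "p \<in> U" "\<And>p k. \<lbrakk>p \<in> U; k \<in> charts_at M p\<rbrakk> \<Longrightarrow> hermitian_frame (g k p) (J k p) (E k p)"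
    using local_frame[OF charts_at_pts[OF k]] by metis
  then interpret hermitian_frame "g k p" "J k p" "E k p" using k by blast
  note acs_pointwise_ex[OF k T o]
  from associated_acs_unique[of T, OF T this(2,1) J'] show ?thesis by simp
qed

text \<open>Compatibility between charts follows from uniqueness, since a transition map carries the
  associated structure to one with the same defining properties. Continuity follows from the
  explicit formula in a local frame.\<close>

lemma acs_field:
  assumes f: "continuous_map Q (mtop M) f" and V: "V \<subseteq> topspace Q" and T: "form_field Q f V T"
    and alt: "\<And>q k u. \<lbrakk>q \<in> V; k \<in> charts_at M (f q)\<rbrakk> \<Longrightarrow> T k q u u = 0"
    and o: "\<And>q k. \<lbrakk>q \<in> V; k \<in> charts_at M (f q)\<rbrakk> \<Longrightarrow> wedge_square (\<omega> k (f q)) * wedge_square (T k q) > 0"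
  shows "endo_field_along Q f V (\<lambda>k q. associated_acs (g k (f q)) (T k q))"
  unfolding endo_field_along_def
proof (intro conjI ballI allI)
  note ex = acs_pointwise_ex[OF _ form_fieldD(1)[OF T] alt o]
  show "linear (associated_acs (g k (f q)) (T k q))" if "q \<in> V" "k \<in> charts_at M (f q)" for q k
    using hermitian.linJ[OF ex(2)] that by blast
  show "tderiv id k l (f q) (associated_acs (g k (f q)) (T k q) u) = associated_acs (g l (f q)) (T l q) (tderiv id k l (f q) u)"
    if q: "q \<in> V" "k \<in> charts_at M (f q)" "l \<in> charts_at M (f q)" for q k l u
  proof -
    let ?D = "tderiv id k l (f q)" and ?D' = "tderiv id l k (f q)" and ?I = "associated_acs (g k (f q)) (T k q)"
    interpret I: hermitian "g k (f q)" ?I by (rule ex(2)[OF q(2,1,2,1,2,1,2)])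
    have D: "linear ?D" "linear ?D'" "\<And>u. ?D' (?D u) = u" "\<And>u. ?D (?D' u) = u"
      using linear_transition transition_inverse q by blast+
    have gl: "g l (f q) u v = g k (f q) (?D' u) (?D' v)" and Tl: "T l q u v = T k q (?D' u) (?D' v)" for u v
      using form_fieldD(2)[OF g_field charts_at_pts[OF q(2)] q(3,2)] form_fieldD(2)[OF T q(1,3,2)] by blast+
    have "associated_acs (g l (f q)) (T l q) = (\<lambda>u. ?D (?I (?D' u)))"
    proof (rule acs_unique[OF q(3) form_fieldD(1)[OF T q(1,3)] alt[OF q(1,3)] o[OF q(1,3)]])
      show "linear (\<lambda>u. ?D (?I (?D' u)))"
        using linear_compose[OF linear_compose[OF D(2) I.linJ] D(1)] by (simp add: o_def)
      show "?D (?I (?D' (?D (?I (?D' u))))) = - u" for u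
        by (simp only: D(3,4) I.JJ linear_neg[OF D(1)])
      show "g l (f q) (?D (?I (?D' u))) v = - g l (f q) u (?D (?I (?D' v)))" for u v
        by (simp only: gl D(3) I.skewJ)
      have c: "compatible (T k q) ?I" by (rule ex(1)[OF q(2,1,2,1,2,1,2)])
      show "compatible (T l q) (\<lambda>u. ?D (?I (?D' u)))"
        unfolding compatible_def
      proof (intro conjI allI impI)
        show "T l q (?D (?I (?D' u))) (?D (?I (?D' v))) = T l q u v" for u v
          using c unfolding compatible_def by (simp only: Tl D(3))
        show "0 < T l q u (?D (?I (?D' u)))" if "u \<noteq> 0" for u
        proof -
          have "?D' u \<noteq> 0" using that D(4)[of u] linear_0[OF D(1)] by auto
          then show ?thesis using c unfolding compatible_def by (simp only: Tl D(3)) blast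
        qed
      qed
    qed
    then show ?thesis by (simp only: D(3))
  qed
  show "continuous_map (subtopology Q {q \<in> V. f q \<in> fst k}) euclidean (\<lambda>q. associated_acs (g k (f q)) (T k q) u)"
    if k: "k \<in> atlas M" for k u
  proof (rule cm_local)
    fix q0 assume "q0 \<in> topspace (subtopology Q {q \<in> V. f q \<in> fst k})"
    then have q0: "q0 \<in> topspace Q" "q0 \<in> V" "f q0 \<in> fst k" by auto
    then have "f q0 \<in> pts M" using chart(3)[OF k] by blast
    then obtain U E where U: "openin (mtop M) U" "f q0 \<in> U" and E: "endo_field_along (mtop M) (\<lambda>p. p) U E"
      and fr: "\<And>p k. \<lbrakk>p \<in> U; k \<in> charts_at M p\<rbrakk> \<Longrightarrow> hermitian_frame (g k p) (J k p) (E k p)"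
      using local_frame by metis
    define W where "W = {q \<in> V. f q \<in> U}"
    define W' where "W' = {q \<in> W. f q \<in> fst k}"
    have WQ: "W \<subseteq> topspace Q" "W \<subseteq> V" using V by (auto simp: W_def)
    have cf: "continuous_map (subtopology Q W) (mtop M) f" by (rule continuous_map_from_subtopology[OF f])
    have UM: "U \<subseteq> pts M" using U(1) openin_subset by blast
    have "endo_field_along (mtop M) (\<lambda>p. p) U J" by (rule field_subset(1)[OF UM order_refl J_field])
    then have JW: "endo_field_along Q f W (\<lambda>k q. J k (f q))" and EW: "endo_field_along Q f W (\<lambda>k q. E k (f q))"
      using field_pullback(1)[OF cf _ WQ(1), of U f "\<lambda>p. p"] E by (auto simp: W_def)
    have JEW: "endo_field_along Q f W (\<lambda>k q u. J k (f q) (E k (f q) u))"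
      by (rule endo_field_comp[OF JW EW])
    have TW: "form_field Q f W T" by (rule field_subset(2)[OF WQ(2) V T])
    let ?S = "subtopology Q W'"
    have c: "continuous_map ?S euclidean (\<lambda>q. A k q v)" if "endo_field_along Q f W A" for A v
      using endo_field_alongD(3)[OF that k] by (simp add: W'_def)
    have ct: "continuous_map ?S euclideanreal (\<lambda>q. T k q (v q) (w q))"
      if "continuous_map ?S euclidean v" "continuous_map ?S euclidean w" for v w
      using cm_bilinear_apply[OF form_fieldD(4)[OF TW k] form_fieldD(3)[OF TW k]] that by (simp add: W'_def)
    \<comment> \<open>Any fixed nonzero vector serves as base vector of \<open>form_vec\<close>;
      with constant coordinates the components of \<open>n\<close> are visibly continuous.\<close>
    let ?e = "axis 1 1 :: real^4"
    define n where "n q = (vector [T k q ?e (J k (f q) ?e) + T k q (E k (f q) ?e) (J k (f q) (E k (f q) ?e)),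
      T k q ?e (E k (f q) ?e) - T k q (J k (f q) ?e) (J k (f q) (E k (f q) ?e)),
      T k q ?e (J k (f q) (E k (f q) ?e)) + T k q (J k (f q) ?e) (E k (f q) ?e)] :: real^3)" for q
    have cn: "continuous_map ?S euclidean n"
      unfolding n_def
      by (intro cm_vec3 continuous_map_add continuous_map_diff ct c[OF JW] c[OF EW] c[OF JEW] continuous_map_canonical_const)
    have W'D: "q \<in> V" "k \<in> charts_at M (f q)" "hermitian_frame (g k (f q)) (J k (f q)) (E k (f q))" if "q \<in> W'" for q
      using that k fr by (auto simp: W'_def W_def charts_at_def)
    have nq: "n q = hermitian_frame.form_vec (J k (f q)) (E k (f q)) (T k q) ?e" if "q \<in> W'" for q
      unfolding n_def hermitian_frame.form_vec_def[OF W'D(3)[OF that]] ..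
    have pw: "n q \<noteq> 0" "associated_acs (g k (f q)) (T k q) = quat_comb (J k (f q)) (E k (f q)) (sgn (n q))" if "q \<in> W'" for q
      unfolding nq[OF that]
      by (rule acs_pointwise[OF W'D(2,3)[OF that] form_fieldD(1)[OF T W'D(1,2)[OF that]] alt[OF W'D(1,2)[OF that]] o[OF W'D(1,2)[OF that]]], simp)+
    have cs: "continuous_map ?S euclidean (\<lambda>q. sgn (n q))"
      by (rule cm_sgn[OF cn]) (use pw(1) in auto)
    show "\<exists>W h. openin (subtopology Q {q \<in> V. f q \<in> fst k}) W \<and> q0 \<in> W \<and>
        continuous_map (subtopology (subtopology Q {q \<in> V. f q \<in> fst k}) W) euclidean h \<and>
        (\<forall>q\<in>W. associated_acs (g k (f q)) (T k q) u = h q)"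
    proof (intro exI conjI ballI)
      have "openin Q {q \<in> topspace Q. f q \<in> U}" by (rule openin_continuous_map_preimage[OF f U(1)])
      moreover have "W' = {q \<in> topspace Q. f q \<in> U} \<inter> {q \<in> V. f q \<in> fst k}" using V by (auto simp: W'_def W_def)
      ultimately show "openin (subtopology Q {q \<in> V. f q \<in> fst k}) W'" unfolding openin_subtopology by blast
      show "q0 \<in> W'" using q0 U(2) by (auto simp: W'_def W_def)
      have e: "{q \<in> V. f q \<in> fst k} \<inter> W' = W'" by (auto simp: W'_def W_def)
      show "continuous_map (subtopology (subtopology Q {q \<in> V. f q \<in> fst k}) W') euclidean
          (\<lambda>q. sgn (n q) $ 1 *\<^sub>R J k (f q) u + sgn (n q) $ 2 *\<^sub>R E k (f q) u + sgn (n q) $ 3 *\<^sub>R J k (f q) (E k (f q) u))"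
        unfolding subtopology_subtopology e
        by (intro continuous_map_add cm_scaleR cm_nth[OF cs] c[OF JW] c[OF EW] c[OF JEW])
      show "associated_acs (g k (f q)) (T k q) u =
          sgn (n q) $ 1 *\<^sub>R J k (f q) u + sgn (n q) $ 2 *\<^sub>R E k (f q) u + sgn (n q) $ 3 *\<^sub>R J k (f q) (E k (f q) u)"
        if "q \<in> W'" for q
        by (simp only: pw(2)[OF that] quat_comb_def)
    qed
  qed
qed

lemma associated_acs_\<omega>:
  assumes k: "k \<in> charts_at M p"
  shows "associated_acs (g k p) (\<omega> k p) = J k p"
proof -
  interpret hermitian "g k p" "J k p" by (rule hermitian[OF k])
  obtain U E where "p \<in> U" "\<And>p k. \<lbrakk>p \<in> U; k \<in> charts_at M p\<rbrakk> \<Longrightarrow> hermitian_frame (g k p) (J k p) (E k p)"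
    using local_frame[OF charts_at_pts[OF k]] by metis
  then interpret hermitian_frame "g k p" "J k p" "E k p" using k by blast
  show ?thesis
    unfolding associated_acs_def
    by (rule the_equality)
      (use at_chart(1-5)[OF k] linJ JJ skewJ associated_acs_unique[of "\<omega> k p", OF at_chart(1,2)[OF k] hermitian[OF k] at_chart(5)[OF k]] in blast)+
qed

text \<open>The path in \<open>Diff_plus_0\<close> ends in a map \<open>F\<close> that agrees with
  \<open>f\<close> only on the points of \<open>M\<close>. Differentials, pullbacks and
  \<open>inv_into\<close> on \<open>M\<close> see nothing else, so the properties of
  \<open>F\<close> pass to \<open>f\<close>.\<close>

lemma Diff_plus_0D:
  assumes f: "f \<in> Diff_plus_0 M \<omega>"
  shows "bij_betw f (pts M) (pts M)" "smooth_map M (pts M) f" "smooth_map M (pts M) (inv_into (pts M) f)"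
    "k \<in> charts_at M p \<Longrightarrow> wedge_square (\<omega> k p) * wedge_square (pullback M f \<omega> k p) > 0"
proof -
  obtain F where F: "orientation_preserving_diffeo M \<omega> F" and Ff: "\<And>p. p \<in> pts M \<Longrightarrow> F p = f p"
    using f unfolding Diff_plus_0_def by fastforce
  then have d: "bij_betw F (pts M) (pts M)" "smooth_map M (pts M) F" "smooth_map M (pts M) (inv_into (pts M) F)"
    and o: "same_orientation_on M (pts M) \<omega> (pullback M F \<omega>)"
    by (auto simp: orientation_preserving_diffeo_def diffeo_def)
  show b: "bij_betw f (pts M) (pts M)" using d(1) Ff bij_betw_cong by blast
  show s: "smooth_map M (pts M) f" by (rule smooth_map_cong[OF Ff d(2)])
  have "(y \<in> pts M \<and> F y = x) \<longleftrightarrow> (y \<in> pts M \<and> f y = x)" for x y using Ff by auto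
  then have "inv_into (pts M) F = inv_into (pts M) f"
    unfolding inv_into_def by (simp only:)
  then show "smooth_map M (pts M) (inv_into (pts M) f)" using d(3) by simp
  show "wedge_square (\<omega> k p) * wedge_square (pullback M f \<omega> k p) > 0" if k: "k \<in> charts_at M p"
  proof -
    have p: "p \<in> pts M" by (rule charts_at_pts[OF k])
    have fp: "f p \<in> pts M" using b p by (auto simp: bij_betw_def)
    define l where "l = chart_of (f p)"
    have l: "l \<in> charts_at M (f p)" unfolding l_def by (rule chart_of[OF fp])
    have lF: "l \<in> charts_at M (F p)" using l Ff[OF p] by simp
    have "pullback M F \<omega> k p u v = pullback M f \<omega> k p u v" for u v
      using pullback_chart[OF d(2) \<omega>_two_form _ k lF] pullback_chart[OF s \<omega>_two_form fp k l] fp Ff[OF p]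
        tderiv_cong[OF Ff d(2) k lF] by simp
    then have "pullback M F \<omega> k p = pullback M f \<omega> k p" by (intro ext)
    then show ?thesis using o p k unfolding same_orientation_on_def by metis
  qed
qed

end

section \<open>Forms moved by a path of diffeomorphisms\<close>

locale diffeo_path = almost_hermitian M \<omega> J for M :: "'a smooth_space" and \<omega> J +
  fixes \<phi> :: "real \<Rightarrow> 'a \<Rightarrow> 'a"
  assumes path: "smooth_path_of_maps M (pts M) \<phi>" and Diff: "\<And>t. t \<in> {0..1} \<Longrightarrow> \<phi> t \<in> Diff_plus_0 M \<omega>"
begin

abbreviation \<phi>inv where "\<phi>inv t \<equiv> inv_into (pts M) (\<phi> t)"

lemmas \<phi> = Diff_plus_0D[OF Diff]

lemma \<phi>_pts: "t \<in> {0..1} \<Longrightarrow> p \<in> pts M \<Longrightarrow> \<phi> t p \<in> pts M"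
  using \<phi>(1)[of t] by (auto simp: bij_betw_def)

lemma \<phi>inv: "t \<in> {0..1} \<Longrightarrow> p \<in> pts M \<Longrightarrow> \<phi>inv t (\<phi> t p) = p" "t \<in> {0..1} \<Longrightarrow> p \<in> pts M \<Longrightarrow> \<phi> t (\<phi>inv t p) = p"
  using \<phi>(1)[of t] by (simp_all add: bij_betw_inv_into_left bij_betw_inv_into_right)

lemma \<phi>_continuous: "continuous_map (prod_topology unit_interval (mtop M)) (mtop M) (\<lambda>z. \<phi> (fst z) (snd z))"
  using path by (simp add: smooth_path_of_maps_def case_prod_unfold)

text \<open>Joint smoothness provides a local extension \<open>G\<close> in time and space. For
  fixed time its derivative in the direction \<open>(0, u)\<close> is the differential of
  \<open>\<phi> t\<close>, and that derivative is continuous in both variables.\<close>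

lemma tderiv_\<phi>_continuous:
  assumes k: "k \<in> atlas M" and l: "l \<in> atlas M"
  shows "continuous_map (subtopology (prod_topology unit_interval (mtop M)) {z. fst z \<in> {0..1} \<and> snd z \<in> fst k \<and> \<phi> (fst z) (snd z) \<in> fst l})
    euclidean (\<lambda>z. tderiv (\<phi> (fst z)) k l (snd z) u)"
proof (rule cm_local)
  let ?Z = "prod_topology unit_interval (mtop M)"
  let ?V = "{z. fst z \<in> {0..1} \<and> snd z \<in> fst k \<and> \<phi> (fst z) (snd z) \<in> fst l}"
  fix z assume "z \<in> topspace (subtopology ?Z ?V)"
  then have z: "z \<in> ?V" by auto
  define S where "S = (\<lambda>(t, p). (t, snd k p)) ` {(t, p). t \<in> {0..1} \<and> p \<in> fst k \<inter> pts M \<and> \<phi> t p \<in> fst l}"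
  have inS: "(fst z, snd k (snd z)) \<in> S" if "z \<in> ?V" for z
  proof -
    have "(fst z, snd z) \<in> {(t, p). t \<in> {0..1} \<and> p \<in> fst k \<inter> pts M \<and> \<phi> t p \<in> fst l}"
      using that chart(3)[OF k] by auto
    from imageI[OF this, of "\<lambda>(t, p). (t, snd k p)"] show ?thesis by (simp only: S_def case_prod_conv)
  qed
  have "smooth_on S (\<lambda>(t, x). snd l (\<phi> t (chart_inv k x)))"
    using path k l unfolding smooth_path_of_maps_def S_def by blast
  then obtain U G where U: "open U" "(fst z, snd k (snd z)) \<in> U" "\<And>y. y \<in> S \<inter> U \<Longrightarrow> G y = (\<lambda>(t, x). snd l (\<phi> t (chart_inv k x))) y"
    "\<And>y. y \<in> U \<Longrightarrow> (G has_derivative frechet_derivative G (at y)) (at y)"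
    "\<And>v. continuous_on U (\<lambda>y. frechet_derivative G (at y) v)"
    using smooth_on_local[OF _ inS[OF z]] by metis
  let ?c = "\<lambda>z. (fst z, snd k (snd z))"
  have cc: "continuous_map (subtopology ?Z ?V) euclidean ?c"
  proof -
    have "continuous_map (subtopology ?Z ?V) euclideanreal fst"
      by (rule continuous_map_from_subtopology[OF cm_fst_real])
    moreover have "continuous_map (subtopology ?Z ?V) (subtopology (mtop M) (fst k)) snd"
      by (rule continuous_map_into_subtopology) (auto intro: continuous_map_from_subtopology continuous_map_snd)
    ultimately have "continuous_map (subtopology ?Z ?V) (prod_topology euclidean euclidean) ?c"
      by (intro cm_pair cm_compose[OF _ chart(4)[OF k]])
    then show ?thesis by simp
  qed
  define W where "W = {z \<in> topspace (subtopology ?Z ?V). ?c z \<in> U}"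
  have oW: "openin (subtopology ?Z ?V) W"
    unfolding W_def by (rule openin_continuous_map_preimage[OF cc]) (use U(1) in simp)
  have cW: "continuous_map (subtopology (subtopology ?Z ?V) W) euclidean (\<lambda>z. frechet_derivative G (at (?c z)) (0, u))"
    by (rule cm_compose_on[OF continuous_map_from_subtopology[OF cc] U(5)]) (auto simp: W_def)
  have "tderiv (\<phi> (fst z)) k l (snd z) u = frechet_derivative G (at (?c z)) (0, u)" if "z \<in> W" for z
  proof -
    define t p where "t = fst z" "p = snd z"
    have zV: "z \<in> ?V" and zU: "(t, snd k p) \<in> U" using that by (auto simp: W_def t_p_def)
    then have t: "t \<in> {0..1}" and kp: "k \<in> charts_at M p" and lp: "l \<in> charts_at M (\<phi> t p)"
      using k l by (auto simp: t_p_def charts_at_def)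
    let ?O = "{q \<in> fst k. \<phi> t q \<in> fst l}"
    let ?N = "snd k ` ?O \<inter> (\<lambda>x. (t, x)) -` U"
    have "open (snd k ` ?O)"
      by (rule chart(9)[OF k smooth_map_has_derivative(2)[OF \<phi>(2)[OF t] kp lp]]) auto
    moreover have "open ((\<lambda>x. (t, x)) -` U)" by (intro open_vimage[OF U(1)] continuous_intros)
    ultimately have oN: "open ?N" by blast
    have GD: "((\<lambda>x. G (t, x)) has_derivative (\<lambda>v. frechet_derivative G (at (t, snd k p)) (0, v))) (at (snd k p))"
      using diff_chain_at[of "\<lambda>x. (t, x)" "\<lambda>v. (0, v)" "snd k p" G "frechet_derivative G (at (t, snd k p))"] U(4)[OF zU]
      by (simp add: o_def has_derivative_Pair)
    have "((\<lambda>x. snd l (\<phi> t (chart_inv k x))) has_derivative (\<lambda>v. frechet_derivative G (at (t, snd k p)) (0, v))) (at (snd k p))"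
    proof (rule has_derivative_transform_within_open[OF GD oN])
      show "snd k p \<in> ?N" using zU kp lp by (auto simp: charts_at_def)
      show "G (t, x) = snd l (\<phi> t (chart_inv k x))" if x: "x \<in> ?N" for x
      proof -
        obtain q where q: "q \<in> ?O" "x = snd k q" using x by blast
        then have "(t, x) \<in> S" using inS[of "(t, q)"] t by simp
        then show ?thesis using U(3)[of "(t, x)"] x by simp
      qed
    qed
    from tderiv_eqI[OF this] show ?thesis by (simp add: t_p_def)
  qed
  then show "\<exists>W h. openin (subtopology ?Z ?V) W \<and> z \<in> W \<and> continuous_map (subtopology (subtopology ?Z ?V) W) euclidean h \<and>
      (\<forall>z\<in>W. tderiv (\<phi> (fst z)) k l (snd z) u = h z)"
    using oW cW z U(2) \<open>z \<in> topspace (subtopology ?Z ?V)\<close> by (intro exI[of _ W] exI[of _ "\<lambda>z. frechet_derivative G (at (?c z)) (0, u)"]) (auto simp: W_def)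
qed

lemma tderiv_\<phi>inv:
  assumes t: "t \<in> {0..1}" and k: "k \<in> charts_at M x" and l: "l \<in> charts_at M (\<phi> t x)"
  shows "tderiv (\<phi>inv t) l k (\<phi> t x) (tderiv (\<phi> t) k l x u) = u" "tderiv (\<phi> t) k l x (tderiv (\<phi>inv t) l k (\<phi> t x) u) = u"
    "linear (tderiv (\<phi>inv t) l k (\<phi> t x))" "linear (tderiv (\<phi> t) k l x)"
proof -
  have x: "x \<in> pts M" by (rule charts_at_pts[OF k])
  have k': "k \<in> charts_at M (\<phi>inv t (\<phi> t x))" using k \<phi>inv(1)[OF t x] by simp
  have l': "l \<in> charts_at M (\<phi> t (\<phi>inv t (\<phi> t x)))" using l \<phi>inv(1)[OF t x] by simp
  show "tderiv (\<phi>inv t) l k (\<phi> t x) (tderiv (\<phi> t) k l x u) = u"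
    by (rule tderiv_inverse[OF \<phi>(2)[OF t] \<phi>(3)[OF t] \<phi>inv(1)[OF t] k l])
  show "tderiv (\<phi> t) k l x (tderiv (\<phi>inv t) l k (\<phi> t x) u) = u"
    using tderiv_inverse[OF \<phi>(3)[OF t] \<phi>(2)[OF t] \<phi>inv(2)[OF t] l k'] \<phi>inv(1)[OF t x] by simp
  show "linear (tderiv (\<phi>inv t) l k (\<phi> t x))" by (rule linear_tderiv[OF \<phi>(3)[OF t] l k'])
  show "linear (tderiv (\<phi> t) k l x)" by (rule linear_tderiv[OF \<phi>(2)[OF t] k l])
qed

lemma moved_form_eq:
  assumes \<tau>: "two_form_on M S \<tau>" "x \<in> S" and t: "t \<in> {0..1}" and k: "k \<in> charts_at M x" and l: "l \<in> charts_at M (\<phi> t x)"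
  shows "moved_form M \<phi> \<tau> t l (\<phi> t x) u v = \<tau> k x (tderiv (\<phi>inv t) l k (\<phi> t x) u) (tderiv (\<phi>inv t) l k (\<phi> t x) v)"
proof -
  have e: "\<phi>inv t (\<phi> t x) = x" by (rule \<phi>inv(1)[OF t charts_at_pts[OF k]])
  show ?thesis
    unfolding moved_form_def
    using pullback_chart[OF \<phi>(3)[OF t] \<tau>(1), of "\<phi> t x" l k u v] \<tau>(2) l k by (simp add: e)
qed

text \<open>The factor \<open>d\<close> is the determinant of the differential of
  \<open>\<phi> t\<close>. It enters once for \<omega>, with a sign known from orientation
  preservation, and once for \<tau>; in the product of the two inequalities it occurs only as a
  square.\<close>

lemma moved_form_at:
  assumes \<tau>: "two_form_on M S \<tau>" "same_orientation_on M S \<omega> \<tau>" "x \<in> S" and t: "t \<in> {0..1}" and l: "l \<in> charts_at M (\<phi> t x)" and x: "x \<in> pts M"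
  shows "bilinear (moved_form M \<phi> \<tau> t l (\<phi> t x))" "moved_form M \<phi> \<tau> t l (\<phi> t x) u u = 0"
    "wedge_square (\<omega> l (\<phi> t x)) * wedge_square (moved_form M \<phi> \<tau> t l (\<phi> t x)) > 0"
proof -
  define k where "k = chart_of x"
  have k: "k \<in> charts_at M x" unfolding k_def by (rule chart_of[OF x])
  let ?D = "tderiv (\<phi> t) k l x" and ?D' = "tderiv (\<phi>inv t) l k (\<phi> t x)" and ?m = "moved_form M \<phi> \<tau> t l (\<phi> t x)"
  note eq = moved_form_eq[OF \<tau>(1,3) t k l]
  note D = tderiv_\<phi>inv[OF t k l]
  have b: "bilinear (\<tau> k x)" using \<tau>(1,3) k unfolding two_form_on_def by blast
  have a: "\<tau> k x u u = 0" for u by (rule two_form_alternating[OF \<tau>(1,3) k])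
  show bm: "bilinear ?m"
    using b D(3) linear_compose[OF D(3)] unfolding bilinear_def eq by (auto simp: o_def)
  show am: "?m u u = 0" for u unfolding eq by (rule a)
  obtain d where d: "\<And>\<sigma>. bilinear \<sigma> \<Longrightarrow> (\<And>u. \<sigma> u u = 0) \<Longrightarrow> wedge_square (\<lambda>u v. \<sigma> (?D u) (?D v)) = d * wedge_square \<sigma>"
    using wedge_square_pullback[OF D(4)] by blast
  have 1: "wedge_square (\<tau> k x) = d * wedge_square ?m"
  proof -
    have "(\<lambda>u v. ?m (?D u) (?D v)) = \<tau> k x" by (intro ext) (simp only: eq D(1))
    then show ?thesis using d[OF bm am] by (simp only:)
  qed
  have "pullback M (\<phi> t) \<omega> k x = (\<lambda>u v. \<omega> l (\<phi> t x) (?D u) (?D v))"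
    using pullback_chart[OF \<phi>(2)[OF t] \<omega>_two_form \<phi>_pts[OF t x] k l] by (intro ext)
  then have 2: "wedge_square (\<omega> k x) * (d * wedge_square (\<omega> l (\<phi> t x))) > 0"
    using \<phi>(4)[OF t k] d[OF at_chart(1,2)[OF l]] by simp
  have 3: "wedge_square (\<omega> k x) * (d * wedge_square ?m) > 0"
    using \<tau>(2,3) k unfolding same_orientation_on_def 1[symmetric] by blast
  have "(wedge_square (\<omega> k x) * (d * wedge_square (\<omega> l (\<phi> t x)))) * (wedge_square (\<omega> k x) * (d * wedge_square ?m)) > 0"
    by (rule mult_pos_pos[OF 2 3])
  also have "(wedge_square (\<omega> k x) * (d * wedge_square (\<omega> l (\<phi> t x)))) * (wedge_square (\<omega> k x) * (d * wedge_square ?m))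
      = (wedge_square (\<omega> k x) * d)\<^sup>2 * (wedge_square (\<omega> l (\<phi> t x)) * wedge_square ?m)"
    by (simp add: power2_eq_square mult_ac)
  finally show "wedge_square (\<omega> l (\<phi> t x)) * wedge_square ?m > 0"
    by (metis mult_nonneg_nonpos not_less zero_le_power2)
qed

lemma moved_form_field:
  assumes S: "openin (mtop M) S" and \<tau>: "two_form_on M S \<tau>"
  shows "form_field (prod_topology unit_interval (mtop M)) (\<lambda>z. \<phi> (fst z) (snd z)) ({0..1} \<times> S)
    (\<lambda>l z. moved_form M \<phi> \<tau> (fst z) l (\<phi> (fst z) (snd z)))"
  unfolding form_field_def
proof (intro conjI ballI allI)
  have SM: "S \<subseteq> pts M" using S openin_subset by blast
  let ?f = "\<lambda>z. \<phi> (fst z) (snd z)"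
  show "bilinear (moved_form M \<phi> \<tau> (fst z) l (?f z))" if z: "z \<in> {0..1} \<times> S" "l \<in> charts_at M (?f z)" for z l
  proof -
    have t: "fst z \<in> {0..1}" and x: "snd z \<in> S" using z(1) by auto
    define k where "k = chart_of (snd z)"
    have k: "k \<in> charts_at M (snd z)" unfolding k_def using chart_of SM x by blast
    have "bilinear (\<tau> k (snd z))" using \<tau> x k unfolding two_form_on_def by blast
    then show ?thesis
      using linear_compose[OF tderiv_\<phi>inv(3)[OF t k z(2)]] unfolding bilinear_def moved_form_eq[OF \<tau> x t k z(2)]
      by (auto simp: o_def)
  qed
  show "moved_form M \<phi> \<tau> (fst z) l (?f z) u v = moved_form M \<phi> \<tau> (fst z) m (?f z) (tderiv id l m (?f z) u) (tderiv id l m (?f z) v)"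
    if z: "z \<in> {0..1} \<times> S" "l \<in> charts_at M (?f z)" "m \<in> charts_at M (?f z)" for z l m u v
  proof -
    have t: "fst z \<in> {0..1}" and x: "snd z \<in> S" "snd z \<in> pts M" using z(1) SM by auto
    define k where "k = chart_of (snd z)"
    have k: "k \<in> charts_at M (snd z)" unfolding k_def by (rule chart_of[OF x(2)])
    have k': "k \<in> charts_at M (\<phi>inv (fst z) (?f z))" using k \<phi>inv(1)[OF t x(2)] by simp
    show ?thesis
      unfolding moved_form_eq[OF \<tau> x(1) t k z(2)] moved_form_eq[OF \<tau> x(1) t k z(3)]
      by (simp only: tderiv_transition(2)[OF \<phi>(3)[OF t] z(2) k' z(3)])
  qed
  show "continuous_map (subtopology (prod_topology unit_interval (mtop M)) {z \<in> {0..1} \<times> S. ?f z \<in> fst l}) euclideanreal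
      (\<lambda>z. moved_form M \<phi> \<tau> (fst z) l (?f z) u v)" if l: "l \<in> atlas M" for l u v
  proof (rule cm_local)
    let ?Z = "prod_topology unit_interval (mtop M)" and ?V = "{z \<in> {0..1} \<times> S. ?f z \<in> fst l}"
    fix z assume "z \<in> topspace (subtopology ?Z ?V)"
    then have z: "z \<in> ?V" by auto
    then have zp: "snd z \<in> pts M" using SM by auto
    define k where "k = chart_of (snd z)"
    have k: "k \<in> charts_at M (snd z)" unfolding k_def by (rule chart_of[OF zp])
    note ka = charts_atD[OF k]
    define W where "W = {z \<in> topspace (subtopology ?Z ?V). snd z \<in> fst k}"
    have oW: "openin (subtopology ?Z ?V) W"
      unfolding W_def by (rule openin_continuous_map_preimage[OF continuous_map_from_subtopology[OF continuous_map_snd] chart(1)[OF ka(1)]])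
    have WD: "fst z \<in> {0..1}" "snd z \<in> S" "k \<in> charts_at M (snd z)" "l \<in> charts_at M (?f z)" if "z \<in> W" for z
      using that ka(1) l by (auto simp: W_def charts_at_def)
    have e: "subtopology (subtopology ?Z ?V) W = subtopology ?Z W"
    proof -
      have "?V \<inter> W = W" by (auto simp: W_def)
      then show ?thesis by (simp add: subtopology_subtopology)
    qed
    have WZ: "W \<subseteq> topspace ?Z" by (auto simp: W_def)
    \<comment> \<open>The inverses are only known to be smooth for each fixed time. Joint continuity
      of their differentials comes from inverting the differentials of
      \<open>\<phi> t\<close>.\<close>
    have cD: "continuous_map (subtopology ?Z W) euclidean (\<lambda>z. tderiv (\<phi>inv (fst z)) l k (?f z) u)" for u
    proof (rule cm_linear_inverse)
      show "linear (tderiv (\<phi> (fst z)) k l (snd z))" if "z \<in> topspace (subtopology ?Z W)" for z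
        using tderiv_\<phi>inv(4) WD that by auto
      show "tderiv (\<phi> (fst z)) k l (snd z) (tderiv (\<phi>inv (fst z)) l k (?f z) u) = u" if "z \<in> topspace (subtopology ?Z W)" for z u
        using tderiv_\<phi>inv(2) WD that by auto
      show "tderiv (\<phi>inv (fst z)) l k (?f z) (tderiv (\<phi> (fst z)) k l (snd z) u) = u" if "z \<in> topspace (subtopology ?Z W)" for z u
        using tderiv_\<phi>inv(1) WD that by auto
      show "continuous_map (subtopology ?Z W) euclidean (\<lambda>z. tderiv (\<phi> (fst z)) k l (snd z) u)" for u
        using tderiv_\<phi>_continuous[OF ka(1) l] by (rule continuous_map_from_subtopology_mono) (auto simp: W_def)
    qed
    have cs: "continuous_map (subtopology ?Z W) (subtopology (mtop M) {p \<in> S. p \<in> fst k}) snd"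
      by (rule continuous_map_into_subtopology) (use WD(2) ka in \<open>auto intro: continuous_map_from_subtopology continuous_map_snd simp: W_def\<close>)
    have b: "bilinear (\<tau> k (snd z))" if "z \<in> topspace (subtopology ?Z W)" for z
      using form_fieldD(1)[OF two_form_field[OF \<tau>]] WD that by auto
    have c\<tau>: "continuous_map (subtopology ?Z W) euclideanreal (\<lambda>z. \<tau> k (snd z) u v)" for u v
      by (rule cm_compose[OF cs form_fieldD(3)[OF two_form_field[OF \<tau>] ka(1)]])
    have cT: "continuous_map (subtopology ?Z W) euclideanreal
        (\<lambda>z. \<tau> k (snd z) (tderiv (\<phi>inv (fst z)) l k (?f z) u) (tderiv (\<phi>inv (fst z)) l k (?f z) v))"
      by (rule cm_bilinear_apply[OF b c\<tau> cD cD])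
    show "\<exists>W h. openin (subtopology ?Z ?V) W \<and> z \<in> W \<and> continuous_map (subtopology (subtopology ?Z ?V) W) euclideanreal h \<and>
        (\<forall>z\<in>W. moved_form M \<phi> \<tau> (fst z) l (?f z) u v = h z)"
    proof (intro exI conjI ballI)
      show "openin (subtopology ?Z ?V) W" by (rule oW)
      show "z \<in> W" using \<open>z \<in> topspace (subtopology ?Z ?V)\<close> ka by (simp add: W_def)
      show "continuous_map (subtopology (subtopology ?Z ?V) W) euclideanreal
        (\<lambda>z. \<tau> k (snd z) (tderiv (\<phi>inv (fst z)) l k (?f z) u) (tderiv (\<phi>inv (fst z)) l k (?f z) v))"
        unfolding e by (rule cT)
      show "moved_form M \<phi> \<tau> (fst z) l (?f z) u v = \<tau> k (snd z) (tderiv (\<phi>inv (fst z)) l k (?f z) u) (tderiv (\<phi>inv (fst z)) l k (?f z) v)"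
        if "z \<in> W" for z
        by (rule moved_form_eq[OF \<tau> WD(2)[OF that] WD(1)[OF that] WD(3)[OF that] WD(4)[OF that]])
    qed
  qed
qed

lemma moved_\<omega>_eq:
  assumes t: "t \<in> {0..1}" and x: "x \<in> pts M" and l: "l \<in> charts_at M (\<phi> t x)"
    and inv: "\<And>k. k \<in> charts_at M x \<Longrightarrow> pullback M (\<phi> t) \<omega> k x = \<omega> k x"
  shows "moved_form M \<phi> \<omega> t l (\<phi> t x) = \<omega> l (\<phi> t x)"
proof (intro ext)
  fix u v
  define k where "k = chart_of x"
  have k: "k \<in> charts_at M x" unfolding k_def by (rule chart_of[OF x])
  let ?D' = "tderiv (\<phi>inv t) l k (\<phi> t x)"
  have "moved_form M \<phi> \<omega> t l (\<phi> t x) u v = \<omega> k x (?D' u) (?D' v)"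
    by (rule moved_form_eq[OF \<omega>_two_form x t k l])
  also have "\<dots> = pullback M (\<phi> t) \<omega> k x (?D' u) (?D' v)" by (simp only: inv[OF k])
  also have "\<dots> = \<omega> l (\<phi> t x) u v"
    by (simp only: pullback_chart[OF \<phi>(2)[OF t] \<omega>_two_form \<phi>_pts[OF t x] k l] tderiv_\<phi>inv(2)[OF t k l])
  finally show "moved_form M \<phi> \<omega> t l (\<phi> t x) u v = \<omega> l (\<phi> t x) u v" .
qed

lemma pullback_identity:
  assumes t: "t \<in> {0..1}" and id: "\<And>p. p \<in> pts M \<Longrightarrow> \<phi> t p = p" and k: "k \<in> charts_at M x"
  shows "pullback M (\<phi> t) \<omega> k x = \<omega> k x"
proof (intro ext)
  fix u v
  have x: "x \<in> pts M" by (rule charts_at_pts[OF k])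
  have k': "k \<in> charts_at M (\<phi> t x)" and k'': "k \<in> charts_at M (id x)" using k id[OF x] by simp_all
  have "tderiv (\<phi> t) k k x = tderiv id k k x"
    by (rule tderiv_cong[OF _ smooth_map_id k k'']) (simp add: id)
  then show "pullback M (\<phi> t) \<omega> k x u v = \<omega> k x u v"
    using pullback_chart[OF \<phi>(2)[OF t] \<omega>_two_form \<phi>_pts[OF t x] k k', of u v] id[OF x] by (simp add: transition_self[OF k])
qed

end

section \<open>Homotopies of surface isotopies\<close>

lemma Ck_on_const: "Ck_on n U (\<lambda>x. c)"
  by (induction n arbitrary: c) (auto simp: frechet_derivative_const)

lemma smooth_on_affine:
  fixes a w :: "'b::real_normed_vector"
  shows "smooth_on S (\<lambda>r::real. a + r *\<^sub>R w)"
proof -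
  have d: "((\<lambda>r::real. a + r *\<^sub>R w) has_derivative (\<lambda>v. v *\<^sub>R w)) (at r)" for r
    by (auto intro!: derivative_eq_intros)
  have "Ck_on n UNIV (\<lambda>r::real. a + r *\<^sub>R w)" for n
  proof (cases n)
    case (Suc m)
    have "frechet_derivative (\<lambda>r. a + r *\<^sub>R w) (at r) v = v *\<^sub>R w" for r v
      using frechet_derivative_at[OF d] by metis
    then show ?thesis using d Suc Ck_on_const by (auto simp: differentiable_def)
  qed (auto intro!: continuous_intros)
  then show ?thesis unfolding smooth_on_def by (intro ballI exI[of _ UNIV]) auto
qed

section \<open>Curves in embedded surfaces and Lagrangian tangent vectors\<close>

context smooth_manifold
begin

text \<open>Straight lines in the plane of the first two coordinates of a slice chart stay in the
  surface for small times; they realize every tangent vector of \<open>L\<close>.\<close>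

lemma slice_curve:
  assumes \<kappa>: "slice_chart M L \<kappa>" and x: "x \<in> L" "x \<in> fst \<kappa>" and w: "w $ 3 = 0" "w $ 4 = 0"
  defines "\<gamma> \<equiv> \<lambda>r. chart_inv \<kappa> (snd \<kappa> x + r *\<^sub>R w)"
  shows "\<gamma> 0 = x" "\<exists>\<epsilon>>0. \<forall>r\<in>{-\<epsilon><..<\<epsilon>}. \<gamma> r \<in> L \<inter> fst \<kappa> \<and> snd \<kappa> (\<gamma> r) = snd \<kappa> x + r *\<^sub>R w"
    "((\<lambda>r. snd \<kappa> (\<gamma> r)) has_vector_derivative w) (at 0)" "\<forall>\<^sub>F r in nhds 0. \<gamma> r \<in> L \<inter> fst \<kappa>"
proof -
  have ka: "\<kappa> \<in> atlas M" and sl: "snd \<kappa> ` (fst \<kappa> \<inter> L) = {x \<in> snd \<kappa> ` fst \<kappa>. x $ 3 = 0 \<and> x $ 4 = 0}"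
    using \<kappa> by (auto simp: slice_chart_def)
  show g0: "\<gamma> 0 = x" by (simp add: \<gamma>_def chart(5)[OF ka x(2)])
  have "snd \<kappa> x \<in> snd \<kappa> ` (fst \<kappa> \<inter> L)" using x by blast
  then have x34: "snd \<kappa> x $ 3 = 0" "snd \<kappa> x $ 4 = 0" unfolding sl by simp_all
  have "open ((\<lambda>r. snd \<kappa> x + r *\<^sub>R w) -` (snd \<kappa> ` fst \<kappa>))"
    by (intro open_vimage[OF chart(2)[OF ka]] continuous_intros)
  moreover have "0 \<in> (\<lambda>r. snd \<kappa> x + r *\<^sub>R w) -` (snd \<kappa> ` fst \<kappa>)" using x by simp
  ultimately obtain \<epsilon> where e: "\<epsilon> > 0" "ball 0 \<epsilon> \<subseteq> (\<lambda>r. snd \<kappa> x + r *\<^sub>R w) -` (snd \<kappa> ` fst \<kappa>)"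
    using openE by blast
  have *: "\<gamma> r \<in> L \<inter> fst \<kappa> \<and> snd \<kappa> (\<gamma> r) = snd \<kappa> x + r *\<^sub>R w" if "r \<in> ball 0 \<epsilon>" for r
  proof -
    have "snd \<kappa> x + r *\<^sub>R w \<in> {x \<in> snd \<kappa> ` fst \<kappa>. x $ 3 = 0 \<and> x $ 4 = 0}"
      using e(2) that x34 w by auto
    then obtain q where "q \<in> fst \<kappa> \<inter> L" "snd \<kappa> x + r *\<^sub>R w = snd \<kappa> q" unfolding sl[symmetric] by blast
    then show ?thesis using chart(5)[OF ka] by (simp add: \<gamma>_def)
  qed
  moreover have b: "ball 0 \<epsilon> = {-\<epsilon><..<\<epsilon>}" by (auto simp: ball_def dist_real_def)
  ultimately show "\<exists>\<epsilon>>0. \<forall>r\<in>{-\<epsilon><..<\<epsilon>}. \<gamma> r \<in> L \<inter> fst \<kappa> \<and> snd \<kappa> (\<gamma> r) = snd \<kappa> x + r *\<^sub>R w"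
    using e(1) by (intro exI[of _ \<epsilon>]) auto
  show "\<forall>\<^sub>F r in nhds 0. \<gamma> r \<in> L \<inter> fst \<kappa>"
    unfolding eventually_nhds using e(1) * by (intro exI[of _ "ball 0 \<epsilon>"]) auto
  have "((\<lambda>r. snd \<kappa> x + r *\<^sub>R w) has_vector_derivative w) (at 0)"
    by (auto intro!: derivative_eq_intros)
  then show "((\<lambda>r. snd \<kappa> (\<gamma> r)) has_vector_derivative w) (at 0)"
    by (rule has_vector_derivative_transform_within_open[of _ _ _ "ball 0 \<epsilon>"]) (use e(1) * in auto)
qed

lemma tangent_space_slice:
  assumes \<kappa>: "slice_chart M L \<kappa>" and x: "x \<in> L" "x \<in> fst \<kappa>" and w: "w $ 3 = 0" "w $ 4 = 0"
  shows "w \<in> tangent_space L \<kappa> x"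
proof -
  let ?\<gamma> = "\<lambda>r. chart_inv \<kappa> (snd \<kappa> x + r *\<^sub>R w)"
  note sc = slice_curve[OF assms]
  obtain \<epsilon> where e: "\<epsilon> > 0" "\<And>r. r \<in> {-\<epsilon><..<\<epsilon>} \<Longrightarrow> ?\<gamma> r \<in> L \<inter> fst \<kappa>" "\<And>r. r \<in> {-\<epsilon><..<\<epsilon>} \<Longrightarrow> snd \<kappa> (?\<gamma> r) = snd \<kappa> x + r *\<^sub>R w"
    using sc(2) by blast
  have "smooth_on {-\<epsilon><..<\<epsilon>} (\<lambda>r. snd \<kappa> (?\<gamma> r))"
    by (rule smooth_on_cong[OF smooth_on_affine[of _ "snd \<kappa> x" w]]) (rule e(3)[symmetric])
  with e(1,2) sc(1,3) show ?thesis
    unfolding tangent_space_def by (intro CollectI exI[of _ ?\<gamma>] exI[of _ \<epsilon>] conjI ballI)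
qed

text \<open>Along a curve in \<open>L\<close> the third and fourth slice coordinates are identically
  zero, hence so are their derivatives.\<close>

lemma slice_curve_derivative:
  fixes v :: "real^4"
  assumes \<kappa>: "slice_chart M L \<kappa>" and g: "\<forall>\<^sub>F r in nhds 0. \<gamma> r \<in> L \<inter> fst \<kappa>"
    and v: "((\<lambda>r. snd \<kappa> (\<gamma> r)) has_vector_derivative v) (at 0)"
  shows "v $ 3 = 0" "v $ 4 = 0"
proof -
  have sl: "snd \<kappa> ` (fst \<kappa> \<inter> L) = {x \<in> snd \<kappa> ` fst \<kappa>. x $ 3 = 0 \<and> x $ 4 = 0}"
    using \<kappa> by (auto simp: slice_chart_def)
  obtain S where S: "open S" "0 \<in> S" "\<And>r. r \<in> S \<Longrightarrow> \<gamma> r \<in> L \<inter> fst \<kappa>"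
    using g unfolding eventually_nhds by blast
  have "v $ i = 0" if i: "i = 3 \<or> i = 4" for i
  proof -
    have "snd \<kappa> (\<gamma> r) $ i = 0" if "r \<in> S" for r
    proof -
      have "snd \<kappa> (\<gamma> r) \<in> snd \<kappa> ` (fst \<kappa> \<inter> L)" using S(3)[OF that] by blast
      then show ?thesis using i unfolding sl by auto
    qed
    then have "((\<lambda>r. 0) has_vector_derivative v $ i) (at 0)"
      using has_vector_derivative_transform_within_open[OF bounded_linear.has_vector_derivative[OF bounded_linear_vec_nth v, of i] S(1,2), of "\<lambda>r. 0"]
      by simp
    then show ?thesis using vector_derivative_unique_at has_vector_derivative_const by blast
  qed
  then show "v $ 3 = 0" "v $ 4 = 0" by simp_all
qed

text \<open>\<open>tangent_space\<close> uses smooth curves, while the curves here are only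
  differentiable at 0. In a slice chart of \<open>S\<close> their velocities lie in the plane of the
  first two coordinates, and there straight lines realize them smoothly.\<close>

lemma lagrangian_velocities:
  assumes lag: "lagrangian_surface M \<tau> S" and p: "p \<in> S" and \<tau>: "two_form_on M N \<tau>" "p \<in> N" and l: "l \<in> charts_at M p"
    and 1: "\<gamma> 0 = p" "\<forall>\<^sub>F r in nhds 0. \<gamma> r \<in> S" "\<forall>\<^sub>F r in nhds 0. \<gamma> r \<in> fst l" "((\<lambda>r. snd l (\<gamma> r)) has_vector_derivative v) (at 0)"
    and 2: "\<delta> 0 = p" "\<forall>\<^sub>F r in nhds 0. \<delta> r \<in> S" "\<forall>\<^sub>F r in nhds 0. \<delta> r \<in> fst l" "((\<lambda>r. snd l (\<delta> r)) has_vector_derivative w) (at 0)"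
  shows "\<tau> l p v w = 0"
proof -
  obtain m where m: "slice_chart M S m" "p \<in> fst m"
    using lag p unfolding lagrangian_surface_def embedded_surface_def by blast
  then have ma: "m \<in> charts_at M p" by (auto simp: slice_chart_def charts_at_def)
  note la = charts_atD[OF l]
  have *: "tderiv id l m p v $ 3 = 0 \<and> tderiv id l m p v $ 4 = 0"
    if g: "\<gamma> 0 = p" "\<forall>\<^sub>F r in nhds 0. \<gamma> r \<in> S" "\<forall>\<^sub>F r in nhds 0. \<gamma> r \<in> fst l" "((\<lambda>r. snd l (\<gamma> r)) has_vector_derivative v) (at 0)" for \<gamma> v
  proof -
    have g0: "\<gamma> 0 \<in> fst l" using la g(1) by simp
    have A: "((\<lambda>x. snd m (chart_inv l x)) has_derivative tderiv id l m p) (at (snd l (\<gamma> 0)))"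
      using transition_has_derivative(1)[OF l ma] g(1) by simp
    have "((\<lambda>r. snd m (\<gamma> r)) has_vector_derivative tderiv id l m p v) (at 0)"
      by (rule curve_map[OF la(1) g0 g(3,4) A])
    moreover have "\<forall>\<^sub>F r in nhds 0. \<gamma> r \<in> fst m"
      by (rule curve_eventually_in[OF la(1) g0 g(3,4) chart(1)[OF charts_atD(1)[OF ma]]]) (use g(1) m in simp)
    then have "\<forall>\<^sub>F r in nhds 0. \<gamma> r \<in> S \<inter> fst m" using g(2) by eventually_elim simp
    ultimately show ?thesis using slice_curve_derivative[OF m(1)] by blast
  qed
  have "tderiv id l m p v \<in> tangent_space S m p" "tderiv id l m p w \<in> tangent_space S m p"
    using *[OF 1] *[OF 2] tangent_space_slice[OF m(1) p m(2)] by blast+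
  then have "\<tau> m p (tderiv id l m p v) (tderiv id l m p w) = 0"
    using lag p ma unfolding lagrangian_surface_def by blast
  then show ?thesis using form_fieldD(2)[OF two_form_field[OF \<tau>(1)] \<tau>(2) l ma] by simp
qed

end

section \<open>Velocities of tangent vectors under the homotopy\<close>

locale surface_homotopy = smooth_manifold M for M :: "'a smooth_space" +
  fixes L :: "'a set" and \<Psi> :: "real \<Rightarrow> real \<Rightarrow> 'a \<Rightarrow> 'a"
  assumes hom: "homotopy_of_isotopies M L \<Psi>" and LM: "L \<subseteq> pts M"
begin

lemma embedding: "\<lbrakk>s \<in> {0..1}; t \<in> {0..1}\<rbrakk> \<Longrightarrow> smooth_embedding M L (\<Psi> s t)"
  using hom by (simp add: homotopy_of_isotopies_def surface_isotopy_def)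

lemma \<Psi>_continuous: "\<lbrakk>s \<in> {0..1}; t \<in> {0..1}\<rbrakk> \<Longrightarrow> continuous_map (subtopology (mtop M) L) (mtop M) (\<Psi> s t)"
  using embedding by (simp add: smooth_embedding_def smooth_map_def)

lemma \<Psi>_pts: "\<lbrakk>s \<in> {0..1}; t \<in> {0..1}; x \<in> L\<rbrakk> \<Longrightarrow> \<Psi> s t x \<in> pts M"
  using continuous_map_image_subset_topspace[OF \<Psi>_continuous] LM by fastforce

text \<open>\<open>G\<close> extends the coordinate expression of \<open>\<Psi>\<close> to an ambient family near the point \<open>(s, t, x)\<close>.\<close>

definition local_extension :: "real \<Rightarrow> real \<Rightarrow> 'a \<Rightarrow> 'a chart \<Rightarrow> 'a chart \<Rightarrow>
    (real \<times> real \<times> (real^4)) set \<Rightarrow> (real \<Rightarrow> real \<times> (real^4) \<Rightarrow> real^4) \<Rightarrow> bool" where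
  "local_extension s t x \<kappa> l W G \<longleftrightarrow>
     openin (top_of_set ({0..1} \<times> UNIV)) W \<and> (s, t, snd \<kappa> x) \<in> W \<and>
     (\<forall>s t p. s \<in> {0..1} \<longrightarrow> t \<in> {0..1} \<longrightarrow> p \<in> L \<longrightarrow> p \<in> fst \<kappa> \<longrightarrow> \<Psi> s t p \<in> fst l \<longrightarrow> (s, t, snd \<kappa> p) \<in> W \<longrightarrow>
        G s (t, snd \<kappa> p) = snd l (\<Psi> s t p)) \<and>
     (\<forall>s y. (s, y) \<in> W \<longrightarrow> (G s has_derivative frechet_derivative (G s) (at y)) (at y)) \<and>
     (\<forall>v. continuous_on W (\<lambda>z. frechet_derivative (G (fst z)) (at (snd z)) v))"

lemma local_extensionD:
  assumes "local_extension s t x \<kappa> l W G"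
  shows "openin (top_of_set ({0..1} \<times> UNIV)) W" "(s, t, snd \<kappa> x) \<in> W"
    "\<lbrakk>s' \<in> {0..1}; t' \<in> {0..1}; p \<in> L; p \<in> fst \<kappa>; \<Psi> s' t' p \<in> fst l; (s', t', snd \<kappa> p) \<in> W\<rbrakk> \<Longrightarrow> G s' (t', snd \<kappa> p) = snd l (\<Psi> s' t' p)"
    "(s', y) \<in> W \<Longrightarrow> (G s' has_derivative frechet_derivative (G s') (at y)) (at y)"
    "continuous_on W (\<lambda>z. frechet_derivative (G (fst z)) (at (snd z)) v)"
  using assms unfolding local_extension_def by blast+

lemma local_extension_ex:
  assumes s: "s \<in> {0..1}" and t: "t \<in> {0..1}" and x: "x \<in> L" and \<kappa>: "\<kappa> \<in> charts_at M x" and l: "l \<in> charts_at M (\<Psi> s t x)"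
  shows "\<exists>W G. local_extension s t x \<kappa> l W G"
proof -
  define D where "D = (\<lambda>(s, t, p). (s, t, snd \<kappa> p)) ` {(s, t, p). s \<in> {0..1} \<and> t \<in> {0..1} \<and> p \<in> fst \<kappa> \<inter> L \<and> \<Psi> s t p \<in> fst l}"
  have inD: "(s, t, snd \<kappa> p) \<in> D" if "s \<in> {0..1}" "t \<in> {0..1}" "p \<in> L" "p \<in> fst \<kappa>" "\<Psi> s t p \<in> fst l" for s t p
  proof -
    have "(s, t, p) \<in> {(s, t, p). s \<in> {0..1} \<and> t \<in> {0..1} \<and> p \<in> fst \<kappa> \<inter> L \<and> \<Psi> s t p \<in> fst l}"
      using that by simp
    from imageI[OF this, of "\<lambda>(s, t, p). (s, t, snd \<kappa> p)"] show ?thesis by (simp only: D_def case_prod_conv)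
  qed
  have ka: "\<kappa> \<in> atlas M" "x \<in> fst \<kappa>" and la: "l \<in> atlas M" "\<Psi> s t x \<in> fst l" using \<kappa> l by (auto simp: charts_at_def)
  have "smooth_family_on {0..1} D (\<lambda>s (t, x). snd l (\<Psi> s t (chart_inv \<kappa> x)))"
    using hom ka(1) la(1) unfolding homotopy_of_isotopies_def D_def by blast
  then obtain W G where W: "openin (top_of_set ({0..1} \<times> UNIV)) W" "(s, t, snd \<kappa> x) \<in> W" and C: "\<And>n. Ck_family_on n W G"
    and eq: "\<forall>(s, y)\<in>D \<inter> W. G s y = (\<lambda>(t, x). snd l (\<Psi> s t (chart_inv \<kappa> x))) y"
    using inD[OF s t x ka(2) la(2)] unfolding smooth_family_on_def by blast
  have "local_extension s t x \<kappa> l W G"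
    unfolding local_extension_def
  proof (intro conjI allI impI W)
    show "G s (t, snd \<kappa> p) = snd l (\<Psi> s t p)"
      if "s \<in> {0..1}" "t \<in> {0..1}" "p \<in> L" "p \<in> fst \<kappa>" "\<Psi> s t p \<in> fst l" "(s, t, snd \<kappa> p) \<in> W" for s t p
    proof -
      have "(s, t, snd \<kappa> p) \<in> D \<inter> W" using inD that by blast
      from bspec[OF eq this] have "G s (t, snd \<kappa> p) = snd l (\<Psi> s t (chart_inv \<kappa> (snd \<kappa> p)))" by simp
      then show ?thesis using chart(5)[OF ka(1) that(4)] by simp
    qed
    show "(G s has_derivative frechet_derivative (G s) (at y)) (at y)" if "(s, y) \<in> W" for s y
    proof -
      have "G s differentiable (at y)" using C[of "Suc 0"] that by auto
      then show ?thesis by (simp only: frechet_derivative_works)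
    qed
    show "continuous_on W (\<lambda>z. frechet_derivative (G (fst z)) (at (snd z)) v)" for v
      using C[of "Suc 0"] by (cases v) (simp add: case_prod_unfold)
  qed
  then show ?thesis by blast
qed

lemma curve_eventually_image:
  assumes s: "s \<in> {0..1}" and t: "t \<in> {0..1}" and \<kappa>: "\<kappa> \<in> atlas M" and Y: "openin (mtop M) Y" "\<Psi> s t (\<gamma> 0) \<in> Y"
    and g: "\<forall>\<^sub>F r in nhds 0. \<gamma> r \<in> L \<inter> fst \<kappa>" and w: "((\<lambda>r. snd \<kappa> (\<gamma> r)) has_vector_derivative w) (at 0)"
  shows "\<forall>\<^sub>F r in nhds 0. \<Psi> s t (\<gamma> r) \<in> Y"
proof -
  have "openin (subtopology (mtop M) L) {p \<in> topspace (subtopology (mtop M) L). \<Psi> s t p \<in> Y}"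
    by (rule openin_continuous_map_preimage[OF \<Psi>_continuous[OF s t] Y(1)])
  then obtain V where V: "openin (mtop M) V" "{p \<in> topspace (subtopology (mtop M) L). \<Psi> s t p \<in> Y} = V \<inter> L"
    unfolding openin_subtopology by blast
  have g0: "\<gamma> 0 \<in> L \<inter> fst \<kappa>" using eventually_nhds_x_imp_x[OF g] .
  then have "\<gamma> 0 \<in> V" using V(2) Y(2) LM by auto
  moreover have "\<forall>\<^sub>F r in nhds 0. \<gamma> r \<in> fst \<kappa>" using g by eventually_elim simp
  ultimately have "\<forall>\<^sub>F r in nhds 0. \<gamma> r \<in> V"
    using curve_eventually_in[of \<kappa> \<gamma>, OF \<kappa> _ _ w V(1)] g0 by blast
  with g show ?thesis by eventually_elim (use V(2) in blast)
qed

text \<open>\<open>G\<close> describes \<open>\<Psi> s t\<close> only at coordinates of points of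
  \<open>L\<close>. The chain rule is therefore applied along curves that stay in \<open>L\<close>,
  where the two expressions agree near time 0.\<close>

lemma curve_image:
  assumes s: "s \<in> {0..1}" and t: "t \<in> {0..1}" and \<kappa>: "\<kappa> \<in> charts_at M (\<gamma> 0)" and l: "l \<in> charts_at M (\<Psi> s t (\<gamma> 0))"
    and g: "\<forall>\<^sub>F r in nhds 0. \<gamma> r \<in> L \<inter> fst \<kappa>" and w: "((\<lambda>r. snd \<kappa> (\<gamma> r)) has_vector_derivative w) (at 0)"
    and W: "openin (top_of_set ({0..1} \<times> UNIV)) W" "(s, t, snd \<kappa> (\<gamma> 0)) \<in> W"
    and eq: "\<And>p. \<lbrakk>p \<in> L; p \<in> fst \<kappa>; \<Psi> s t p \<in> fst l; (s, t, snd \<kappa> p) \<in> W\<rbrakk> \<Longrightarrow> G (t, snd \<kappa> p) = snd l (\<Psi> s t p)"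
    and D: "(G has_derivative G') (at (t, snd \<kappa> (\<gamma> 0)))"
  shows "((\<lambda>r. snd l (\<Psi> s t (\<gamma> r))) has_vector_derivative G' (0, w)) (at (0::real))"
proof -
  note ka = charts_atD[OF \<kappa>] and la = charts_atD[OF l]
  obtain T where T: "open T" "W = ({0..1} \<times> UNIV) \<inter> T" using W(1) by (auto simp: openin_open)
  have "isCont (\<lambda>r. snd \<kappa> (\<gamma> r)) 0" using w has_vector_derivative_continuous by blast
  then have "isCont (\<lambda>r. (s, t, snd \<kappa> (\<gamma> r))) 0" by (intro continuous_intros)
  then have "((\<lambda>r. (s, t, snd \<kappa> (\<gamma> r))) \<longlongrightarrow> (s, t, snd \<kappa> (\<gamma> 0))) (nhds 0)"
    using tendsto_at_iff_tendsto_nhds[of "\<lambda>r. (s, t, snd \<kappa> (\<gamma> r))" 0] by (simp add: isCont_def)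
  then have "\<forall>\<^sub>F r in nhds 0. (s, t, snd \<kappa> (\<gamma> r)) \<in> T"
    using topological_tendstoD T W(2) by blast
  moreover have "\<forall>\<^sub>F r in nhds 0. \<Psi> s t (\<gamma> r) \<in> fst l"
    by (rule curve_eventually_image[OF s t ka(1) chart(1)[OF la(1)] la(2) g w])
  ultimately have "\<forall>\<^sub>F r in nhds 0. G (t, snd \<kappa> (\<gamma> r)) = snd l (\<Psi> s t (\<gamma> r))"
    using g by eventually_elim (use eq s T(2) in blast)
  then obtain S where S: "open S" "0 \<in> S" "\<And>r. r \<in> S \<Longrightarrow> G (t, snd \<kappa> (\<gamma> r)) = snd l (\<Psi> s t (\<gamma> r))"
    unfolding eventually_nhds by blast
  have "((\<lambda>r. (t, snd \<kappa> (\<gamma> r))) has_vector_derivative (0, w)) (at 0)"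
    by (intro has_vector_derivative_Pair w) simp
  then have "((\<lambda>r. G (t, snd \<kappa> (\<gamma> r))) has_vector_derivative G' (0, w)) (at 0)"
    using vector_derivative_diff_chain_within[of "\<lambda>r. (t, snd \<kappa> (\<gamma> r))" "(0, w)" 0 UNIV G G'] has_derivative_at_withinI[OF D]
    by (simp add: o_def)
  then show ?thesis by (rule has_vector_derivative_transform_within_open[OF _ S])
qed

text \<open>The differential of \<open>\<Psi> s t\<close> on a tangent vector of \<open>L\<close>
  with slice coordinates \<open>w\<close>. It is taken along a coordinate line because \<Psi> is
  controlled on \<open>L\<close> only and has no ambient derivative.\<close>

definition velocity :: "real \<Rightarrow> real \<Rightarrow> 'a chart \<Rightarrow> 'a chart \<Rightarrow> 'a \<Rightarrow> real^4 \<Rightarrow> real^4" where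
  "velocity s t \<kappa> l x w = vector_derivative (\<lambda>r. snd l (\<Psi> s t (chart_inv \<kappa> (snd \<kappa> x + r *\<^sub>R w)))) (at 0)"

context
  fixes s t :: real and \<kappa> :: "'a chart" and x :: 'a
  assumes s: "s \<in> {0..1}" and t: "t \<in> {0..1}" and \<kappa>: "slice_chart M L \<kappa>" and x: "x \<in> L" "x \<in> fst \<kappa>"
begin

lemma \<kappa>_charts_at: "\<kappa> \<in> charts_at M x"
  using \<kappa> x by (auto simp: slice_chart_def charts_at_def)

text \<open>An ambient extension is not unique, but on directions tangent to the slice its
  derivative is determined by curves in \<open>L\<close>. So linearity and continuity can be read
  off from any extension.\<close>

lemma velocity_frechet:
  assumes l: "l \<in> charts_at M (\<Psi> s t x)" and w: "w $ 3 = 0" "w $ 4 = 0"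
    and W: "openin (top_of_set ({0..1} \<times> UNIV)) W" "(s, t, snd \<kappa> x) \<in> W"
    and eq: "\<And>p. \<lbrakk>p \<in> L; p \<in> fst \<kappa>; \<Psi> s t p \<in> fst l; (s, t, snd \<kappa> p) \<in> W\<rbrakk> \<Longrightarrow> G (t, snd \<kappa> p) = snd l (\<Psi> s t p)"
    and D: "(G has_derivative G') (at (t, snd \<kappa> x))"
  shows "velocity s t \<kappa> l x w = G' (0, w)"
proof -
  let ?\<gamma> = "\<lambda>r. chart_inv \<kappa> (snd \<kappa> x + r *\<^sub>R w)"
  note sc = slice_curve[OF \<kappa> x w]
  have A1: "\<kappa> \<in> charts_at M (?\<gamma> 0)" unfolding sc(1) by (rule \<kappa>_charts_at)
  have A2: "l \<in> charts_at M (\<Psi> s t (?\<gamma> 0))" unfolding sc(1) by (rule l)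
  have A3: "(s, t, snd \<kappa> (?\<gamma> 0)) \<in> W" unfolding sc(1) by (rule W(2))
  have A4: "(G has_derivative G') (at (t, snd \<kappa> (?\<gamma> 0)))" unfolding sc(1) by (rule D)
  have "((\<lambda>r. snd l (\<Psi> s t (?\<gamma> r))) has_vector_derivative G' (0, w)) (at 0)"
    by (rule curve_image[OF s t A1 A2 sc(4,3) W(1) A3 eq A4])
  then show ?thesis unfolding velocity_def by (rule vector_derivative_at)
qed

lemma velocity_curve:
  assumes l: "l \<in> charts_at M (\<Psi> s t x)" and g: "\<gamma> 0 = x" "\<forall>\<^sub>F r in nhds 0. \<gamma> r \<in> L \<inter> fst \<kappa>"
    and w: "((\<lambda>r. snd \<kappa> (\<gamma> r)) has_vector_derivative w) (at 0)"
  shows "((\<lambda>r. snd l (\<Psi> s t (\<gamma> r))) has_vector_derivative velocity s t \<kappa> l x w) (at 0)"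
proof -
  obtain W G where F: "local_extension s t x \<kappa> l W G"
    using local_extension_ex[OF s t x(1) \<kappa>_charts_at l] by blast
  note W = local_extensionD(1,2)[OF F] and eq = local_extensionD(3)[OF F] and D = local_extensionD(4)[OF F] and cD = local_extensionD(5)[OF F]
  have v: "velocity s t \<kappa> l x w = frechet_derivative (G s) (at (t, snd \<kappa> x)) (0, w)"
    by (rule velocity_frechet[OF l slice_curve_derivative[OF \<kappa> g(2) w] W eq[OF s t] D[OF W(2)]])
  show ?thesis
    unfolding v
  proof -
    have A1: "\<kappa> \<in> charts_at M (\<gamma> 0)" unfolding g(1) by (rule \<kappa>_charts_at)
    have A2: "l \<in> charts_at M (\<Psi> s t (\<gamma> 0))" unfolding g(1) by (rule l)
    have A3: "(s, t, snd \<kappa> (\<gamma> 0)) \<in> W" unfolding g(1) by (rule W(2))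
    have A4: "(G s has_derivative frechet_derivative (G s) (at (t, snd \<kappa> x))) (at (t, snd \<kappa> (\<gamma> 0)))"
      unfolding g(1) by (rule D[OF W(2)])
    show "((\<lambda>r. snd l (\<Psi> s t (\<gamma> r))) has_vector_derivative frechet_derivative (G s) (at (t, snd \<kappa> x)) (0, w)) (at 0)"
      by (rule curve_image[OF s t A1 A2 g(2) w W(1) A3 eq[OF s t] A4])
  qed
qed

lemma velocity_linear:
  assumes l: "l \<in> charts_at M (\<Psi> s t x)" and w: "w $ 3 = 0" "w $ 4 = 0" and w': "w' $ 3 = 0" "w' $ 4 = 0"
  shows "velocity s t \<kappa> l x (a *\<^sub>R w + b *\<^sub>R w') = a *\<^sub>R velocity s t \<kappa> l x w + b *\<^sub>R velocity s t \<kappa> l x w'"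
proof -
  obtain W G where F: "local_extension s t x \<kappa> l W G"
    using local_extension_ex[OF s t x(1) \<kappa>_charts_at l] by blast
  note W = local_extensionD(1,2)[OF F] and eq = local_extensionD(3)[OF F] and D = local_extensionD(4)[OF F] and cD = local_extensionD(5)[OF F]
  let ?G' = "frechet_derivative (G s) (at (t, snd \<kappa> x))"
  have v: "velocity s t \<kappa> l x w = ?G' (0, w)" if "w $ 3 = 0" "w $ 4 = 0" for w
    by (rule velocity_frechet[OF l that W eq[OF s t] D[OF W(2)]])
  have lin: "linear ?G'" using D[OF W(2)] has_derivative_linear by blast
  have "velocity s t \<kappa> l x (a *\<^sub>R w + b *\<^sub>R w') = ?G' (0, a *\<^sub>R w + b *\<^sub>R w')"
    using w w' by (intro v) simp_all
  also have "(0, a *\<^sub>R w + b *\<^sub>R w') = a *\<^sub>R (0 :: real, w) + b *\<^sub>R (0, w')" by simp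
  also have "?G' \<dots> = a *\<^sub>R ?G' (0, w) + b *\<^sub>R ?G' (0, w')"
    by (simp only: linear_add[OF lin] linear_cmul[OF lin])
  finally show ?thesis using v w w' by simp
qed

lemma velocity_transition:
  assumes l: "l \<in> charts_at M (\<Psi> s t x)" and m: "m \<in> charts_at M (\<Psi> s t x)" and w: "w $ 3 = 0" "w $ 4 = 0"
  shows "tderiv id l m (\<Psi> s t x) (velocity s t \<kappa> l x w) = velocity s t \<kappa> m x w"
proof -
  let ?\<gamma> = "\<lambda>r. chart_inv \<kappa> (snd \<kappa> x + r *\<^sub>R w)"
  note sc = slice_curve[OF \<kappa> x w]
  note la = charts_atD[OF l]
  have 1: "((\<lambda>r. snd l (\<Psi> s t (?\<gamma> r))) has_vector_derivative velocity s t \<kappa> l x w) (at 0)"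
    "((\<lambda>r. snd m (\<Psi> s t (?\<gamma> r))) has_vector_derivative velocity s t \<kappa> m x w) (at 0)"
    by (rule velocity_curve[OF _ sc(1,4,3)], fact)+
  have 2: "\<forall>\<^sub>F r in nhds 0. \<Psi> s t (?\<gamma> r) \<in> fst l"
    using curve_eventually_image[where \<gamma> = ?\<gamma>, OF s t charts_atD(1)[OF \<kappa>_charts_at] chart(1)[OF la(1)] _ sc(4,3)] la(2) sc(1) by simp
  have A: "((\<lambda>y. snd m (chart_inv l y)) has_derivative tderiv id l m (\<Psi> s t x)) (at (snd l (\<Psi> s t (?\<gamma> 0))))"
    using transition_has_derivative(1)[OF l m] sc(1) by simp
  have "((\<lambda>r. snd m (\<Psi> s t (?\<gamma> r))) has_vector_derivative tderiv id l m (\<Psi> s t x) (velocity s t \<kappa> l x w)) (at 0)"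
    by (rule curve_map[where \<gamma> = "\<lambda>r. \<Psi> s t (?\<gamma> r)", OF la(1) _ 2 1(1) A]) (use la(2) sc(1) in simp)
  then show ?thesis using 1(2) vector_derivative_unique_at by blast
qed

text \<open>The inverse of the embedding is smooth on the image, so a local extension of it recovers
  the coordinate line from its image. If the image had zero velocity, the line would too.\<close>

lemma velocity_nonzero:
  assumes l: "l \<in> charts_at M (\<Psi> s t x)" and w: "w $ 3 = 0" "w $ 4 = 0" and 0: "velocity s t \<kappa> l x w = 0"
  shows "w = 0"
proof -
  let ?\<gamma> = "\<lambda>r. chart_inv \<kappa> (snd \<kappa> x + r *\<^sub>R w)" and ?f = "\<Psi> s t"
  note sc = slice_curve[OF \<kappa> x w]
  note la = charts_atD[OF l] and ka = charts_atD[OF \<kappa>_charts_at]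
  have inj: "inj_on ?f L" and sm: "smooth_map M (?f ` L) (inv_into L ?f)"
    using embedding[OF s t] by (auto simp: smooth_embedding_def)
  define S where "S = snd l ` {p \<in> fst l \<inter> ?f ` L. inv_into L ?f p \<in> fst \<kappa>}"
  have inS: "snd l (?f p) \<in> S \<and> snd \<kappa> (inv_into L ?f (chart_inv l (snd l (?f p)))) = snd \<kappa> p"
    if "p \<in> L \<inter> fst \<kappa>" "?f p \<in> fst l" for p
    using that inv_into_f_f[OF inj, of p] chart(5)[OF la(1)] by (auto simp: S_def)
  have "smooth_on S (\<lambda>y. snd \<kappa> (inv_into L ?f (chart_inv l y)))"
    using sm ka(1) la(1) unfolding smooth_map_def S_def by blast
  moreover have "snd l (?f x) \<in> S" using inS x la(2) by blast
  ultimately obtain U G where U: "open U" "snd l (?f x) \<in> U" "\<And>y. y \<in> S \<inter> U \<Longrightarrow> G y = snd \<kappa> (inv_into L ?f (chart_inv l y))"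
    "\<And>y. y \<in> U \<Longrightarrow> (G has_derivative frechet_derivative G (at y)) (at y)"
    by (rule smooth_on_local) metis
  have 1: "((\<lambda>r. snd l (?f (?\<gamma> r))) has_vector_derivative velocity s t \<kappa> l x w) (at 0)"
    by (rule velocity_curve[OF l sc(1,4,3)])
  have "((\<lambda>r. G (snd l (?f (?\<gamma> r)))) has_vector_derivative frechet_derivative G (at (snd l (?f x))) (velocity s t \<kappa> l x w)) (at 0)"
    using vector_derivative_diff_chain_within[OF 1, of G] has_derivative_at_withinI[OF U(4)[OF U(2)]] sc(1)
    by (simp add: o_def)
  moreover have "frechet_derivative G (at (snd l (?f x))) (velocity s t \<kappa> l x w) = 0"
    using 0 linear_0[OF has_derivative_linear[OF U(4)[OF U(2)]]] by simp
  ultimately have d0: "((\<lambda>r. G (snd l (?f (?\<gamma> r)))) has_vector_derivative 0) (at 0)" by simp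
  have "isCont (\<lambda>r. snd l (?f (?\<gamma> r))) 0" using 1 has_vector_derivative_continuous by blast
  then have "((\<lambda>r. snd l (?f (?\<gamma> r))) \<longlongrightarrow> snd l (?f x)) (nhds 0)"
    using tendsto_at_iff_tendsto_nhds[of "\<lambda>r. snd l (?f (?\<gamma> r))" 0] sc(1) by (simp add: isCont_def)
  then have "\<forall>\<^sub>F r in nhds 0. snd l (?f (?\<gamma> r)) \<in> U" using topological_tendstoD U(1,2) by blast
  moreover have "\<forall>\<^sub>F r in nhds 0. ?f (?\<gamma> r) \<in> fst l"
    using curve_eventually_image[where \<gamma> = ?\<gamma>, OF s t ka(1) chart(1)[OF la(1)] _ sc(4,3)] la(2) sc(1) by simp
  ultimately have "\<forall>\<^sub>F r in nhds 0. G (snd l (?f (?\<gamma> r))) = snd \<kappa> (?\<gamma> r)"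
    using sc(4) by eventually_elim (use U(3) inS in \<open>metis IntI\<close>)
  then obtain T where T: "open T" "0 \<in> T" "\<And>r. r \<in> T \<Longrightarrow> G (snd l (?f (?\<gamma> r))) = snd \<kappa> (?\<gamma> r)"
    unfolding eventually_nhds by blast
  have "((\<lambda>r. snd \<kappa> (?\<gamma> r)) has_vector_derivative 0) (at 0)"
    by (rule has_vector_derivative_transform_within_open[OF d0 T])
  then show ?thesis using sc(3) vector_derivative_unique_at by blast
qed

text \<open>A coordinate line of \<open>\<kappa>'\<close> is also a curve in \<open>L\<close> for
  \<kappa>, where its velocity is given by the transition map and is again tangent to the
  slice.\<close>

lemma velocity_slice:
  assumes l: "l \<in> charts_at M (\<Psi> s t x)" and \<kappa>': "slice_chart M L \<kappa>'" "x \<in> fst \<kappa>'" and w: "w $ 3 = 0" "w $ 4 = 0"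
  shows "((\<lambda>r. snd l (\<Psi> s t (chart_inv \<kappa>' (snd \<kappa>' x + r *\<^sub>R w)))) has_vector_derivative velocity s t \<kappa> l x (tderiv id \<kappa>' \<kappa> x w)) (at 0)"
    "velocity s t \<kappa>' l x w = velocity s t \<kappa> l x (tderiv id \<kappa>' \<kappa> x w)"
    "tderiv id \<kappa>' \<kappa> x w $ 3 = 0" "tderiv id \<kappa>' \<kappa> x w $ 4 = 0"
proof -
  let ?\<gamma> = "\<lambda>r. chart_inv \<kappa>' (snd \<kappa>' x + r *\<^sub>R w)"
  note sc = slice_curve[OF \<kappa>'(1) x(1) \<kappa>'(2) w]
  have k': "\<kappa>' \<in> charts_at M x" using \<kappa>' by (auto simp: slice_chart_def charts_at_def)
  note ka' = charts_atD[OF k'] and ka = charts_atD[OF \<kappa>_charts_at]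
  have e: "\<forall>\<^sub>F r in nhds 0. ?\<gamma> r \<in> fst \<kappa>'" using sc(4) by eventually_elim simp
  have g0: "?\<gamma> 0 \<in> fst \<kappa>'" unfolding sc(1) by (rule ka'(2))
  have A: "((\<lambda>y. snd \<kappa> (chart_inv \<kappa>' y)) has_derivative tderiv id \<kappa>' \<kappa> x) (at (snd \<kappa>' (?\<gamma> 0)))"
    using transition_has_derivative(1)[OF k' \<kappa>_charts_at] unfolding sc(1) id_apply .
  have d: "((\<lambda>r. snd \<kappa> (?\<gamma> r)) has_vector_derivative tderiv id \<kappa>' \<kappa> x w) (at 0)"
    by (rule curve_map[where \<gamma> = ?\<gamma>, OF ka'(1) g0 e sc(3) A])
  have "\<forall>\<^sub>F r in nhds 0. ?\<gamma> r \<in> fst \<kappa>"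
    by (rule curve_eventually_in[where \<gamma> = ?\<gamma>, OF ka'(1) _ e sc(3) chart(1)[OF ka(1)]]) (use sc(1) ka ka' in simp_all)
  with sc(4) have g: "\<forall>\<^sub>F r in nhds 0. ?\<gamma> r \<in> L \<inter> fst \<kappa>" by eventually_elim simp
  show "tderiv id \<kappa>' \<kappa> x w $ 3 = 0" "tderiv id \<kappa>' \<kappa> x w $ 4 = 0"
    using slice_curve_derivative[OF \<kappa> g d] by blast+
  show v: "((\<lambda>r. snd l (\<Psi> s t (?\<gamma> r))) has_vector_derivative velocity s t \<kappa> l x (tderiv id \<kappa>' \<kappa> x w)) (at 0)"
    by (rule velocity_curve[OF l sc(1) g d])
  show "velocity s t \<kappa>' l x w = velocity s t \<kappa> l x (tderiv id \<kappa>' \<kappa> x w)"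
    unfolding velocity_def[of s t \<kappa>'] by (rule vector_derivative_at[OF v])
qed

lemma velocity_lagrangian:
  assumes l: "l \<in> charts_at M (\<Psi> s t x)" and lag: "lagrangian_surface M \<tau> (\<Psi> s t ` L)" and \<tau>: "two_form_on M N \<tau>" "\<Psi> s t x \<in> N"
    and w: "w $ 3 = 0" "w $ 4 = 0" and w': "w' $ 3 = 0" "w' $ 4 = 0"
  shows "\<tau> l (\<Psi> s t x) (velocity s t \<kappa> l x w) (velocity s t \<kappa> l x w') = 0"
proof -
  note la = charts_atD[OF l] and ka = charts_atD[OF \<kappa>_charts_at]
  let ?\<gamma> = "\<lambda>w r. chart_inv \<kappa> (snd \<kappa> x + r *\<^sub>R w)"
  have 1: "\<Psi> s t (?\<gamma> w 0) = \<Psi> s t x" "\<forall>\<^sub>F r in nhds 0. \<Psi> s t (?\<gamma> w r) \<in> \<Psi> s t ` L" "\<forall>\<^sub>F r in nhds 0. \<Psi> s t (?\<gamma> w r) \<in> fst l"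
    "((\<lambda>r. snd l (\<Psi> s t (?\<gamma> w r))) has_vector_derivative velocity s t \<kappa> l x w) (at 0)" if "w $ 3 = 0" "w $ 4 = 0" for w
  proof -
    note sc = slice_curve[OF \<kappa> x that]
    show "\<Psi> s t (?\<gamma> w 0) = \<Psi> s t x" using sc(1) by simp
    show "\<forall>\<^sub>F r in nhds 0. \<Psi> s t (?\<gamma> w r) \<in> \<Psi> s t ` L" using sc(4) by eventually_elim simp
    show "\<forall>\<^sub>F r in nhds 0. \<Psi> s t (?\<gamma> w r) \<in> fst l"
      using curve_eventually_image[where \<gamma> = "?\<gamma> w", OF s t ka(1) chart(1)[OF la(1)] _ sc(4,3)] la(2) sc(1) by simp
    show "((\<lambda>r. snd l (\<Psi> s t (?\<gamma> w r))) has_vector_derivative velocity s t \<kappa> l x w) (at 0)"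
      by (rule velocity_curve[OF l sc(1,4,3)])
  qed
  show ?thesis
    by (rule lagrangian_velocities[OF lag imageI[OF x(1)] \<tau> l 1[OF w] 1[OF w']])
qed

end

text \<open>Near each point one local extension computes all velocities, and for a continuous family
  of smooth isotopies its first derivatives are jointly continuous.\<close>

lemma velocity_continuous:
  assumes \<kappa>: "slice_chart M L \<kappa>" and l: "l \<in> atlas M" and w: "w $ 3 = 0" "w $ 4 = 0"
  shows "continuous_map (subtopology (prod_topology unit_interval (prod_topology unit_interval (subtopology (mtop M) L)))
      {q. snd (snd q) \<in> fst \<kappa> \<and> \<Psi> (fst q) (fst (snd q)) (snd (snd q)) \<in> fst l}) euclidean
    (\<lambda>q. velocity (fst q) (fst (snd q)) \<kappa> l (snd (snd q)) w)"
proof (rule cm_local)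
  let ?Q = "prod_topology unit_interval (prod_topology unit_interval (subtopology (mtop M) L))"
  let ?V = "{q. snd (snd q) \<in> fst \<kappa> \<and> \<Psi> (fst q) (fst (snd q)) (snd (snd q)) \<in> fst l}"
  have ka: "\<kappa> \<in> atlas M" using \<kappa> by (simp add: slice_chart_def)
  fix q assume q: "q \<in> topspace (subtopology ?Q ?V)"
  have V: "fst q \<in> {0..1}" "fst (snd q) \<in> {0..1}" "snd (snd q) \<in> L" "snd (snd q) \<in> fst \<kappa>"
    "\<kappa> \<in> charts_at M (snd (snd q))" "l \<in> charts_at M (\<Psi> (fst q) (fst (snd q)) (snd (snd q)))"
    if "q \<in> topspace (subtopology ?Q ?V)" for q
    using that ka l by (auto simp: charts_at_def)
  obtain W G where F: "local_extension (fst q) (fst (snd q)) (snd (snd q)) \<kappa> l W G"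
    using local_extension_ex[OF V(1)[OF q] V(2)[OF q] V(3)[OF q] V(5)[OF q] V(6)[OF q]] by blast
  note W = local_extensionD(1,2)[OF F] and eq = local_extensionD(3)[OF F] and D = local_extensionD(4)[OF F] and cD = local_extensionD(5)[OF F]
  let ?c = "\<lambda>q. (fst q, fst (snd q), snd \<kappa> (snd (snd q)))"
  have cc: "continuous_map (subtopology ?Q ?V) (top_of_set ({0..1} \<times> UNIV)) ?c"
  proof -
    have 1: "continuous_map (subtopology ?Q ?V) unit_interval fst"
      by (rule continuous_map_from_subtopology[OF continuous_map_fst])
    have 2: "continuous_map (subtopology ?Q ?V) unit_interval (\<lambda>q. fst (snd q))"
      by (rule continuous_map_from_subtopology[OF cm_compose[OF continuous_map_snd continuous_map_fst]])
    have "continuous_map (subtopology ?Q ?V) (mtop M) (\<lambda>q. snd (snd q))"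
      using continuous_map_from_subtopology[OF cm_compose[OF continuous_map_snd continuous_map_snd], of unit_interval unit_interval "subtopology (mtop M) L" ?V]
      by (simp add: continuous_map_in_subtopology)
    then have "continuous_map (subtopology ?Q ?V) (subtopology (mtop M) (fst \<kappa>)) (\<lambda>q. snd (snd q))"
      by (rule continuous_map_into_subtopology) auto
    from cm_compose[OF this chart(4)[OF ka]]
    have 3: "continuous_map (subtopology ?Q ?V) euclidean (\<lambda>q. snd \<kappa> (snd (snd q)))" .
    have "continuous_map (subtopology ?Q ?V) (prod_topology euclidean (prod_topology euclidean euclidean)) ?c"
      by (intro cm_pair cm_of_interval[OF 1] cm_of_interval[OF 2] 3)
    then have "continuous_map (subtopology ?Q ?V) euclidean ?c" by simp
    then show ?thesis by (rule continuous_map_into_subtopology) auto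
  qed
  define N where "N = {q \<in> topspace (subtopology ?Q ?V). ?c q \<in> W}"
  show "\<exists>W h. openin (subtopology ?Q ?V) W \<and> q \<in> W \<and> continuous_map (subtopology (subtopology ?Q ?V) W) euclidean h \<and>
      (\<forall>q\<in>W. velocity (fst q) (fst (snd q)) \<kappa> l (snd (snd q)) w = h q)"
  proof (intro exI conjI ballI)
    show "openin (subtopology ?Q ?V) N"
      unfolding N_def by (rule openin_continuous_map_preimage[OF cc W(1)])
    show "q \<in> N" using q W(2) by (simp add: N_def)
    have "continuous_map (subtopology (subtopology ?Q ?V) N) euclidean ?c"
      using continuous_map_from_subtopology[OF cc, of N] by (simp add: continuous_map_in_subtopology)
    then show "continuous_map (subtopology (subtopology ?Q ?V) N) euclidean
        (\<lambda>q. frechet_derivative (G (fst (?c q))) (at (snd (?c q))) (0, w))"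
      by (rule cm_compose_on[OF _ cD]) (auto simp: N_def)
    show "velocity (fst q) (fst (snd q)) \<kappa> l (snd (snd q)) w = frechet_derivative (G (fst (?c q))) (at (snd (?c q))) (0, w)"
      if "q \<in> N" for q
    proof -
      have q: "q \<in> topspace (subtopology ?Q ?V)" and cW: "?c q \<in> W" using that by (auto simp: N_def)
      show ?thesis
        unfolding fst_conv snd_conv
        by (rule velocity_frechet[OF V(1,2)[OF q] \<kappa> V(3,4)[OF q] V(6)[OF q] w W(1) cW eq[OF V(1,2)[OF q]] D[OF cW]])
    qed
  qed
qed

end

section \<open>Complex coordinates in the plane bundle orthogonal to J\<close>

lemma cm_Complex:
  assumes "continuous_map X euclideanreal f" "continuous_map X euclideanreal h"
  shows "continuous_map X euclidean (\<lambda>x. Complex (f x) (h x))"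
  using assms by (simp add: continuous_map_atin tendsto_Complex)

context hermitian
begin

text \<open>Scalar multiplication on the complex line of antilinear skew endomorphisms, with
  composition by \<open>J\<close> as the imaginary unit; \<open>complex_coord E\<close> is its
  inverse for a frame \<open>E\<close>.\<close>

definition complex_mult :: "endo \<Rightarrow> complex \<Rightarrow> endo" where
  "complex_mult E c = (\<lambda>u. Re c *\<^sub>R E u + Im c *\<^sub>R J (E u))"

definition complex_coord :: "endo \<Rightarrow> endo \<Rightarrow> complex" where
  "complex_coord E A = Complex (endo_inner A E) (endo_inner A (\<lambda>u. J (E u)))"

lemma complex_mult_quat_comb: "complex_mult E c = quat_comb J E (vector [0, Re c, Im c])"
  by (simp add: complex_mult_def quat_comb_def)

context
  fixes E
  assumes E: "hermitian_frame g J E"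
begin

interpretation E: hermitian_frame g J E by (rule E)

lemma complex_coord_mult: "complex_coord E (complex_mult E c) = c"
  using E.quat_units endo_inner_quat_comb[OF E.quat_units, of "vector [0, Re c, Im c]" "axis 2 1"]
    endo_inner_quat_comb[OF E.quat_units, of "vector [0, Re c, Im c]" "axis 3 1"]
  by (simp add: complex_coord_def complex_mult_quat_comb quat_comb_axis inner_axis)

lemma complex_mult_coord: "antilinear_skew A \<Longrightarrow> complex_mult E (complex_coord E A) = A"
  using E.antilinear_skew_expansion by (auto simp: complex_mult_def complex_coord_def)

lemma complex_mult_frame:
  assumes c: "norm c = 1"
  shows "hermitian_frame g J (complex_mult E c)"
proof -
  have "antilinear_skew (complex_mult E c)"
    unfolding complex_mult_def by (intro antilinear_skew_add antilinear_skew_scaleR antilinear_skew_J E.E)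
  moreover have "complex_mult E c (complex_mult E c u) = - u" for u
  proof -
    have "(Re c)\<^sup>2 + (Im c)\<^sup>2 = 1" using c by (simp add: norm_complex_def)
    then have "vector [0, Re c, Im c] \<bullet> (vector [0, Re c, Im c] :: real^3) = 1"
      by (simp add: inner_vec_def sum_3 power2_eq_square)
    then show ?thesis
      unfolding complex_mult_quat_comb quat_comb_comp[OF E.quat_units] by (simp add: quat_comb_def)
  qed
  ultimately show ?thesis
    by (intro hermitian_frame.intro hermitian_frame_axioms.intro hermitian_axioms)
qed

lemma complex_mult_mult:
  "complex_mult (complex_mult E c) d = complex_mult E (c * d)"
  by (rule ext) (simp add: complex_mult_def J_simps algebra_simps)

context
  fixes F
  assumes F: "hermitian_frame g J F"
begin

interpretation F: hermitian_frame g J F by (rule F)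

lemma frame_change: "complex_mult F c = complex_mult E (complex_coord E F * c)"
  using complex_mult_mult complex_mult_coord[OF F.E] by metis

lemma norm_complex_coord: "norm (complex_coord E F) = 1"
proof -
  define z where "z = complex_coord E F"
  have F': "F = quat_comb J E (vector [0, Re z, Im z])"
    using complex_mult_coord[OF F.E] by (simp add: z_def complex_mult_quat_comb)
  have "endo_inner F F = 1"
    using endo_inner_quat_comb[OF F.quat_units, of "axis 2 1" "axis 2 1"] by (simp add: quat_comb_axis inner_axis_axis)
  then have "vector [0, Re z, Im z] \<bullet> (vector [0, Re z, Im z] :: real^3) = 1"
    using endo_inner_quat_comb[OF E.quat_units] F' by metis
  then have "(Re z)\<^sup>2 + (Im z)\<^sup>2 = 1" by (simp add: inner_vec_def sum_3 power2_eq_square)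
  then show ?thesis by (simp add: norm_complex_def flip: z_def)
qed

end

end

text \<open>The last two coordinates of \<open>plane_vec\<close> as one complex number: the part of
  an oriented plane that is seen by the bundle orthogonal to \<open>J\<close>.\<close>

definition plane_coord :: "endo \<Rightarrow> real^4 \<Rightarrow> real^4 \<Rightarrow> complex" where
  "plane_coord E u v = Complex (g (E u) v) (g (J (E u)) v)"

lemma plane_coord_mult: "plane_coord (complex_mult E c) u v = cnj c * plane_coord E u v"
  by (simp add: plane_coord_def complex_mult_def g_simps J_simps complex_eq_iff)

text \<open>Multiplying the frame by a scalar multiplies the coordinate by its conjugate, and for a
  unit scalar that is the inverse. So \<open>plane_coord\<close> transforms like the coordinate of
  an element of the complex line.\<close>

lemma plane_coord_change:
  assumes E: "hermitian_frame g J E" and F: "hermitian_frame g J F"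
  shows "plane_coord E u v = complex_coord E F * plane_coord F u v"
proof -
  have "antilinear_skew F" by (rule hermitian_frame.E[OF F])
  then have "plane_coord F u v = cnj (complex_coord E F) * plane_coord E u v"
    using complex_mult_coord[OF E] plane_coord_mult[of E "complex_coord E F" u v] by simp
  moreover have "complex_coord E F * cnj (complex_coord E F) = 1"
    using norm_complex_coord[OF E F] by (simp add: complex_norm_square[symmetric])
  ultimately show ?thesis by (metis mult.assoc mult_1)
qed

end

text \<open>Pairing \<open>F\<close> with the time gives a map from a compact space to a Hausdorff
  space, so it sends closed sets to closed sets. The preimage of a closed \<open>C\<close> under the
  reparametrization is the preimage of such an image under \<open>G\<close> paired with the
  time.\<close>

lemma cm_reparametrization:
  fixes F G :: "real \<Rightarrow> 'x \<Rightarrow> 'y"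
  assumes X: "compact_space X" and Y: "Hausdorff_space Y"
    and F: "continuous_map (prod_topology unit_interval X) Y (\<lambda>z. F (fst z) (snd z))"
    and G: "continuous_map (prod_topology unit_interval X) Y (\<lambda>z. G (fst z) (snd z))"
    and inj: "\<And>t. t \<in> {0..1} \<Longrightarrow> inj_on (F t) (topspace X)"
    and im: "\<And>t. t \<in> {0..1} \<Longrightarrow> G t ` topspace X \<subseteq> F t ` topspace X"
  shows "continuous_map (prod_topology unit_interval X) X (\<lambda>z. inv_into (topspace X) (F (fst z)) (G (fst z) (snd z)))"
  unfolding continuous_map_closedin
proof (intro conjI ballI allI impI)
  let ?P = "prod_topology unit_interval X" and ?a = "\<lambda>z. inv_into (topspace X) (F (fst z)) (G (fst z) (snd z))"
  have a: "?a z \<in> topspace X" "F (fst z) (?a z) = G (fst z) (snd z)" if "z \<in> topspace ?P" for z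
  proof -
    have "fst z \<in> {0..1}" "snd z \<in> topspace X" using that by auto
    then have "G (fst z) (snd z) \<in> F (fst z) ` topspace X" using im[of "fst z"] by blast
    then show "?a z \<in> topspace X" "F (fst z) (?a z) = G (fst z) (snd z)" by (auto intro: inv_into_into f_inv_into_f)
  qed
  show "?a \<in> topspace ?P \<rightarrow> topspace X" using a(1) by blast
  fix C assume C: "closedin X C"
  have cF: "continuous_map ?P (prod_topology unit_interval Y) (\<lambda>z. (fst z, F (fst z) (snd z)))"
    and cG: "continuous_map ?P (prod_topology unit_interval Y) (\<lambda>z. (fst z, G (fst z) (snd z)))"
    by (intro cm_pair continuous_map_fst F G)+
  have "Hausdorff_space unit_interval" by (simp add: Hausdorff_space_subtopology)
  then have H: "Hausdorff_space (prod_topology unit_interval Y)" using Y by (simp add: Hausdorff_space_prod_topology)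
  have "compactin X C" using X C by (rule closedin_compact_space)
  then have "compactin ?P ({0..1} \<times> C)"
    by (simp add: compactin_Times compactin_subtopology)
  then have "compactin (prod_topology unit_interval Y) ((\<lambda>z. (fst z, F (fst z) (snd z))) ` ({0..1} \<times> C))"
    by (rule image_compactin[OF _ cF])
  then have "closedin (prod_topology unit_interval Y) ((\<lambda>z. (fst z, F (fst z) (snd z))) ` ({0..1} \<times> C))"
    by (rule compactin_imp_closedin[OF H])
  then have "closedin ?P {z \<in> topspace ?P. (fst z, G (fst z) (snd z)) \<in> (\<lambda>z. (fst z, F (fst z) (snd z))) ` ({0..1} \<times> C)}"
    by (rule closedin_continuous_map_preimage[OF cG])
  moreover have "(fst z, G (fst z) (snd z)) \<in> (\<lambda>z. (fst z, F (fst z) (snd z))) ` ({0..1} \<times> C) \<longleftrightarrow> ?a z \<in> C"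
    if z: "z \<in> topspace ?P" for z
  proof
    assume "(fst z, G (fst z) (snd z)) \<in> (\<lambda>z. (fst z, F (fst z) (snd z))) ` ({0..1} \<times> C)"
    then obtain y where y: "y \<in> C" "G (fst z) (snd z) = F (fst z) y" by auto
    have "y \<in> topspace X" using y(1) C closedin_subset by blast
    then have "?a z = y" using inj[of "fst z"] z y(2) by (auto simp: inv_into_f_f)
    then show "?a z \<in> C" using y(1) by simp
  next
    assume "?a z \<in> C"
    then have "(fst z, ?a z) \<in> {0..1} \<times> C" using z by auto
    from imageI[OF this, of "\<lambda>z. (fst z, F (fst z) (snd z))"]
    show "(fst z, G (fst z) (snd z)) \<in> (\<lambda>z. (fst z, F (fst z) (snd z))) ` ({0..1} \<times> C)"
      using a(2)[OF z] by (simp only: fst_conv snd_conv)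
  qed
  then have "{z \<in> topspace ?P. (fst z, G (fst z) (snd z)) \<in> (\<lambda>z. (fst z, F (fst z) (snd z))) ` ({0..1} \<times> C)} = {z \<in> topspace ?P. ?a z \<in> C}"
    by blast
  ultimately show "closedin ?P {z \<in> topspace ?P. ?a z \<in> C}" by simp
qed

text \<open>The unit interval is locally compact and Hausdorff, so its product with the collapsing
  map is again a quotient map, and a homotopy that is constant on \<open>B\<close> at each time
  descends.\<close>

lemma homotopic_with_collapse:
  fixes H :: "real \<times> 'b \<Rightarrow> 'c"
  assumes H: "continuous_map (prod_topology unit_interval Y) S H"
    and const: "\<And>r y y'. \<lbrakk>r \<in> {0..1}; y \<in> B; y' \<in> B\<rbrakk> \<Longrightarrow> H (r, y) = H (r, y')"
  shows "homotopic_with (\<lambda>_. True) (collapse_topology Y B) S (\<lambda>C. H (0, SOME z. z \<in> C)) (\<lambda>C. H (1, SOME z. z \<in> C))"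
proof -
  let ?X = "collapse_topology Y B" and ?h = "\<lambda>z. H (fst z, SOME y. y \<in> snd z)"
  have "locally_compact_space unit_interval"
    by (simp add: compact_imp_locally_compact_space compact_space_subtopology)
  moreover have "Hausdorff_space unit_interval" by (simp add: Hausdorff_space_subtopology)
  ultimately have q: "quotient_map (prod_topology unit_interval Y) (prod_topology unit_interval ?X) (\<lambda>(r, y). (r, collapse B y))"
    using quotient_map_prod_right[OF _ _ quotient_map_collapse] by blast
  have "continuous_map (prod_topology unit_interval Y) S (?h \<circ> (\<lambda>(r, y). (r, collapse B y)))"
  proof (rule continuous_map_eq[OF H])
    fix z assume "z \<in> topspace (prod_topology unit_interval Y)"
    then obtain r y where z: "z = (r, y)" "r \<in> {0..1}" by auto
    have "H (r, y) = H (r, SOME y'. y' \<in> collapse B y)"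
    proof (cases "y \<in> B")
      case True
      then have "(SOME y'. y' \<in> collapse B y) \<in> B"
        using someI[of "\<lambda>y'. y' \<in> B", OF True] by (simp add: collapse_def)
      then show ?thesis using const[OF z(2) True] by blast
    qed (simp add: collapse_def)
    then show "H z = (?h \<circ> (\<lambda>(r, y). (r, collapse B y))) z" by (simp add: z)
  qed
  then have "continuous_map (prod_topology unit_interval ?X) S ?h"
    by (rule continuous_compose_quotient_map[OF q])
  then show ?thesis unfolding homotopic_with_def by (intro exI[of _ ?h]) simp
qed

context smooth_manifold
begin

lemma endo_field_local:
  assumes V: "V \<subseteq> topspace Q"
    and loc: "\<And>q. q \<in> V \<Longrightarrow> \<exists>W A'. openin Q W \<and> q \<in> W \<and> endo_field_along Q f (W \<inter> V) A' \<and>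
        (\<forall>q'\<in>W \<inter> V. \<forall>k\<in>charts_at M (f q'). A k q' = A' k q')"
  shows "endo_field_along Q f V A"
  unfolding endo_field_along_def
proof (intro conjI ballI allI)
  show "linear (A k q)" if q: "q \<in> V" and k: "k \<in> charts_at M (f q)" for q k
  proof -
    obtain W A' where W: "q \<in> W" "endo_field_along Q f (W \<inter> V) A'" "\<forall>q'\<in>W \<inter> V. \<forall>k\<in>charts_at M (f q'). A k q' = A' k q'"
      using loc[OF q] by blast
    then have "A k q = A' k q" using q k by blast
    then show ?thesis using endo_field_alongD(1)[OF W(2) _ k] q W(1) by simp
  qed
  show "tderiv id k l (f q) (A k q u) = A l q (tderiv id k l (f q) u)"
    if q: "q \<in> V" and k: "k \<in> charts_at M (f q)" and l: "l \<in> charts_at M (f q)" for q k l u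
  proof -
    obtain W A' where W: "q \<in> W" "endo_field_along Q f (W \<inter> V) A'" "\<forall>q'\<in>W \<inter> V. \<forall>k\<in>charts_at M (f q'). A k q' = A' k q'"
      using loc[OF q] by blast
    then have "A k q = A' k q" "A l q = A' l q" using q k l by blast+
    then show ?thesis using endo_field_alongD(2)[OF W(2) _ k l] q W(1) by simp
  qed
  show "continuous_map (subtopology Q {q \<in> V. f q \<in> fst k}) euclidean (\<lambda>q. A k q u)" if k: "k \<in> atlas M" for k u
  proof (rule cm_local)
    let ?V = "{q \<in> V. f q \<in> fst k}"
    fix q assume "q \<in> topspace (subtopology Q ?V)"
    then have q: "q \<in> V" "f q \<in> fst k" by auto
    obtain W A' where W: "openin Q W" "q \<in> W" "endo_field_along Q f (W \<inter> V) A'" "\<forall>q'\<in>W \<inter> V. \<forall>k\<in>charts_at M (f q'). A k q' = A' k q'"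
      using loc[OF q(1)] by blast
    show "\<exists>W h. openin (subtopology Q ?V) W \<and> q \<in> W \<and> continuous_map (subtopology (subtopology Q ?V) W) euclidean h \<and> (\<forall>q\<in>W. A k q u = h q)"
    proof (intro exI conjI ballI)
      show "openin (subtopology Q ?V) (W \<inter> ?V)" using W(1) unfolding openin_subtopology by blast
      show "q \<in> W \<inter> ?V" using q W(2) by blast
      have e: "?V \<inter> (W \<inter> ?V) = {q \<in> W \<inter> V. f q \<in> fst k}" by blast
      show "continuous_map (subtopology (subtopology Q ?V) (W \<inter> ?V)) euclidean (\<lambda>q. A' k q u)"
        unfolding subtopology_subtopology e by (rule endo_field_alongD(3)[OF W(3) k])
      show "A k q u = A' k q u" if "q \<in> W \<inter> ?V" for q
      proof -
        have "k \<in> charts_at M (f q)" "q \<in> W \<inter> V" using that k by (auto simp: charts_at_def)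
        then show ?thesis using W(4) by simp
      qed
    qed
  qed
qed

end

section \<open>Homotopies to a Lagrangian isotopy\<close>

locale lagrangian_homotopy = diffeo_path M \<omega> J \<phi> + surface_homotopy M L \<Psi>
  for M :: "'a smooth_space" and \<omega> J \<phi> L \<Psi> +
  fixes B :: "'a chart set"
  assumes compact_L: "compactin (mtop M) L"
    and B_slice: "\<kappa> \<in> B \<Longrightarrow> slice_chart M L \<kappa>"
    and B_cover: "L \<subseteq> (\<Union>\<kappa>\<in>B. fst \<kappa>)"
    and B_oriented: "\<lbrakk>\<kappa> \<in> B; \<kappa>' \<in> B; x \<in> fst \<kappa>; x \<in> fst \<kappa>'; x \<in> L\<rbrakk> \<Longrightarrow>
      tderiv id \<kappa> \<kappa>' x (axis 1 1) $ 1 * tderiv id \<kappa> \<kappa>' x (axis 2 1) $ 2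
      - tderiv id \<kappa> \<kappa>' x (axis 2 1) $ 1 * tderiv id \<kappa> \<kappa>' x (axis 1 1) $ 2 > 0"
    and start: "t \<in> {0..1} \<Longrightarrow> \<Psi> 0 t ` L = \<phi> t ` L"
    and lagrangian_ends: "\<lbrakk>s \<in> {0..1}; t \<in> {0, 1}\<rbrakk> \<Longrightarrow> lagrangian_surface M \<omega> (\<Psi> s t ` L)"
    and lagrangian_final: "t \<in> {0..1} \<Longrightarrow> lagrangian_surface M \<omega> (\<Psi> 1 t ` L)"
    and lagrangian_L: "lagrangian_surface M \<omega> L"
    and \<phi>_ends: "\<lbrakk>t \<in> {0, 1}; x \<in> L; k \<in> charts_at M x\<rbrakk> \<Longrightarrow> pullback M (\<phi> t) \<omega> k x = \<omega> k x"
begin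

abbreviation TL :: "'a topology" where "TL \<equiv> subtopology (mtop M) L"
abbreviation TP :: "(real \<times> 'a) topology" where "TP \<equiv> prod_topology unit_interval TL"
abbreviation TQ :: "(real \<times> real \<times> 'a) topology" where "TQ \<equiv> prod_topology unit_interval TP"

definition psi :: "real \<times> real \<times> 'a \<Rightarrow> 'a" where
  "psi q = \<Psi> (fst q) (fst (snd q)) (snd (snd q))"

definition tangent :: "'a chart \<Rightarrow> 4 \<Rightarrow> 'a chart \<Rightarrow> real \<times> real \<times> 'a \<Rightarrow> real^4" where
  "tangent \<kappa> i l q = velocity (fst q) (fst (snd q)) \<kappa> l (snd (snd q)) (axis i 1)"

definition slice :: "'a \<Rightarrow> 'a chart" where
  "slice x = (SOME \<kappa>. \<kappa> \<in> B \<and> x \<in> fst \<kappa>)"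

abbreviation plane :: "'a chart \<Rightarrow> endo \<Rightarrow> 'a chart \<Rightarrow> real \<times> real \<times> 'a \<Rightarrow> real^3" where
  "plane \<kappa> E l q \<equiv> hermitian_frame.plane_vec (g l (psi q)) (J l (psi q)) E (tangent \<kappa> 1 l q) (tangent \<kappa> 2 l q)"

lemma topspace_TL [simp]: "topspace TL = L"
  using LM by (simp add: inf_absorb2)

lemma topspace_TQ: "q \<in> topspace TQ \<longleftrightarrow> fst q \<in> {0..1} \<and> fst (snd q) \<in> {0..1} \<and> snd (snd q) \<in> L"
  using LM by (cases q) auto

declare topspace_prod_topology [simp del]

lemma compact_TL: "compact_space TL" "Hausdorff_space TL"
  using compact_L Hausdorff by (auto simp: compact_space_subtopology Hausdorff_space_subtopology)

lemma compact_TP: "compact_space TP" "Hausdorff_space TP"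
proof -
  have "compact_space unit_interval" "Hausdorff_space unit_interval"
    by (simp_all add: compact_space_subtopology Hausdorff_space_subtopology)
  then show "compact_space TP" "Hausdorff_space TP"
    using compact_TL by (simp_all add: compact_space_prod_topology Hausdorff_space_prod_topology)
qed

lemma psi_continuous: "continuous_map TQ (mtop M) psi"
proof -
  have "continuous_map TQ (mtop M) (\<lambda>(s, t, p). \<Psi> s t p)"
    using hom unfolding homotopy_of_isotopies_def by blast
  moreover have "(\<lambda>(s, t, p). \<Psi> s t p) = psi" by (auto simp: psi_def)
  ultimately show ?thesis by simp
qed

lemma psi_pts: "q \<in> topspace TQ \<Longrightarrow> psi q \<in> pts M"
  using \<Psi>_pts by (simp add: topspace_TQ psi_def)

lemma slice:
  assumes "x \<in> L"
  shows "slice x \<in> B" "x \<in> fst (slice x)"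
proof -
  have "\<exists>\<kappa>. \<kappa> \<in> B \<and> x \<in> fst \<kappa>" using B_cover assms by blast
  from someI_ex[OF this] show "slice x \<in> B" "x \<in> fst (slice x)" by (auto simp: slice_def)
qed

lemma axis_34 [simp]:
  "(axis 1 1 :: real^4) $ 3 = 0" "(axis 1 1 :: real^4) $ 4 = 0" "(axis 2 1 :: real^4) $ 3 = 0" "(axis 2 1 :: real^4) $ 4 = 0"
  by (simp_all add: axis_def)

lemma tangent_field:
  assumes \<kappa>: "\<kappa> \<in> B" and i: "i = 1 \<or> i = 2"
  shows "vector_field TQ psi {q \<in> topspace TQ. snd (snd q) \<in> fst \<kappa>} (tangent \<kappa> i)"
  unfolding vector_field_def
proof (intro conjI ballI)
  have w: "(axis i 1 :: real^4) $ 3 = 0" "(axis i 1 :: real^4) $ 4 = 0" using i by auto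
  show "tderiv id k l (psi q) (tangent \<kappa> i k q) = tangent \<kappa> i l q"
    if "q \<in> {q \<in> topspace TQ. snd (snd q) \<in> fst \<kappa>}" "k \<in> charts_at M (psi q)" "l \<in> charts_at M (psi q)" for q k l
  proof -
    have "fst q \<in> {0..1}" "fst (snd q) \<in> {0..1}" "snd (snd q) \<in> L" "snd (snd q) \<in> fst \<kappa>"
      using that(1) by (auto simp: topspace_TQ)
    from velocity_transition[OF this(1,2) B_slice[OF \<kappa>] this(3,4) that(2,3)[unfolded psi_def] w]
    show ?thesis by (simp only: tangent_def psi_def)
  qed
  show "continuous_map (subtopology TQ {q \<in> {q \<in> topspace TQ. snd (snd q) \<in> fst \<kappa>}. psi q \<in> fst l}) euclidean (tangent \<kappa> i l)"
    if l: "l \<in> atlas M" for l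
    using velocity_continuous[OF B_slice[OF \<kappa>] l w] unfolding tangent_def
    by (rule continuous_map_from_subtopology_mono) (auto simp: psi_def)
qed

text \<open>The differential of \<open>\<Psi> s t\<close> is linear, so the two pairs of tangent
  vectors differ by the Jacobian matrix of the transition between the slice charts, whose
  determinant is positive in an oriented atlas.\<close>

lemma tangent_change:
  assumes q: "q \<in> topspace TQ" and \<kappa>: "\<kappa> \<in> B" "\<kappa>' \<in> B" "snd (snd q) \<in> fst \<kappa>" "snd (snd q) \<in> fst \<kappa>'"
    and l: "l \<in> charts_at M (psi q)"
  obtains a b c d where "tangent \<kappa>' 1 l q = a *\<^sub>R tangent \<kappa> 1 l q + b *\<^sub>R tangent \<kappa> 2 l q"
    "tangent \<kappa>' 2 l q = c *\<^sub>R tangent \<kappa> 1 l q + d *\<^sub>R tangent \<kappa> 2 l q" "a * d - b * c > 0"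
proof -
  define s t x where "s = fst q" "t = fst (snd q)" "x = snd (snd q)"
  note stx = s_t_x_def
  have s: "s \<in> {0..1}" and t: "t \<in> {0..1}" and x: "x \<in> L" using q by (auto simp: topspace_TQ stx)
  have \<kappa>x: "x \<in> fst \<kappa>" "x \<in> fst \<kappa>'" using \<kappa> by (auto simp: stx)
  have l': "l \<in> charts_at M (\<Psi> s t x)" using l by (simp add: psi_def stx)
  let ?D = "tderiv id \<kappa>' \<kappa> x"
  have v: "tangent \<kappa>' i l q = ?D (axis i 1) $ 1 *\<^sub>R tangent \<kappa> 1 l q + ?D (axis i 1) $ 2 *\<^sub>R tangent \<kappa> 2 l q"
    if i: "(axis i 1 :: real^4) $ 3 = 0" "(axis i 1 :: real^4) $ 4 = 0" for i
  proof -
    note vs = velocity_slice[OF s t B_slice[OF \<kappa>(1)] x \<kappa>x(1) l' B_slice[OF \<kappa>(2)] \<kappa>x(2) i]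
    have "?D (axis i 1) = ?D (axis i 1) $ 1 *\<^sub>R axis 1 1 + ?D (axis i 1) $ 2 *\<^sub>R axis 2 1"
      using vs(3,4) by (simp add: vec_eq_iff forall_4 axis_def)
    then have "velocity s t \<kappa> l x (?D (axis i 1)) = velocity s t \<kappa> l x (?D (axis i 1) $ 1 *\<^sub>R axis 1 1 + ?D (axis i 1) $ 2 *\<^sub>R axis 2 1)"
      by simp
    also have "\<dots> = ?D (axis i 1) $ 1 *\<^sub>R velocity s t \<kappa> l x (axis 1 1) + ?D (axis i 1) $ 2 *\<^sub>R velocity s t \<kappa> l x (axis 2 1)"
      by (rule velocity_linear[OF s t B_slice[OF \<kappa>(1)] x \<kappa>x(1) l']) simp_all
    finally show ?thesis using vs(2) by (simp add: tangent_def flip: stx)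
  qed
  show ?thesis
  proof (rule that)
    show "tangent \<kappa>' 1 l q = ?D (axis 1 1) $ 1 *\<^sub>R tangent \<kappa> 1 l q + ?D (axis 1 1) $ 2 *\<^sub>R tangent \<kappa> 2 l q"
      "tangent \<kappa>' 2 l q = ?D (axis 2 1) $ 1 *\<^sub>R tangent \<kappa> 1 l q + ?D (axis 2 1) $ 2 *\<^sub>R tangent \<kappa> 2 l q"
      by (rule v; simp)+
    show "?D (axis 1 1) $ 1 * ?D (axis 2 1) $ 2 - ?D (axis 1 1) $ 2 * ?D (axis 2 1) $ 1 > 0"
      using B_oriented[OF \<kappa>(2,1) \<kappa>x(2,1) x] by (simp add: mult.commute)
  qed
qed

context
  fixes q \<kappa> l
  assumes q: "q \<in> topspace TQ" and \<kappa>: "\<kappa> \<in> B" "snd (snd q) \<in> fst \<kappa>" and l: "l \<in> charts_at M (psi q)"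
begin

lemma tangent_nonzero: "tangent \<kappa> 1 l q \<noteq> 0" "tangent \<kappa> 2 l q \<noteq> c *\<^sub>R tangent \<kappa> 1 l q"
proof -
  have x: "fst q \<in> {0..1}" "fst (snd q) \<in> {0..1}" "snd (snd q) \<in> L" using q by (auto simp: topspace_TQ)
  note nz = velocity_nonzero[OF x(1,2) B_slice[OF \<kappa>(1)] x(3) \<kappa>(2) l[unfolded psi_def]]
  show "tangent \<kappa> 1 l q \<noteq> 0"
    unfolding tangent_def using nz[of "axis 1 1"] by auto
  show "tangent \<kappa> 2 l q \<noteq> c *\<^sub>R tangent \<kappa> 1 l q"
  proof
    let ?w = "1 *\<^sub>R axis 2 1 + (- c) *\<^sub>R axis 1 1 :: real^4"
    assume "tangent \<kappa> 2 l q = c *\<^sub>R tangent \<kappa> 1 l q"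
    then have "velocity (fst q) (fst (snd q)) \<kappa> l (snd (snd q)) ?w = 0"
      unfolding velocity_linear[OF x(1,2) B_slice[OF \<kappa>(1)] x(3) \<kappa>(2) l[unfolded psi_def] axis_34(3,4,1,2)]
      by (simp add: tangent_def)
    then have "?w = 0" by (rule nz[rotated 2]) simp_all
    then have "?w $ 2 = 0" by simp
    then show False by (simp add: axis_def)
  qed
qed

context
  fixes E
  assumes E: "hermitian_frame (g l (psi q)) (J l (psi q)) E"
begin

interpretation E: hermitian_frame "g l (psi q)" "J l (psi q)" E by (rule E)

lemma plane_nonzero: "plane \<kappa> E l q \<noteq> 0"
  by (rule E.plane_vec_nonzero[OF tangent_nonzero])

text \<open>\<open>plane_vec\<close> is multiplied by the Jacobian determinant of the change of
  slice chart. Here the orientation of \<open>L\<close> makes the normalized vector well defined,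
  not just up to sign.\<close>

lemma plane_change:
  assumes \<kappa>': "\<kappa>' \<in> B" "snd (snd q) \<in> fst \<kappa>'"
  obtains r where "r > 0" "plane \<kappa>' E l q = r *\<^sub>R plane \<kappa> E l q"
proof -
  obtain a b c d where ab: "tangent \<kappa>' 1 l q = a *\<^sub>R tangent \<kappa> 1 l q + b *\<^sub>R tangent \<kappa> 2 l q"
    "tangent \<kappa>' 2 l q = c *\<^sub>R tangent \<kappa> 1 l q + d *\<^sub>R tangent \<kappa> 2 l q" and pos: "a * d - b * c > 0"
    using tangent_change[OF q \<kappa>(1) \<kappa>'(1) \<kappa>(2) \<kappa>'(2) l] .
  show ?thesis
    by (rule that[OF pos]) (simp only: ab E.plane_vec_linear_comb)
qed

text \<open>The first coordinate of \<open>plane_vec\<close> is the value of \<omega> on the two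
  tangent vectors, because \<open>g (J u) v\<close> is \<omega>.\<close>

lemma plane_lagrangian:
  assumes "lagrangian_surface M \<omega> (\<Psi> (fst q) (fst (snd q)) ` L)"
  shows "plane \<kappa> E l q $ 1 = 0"
proof -
  have x: "fst q \<in> {0..1}" "fst (snd q) \<in> {0..1}" "snd (snd q) \<in> L" using q by (auto simp: topspace_TQ)
  have "\<omega> l (psi q) (tangent \<kappa> 1 l q) (tangent \<kappa> 2 l q) = 0"
    unfolding tangent_def psi_def
    by (rule velocity_lagrangian[OF x(1,2) B_slice[OF \<kappa>(1)] x(3) \<kappa>(2) l[unfolded psi_def] assms \<omega>_two_form])
      (use psi_pts[OF q] in \<open>simp_all add: psi_def\<close>)
  then show ?thesis by (simp add: E.plane_vec_def at_chart(8)[OF l])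
qed

end

end

lemma plane_scalar_field:
  assumes \<kappa>: "\<kappa> \<in> B" and V: "V \<subseteq> topspace TQ" and A: "endo_field_along TQ psi V A"
  shows "scalar_field TQ psi {q \<in> V. snd (snd q) \<in> fst \<kappa>} (\<lambda>l q. g l (psi q) (A l q (tangent \<kappa> 1 l q)) (tangent \<kappa> 2 l q))"
proof -
  let ?V = "{q \<in> V. snd (snd q) \<in> fst \<kappa>}"
  have VV: "?V \<subseteq> V" "?V \<subseteq> topspace TQ" and V': "?V \<subseteq> {q \<in> topspace TQ. snd (snd q) \<in> fst \<kappa>}" using V by auto
  have t: "vector_field TQ psi ?V (tangent \<kappa> i)" if "i = 1 \<or> i = 2" for i
    by (rule field_subset(3)[OF V' _ tangent_field[OF \<kappa> that]]) blast
  have A': "endo_field_along TQ psi ?V A" by (rule field_subset(1)[OF VV(1) V A])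
  have gV: "form_field TQ psi ?V (\<lambda>l q. g l (psi q))"
    by (rule field_pullback(2)[OF continuous_map_from_subtopology[OF psi_continuous] _ VV(2) g_field]) (use VV(2) psi_pts in blast)
  show ?thesis
    by (rule form_field_scalar[OF gV vector_field_apply[OF A' t] t]) simp_all
qed

text \<open>The chosen slice chart jumps, but \<open>F\<close> takes the same value for all charts
  of \<open>B\<close> around a point, so near each point one chart can be kept.\<close>

lemma cm_slice:
  assumes c: "\<And>\<kappa>. \<kappa> \<in> B \<Longrightarrow> continuous_map (subtopology TQ {q \<in> V. snd (snd q) \<in> fst \<kappa>}) T (F \<kappa>)"
    and e: "\<And>q \<kappa> \<kappa>'. \<lbrakk>q \<in> V; \<kappa> \<in> B; \<kappa>' \<in> B; snd (snd q) \<in> fst \<kappa>; snd (snd q) \<in> fst \<kappa>'\<rbrakk> \<Longrightarrow> F \<kappa> q = F \<kappa>' q"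
    and V: "V \<subseteq> topspace TQ"
  shows "continuous_map (subtopology TQ V) T (\<lambda>q. F (slice (snd (snd q))) q)"
proof (rule cm_local)
  fix q assume "q \<in> topspace (subtopology TQ V)"
  then have q: "q \<in> V" "snd (snd q) \<in> L" using V by (auto simp: topspace_TQ)
  define \<kappa> where "\<kappa> = slice (snd (snd q))"
  have \<kappa>: "\<kappa> \<in> B" "snd (snd q) \<in> fst \<kappa>" using slice[OF q(2)] by (auto simp: \<kappa>_def)
  have ka: "\<kappa> \<in> atlas M" using B_slice[OF \<kappa>(1)] by (simp add: slice_chart_def)
  let ?W = "{q \<in> V. snd (snd q) \<in> fst \<kappa>}"
  show "\<exists>W h. openin (subtopology TQ V) W \<and> q \<in> W \<and> continuous_map (subtopology (subtopology TQ V) W) T h \<and>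
      (\<forall>q\<in>W. F (slice (snd (snd q))) q = h q)"
  proof (intro exI conjI ballI)
    have "continuous_map TQ TL (\<lambda>q. snd (snd q))" by (rule cm_compose[OF continuous_map_snd continuous_map_snd])
    then have "continuous_map TQ (mtop M) (\<lambda>q. snd (snd q))" by (simp add: continuous_map_in_subtopology)
    then have "openin TQ {q \<in> topspace TQ. snd (snd q) \<in> fst \<kappa>}"
      by (rule openin_continuous_map_preimage[OF _ chart(1)[OF ka]])
    moreover have "?W = {q \<in> topspace TQ. snd (snd q) \<in> fst \<kappa>} \<inter> V" using V by blast
    ultimately show "openin (subtopology TQ V) ?W" unfolding openin_subtopology by blast
    show "q \<in> ?W" using q(1) \<kappa>(2) by blast
    have i: "V \<inter> ?W = ?W" by blast
    show "continuous_map (subtopology (subtopology TQ V) ?W) T (F \<kappa>)"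
      unfolding subtopology_subtopology i by (rule c[OF \<kappa>(1)])
    show "F (slice (snd (snd q))) q = F \<kappa> q" if "q \<in> ?W" for q
    proof -
      have "snd (snd q) \<in> L" using that V by (auto simp: topspace_TQ)
      then show ?thesis using e[of q "slice (snd (snd q))" \<kappa>] slice \<kappa>(1) that by blast
    qed
  qed
qed

text \<open>Two local frames differ by a unit complex function. On the side \<open>s = 1\<close> the tangent planes of
  the Lagrangian surfaces single out a section, which extends over the square by transport in \<open>s\<close>.\<close>

lemma frame_along:
  obtains E where "endo_field_along TQ psi (topspace TQ) E"
    "\<And>q l. \<lbrakk>q \<in> topspace TQ; l \<in> charts_at M (psi q)\<rbrakk> \<Longrightarrow> hermitian_frame (g l (psi q)) (J l (psi q)) (E l q)"
    "\<And>q l \<kappa>. \<lbrakk>q \<in> topspace TQ; fst q = 1; l \<in> charts_at M (psi q); \<kappa> \<in> B; snd (snd q) \<in> fst \<kappa>\<rbrakk> \<Longrightarrow>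
       sgn (plane \<kappa> (E l q) l q) = axis 2 1"
proof -
  have "\<forall>p\<in>pts M. \<exists>UE. openin (mtop M) (fst UE) \<and> p \<in> fst UE \<and> endo_field_along (mtop M) (\<lambda>p. p) (fst UE) (snd UE) \<and>
      (\<forall>p k. p \<in> fst UE \<longrightarrow> k \<in> charts_at M p \<longrightarrow> hermitian_frame (g k p) (J k p) (snd UE k p))"
  proof
    fix p assume p: "p \<in> pts M"
    obtain U F where "openin (mtop M) U" "p \<in> U" "endo_field_along (mtop M) (\<lambda>p. p) U F"
      "\<And>p k. \<lbrakk>p \<in> U; k \<in> charts_at M p\<rbrakk> \<Longrightarrow> hermitian_frame (g k p) (J k p) (F k p)"
      by (rule local_frame[OF p]) (rule that)
    then show "\<exists>UE. openin (mtop M) (fst UE) \<and> p \<in> fst UE \<and> endo_field_along (mtop M) (\<lambda>p. p) (fst UE) (snd UE) \<and>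
      (\<forall>p k. p \<in> fst UE \<longrightarrow> k \<in> charts_at M p \<longrightarrow> hermitian_frame (g k p) (J k p) (snd UE k p))"
      by (intro exI[of _ "(U, F)"]) simp
  qed
  then obtain UF where UF: "\<forall>p\<in>pts M. openin (mtop M) (fst (UF p)) \<and> p \<in> fst (UF p) \<and> endo_field_along (mtop M) (\<lambda>p. p) (fst (UF p)) (snd (UF p)) \<and>
      (\<forall>p' k. p' \<in> fst (UF p) \<longrightarrow> k \<in> charts_at M p' \<longrightarrow> hermitian_frame (g k p') (J k p') (snd (UF p) k p'))"
    by (rule bchoice[THEN exE])
  \<comment> \<open>The cover is indexed by the whole type of points; indices outside
    \<open>M\<close> get the empty set, so that all conditions hold without a restriction on
    \<open>i\<close>.\<close>
  define U where "U i = {q \<in> topspace TQ. i \<in> pts M \<and> psi q \<in> fst (UF i)}" for i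
  define F where "F i l q = snd (UF i) l (psi q)" for i l q
  have UQ: "U i \<subseteq> topspace TQ" for i by (auto simp: U_def)
  have oU: "openin TQ (U i)" for i
  proof (cases "i \<in> pts M")
    case True
    then have "openin TQ {q \<in> topspace TQ. psi q \<in> fst (UF i)}"
      using UF by (intro openin_continuous_map_preimage[OF psi_continuous]) blast
    then show ?thesis using True by (simp add: U_def)
  qed (simp add: U_def)
  have cover: "\<exists>i. q \<in> U i" if "q \<in> topspace TQ" for q
    using that UF psi_pts[OF that] by (intro exI[of _ "psi q"]) (simp add: U_def)
  have fr: "hermitian_frame (g l (psi q)) (J l (psi q)) (F i l q)" if "q \<in> U i" "l \<in> charts_at M (psi q)" for i l q
    using UF that unfolding U_def F_def by blast
  have FU: "endo_field_along TQ psi (U i) (F i)" for i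
  proof (cases "i \<in> pts M")
    case True
    then have "endo_field_along (mtop M) (\<lambda>p. p) (fst (UF i)) (snd (UF i))" using UF by blast
    then show ?thesis
      unfolding F_def
      by (rule field_pullback(1)[OF continuous_map_from_subtopology[OF psi_continuous] _ UQ, rotated]) (simp add: U_def)
  next
    case False
    then have e: "U i = {}" by (simp add: U_def)
    have e': "{q \<in> {}. psi q \<in> fst k} = {}" for k by blast
    show ?thesis unfolding e endo_field_along_def e' by simp
  qed
  have "endo_field_along TQ psi (topspace TQ) (\<lambda>l q. J l (psi q))"
    by (rule field_pullback(1)[OF continuous_map_from_subtopology[OF psi_continuous] _ order_refl J_field]) (use psi_pts in blast)
  then have JU: "endo_field_along TQ psi (U i) (\<lambda>l q. J l (psi q))" for i
    by (rule field_subset(1)[OF UQ order_refl])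
  have JFU: "endo_field_along TQ psi (U i) (\<lambda>l q u. J l (psi q) (F i l q u))" for i
    by (rule endo_field_comp[OF JU FU])
  have herm: "hermitian (g l (psi q)) (J l (psi q))" if "l \<in> charts_at M (psi q)" for l q
    by (rule hermitian[OF that])
  have ch: "chart_of (psi q) \<in> charts_at M (psi q)" if "q \<in> topspace TQ" for q
    by (rule chart_of[OF psi_pts[OF that]])
  \<comment> \<open>The cocycle of the plane bundle orthogonal to \<open>J\<close>: the complex
    coordinate of the frame \<open>F j\<close> with respect to \<open>F i\<close>.\<close>
  define z where "z i j q = (let l = chart_of (psi q) in
     Complex (endo_inner (F j l q) (F i l q)) (endo_inner (F j l q) (\<lambda>u. J l (psi q) (F i l q u))))" for i j q
  have UU: "U i \<inter> U j \<subseteq> U i" "U i \<inter> U j \<subseteq> U j" "U i \<inter> U j \<subseteq> topspace TQ" for i j using UQ by blast+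
  have sz: "scalar_field TQ psi (U i \<inter> U j) (\<lambda>l q. endo_inner (F j l q) (F i l q))"
    "scalar_field TQ psi (U i \<inter> U j) (\<lambda>l q. endo_inner (F j l q) (\<lambda>u. J l (psi q) (F i l q u)))" for i j
    by (rule endo_field_inner; rule field_subset(1)[OF UU(1) UQ] field_subset(1)[OF UU(2) UQ]; rule FU JFU)+
  have zl: "z i j q = hermitian.complex_coord (J l (psi q)) (F i l q) (F j l q)"
    if q: "q \<in> U i \<inter> U j" and l: "l \<in> charts_at M (psi q)" for i j q l
  proof -
    have c: "chart_of (psi q) \<in> charts_at M (psi q)" using ch UU(3) q by blast
    have "endo_inner (F j (chart_of (psi q)) q) (F i (chart_of (psi q)) q) = endo_inner (F j l q) (F i l q)"
      using sz(1) q l c unfolding scalar_field_def by blast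
    moreover have "endo_inner (F j (chart_of (psi q)) q) (\<lambda>u. J (chart_of (psi q)) (psi q) (F i (chart_of (psi q)) q u)) =
        endo_inner (F j l q) (\<lambda>u. J l (psi q) (F i l q u))"
      using sz(2)[of i j] q l c unfolding scalar_field_def by blast
    ultimately show ?thesis by (simp add: z_def Let_def hermitian.complex_coord_def[OF herm[OF l]])
  qed
  have cz: "continuous_map (subtopology TQ (U i \<inter> U j)) euclidean (z i j)" for i j
    unfolding z_def Let_def
    by (intro cm_Complex scalar_field_continuous[OF psi_continuous UU(3) sz(1)] scalar_field_continuous[OF psi_continuous UU(3) sz(2)])
  have nz: "norm (z i j q) = 1" if q: "q \<in> U i \<inter> U j" for i j q
  proof -
    have l: "chart_of (psi q) \<in> charts_at M (psi q)" using ch UU(3) q by blast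
    show ?thesis
      unfolding zl[OF q l] using q by (intro hermitian.norm_complex_coord[OF herm[OF l] fr[OF _ l] fr[OF _ l]]) auto
  qed
  have zz: "z i j q * z j k q = z i k q" if q: "q \<in> U i \<inter> U j \<inter> U k" for i j k q
  proof -
    have l: "chart_of (psi q) \<in> charts_at M (psi q)" using ch UQ q by blast
    interpret H: hermitian "g (chart_of (psi q)) (psi q)" "J (chart_of (psi q)) (psi q)" by (rule herm[OF l])
    let ?F = "\<lambda>i. F i (chart_of (psi q)) q"
    have fi: "hermitian_frame (g (chart_of (psi q)) (psi q)) (J (chart_of (psi q)) (psi q)) (?F i)"
      and fj: "hermitian_frame (g (chart_of (psi q)) (psi q)) (J (chart_of (psi q)) (psi q)) (?F j)"
      and fk: "hermitian_frame (g (chart_of (psi q)) (psi q)) (J (chart_of (psi q)) (psi q)) (?F k)"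
      using fr l q by blast+
    have "?F k = H.complex_mult (?F j) (H.complex_coord (?F j) (?F k))"
      using H.complex_mult_coord[OF fj hermitian_frame.E[OF fk]] by simp
    also have "\<dots> = H.complex_mult (?F i) (H.complex_coord (?F i) (?F j) * H.complex_coord (?F j) (?F k))"
      by (rule H.frame_change[OF fi fj])
    finally have "H.complex_coord (?F i) (?F k) = H.complex_coord (?F i) (?F j) * H.complex_coord (?F j) (?F k)"
      using H.complex_coord_mult[OF fi] by metis
    then show ?thesis
      using zl[of q i j, OF _ l] zl[of q j k, OF _ l] zl[of q i k, OF _ l] q by auto
  qed
  define pc where "pc \<kappa> i l q = hermitian.plane_coord (g l (psi q)) (J l (psi q)) (F i l q) (tangent \<kappa> 1 l q) (tangent \<kappa> 2 l q)" for \<kappa> i l q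
  have pc_plane: "pc \<kappa> i l q = Complex (plane \<kappa> (F i l q) l q $ 2) (plane \<kappa> (F i l q) l q $ 3)"
    if "q \<in> U i" "l \<in> charts_at M (psi q)" for \<kappa> i l q
    unfolding pc_def hermitian.plane_coord_def[OF herm[OF that(2)]] hermitian_frame.plane_vec_def[OF fr[OF that]] by simp
  \<comment> \<open>On the Lagrangian side the \<open>J\<close> coordinate of the plane vanishes; as
    the whole vector does not, the remaining complex coordinate is nonzero and has a
    direction.\<close>
  have pc_nz: "pc \<kappa> i l q \<noteq> 0"
    if q: "q \<in> U i" "fst q = 1" and l: "l \<in> charts_at M (psi q)" and \<kappa>: "\<kappa> \<in> B" "snd (snd q) \<in> fst \<kappa>" for \<kappa> i l q
  proof -
    have qQ: "q \<in> topspace TQ" using q(1) UQ by blast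
    have "plane \<kappa> (F i l q) l q $ 1 = 0"
      using plane_lagrangian[OF qQ \<kappa> l fr[OF q(1) l]] lagrangian_final q(2) qQ by (simp add: topspace_TQ)
    moreover have "plane \<kappa> (F i l q) l q \<noteq> 0" by (rule plane_nonzero[OF qQ \<kappa> l fr[OF q(1) l]])
    ultimately show ?thesis
      unfolding pc_plane[OF q(1) l] by (auto simp: vec_eq_iff forall_3 complex_eq_iff)
  qed
  have pc_sgn: "sgn (pc \<kappa> i l q) = sgn (pc \<kappa>' i l q)"
    if q: "q \<in> U i" and l: "l \<in> charts_at M (psi q)" and \<kappa>: "\<kappa> \<in> B" "\<kappa>' \<in> B" "snd (snd q) \<in> fst \<kappa>" "snd (snd q) \<in> fst \<kappa>'" for \<kappa> \<kappa>' i l q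
  proof -
    have qQ: "q \<in> topspace TQ" using q UQ by blast
    obtain r where r: "r > 0" "plane \<kappa>' (F i l q) l q = r *\<^sub>R plane \<kappa> (F i l q) l q"
      using plane_change[OF qQ \<kappa>(1,3) l fr[OF q l] \<kappa>(2,4)] .
    have "pc \<kappa>' i l q = r *\<^sub>R pc \<kappa> i l q"
      unfolding pc_plane[OF q l] r(2) by (simp add: complex_eq_iff)
    then show ?thesis using r(1) by (simp add: sgn_scaleR)
  qed
  have sp: "scalar_field TQ psi {q \<in> U i. snd (snd q) \<in> fst \<kappa>} (\<lambda>l q. Re (pc \<kappa> i l q))"
    "scalar_field TQ psi {q \<in> U i. snd (snd q) \<in> fst \<kappa>} (\<lambda>l q. Im (pc \<kappa> i l q))" if \<kappa>: "\<kappa> \<in> B" for \<kappa> i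
  proof -
    have e: "Re (pc \<kappa> i l q) = g l (psi q) (F i l q (tangent \<kappa> 1 l q)) (tangent \<kappa> 2 l q)"
      "Im (pc \<kappa> i l q) = g l (psi q) (J l (psi q) (F i l q (tangent \<kappa> 1 l q))) (tangent \<kappa> 2 l q)"
      if "l \<in> charts_at M (psi q)" for l q
      unfolding pc_def hermitian.plane_coord_def[OF herm[OF that]] by simp_all
    have cong: "scalar_field TQ psi V s" if s: "scalar_field TQ psi V s'" "\<And>l q. l \<in> charts_at M (psi q) \<Longrightarrow> s l q = s' l q" for V s s'
      unfolding scalar_field_def
    proof (intro conjI ballI)
      show "s k q = s l q" if "q \<in> V" "k \<in> charts_at M (psi q)" "l \<in> charts_at M (psi q)" for q k l
        unfolding s(2)[OF that(2)] s(2)[OF that(3)] using s(1) that unfolding scalar_field_def by blast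
      show "continuous_map (subtopology TQ {q \<in> V. psi q \<in> fst k}) euclideanreal (s k)" if k: "k \<in> atlas M" for k
      proof (rule continuous_map_eq)
        show "continuous_map (subtopology TQ {q \<in> V. psi q \<in> fst k}) euclideanreal (s' k)"
          using s(1) k unfolding scalar_field_def by blast
      qed (use s(2) k in \<open>simp add: charts_at_def\<close>)
    qed
    show "scalar_field TQ psi {q \<in> U i. snd (snd q) \<in> fst \<kappa>} (\<lambda>l q. Re (pc \<kappa> i l q))"
      by (rule cong[OF plane_scalar_field[OF \<kappa> UQ FU]]) (rule e(1))
    show "scalar_field TQ psi {q \<in> U i. snd (snd q) \<in> fst \<kappa>} (\<lambda>l q. Im (pc \<kappa> i l q))"
      by (rule cong[OF plane_scalar_field[OF \<kappa> UQ JFU]]) (rule e(2))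
  qed
  have pc_chart: "pc \<kappa> i k q = pc \<kappa> i l q"
    if "q \<in> U i" "snd (snd q) \<in> fst \<kappa>" "\<kappa> \<in> B" "k \<in> charts_at M (psi q)" "l \<in> charts_at M (psi q)" for \<kappa> i k l q
    using sp[OF that(3), of i] that unfolding scalar_field_def complex_eq_iff by blast
  \<comment> \<open>The direction of the tangent plane in the frame \<open>F i\<close>. It is used
    as a unit section only over \<open>s = 1\<close>, where \<open>pc_nz\<close> applies.\<close>
  define zeta where "zeta i q = sgn (pc (slice (snd (snd q))) i (chart_of (psi q)) q)" for i q
  let ?U1 = "\<lambda>i. {q \<in> U i. fst q = 1}"
  have czeta: "continuous_map (subtopology TQ (?U1 i)) euclidean (zeta i)" for i
    unfolding zeta_def
  proof (rule cm_slice)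
    show "?U1 i \<subseteq> topspace TQ" using UQ by blast
    show "sgn (pc \<kappa> i (chart_of (psi q)) q) = sgn (pc \<kappa>' i (chart_of (psi q)) q)"
      if "q \<in> ?U1 i" "\<kappa> \<in> B" "\<kappa>' \<in> B" "snd (snd q) \<in> fst \<kappa>" "snd (snd q) \<in> fst \<kappa>'" for q \<kappa> \<kappa>'
      using pc_sgn ch UQ that by blast
    show "continuous_map (subtopology TQ {q \<in> ?U1 i. snd (snd q) \<in> fst \<kappa>}) euclidean (\<lambda>q. sgn (pc \<kappa> i (chart_of (psi q)) q))"
      if \<kappa>: "\<kappa> \<in> B" for \<kappa>
    proof (rule cm_sgn)
      have V: "{q \<in> U i. snd (snd q) \<in> fst \<kappa>} \<subseteq> topspace TQ" using UQ by blast
      have "continuous_map (subtopology TQ {q \<in> U i. snd (snd q) \<in> fst \<kappa>}) euclidean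
          (\<lambda>q. Complex (Re (pc \<kappa> i (chart_of (psi q)) q)) (Im (pc \<kappa> i (chart_of (psi q)) q)))"
        by (intro cm_Complex scalar_field_continuous[OF psi_continuous V sp(1)[OF \<kappa>]] scalar_field_continuous[OF psi_continuous V sp(2)[OF \<kappa>]])
      then show "continuous_map (subtopology TQ {q \<in> ?U1 i. snd (snd q) \<in> fst \<kappa>}) euclidean (\<lambda>q. pc \<kappa> i (chart_of (psi q)) q)"
        unfolding complex_surj by (rule continuous_map_from_subtopology_mono) auto
      show "pc \<kappa> i (chart_of (psi q)) q \<noteq> 0" if "q \<in> topspace (subtopology TQ {q \<in> ?U1 i. snd (snd q) \<in> fst \<kappa>})" for q
        using pc_nz[of q i "chart_of (psi q)" \<kappa>] ch[of q] that \<kappa> by auto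
    qed
  qed
  have zeta_eq: "zeta i q = sgn (pc \<kappa> i l q)"
    if q: "q \<in> U i" and l: "l \<in> charts_at M (psi q)" and \<kappa>: "\<kappa> \<in> B" "snd (snd q) \<in> fst \<kappa>" for i q l \<kappa>
  proof -
    have qQ: "q \<in> topspace TQ" using q UQ by blast
    then have x: "snd (snd q) \<in> L" by (simp add: topspace_TQ)
    have "zeta i q = sgn (pc \<kappa> i (chart_of (psi q)) q)"
      unfolding zeta_def by (rule pc_sgn[OF q ch[OF qQ] slice(1)[OF x] \<kappa>(1) slice(2)[OF x] \<kappa>(2)])
    then show ?thesis using pc_chart[OF q \<kappa>(2,1) ch[OF qQ] l] by simp
  qed
  have nzeta: "norm (zeta i q) = 1" if "q \<in> ?U1 i" for i q
  proof -
    have qQ: "q \<in> topspace TQ" using that UQ by blast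
    then have x: "snd (snd q) \<in> L" by (simp add: topspace_TQ)
    have "pc (slice (snd (snd q))) i (chart_of (psi q)) q \<noteq> 0"
      using pc_nz[of q i, OF _ _ ch[OF qQ] slice[OF x]] that by blast
    then show ?thesis by (simp add: zeta_def norm_sgn)
  qed
  have zzeta: "zeta i q = z i j q * zeta j q" if q: "q \<in> U i \<inter> U j" for i j q
  proof -
    have l: "chart_of (psi q) \<in> charts_at M (psi q)" using ch UQ q by blast
    have fi: "hermitian_frame (g (chart_of (psi q)) (psi q)) (J (chart_of (psi q)) (psi q)) (F i (chart_of (psi q)) q)"
      and fj: "hermitian_frame (g (chart_of (psi q)) (psi q)) (J (chart_of (psi q)) (psi q)) (F j (chart_of (psi q)) q)"
      using fr l q by blast+
    show ?thesis
      unfolding zeta_def pc_def hermitian.plane_coord_change[OF herm[OF l] fi fj] sgn_mult zl[OF q l, symmetric]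
      by (simp add: sgn_of_unit nz[OF q])
  qed
  have c1: "continuous_map TP TQ (\<lambda>x. (1, x))"
    by (rule cm_pair) (auto simp: continuous_map_in_subtopology intro: continuous_map_canonical_const)
  have c0: "continuous_map (subtopology TP {x. (1, x) \<in> U i}) euclidean (\<lambda>x. zeta i (1, x))" for i
  proof (rule cm_compose[OF _ czeta])
    show "continuous_map (subtopology TP {x. (1, x) \<in> U i}) (subtopology TQ (?U1 i)) (\<lambda>x. (1, x))"
      by (rule continuous_map_into_subtopology[OF continuous_map_from_subtopology[OF c1]]) auto
  qed
  have n0: "norm (zeta i (1, x)) = 1" if "(1, x) \<in> U i" for i x using nzeta that by simp
  have z0: "zeta i (1, x) = z i j (1, x) * zeta j (1, x)" if "(1, x) \<in> U i \<inter> U j" for i j x by (rule zzeta[OF that])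
  obtain \<eta> where c\<eta>: "\<And>i. continuous_map (subtopology TQ (U i)) euclidean (\<eta> i)"
    and n\<eta>: "\<And>i q. q \<in> U i \<Longrightarrow> norm (\<eta> i q) = 1"
    and z\<eta>: "\<And>i j q. q \<in> U i \<inter> U j \<Longrightarrow> \<eta> i q = z i j q * \<eta> j q"
    and \<eta>1: "\<And>i x. (1, x) \<in> U i \<Longrightarrow> \<eta> i (1, x) = zeta i (1, x)"
    by (rule extend_unit_section[OF compact_TP oU cover cz nz zz c0 n0 z0]; (assumption | rule that; assumption))
  define ix where "ix q = (SOME i. q \<in> U i)" for q
  have ix: "q \<in> U (ix q)" if "q \<in> topspace TQ" for q
    unfolding ix_def by (rule someI_ex[OF cover[OF that]])
  \<comment> \<open>By the cocycle relation the product of frame and coordinate is the same for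
    every index, so the discontinuous choice \<open>ix\<close> does not affect
    \<open>E\<close>.\<close>
  define E where "E l q = hermitian.complex_mult (J l (psi q)) (F (ix q) l q) (\<eta> (ix q) q)" for l q
  have EU: "E l q = hermitian.complex_mult (J l (psi q)) (F i l q) (\<eta> i q)" if q: "q \<in> U i" and l: "l \<in> charts_at M (psi q)" for i l q
  proof -
    have qQ: "q \<in> topspace TQ" using q UQ by blast
    have i: "q \<in> U i \<inter> U (ix q)" using q ix[OF qQ] by blast
    show ?thesis
      unfolding E_def hermitian.frame_change[OF herm[OF l] fr[OF q l] fr[OF ix[OF qQ] l]] z\<eta>[OF i] zl[OF i l] ..
  qed
  show ?thesis
  proof (rule that)
    show "endo_field_along TQ psi (topspace TQ) E"
    proof (rule endo_field_local[OF order_refl])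
      fix q assume q: "q \<in> topspace TQ"
      let ?i = "ix q"
      let ?A = "\<lambda>l q u. Re (\<eta> ?i q) *\<^sub>R F ?i l q u + Im (\<eta> ?i q) *\<^sub>R J l (psi q) (F ?i l q u)"
      have e: "U ?i \<inter> topspace TQ = U ?i" using UQ by blast
      have cRe: "continuous_map (subtopology TQ (U ?i)) euclideanreal (\<lambda>q. Re (\<eta> ?i q))"
        "continuous_map (subtopology TQ (U ?i)) euclideanreal (\<lambda>q. Im (\<eta> ?i q))"
        by (rule cm_compose_on[OF c\<eta>, of UNIV]; auto intro!: continuous_intros)+
      have "endo_field_along TQ psi (U ?i) ?A"
        by (intro endo_field_add endo_field_scaleR FU JFU cRe)
      moreover have "E k q' = ?A k q'" if "q' \<in> U ?i" "k \<in> charts_at M (psi q')" for q' k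
        unfolding EU[OF that] hermitian.complex_mult_def[OF herm[OF that(2)]] ..
      ultimately show "\<exists>W A'. openin TQ W \<and> q \<in> W \<and> endo_field_along TQ psi (W \<inter> topspace TQ) A' \<and>
        (\<forall>q'\<in>W \<inter> topspace TQ. \<forall>k\<in>charts_at M (psi q'). E k q' = A' k q')"
        using oU ix[OF q] by (intro exI[of _ "U ?i"] exI[of _ ?A]) (simp add: e)
    qed
    show hE: "hermitian_frame (g l (psi q)) (J l (psi q)) (E l q)" if q: "q \<in> topspace TQ" and l: "l \<in> charts_at M (psi q)" for q l
      unfolding EU[OF ix[OF q] l]
      by (rule hermitian.complex_mult_frame[OF herm[OF l] fr[OF ix[OF q] l] n\<eta>[OF ix[OF q]]])
    show "sgn (plane \<kappa> (E l q) l q) = axis 2 1"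
      if q: "q \<in> topspace TQ" "fst q = 1" and l: "l \<in> charts_at M (psi q)" and \<kappa>: "\<kappa> \<in> B" "snd (snd q) \<in> fst \<kappa>" for q l \<kappa>
    proof -
      let ?i = "ix q" and ?u = "tangent \<kappa> 1 l q" and ?v = "tangent \<kappa> 2 l q"
      note i = ix[OF q(1)]
      have frE: "hermitian_frame (g l (psi q)) (J l (psi q)) (E l q)" by (rule hE[OF q(1) l])
      interpret hermitian_frame "g l (psi q)" "J l (psi q)" "E l q" by (rule frE)
      have "\<eta> ?i q = zeta ?i q" using \<eta>1[of "snd q" ?i] i q(2) by (cases q) simp
      then have \<eta>q: "\<eta> ?i q = sgn (pc \<kappa> ?i l q)" using zeta_eq[OF i l \<kappa>] by simp
      have nz: "pc \<kappa> ?i l q \<noteq> 0" by (rule pc_nz[OF i q(2) l \<kappa>])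
      \<comment> \<open>Over \<open>s = 1\<close> the scalar \<eta> is the direction of the plane
        coordinate, so the conjugate rotates that coordinate onto the positive real axis: the plane
        points along \<open>E\<close>.\<close>
      have "plane_coord (E l q) ?u ?v = cnj (\<eta> ?i q) * pc \<kappa> ?i l q"
        unfolding EU[OF i l] plane_coord_mult pc_def ..
      also have "\<dots> = cmod (pc \<kappa> ?i l q)"
      proof -
        have "cnj (sgn w) * w = complex_of_real (cmod w)" for w
          by (cases "w = 0") (simp_all add: sgn_eq field_simps complex_norm_square[symmetric] power2_eq_square)
        then show ?thesis unfolding \<eta>q .
      qed
      finally have pE: "plane_vec ?u ?v $ 2 = cmod (pc \<kappa> ?i l q)" "plane_vec ?u ?v $ 3 = 0"
        by (simp_all add: plane_coord_def plane_vec_def complex_eq_iff)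
      have "plane_vec ?u ?v $ 1 = 0"
        using plane_lagrangian[OF q(1) \<kappa> l frE] lagrangian_final q by (simp add: topspace_TQ)
      then have "plane_vec ?u ?v = cmod (pc \<kappa> ?i l q) *\<^sub>R axis 2 1"
        using pE by (simp add: vec_eq_iff forall_3 axis_def)
      then show ?thesis using nz by (simp add: sgn_scaleR sgn_of_unit)
    qed
  qed
qed

end

context smooth_manifold
begin

lemma form_field_cong:
  assumes V: "V \<subseteq> topspace Q" and T: "form_field Q f V T" and e: "\<And>q k. \<lbrakk>q \<in> V; k \<in> charts_at M (f q)\<rbrakk> \<Longrightarrow> T' k q = T k q"
  shows "form_field Q f V T'"
  unfolding form_field_def
proof (intro conjI ballI allI)
  show "bilinear (T' k q)" if "q \<in> V" "k \<in> charts_at M (f q)" for q k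
    unfolding e[OF that] by (rule form_fieldD(1)[OF T that])
  show "T' k q u v = T' l q (tderiv id k l (f q) u) (tderiv id k l (f q) v)"
    if "q \<in> V" "k \<in> charts_at M (f q)" "l \<in> charts_at M (f q)" for q k l u v
    unfolding e[OF that(1,2)] e[OF that(1,3)] by (rule form_fieldD(2)[OF T that])
  show "continuous_map (subtopology Q {q \<in> V. f q \<in> fst k}) euclideanreal (\<lambda>q. T' k q u v)" if k: "k \<in> atlas M" for k u v
  proof (rule continuous_map_eq[OF form_fieldD(3)[OF T k]])
    fix q assume "q \<in> topspace (subtopology Q {q \<in> V. f q \<in> fst k})"
    from topspace_fieldD[OF this k] show "T k q u v = T' k q u v" using e by simp
  qed
qed

end

section \<open>The given path in the parametrization of the homotopy\<close>

context lagrangian_homotopy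
begin

lemma topspace_TP: "z \<in> topspace TP \<longleftrightarrow> fst z \<in> {0..1} \<and> snd z \<in> L"
  using LM by (cases z) (auto simp: topspace_prod_topology)

lemma initial_TQ: "z \<in> topspace TP \<Longrightarrow> (0, z) \<in> topspace TQ"
  by (simp add: topspace_TP topspace_TQ)

lemma cm_initial: "continuous_map TP TQ (\<lambda>z. (0, z))"
  by (rule cm_pair) (auto simp: continuous_map_in_subtopology intro: continuous_map_canonical_const)

lemma psi_initial: "continuous_map TP (mtop M) (\<lambda>z. psi (0, z))"
  by (rule cm_compose[OF cm_initial psi_continuous])

lemma \<phi>_TP: "continuous_map TP (mtop M) (\<lambda>z. \<phi> (fst z) (snd z))"
proof -
  have "continuous_map TL (mtop M) (\<lambda>x. x)" by (simp add: continuous_map_from_subtopology)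
  from cm_pair[OF continuous_map_fst cm_compose[OF continuous_map_snd this]]
  have "continuous_map TP (prod_topology unit_interval (mtop M)) (\<lambda>z. (fst z, snd z))" .
  from cm_compose[OF this \<phi>_continuous] show ?thesis by simp
qed

lemma \<phi>_inj: "t \<in> {0..1} \<Longrightarrow> inj_on (\<phi> t) L"
  using bij_betw_imp_inj_on[OF \<phi>(1)] LM by (rule inj_on_subset)

text \<open>The two parametrizations of \<open>L\<^sub>t\<close> by \<open>L\<close>, one through \<open>\<phi>\<close> and one through the homotopy,
  differ by these mutually inverse maps.\<close>

definition alpha :: "real \<times> 'a \<Rightarrow> 'a" where
  "alpha z = inv_into L (\<phi> (fst z)) (\<Psi> 0 (fst z) (snd z))"

definition beta :: "real \<times> 'a \<Rightarrow> 'a" where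
  "beta z = inv_into L (\<Psi> 0 (fst z)) (\<phi> (fst z) (snd z))"

lemma alpha:
  assumes "z \<in> topspace TP"
  shows "alpha z \<in> L" "\<phi> (fst z) (alpha z) = psi (0, z)"
proof -
  have t: "fst z \<in> {0..1}" and x: "snd z \<in> L" using assms by (auto simp: topspace_TP)
  have "\<Psi> 0 (fst z) (snd z) \<in> \<phi> (fst z) ` L" using x unfolding start[OF t, symmetric] by (rule imageI)
  from inv_into_into[OF this] f_inv_into_f[OF this]
  show "alpha z \<in> L" "\<phi> (fst z) (alpha z) = psi (0, z)" by (simp_all add: alpha_def psi_def)
qed

lemma beta:
  assumes "z \<in> topspace TP"
  shows "beta z \<in> L" "psi (0, fst z, beta z) = \<phi> (fst z) (snd z)" "alpha (fst z, beta z) = snd z"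
proof -
  have t: "fst z \<in> {0..1}" and x: "snd z \<in> L" using assms by (auto simp: topspace_TP)
  have "\<phi> (fst z) (snd z) \<in> \<Psi> 0 (fst z) ` L" using x unfolding start[OF t] by (rule imageI)
  from inv_into_into[OF this] f_inv_into_f[OF this]
  show "beta z \<in> L" and e: "psi (0, fst z, beta z) = \<phi> (fst z) (snd z)" by (simp_all add: beta_def psi_def)
  then have "alpha (fst z, beta z) = inv_into L (\<phi> (fst z)) (\<phi> (fst z) (snd z))"
    by (simp add: alpha_def psi_def)
  then show "alpha (fst z, beta z) = snd z" by (simp add: inv_into_f_f[OF \<phi>_inj[OF t] x])
qed

lemma \<Psi>_TP: "continuous_map TP (mtop M) (\<lambda>z. \<Psi> 0 (fst z) (snd z))"
  using psi_initial by (simp add: psi_def)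

lemma alpha_continuous: "continuous_map TP TL alpha"
proof -
  have "continuous_map TP TL (\<lambda>z. inv_into (topspace TL) (\<phi> (fst z)) (\<Psi> 0 (fst z) (snd z)))"
    by (rule cm_reparametrization[OF compact_TL(1) Hausdorff \<phi>_TP \<Psi>_TP]) (simp_all only: topspace_TL \<phi>_inj start order_refl)
  then show ?thesis unfolding topspace_TL alpha_def[abs_def] .
qed

lemma beta_continuous: "continuous_map TP TL beta"
proof -
  have "continuous_map TP TL (\<lambda>z. inv_into (topspace TL) (\<Psi> 0 (fst z)) (\<phi> (fst z) (snd z)))"
  proof (rule cm_reparametrization[OF compact_TL(1) Hausdorff \<Psi>_TP \<phi>_TP])
    show "inj_on (\<Psi> 0 t) (topspace TL)" if t: "t \<in> {0..1}" for t
      using embedding[of 0 t] t unfolding topspace_TL by (simp add: smooth_embedding_def)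
  qed (simp_all only: topspace_TL start order_refl)
  then show ?thesis unfolding topspace_TL beta_def[abs_def] .
qed

text \<open>The structures of the moved forms at \<open>psi (0, z)\<close>, that is, parametrized
  through \<Psi> instead of \<phi>, because the global frame is a field along
  \<open>psi\<close>.\<close>

definition moved :: "'a two_form \<Rightarrow> 'a chart \<Rightarrow> real \<times> 'a \<Rightarrow> endo" where
  "moved \<tau> l z = moved_acs M g \<phi> \<tau> (fst z) l (psi (0, z))"

context
  fixes S \<tau>
  assumes S: "openin (mtop M) S" "L \<subseteq> S" and \<tau>: "two_form_on M S \<tau>" "same_orientation_on M S \<omega> \<tau>"
begin

lemma moved_form_psi:
  assumes z: "z \<in> topspace TP" and l: "l \<in> charts_at M (psi (0, z))"
  shows "bilinear (moved_form M \<phi> \<tau> (fst z) l (psi (0, z)))" "moved_form M \<phi> \<tau> (fst z) l (psi (0, z)) u u = 0"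
    "wedge_square (\<omega> l (psi (0, z))) * wedge_square (moved_form M \<phi> \<tau> (fst z) l (psi (0, z))) > 0"
proof -
  have t: "fst z \<in> {0..1}" using z by (simp add: topspace_TP)
  have y: "alpha z \<in> S" "alpha z \<in> pts M" using alpha(1)[OF z] S(2) LM by auto
  have l': "l \<in> charts_at M (\<phi> (fst z) (alpha z))" using l by (simp add: alpha(2)[OF z])
  note m = moved_form_at[OF \<tau> y(1) t l' y(2), unfolded alpha(2)[OF z]]
  show "bilinear (moved_form M \<phi> \<tau> (fst z) l (psi (0, z)))" "moved_form M \<phi> \<tau> (fst z) l (psi (0, z)) u u = 0"
    "wedge_square (\<omega> l (psi (0, z))) * wedge_square (moved_form M \<phi> \<tau> (fst z) l (psi (0, z))) > 0"
    by (rule m)+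
qed

lemma moved_field: "endo_field_along TP (\<lambda>z. psi (0, z)) (topspace TP) (moved \<tau>)"
proof -
  have h: "continuous_map (subtopology TP (topspace TP)) (prod_topology unit_interval (mtop M)) (\<lambda>z. (fst z, alpha z))"
  proof -
    have "continuous_map TP (mtop M) alpha" using alpha_continuous by (simp add: continuous_map_in_subtopology)
    then show ?thesis unfolding subtopology_topspace by (rule cm_pair[OF continuous_map_fst])
  qed
  have "form_field TP (\<lambda>z. psi (0, z)) (topspace TP)
      (\<lambda>l z. moved_form M \<phi> \<tau> (fst (fst z, alpha z)) l (\<phi> (fst (fst z, alpha z)) (snd (fst z, alpha z))))"
  proof (rule field_pullback(2)[OF h _ order_refl moved_form_field[OF S(1) \<tau>(1)]])
    show "(fst z, alpha z) \<in> {0..1} \<times> S \<and> psi (0, z) = \<phi> (fst (fst z, alpha z)) (snd (fst z, alpha z))" if "z \<in> topspace TP" for z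
      using alpha[OF that] S(2) that by (auto simp: topspace_TP)
  qed
  then have F: "form_field TP (\<lambda>z. psi (0, z)) (topspace TP) (\<lambda>l z. moved_form M \<phi> \<tau> (fst z) l (\<phi> (fst z) (alpha z)))"
    by simp
  have "form_field TP (\<lambda>z. psi (0, z)) (topspace TP) (\<lambda>l z. moved_form M \<phi> \<tau> (fst z) l (psi (0, z)))"
    by (rule form_field_cong[OF order_refl F]) (simp only: alpha(2))
  from acs_field[OF psi_initial order_refl this moved_form_psi(2,3)]
  show ?thesis unfolding moved_def[abs_def] moved_acs_def .
qed

lemma moved_compatible:
  assumes z: "z \<in> topspace TP" and l: "l \<in> charts_at M (psi (0, z))"
  shows "compatible (moved_form M \<phi> \<tau> (fst z) l (psi (0, z))) (moved \<tau> l z)"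
  using acs_pointwise_ex(1)[OF l moved_form_psi(1,2,3)[OF z l]] by (simp add: moved_def moved_acs_def)

lemma moved_quat_comb:
  assumes z: "z \<in> topspace TP" and l: "l \<in> charts_at M (psi (0, z))"
    and fr: "hermitian_frame (g l (psi (0, z))) (J l (psi (0, z))) E"
  obtains n where "norm n = 1" "moved \<tau> l z = quat_comb (J l (psi (0, z))) E n"
proof -
  have e: "(axis 1 1 :: real^4) \<noteq> 0" by (simp add: axis_eq_0_iff)
  note m = acs_pointwise(1,2)[OF l fr moved_form_psi(1,2,3)[OF z l] e]
  show ?thesis by (rule that[OF _ m(2)[folded moved_acs_def, folded moved_def]]) (simp add: norm_sgn m(1))
qed

end

text \<open>The wedge square of \<omega> is nonzero because it is a factor of the positive product
  in the orientation condition for \<open>\<phi> 0\<close>.\<close>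

lemma \<omega>_same_orientation: "same_orientation_on M (pts M) \<omega> \<omega>"
  unfolding same_orientation_on_def
proof (intro ballI)
  fix p k assume "p \<in> pts M" "k \<in> charts_at M p"
  then have "wedge_square (\<omega> k p) * wedge_square (pullback M (\<phi> 0) \<omega> k p) > 0"
    by (intro \<phi>(4)) simp_all
  then have "wedge_square (\<omega> k p) \<noteq> 0" by auto
  then show "wedge_square (\<omega> k p) * wedge_square (\<omega> k p) > 0" by (auto simp: zero_less_mult_iff)
qed

lemma moved_\<omega>_ends:
  assumes z: "z \<in> topspace TP" and t: "fst z \<in> {0, 1}" and l: "l \<in> charts_at M (psi (0, z))"
  shows "moved \<omega> l z = J l (psi (0, z))"
proof -
  have t': "fst z \<in> {0..1}" using z by (simp add: topspace_TP)
  have y: "alpha z \<in> L" "alpha z \<in> pts M" using alpha(1)[OF z] LM by auto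
  have l': "l \<in> charts_at M (\<phi> (fst z) (alpha z))" using l by (simp add: alpha(2)[OF z])
  have "moved_form M \<phi> \<omega> (fst z) l (psi (0, z)) = \<omega> l (psi (0, z))"
    using moved_\<omega>_eq[OF t' y(2) l' \<phi>_ends[OF t y(1)]] by (simp add: alpha(2)[OF z])
  then show ?thesis by (simp add: moved_def moved_acs_def associated_acs_\<omega>[OF l])
qed

text \<open>The inverse of \<open>\<phi> t\<close> carries curves in the moved surface to curves in
  \<open>L\<close>. The moved form is \<omega> evaluated on their velocities, and \<open>L\<close>
  is Lagrangian for \<omega>.\<close>

lemma moved_lagrangian:
  assumes z: "z \<in> topspace TP" and \<kappa>: "\<kappa> \<in> B" "snd z \<in> fst \<kappa>" and l: "l \<in> charts_at M (psi (0, z))"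
  shows "moved_form M \<phi> \<omega> (fst z) l (psi (0, z)) (tangent \<kappa> 1 l (0, z)) (tangent \<kappa> 2 l (0, z)) = 0"
proof -
  define t x y k where "t = fst z" "x = snd z" "y = alpha z" "k = chart_of (alpha z)"
  note d = t_x_y_k_def
  have t: "t \<in> {0..1}" and x: "x \<in> L" "x \<in> fst \<kappa>" using z \<kappa> by (auto simp: topspace_TP d)
  have y: "y \<in> L" "y \<in> pts M" using alpha(1)[OF z] LM by (auto simp: d)
  have k: "k \<in> charts_at M y" using chart_of[OF y(2)] by (simp add: d)
  have p: "\<phi> t y = psi (0, z)" using alpha(2)[OF z] by (simp add: d)
  have p': "\<Psi> 0 t x = psi (0, z)" by (simp add: d psi_def)
  have inv: "\<phi>inv t (psi (0, z)) = y" using \<phi>inv(1)[OF t y(2)] by (simp add: p)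
  have l': "l \<in> charts_at M (\<phi> t y)" and l'': "l \<in> charts_at M (\<Psi> 0 t x)" using l by (simp_all add: p p')
  have k': "k \<in> charts_at M (\<phi>inv t (psi (0, z)))" using k by (simp add: inv)
  note ka = charts_atD[OF k] and la = charts_atD[OF l]
  have s: "(0::real) \<in> {0..1}" by simp
  have \<kappa>a: "\<kappa> \<in> atlas M" using B_slice[OF \<kappa>(1)] by (simp add: slice_chart_def)
  let ?D = "tderiv (\<phi>inv t) l k (psi (0, z))"
  let ?c = "\<lambda>w r. chart_inv \<kappa> (snd \<kappa> x + r *\<^sub>R w)"
  have 1: "\<phi>inv t (\<Psi> 0 t (?c w 0)) = y" "\<forall>\<^sub>F r in nhds 0. \<phi>inv t (\<Psi> 0 t (?c w r)) \<in> L"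
    "\<forall>\<^sub>F r in nhds 0. \<phi>inv t (\<Psi> 0 t (?c w r)) \<in> fst k"
    "((\<lambda>r. snd k (\<phi>inv t (\<Psi> 0 t (?c w r)))) has_vector_derivative ?D (velocity 0 t \<kappa> l x w)) (at 0)"
    if w: "w $ 3 = 0" "w $ 4 = 0" for w
  proof -
    note sc = slice_curve[OF B_slice[OF \<kappa>(1)] x w]
    have c0: "\<Psi> 0 t (?c w 0) = psi (0, z)" using sc(1) p' by simp
    show "\<phi>inv t (\<Psi> 0 t (?c w 0)) = y" unfolding c0 by (rule inv)
    \<comment> \<open>Here the equality of the images of \<open>L\<close> under
      \<open>\<Psi> 0 t\<close> and \<open>\<phi> t\<close> is used; the two maps themselves may
      differ.\<close>
    have inL: "\<phi>inv t (\<Psi> 0 t x') \<in> L" if "x' \<in> L" for x'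
    proof -
      have "\<Psi> 0 t x' \<in> \<phi> t ` L" using that unfolding start[OF t, symmetric] by (rule imageI)
      then obtain y' where "y' \<in> L" "\<Psi> 0 t x' = \<phi> t y'" by blast
      then show ?thesis using \<phi>inv(1)[OF t, of y'] LM by auto
    qed
    show "\<forall>\<^sub>F r in nhds 0. \<phi>inv t (\<Psi> 0 t (?c w r)) \<in> L" using sc(4) by eventually_elim (simp add: inL)
    have "continuous_map (mtop M) (mtop M) (\<phi>inv t)" using \<phi>(3)[OF t] by (simp add: smooth_map_def)
    then have o: "openin (mtop M) {p \<in> topspace (mtop M). \<phi>inv t p \<in> fst k}"
      by (rule openin_continuous_map_preimage[OF _ chart(1)[OF ka(1)]])
    have m: "\<Psi> 0 t (?c w 0) \<in> {p \<in> topspace (mtop M). \<phi>inv t p \<in> fst k}"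
      unfolding c0 using inv ka(2) charts_at_pts[OF l] by simp
    have "\<forall>\<^sub>F r in nhds 0. \<Psi> 0 t (?c w r) \<in> {p \<in> topspace (mtop M). \<phi>inv t p \<in> fst k}"
      by (rule curve_eventually_image[where \<gamma> = "?c w", OF s t \<kappa>a o m sc(4,3)])
    then show "\<forall>\<^sub>F r in nhds 0. \<phi>inv t (\<Psi> 0 t (?c w r)) \<in> fst k" by eventually_elim simp
    have ml: "\<Psi> 0 t (?c w 0) \<in> fst l" unfolding c0 by (rule la(2))
    have el: "\<forall>\<^sub>F r in nhds 0. \<Psi> 0 t (?c w r) \<in> fst l"
      by (rule curve_eventually_image[where \<gamma> = "?c w", OF s t \<kappa>a chart(1)[OF la(1)] ml sc(4,3)])
    have hd: "((\<lambda>x. snd k (\<phi>inv t (chart_inv l x))) has_derivative ?D) (at (snd l (\<Psi> 0 t (?c w 0))))"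
      unfolding c0 by (rule smooth_map_has_derivative(1)[OF \<phi>(3)[OF t] l k'])
    have vc: "((\<lambda>r. snd l (\<Psi> 0 t (?c w r))) has_vector_derivative velocity 0 t \<kappa> l x w) (at 0)"
      by (rule velocity_curve[OF s t B_slice[OF \<kappa>(1)] x l'' sc(1,4,3)])
    show "((\<lambda>r. snd k (\<phi>inv t (\<Psi> 0 t (?c w r)))) has_vector_derivative ?D (velocity 0 t \<kappa> l x w)) (at 0)"
      by (rule curve_map[where \<gamma> = "\<lambda>r. \<Psi> 0 t (?c w r)" and h = "\<lambda>p. snd k (\<phi>inv t p)", OF la(1) ml el vc hd])
  qed
  have "\<omega> k y (?D (velocity 0 t \<kappa> l x (axis 1 1))) (?D (velocity 0 t \<kappa> l x (axis 2 1))) = 0"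
    by (rule lagrangian_velocities[OF lagrangian_L y(1) \<omega>_two_form y(2) k 1[OF axis_34(1,2)] 1[OF axis_34(3,4)]])
  then show ?thesis
    using moved_form_eq[OF \<omega>_two_form y(2) t k l'] by (simp add: tangent_def p d[symmetric])
qed

end

lemma cm_cross3:
  assumes "continuous_map X euclidean f" "continuous_map X euclidean h"
  shows "continuous_map X euclidean (\<lambda>x. cross3 (f x) (h x))"
  unfolding cross3_def
  by (intro cm_vec3 continuous_map_diff continuous_map_real_mult cm_nth assms)

lemma cm_sphere_coords:
  assumes a: "continuous_map X euclidean a" and c: "continuous_map X euclidean c" and v: "continuous_map X euclidean v"
    and ne: "\<And>x. x \<in> topspace X \<Longrightarrow> c x - (c x \<bullet> a x) *\<^sub>R a x \<noteq> 0"
  shows "continuous_map X euclidean (\<lambda>x. sphere_coords (a x) (c x) (v x))"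
proof -
  have d: "continuous_map X euclidean (\<lambda>x. c x - (c x \<bullet> a x) *\<^sub>R a x)"
    by (intro continuous_map_diff cm_scaleR cm_inner a c)
  note k = cm_sgn[OF d ne]
  show ?thesis unfolding sphere_coords_def Let_def by (intro cm_vec3 cm_inner cm_cross3 a v k)
qed

section \<open>Structures and tangent planes in the coordinates of the global frame\<close>

locale lagrangian_homotopy_frame = lagrangian_homotopy M \<omega> J \<phi> L \<Psi> B
  for M :: "'a smooth_space" and \<omega> J \<phi> L \<Psi> B +
  fixes E :: "'a chart \<Rightarrow> real \<times> real \<times> 'a \<Rightarrow> endo"
  assumes E: "endo_field_along TQ psi (topspace TQ) E"
    and frame: "\<And>q l. \<lbrakk>q \<in> topspace TQ; l \<in> charts_at M (psi q)\<rbrakk> \<Longrightarrow> hermitian_frame (g l (psi q)) (J l (psi q)) (E l q)"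
    and final: "\<And>q l \<kappa>. \<lbrakk>q \<in> topspace TQ; fst q = 1; l \<in> charts_at M (psi q); \<kappa> \<in> B; snd (snd q) \<in> fst \<kappa>\<rbrakk> \<Longrightarrow>
       sgn (plane \<kappa> (E l q) l q) = axis 2 1"
begin

text \<open>Coordinates in the frame \<open>J\<close>, \<open>E\<close>, \<open>J \<circ> E\<close>
  over the side \<open>s = 0\<close>. For the structures moved from \<omega> this is the map called
  \<open>a\<close> in the overview.\<close>

definition coords :: "('a chart \<Rightarrow> real \<times> 'a \<Rightarrow> endo) \<Rightarrow> real \<times> 'a \<Rightarrow> real^3" where
  "coords A z = (let l = chart_of (psi (0, z)) in
     vector [endo_inner (A l z) (J l (psi (0, z))), endo_inner (A l z) (E l (0, z)),
       endo_inner (A l z) (\<lambda>u. J l (psi (0, z)) (E l (0, z) u))])"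

context
  fixes A
  assumes A: "endo_field_along TP (\<lambda>z. psi (0, z)) (topspace TP) A"
    and comb: "\<And>z l. \<lbrakk>z \<in> topspace TP; l \<in> charts_at M (psi (0, z))\<rbrakk> \<Longrightarrow>
      \<exists>n. norm n = 1 \<and> A l z = quat_comb (J l (psi (0, z))) (E l (0, z)) n"
begin

lemma coords_fields:
  "scalar_field TP (\<lambda>z. psi (0, z)) (topspace TP) (\<lambda>l z. endo_inner (A l z) (J l (psi (0, z))))"
  "scalar_field TP (\<lambda>z. psi (0, z)) (topspace TP) (\<lambda>l z. endo_inner (A l z) (E l (0, z)))"
  "scalar_field TP (\<lambda>z. psi (0, z)) (topspace TP) (\<lambda>l z. endo_inner (A l z) (\<lambda>u. J l (psi (0, z)) (E l (0, z) u)))"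
proof -
  have J': "endo_field_along TP (\<lambda>z. psi (0, z)) (topspace TP) (\<lambda>l z. J l (psi (0, z)))"
    by (rule field_pullback(1)[OF continuous_map_from_subtopology[OF psi_initial] _ order_refl J_field])
      (use psi_pts initial_TQ in blast)
  have E': "endo_field_along TP (\<lambda>z. psi (0, z)) (topspace TP) (\<lambda>l z. E l (0, z))"
    by (rule field_pullback(1)[OF continuous_map_from_subtopology[OF cm_initial] _ order_refl E])
      (use initial_TQ in blast)
  show "scalar_field TP (\<lambda>z. psi (0, z)) (topspace TP) (\<lambda>l z. endo_inner (A l z) (J l (psi (0, z))))"
    by (rule endo_field_inner[OF A J'])
  show "scalar_field TP (\<lambda>z. psi (0, z)) (topspace TP) (\<lambda>l z. endo_inner (A l z) (E l (0, z)))"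
    by (rule endo_field_inner[OF A E'])
  show "scalar_field TP (\<lambda>z. psi (0, z)) (topspace TP) (\<lambda>l z. endo_inner (A l z) (\<lambda>u. J l (psi (0, z)) (E l (0, z) u)))"
    by (rule endo_field_inner[OF A endo_field_comp[OF J' E']])
qed

lemma coords_continuous: "continuous_map TP euclidean (coords A)"
  unfolding coords_def[abs_def] Let_def
  by (intro cm_vec3; rule scalar_field_continuous[OF psi_initial order_refl coords_fields(1), unfolded subtopology_topspace]
      scalar_field_continuous[OF psi_initial order_refl coords_fields(2), unfolded subtopology_topspace]
      scalar_field_continuous[OF psi_initial order_refl coords_fields(3), unfolded subtopology_topspace])

lemma coords:
  assumes z: "z \<in> topspace TP" and l: "l \<in> charts_at M (psi (0, z))"
  shows "norm (coords A z) = 1" "A l z = quat_comb (J l (psi (0, z))) (E l (0, z)) (coords A z)"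
proof -
  obtain n where n: "norm n = 1" "A l z = quat_comb (J l (psi (0, z))) (E l (0, z)) n" using comb[OF z l] by blast
  have k: "chart_of (psi (0, z)) \<in> charts_at M (psi (0, z))" by (rule chart_of[OF psi_pts[OF initial_TQ[OF z]]])
  have s: "f (chart_of (psi (0, z))) z = f l z" if "scalar_field TP (\<lambda>z. psi (0, z)) (topspace TP) f" for f
    using that z k l unfolding scalar_field_def by blast
  have "coords A z = vector [endo_inner (A l z) (J l (psi (0, z))), endo_inner (A l z) (E l (0, z)),
       endo_inner (A l z) (\<lambda>u. J l (psi (0, z)) (E l (0, z) u))]"
    unfolding coords_def Let_def by (simp only: s[OF coords_fields(1)] s[OF coords_fields(2)] s[OF coords_fields(3)])
  also have "\<dots> = n"
    unfolding n(2) by (rule quat_comb_coords[OF hermitian_frame.quat_units[OF frame[OF initial_TQ[OF z] l]], symmetric])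
  finally show "norm (coords A z) = 1" "A l z = quat_comb (J l (psi (0, z))) (E l (0, z)) (coords A z)"
    using n by simp_all
qed

end

text \<open>The map called \<open>b\<close> in the overview. The choices of slice chart and chart do
  not matter, by \<open>plane_change\<close> and the chart independence of the components.\<close>

definition tplane :: "real \<times> real \<times> 'a \<Rightarrow> real^3" where
  "tplane q = sgn (plane (slice (snd (snd q))) (E (chart_of (psi q)) q) (chart_of (psi q)) q)"

lemma tplane_nonzero:
  assumes "q \<in> topspace TQ" "\<kappa> \<in> B" "snd (snd q) \<in> fst \<kappa>"
  shows "plane \<kappa> (E (chart_of (psi q)) q) (chart_of (psi q)) q \<noteq> 0"
  using chart_of[OF psi_pts[OF assms(1)]] by (intro plane_nonzero[OF assms] frame[OF assms(1)])

lemma tplane_at: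
  assumes q: "q \<in> topspace TQ"
  shows "snd (snd q) \<in> L" "slice (snd (snd q)) \<in> B" "snd (snd q) \<in> fst (slice (snd (snd q)))"
    "chart_of (psi q) \<in> charts_at M (psi q)"
proof -
  show x: "snd (snd q) \<in> L" using q by (simp add: topspace_TQ)
  show "slice (snd (snd q)) \<in> B" "snd (snd q) \<in> fst (slice (snd (snd q)))" by (rule slice[OF x])+
  show "chart_of (psi q) \<in> charts_at M (psi q)" by (rule chart_of[OF psi_pts[OF q]])
qed

lemma tplane_continuous: "continuous_map TQ euclidean tplane"
proof -
  let ?V = "topspace TQ"
  have J': "endo_field_along TQ psi ?V (\<lambda>l q. J l (psi q))"
    by (rule field_pullback(1)[OF continuous_map_from_subtopology[OF psi_continuous] _ order_refl J_field]) (use psi_pts in blast)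
  have c: "continuous_map (subtopology TQ {q \<in> ?V. snd (snd q) \<in> fst \<kappa>}) euclidean
      (\<lambda>q. sgn (plane \<kappa> (E (chart_of (psi q)) q) (chart_of (psi q)) q))" if \<kappa>: "\<kappa> \<in> B" for \<kappa>
  proof (rule cm_sgn)
    have V: "{q \<in> ?V. snd (snd q) \<in> fst \<kappa>} \<subseteq> topspace TQ" by blast
    let ?g = "\<lambda>A q. g (chart_of (psi q)) (psi q) (A (chart_of (psi q)) q (tangent \<kappa> 1 (chart_of (psi q)) q)) (tangent \<kappa> 2 (chart_of (psi q)) q)"
    have s: "continuous_map (subtopology TQ {q \<in> ?V. snd (snd q) \<in> fst \<kappa>}) euclideanreal (?g A)"
      if "endo_field_along TQ psi ?V A" for A
      by (rule scalar_field_continuous[OF psi_continuous V plane_scalar_field[OF \<kappa> order_refl that]])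
    have "continuous_map (subtopology TQ {q \<in> ?V. snd (snd q) \<in> fst \<kappa>}) euclidean
        (\<lambda>q. vector [?g (\<lambda>l q. J l (psi q)) q, ?g E q, ?g (\<lambda>l q u. J l (psi q) (E l q u)) q] :: real^3)"
      by (intro cm_vec3 s J' E endo_field_comp[OF J' E])
    then show "continuous_map (subtopology TQ {q \<in> ?V. snd (snd q) \<in> fst \<kappa>}) euclidean
        (\<lambda>q. plane \<kappa> (E (chart_of (psi q)) q) (chart_of (psi q)) q)"
    proof (rule continuous_map_eq)
      fix q assume "q \<in> topspace (subtopology TQ {q \<in> ?V. snd (snd q) \<in> fst \<kappa>})"
      then have q: "q \<in> ?V" by simp
      show "vector [?g (\<lambda>l q. J l (psi q)) q, ?g E q, ?g (\<lambda>l q u. J l (psi q) (E l q u)) q] =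
          plane \<kappa> (E (chart_of (psi q)) q) (chart_of (psi q)) q"
        unfolding hermitian_frame.plane_vec_def[OF frame[OF q tplane_at(4)[OF q]]] ..
    qed
    show "plane \<kappa> (E (chart_of (psi q)) q) (chart_of (psi q)) q \<noteq> 0"
      if "q \<in> topspace (subtopology TQ {q \<in> ?V. snd (snd q) \<in> fst \<kappa>})" for q
      by (rule tplane_nonzero[OF _ \<kappa>]) (use that in auto)
  qed
  have "continuous_map (subtopology TQ ?V) euclidean
      (\<lambda>q. sgn (plane (slice (snd (snd q))) (E (chart_of (psi q)) q) (chart_of (psi q)) q))"
  proof (rule cm_slice[OF c _ order_refl])
    fix q \<kappa> \<kappa>' assume q: "q \<in> ?V" and \<kappa>: "\<kappa> \<in> B" "\<kappa>' \<in> B" "snd (snd q) \<in> fst \<kappa>" "snd (snd q) \<in> fst \<kappa>'"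
    note l = tplane_at(4)[OF q]
    obtain r where "r > 0" "plane \<kappa>' (E (chart_of (psi q)) q) (chart_of (psi q)) q = r *\<^sub>R plane \<kappa> (E (chart_of (psi q)) q) (chart_of (psi q)) q"
      using plane_change[OF q \<kappa>(1,3) l frame[OF q l] \<kappa>(2,4)] .
    then show "sgn (plane \<kappa> (E (chart_of (psi q)) q) (chart_of (psi q)) q) = sgn (plane \<kappa>' (E (chart_of (psi q)) q) (chart_of (psi q)) q)"
      by (simp add: sgn_scaleR)
  qed
  then show ?thesis unfolding subtopology_topspace tplane_def[abs_def] .
qed

lemma norm_tplane: "q \<in> topspace TQ \<Longrightarrow> norm (tplane q) = 1"
  using tplane_nonzero[OF _ tplane_at(2,3)] by (simp add: tplane_def norm_sgn)

lemma tplane_final: "q \<in> topspace TQ \<Longrightarrow> fst q = 1 \<Longrightarrow> tplane q = axis 2 1"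
  unfolding tplane_def by (intro final tplane_at)

text \<open>The surfaces at the ends are Lagrangian for every \<open>s\<close>, so the
  \<open>J\<close> coordinate of their tangent planes is zero.\<close>

lemma tplane_ends:
  assumes q: "q \<in> topspace TQ" and t: "fst (snd q) \<in> {0, 1}"
  shows "axis 1 1 \<noteq> tplane q" "axis 1 1 \<noteq> - tplane q"
proof -
  have "fst q \<in> {0..1}" using q by (simp add: topspace_TQ)
  then have "plane (slice (snd (snd q))) (E (chart_of (psi q)) q) (chart_of (psi q)) q $ 1 = 0"
    by (intro plane_lagrangian[OF q tplane_at(2,3,4)[OF q] frame[OF q tplane_at(4)[OF q]]] lagrangian_ends t)
  then have "tplane q $ 1 = 0" by (simp add: tplane_def sgn_div_norm)
  then show "axis 1 1 \<noteq> tplane q" "axis 1 1 \<noteq> - tplane q" by (auto simp: vec_eq_iff axis_def)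
qed

lemma coords_\<omega>:
  "continuous_map TP euclidean (coords (moved \<omega>))"
  "\<lbrakk>z \<in> topspace TP; l \<in> charts_at M (psi (0, z))\<rbrakk> \<Longrightarrow> norm (coords (moved \<omega>) z) = 1"
  "\<lbrakk>z \<in> topspace TP; l \<in> charts_at M (psi (0, z))\<rbrakk> \<Longrightarrow>
     moved \<omega> l z = quat_comb (J l (psi (0, z))) (E l (0, z)) (coords (moved \<omega>) z)"
proof -
  have o: "openin (mtop M) (pts M)" using openin_topspace[of "mtop M"] by simp
  note f = moved_field[OF o LM \<omega>_two_form \<omega>_same_orientation]
  have c: "\<exists>n. norm n = 1 \<and> moved \<omega> l z = quat_comb (J l (psi (0, z))) (E l (0, z)) n"
    if "z \<in> topspace TP" "l \<in> charts_at M (psi (0, z))" for z l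
    using moved_quat_comb[OF o LM \<omega>_two_form \<omega>_same_orientation that frame[OF initial_TQ[OF that(1)] that(2)]] by metis
  show "continuous_map TP euclidean (coords (moved \<omega>))" by (rule coords_continuous[OF f c])
  show "norm (coords (moved \<omega>) z) = 1" "moved \<omega> l z = quat_comb (J l (psi (0, z))) (E l (0, z)) (coords (moved \<omega>) z)"
    if "z \<in> topspace TP" "l \<in> charts_at M (psi (0, z))" for z l
    by (rule coords[OF f c that]; assumption)+
qed

text \<open>If the moved structure were plus or minus that of the tangent plane, it would map the
  tangent vector \<open>u\<close> into the plane. The moved form vanishes on the plane, yet it is
  positive on \<open>u\<close> and its image.\<close>

lemma coords_\<omega>_not_tplane:
  assumes z: "z \<in> topspace TP"
  shows "coords (moved \<omega>) z \<noteq> tplane (0, z)" "coords (moved \<omega>) z \<noteq> - tplane (0, z)"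
proof -
  define q l \<kappa> where "q = (0 :: real, z)" "l = chart_of (psi (0, z))" "\<kappa> = slice (snd z)"
  note d = q_l_\<kappa>_def
  have q: "q \<in> topspace TQ" using initial_TQ[OF z] by (simp add: d)
  have \<kappa>: "\<kappa> \<in> B" "snd z \<in> fst \<kappa>" and l: "l \<in> charts_at M (psi (0, z))"
    using tplane_at(2,3,4)[OF q] by (simp_all add: d)
  have \<kappa>': "snd (snd q) \<in> fst \<kappa>" and l': "l \<in> charts_at M (psi q)" using \<kappa> l by (simp_all add: d)
  interpret F: hermitian_frame "g l (psi q)" "J l (psi q)" "E l q" by (rule frame[OF q l'])
  let ?u = "tangent \<kappa> 1 l q" and ?v = "tangent \<kappa> 2 l q" and ?m = "moved_form M \<phi> \<omega> (fst z) l (psi (0, z))"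
  have o: "openin (mtop M) (pts M)" using openin_topspace[of "mtop M"] by simp
  note m = moved_form_psi[OF o LM \<omega>_two_form \<omega>_same_orientation z l]
  have u: "?u \<noteq> 0" by (rule tangent_nonzero(1)[OF q \<kappa>(1) \<kappa>' l'])
  have n: "F.plane_vec ?u ?v \<noteq> 0" by (rule plane_nonzero[OF q \<kappa>(1) \<kappa>' l' frame[OF q l']])
  have "\<not> (coords (moved \<omega>) z = sgn (F.plane_vec ?u ?v) \<or> coords (moved \<omega>) z = - sgn (F.plane_vec ?u ?v))"
  proof
    assume a: "coords (moved \<omega>) z = sgn (F.plane_vec ?u ?v) \<or> coords (moved \<omega>) z = - sgn (F.plane_vec ?u ?v)"
    obtain b c where bc: "quat_comb (J l (psi q)) (E l q) (coords (moved \<omega>) z) ?u = b *\<^sub>R ?u + c *\<^sub>R ?v"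
      using F.quat_comb_in_plane[OF u n a] .
    have "moved \<omega> l z ?u = b *\<^sub>R ?u + c *\<^sub>R ?v"
      using coords_\<omega>(3)[OF z l] bc by (simp add: d(1))
    moreover have "?m ?u (moved \<omega> l z ?u) > 0"
      using moved_compatible[OF o LM \<omega>_two_form \<omega>_same_orientation z l] u unfolding compatible_def by blast
    moreover have "?m ?u (b *\<^sub>R ?u + c *\<^sub>R ?v) = 0"
      using moved_lagrangian[OF z \<kappa> l] by (simp add: bilinear_radd[OF m(1)] bilinear_rmul[OF m(1)] m(2) d(1))
    ultimately show False by simp
  qed
  then show "coords (moved \<omega>) z \<noteq> tplane (0, z)" "coords (moved \<omega>) z \<noteq> - tplane (0, z)"
    unfolding tplane_def by (simp_all add: d)
qed

lemma coords_\<omega>_ends: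
  assumes z: "z \<in> topspace TP" and t: "fst z \<in> {0, 1}"
  shows "coords (moved \<omega>) z = axis 1 1"
proof -
  note q = initial_TQ[OF z]
  note l = tplane_at(4)[OF q]
  have u: "quat_units (J (chart_of (psi (0, z))) (psi (0, z))) (E (chart_of (psi (0, z))) (0, z))"
    by (rule hermitian_frame.quat_units[OF frame[OF q l]])
  have "coords (moved \<omega>) z = vector [endo_inner (quat_comb (J (chart_of (psi (0, z))) (psi (0, z))) (E (chart_of (psi (0, z))) (0, z)) (axis 1 1)) (J (chart_of (psi (0, z))) (psi (0, z))),
      endo_inner (quat_comb (J (chart_of (psi (0, z))) (psi (0, z))) (E (chart_of (psi (0, z))) (0, z)) (axis 1 1)) (E (chart_of (psi (0, z))) (0, z)),
      endo_inner (quat_comb (J (chart_of (psi (0, z))) (psi (0, z))) (E (chart_of (psi (0, z))) (0, z)) (axis 1 1)) (\<lambda>u. J (chart_of (psi (0, z))) (psi (0, z)) (E (chart_of (psi (0, z))) (0, z) u))]"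
    unfolding coords_def Let_def moved_\<omega>_ends[OF z t l] quat_comb_axis(1) ..
  also have "\<dots> = axis 1 1" by (rule quat_comb_coords[OF u, symmetric])
  finally show ?thesis .
qed

text \<open>In the global frame the first axis stands for \<open>J\<close>, so this is the homotopy
  between the moved structures and \<open>J\<close> relative to the ends.\<close>

lemma coords_homotopy: "homotopic_rel_ends TL (coords (moved \<omega>)) (\<lambda>z. axis 1 1)"
proof (rule homotopic_rel_ends_const[where b = tplane])
  have z: "(t, x) \<in> topspace TP" if "t \<in> {0..1}" "x \<in> topspace TL" for t x
    using that unfolding topspace_TL by (simp add: topspace_TP)
  have q: "(s, t, x) \<in> topspace TQ" if "s \<in> {0..1}" "t \<in> {0..1}" "x \<in> topspace TL" for s t x
    using that unfolding topspace_TL by (simp add: topspace_TQ)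
  show "continuous_map TP euclidean (coords (moved \<omega>))" by (rule coords_\<omega>(1))
  show "continuous_map TQ euclidean tplane" by (rule tplane_continuous)
  show "norm (coords (moved \<omega>) (t, x)) = 1" if "t \<in> {0..1}" "x \<in> topspace TL" for t x
    by (rule coords_\<omega>(2)[OF z[OF that] tplane_at(4)[OF initial_TQ[OF z[OF that]]]])
  show "norm (tplane (s, t, x)) = 1" if "s \<in> {0..1}" "t \<in> {0..1}" "x \<in> topspace TL" for s t x
    by (rule norm_tplane[OF q[OF that]])
  show "coords (moved \<omega>) (0, x) = axis 1 1 \<and> coords (moved \<omega>) (1, x) = axis 1 1" if "x \<in> topspace TL" for x
    by (intro conjI coords_\<omega>_ends z that) simp_all
  show "tplane (1, t, x) = axis 2 1" if "t \<in> {0..1}" "x \<in> topspace TL" for t x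
    by (rule tplane_final[OF q[OF _ that]]) simp_all
  show "axis 1 1 \<noteq> tplane (s, t, x) \<and> axis 1 1 \<noteq> - tplane (s, t, x)"
    if "s \<in> {0..1}" "t \<in> {0, 1}" "x \<in> topspace TL" for s t x
  proof -
    have "t \<in> {0..1}" using that(2) by auto
    from tplane_ends[OF q[OF that(1) this that(3)]] that(2) show ?thesis by simp
  qed
  show "coords (moved \<omega>) (t, x) \<noteq> tplane (0, t, x) \<and> coords (moved \<omega>) (t, x) \<noteq> - tplane (0, t, x)"
    if "t \<in> {0..1}" "x \<in> topspace TL" for t x
    by (intro conjI coords_\<omega>_not_tplane z that)
qed

end

section \<open>From the relative homotopy to the homotopy class on the quotient\<close>

context lagrangian_homotopy
begin

context
  fixes N \<omega>p
  assumes N: "openin (mtop M) N" "L \<subseteq> N" and \<omega>p: "two_form_on M N \<omega>p" "same_orientation_on M N \<omega> \<omega>p"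
    and independent: "\<And>t x k. \<lbrakk>t \<in> {0..1}; x \<in> L; k \<in> charts_at M (\<phi> t x)\<rbrakk> \<Longrightarrow>
      endos_independent (moved_acs M g \<phi> \<omega> t k (\<phi> t x)) (moved_acs M g \<phi> \<omega>p t k (\<phi> t x))"
begin

text \<open>The homotopy from \<open>J\<close> to the moved structures is rewritten at each point in
  the frame adapted to \<open>moved \<omega>\<close> and \<open>moved \<omega>p\<close>. There
  \<open>J\<close> has the coordinates \<open>F_map\<close>, while \<open>moved \<omega>\<close>
  always has the first axis. The map \<open>alpha\<close> accounts for the change of
  parametrization.\<close>

lemma F_homotopy:
  obtains K where "continuous_map TQ sphere2 K"
    "\<And>r z. \<lbrakk>r \<in> {0..1}; z \<in> topspace TP; fst z \<in> {0, 1}\<rbrakk> \<Longrightarrow> K (r, z) = axis 1 1"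
    "\<And>z. z \<in> topspace TP \<Longrightarrow> K (0, z) = F_map M \<omega> J \<omega>p \<phi> (alpha z, fst z)"
    "\<And>z. z \<in> topspace TP \<Longrightarrow> K (1, z) = axis 1 1"
proof -
  obtain E where E: "endo_field_along TQ psi (topspace TQ) E"
    "\<And>q l. \<lbrakk>q \<in> topspace TQ; l \<in> charts_at M (psi q)\<rbrakk> \<Longrightarrow> hermitian_frame (g l (psi q)) (J l (psi q)) (E l q)"
    "\<And>q l \<kappa>. \<lbrakk>q \<in> topspace TQ; fst q = 1; l \<in> charts_at M (psi q); \<kappa> \<in> B; snd (snd q) \<in> fst \<kappa>\<rbrakk> \<Longrightarrow>
       sgn (plane \<kappa> (E l q) l q) = axis 2 1"
    by (rule frame_along) (rule that)
  interpret R: lagrangian_homotopy_frame M \<omega> J \<phi> L \<Psi> B E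
    by (intro lagrangian_homotopy_frame.intro lagrangian_homotopy_axioms lagrangian_homotopy_frame_axioms.intro E)
  define a where "a = R.coords (moved \<omega>)"
  define c where "c = R.coords (moved \<omega>p)"
  note a = R.coords_\<omega>[folded a_def]
  have ch: "chart_of (psi (0, z)) \<in> charts_at M (psi (0, z))" if "z \<in> topspace TP" for z
    by (rule chart_of[OF psi_pts[OF initial_TQ[OF that]]])
  note f = moved_field[OF N \<omega>p]
  have ex: "\<exists>n. norm n = 1 \<and> moved \<omega>p l z = quat_comb (J l (psi (0, z))) (E l (0, z)) n"
    if "z \<in> topspace TP" "l \<in> charts_at M (psi (0, z))" for z l
    using moved_quat_comb[OF N \<omega>p that E(2)[OF initial_TQ[OF that(1)] that(2)]] by metis
  have c1: "continuous_map TP euclidean c"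
    unfolding c_def by (rule R.coords_continuous[OF f ex])
  have c2: "moved \<omega>p l z = quat_comb (J l (psi (0, z))) (E l (0, z)) (c z)"
    if "z \<in> topspace TP" "l \<in> charts_at M (psi (0, z))" for z l
    unfolding c_def by (rule R.coords(2)[OF f ex that]; assumption)
  \<comment> \<open>Otherwise \<open>c z\<close> would be a multiple of \<open>a z\<close>, contrary
    to the pointwise independence of the two moved structures; so the orthonormalization is
    defined.\<close>
  have ne: "c z - (c z \<bullet> a z) *\<^sub>R a z \<noteq> 0" if z: "z \<in> topspace TP" for z
  proof
    assume "c z - (c z \<bullet> a z) *\<^sub>R a z = 0"
    then have cz: "c z = (c z \<bullet> a z) *\<^sub>R a z" by simp
    let ?l = "chart_of (psi (0, z))"
    have t: "fst z \<in> {0..1}" using z by (simp add: topspace_TP)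
    have l: "?l \<in> charts_at M (\<phi> (fst z) (alpha z))" using ch[OF z] by (simp add: alpha(2)[OF z])
    have i: "endos_independent (moved \<omega> ?l z) (moved \<omega>p ?l z)"
      using independent[OF t alpha(1)[OF z] l] by (simp add: moved_def alpha(2)[OF z])
    have "moved \<omega>p ?l z u = (c z \<bullet> a z) *\<^sub>R moved \<omega> ?l z u" for u
      unfolding c2[OF z ch[OF z]] a(3)[OF z ch[OF z]] by (subst cz) (rule quat_comb_scaleR)
    then have "\<forall>u. (- (c z \<bullet> a z)) *\<^sub>R moved \<omega> ?l z u + 1 *\<^sub>R moved \<omega>p ?l z u = 0" by simp
    then have "(1::real) = 0" using i unfolding endos_independent_def by blast
    then show False by simp
  qed
  have na: "norm (a z) = 1" if "z \<in> topspace TP" for z by (rule a(2)[OF that ch[OF that]])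
  have "homotopic_rel_ends TL a (\<lambda>z. axis 1 1)"
    unfolding a_def by (rule R.coords_homotopy)
  then obtain h0 where h0: "continuous_map TQ sphere2 h0" "\<forall>z. h0 (0, z) = a z" "\<forall>z. h0 (1, z) = axis 1 1"
    "\<forall>r\<in>{0..1}. \<forall>x\<in>topspace TL. h0 (r, 0, x) = axis 1 1 \<and> h0 (r, 1, x) = axis 1 1"
    unfolding homotopic_with_def by blast
  \<comment> \<open>Reversed in time, so that it starts at \<open>J\<close>, which gives
    \<open>F_map\<close>, and ends at \<open>a\<close>, which gives the constant.\<close>
  define h where "h q = h0 (1 - fst q, snd q)" for q
  have flip: "continuous_map TQ TQ (\<lambda>q. (1 - fst q, snd q))"
    by (intro cm_pair cm_into_interval continuous_map_diff cm_fst_real continuous_map_snd)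
      (auto simp: topspace_TQ intro: continuous_map_canonical_const)
  have h: "continuous_map TQ sphere2 h" unfolding h_def[abs_def] by (rule cm_compose[OF flip h0(1)])
  then have ch': "continuous_map TQ euclidean h" and nh: "\<And>q. q \<in> topspace TQ \<Longrightarrow> norm (h q) = 1"
    by (auto simp: continuous_map_in_subtopology)
  define K where "K q = sphere_coords (a (snd q)) (c (snd q)) (h q)" for q
  have z: "snd q \<in> topspace TP" if "q \<in> topspace TQ" for q using that by (simp add: topspace_TQ topspace_TP)
  show ?thesis
  proof (rule that)
    have "continuous_map TQ euclidean K"
      unfolding K_def[abs_def]
      by (rule cm_sphere_coords[OF cm_compose[OF continuous_map_snd a(1)] cm_compose[OF continuous_map_snd c1] ch' ne[OF z]])
    moreover have "norm (K q) = 1" if "q \<in> topspace TQ" for q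
      unfolding K_def by (rule norm_sphere_coords[OF na[OF z[OF that]] nh[OF that] ne[OF z[OF that]]])
    ultimately show "continuous_map TQ sphere2 K" by (auto simp: continuous_map_in_subtopology)
    show "K (r, z) = axis 1 1" if "r \<in> {0..1}" and zP: "z \<in> topspace TP" and t: "fst z \<in> {0, 1}" for r z
    proof -
      \<comment> \<open>At the ends both \<open>h\<close> and \<open>a\<close> are the first axis,
        and any unit vector has coordinates \<open>axis 1 1\<close> in the frame adapted to
        itself.\<close>
      have az: "a z = axis 1 1" unfolding a_def by (rule R.coords_\<omega>_ends[OF zP t])
      have "snd z \<in> topspace TL" using zP unfolding topspace_TL by (simp add: topspace_TP)
      then have "h (r, z) = axis 1 1" using h0(4) that(1) t by (cases z) (auto simp: h_def)
      then have "h (r, z) = a z" by (simp add: az)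
      then show ?thesis unfolding K_def by (simp add: sphere_coords_self[OF na[OF zP]])
    qed
    show "K (1, z) = axis 1 1" if zP: "z \<in> topspace TP" for z
      unfolding K_def by (simp add: h_def h0(2) sphere_coords_self[OF na[OF zP]])
    show "K (0, z) = F_map M \<omega> J \<omega>p \<phi> (alpha z, fst z)" if zP: "z \<in> topspace TP" for z
    proof -
      let ?p = "psi (0, z)" let ?l = "chart_of ?p"
      note l = ch[OF zP]
      have "F_map M \<omega> J \<omega>p \<phi> (alpha z, fst z) = frame_coords (moved \<omega> ?l z) (moved \<omega>p ?l z) (J ?l ?p)"
        unfolding F_map_def moved_def by (simp add: alpha(2)[OF zP] chart_of_def Let_def)
      also have "\<dots> = frame_coords (quat_comb (J ?l ?p) (E ?l (0, z)) (a z)) (quat_comb (J ?l ?p) (E ?l (0, z)) (c z))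
          (quat_comb (J ?l ?p) (E ?l (0, z)) (axis 1 1))"
        unfolding a(3)[OF zP l, symmetric] c2[OF zP l, symmetric] quat_comb_axis(1) ..
      also have "\<dots> = sphere_coords (a z) (c z) (axis 1 1)"
        by (rule frame_coords_quat_comb[OF hermitian_frame.quat_units[OF E(2)[OF initial_TQ[OF zP] l]]])
      finally show ?thesis by (simp add: K_def h_def h0(3))
    qed
  qed
qed

text \<open>Precomposing with \<open>beta\<close> cancels \<open>alpha\<close>, so the homotopy
  starts at \<open>F_map\<close> itself. It is constant on the ends of the cylinder and therefore
  descends to the quotient.\<close>

lemma n_invariant_null: "n_invariant M \<omega> J \<omega>p \<phi> L = null_class M L"
proof -
  obtain K where K: "continuous_map TQ sphere2 K"
    "\<And>r z. \<lbrakk>r \<in> {0..1}; z \<in> topspace TP; fst z \<in> {0, 1}\<rbrakk> \<Longrightarrow> K (r, z) = axis 1 1"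
    "\<And>z. z \<in> topspace TP \<Longrightarrow> K (0, z) = F_map M \<omega> J \<omega>p \<phi> (alpha z, fst z)"
    "\<And>z. z \<in> topspace TP \<Longrightarrow> K (1, z) = axis 1 1"
    by (rule F_homotopy) (rule that)
  let ?Y = "prod_topology TL unit_interval"
  let ?X = "collapse_topology ?Y (cylinder_ends L)"
  let ?F = "\<lambda>C. F_map M \<omega> J \<omega>p \<phi> (SOME z. z \<in> C)"
  \<comment> \<open>The cylinder of the invariant has the surface as first factor, whereas
    \<open>TP\<close> has the time first; \<open>s\<close> exchanges them and passes to the
    parametrization by \<Psi>.\<close>
  define s where "s q = (snd (snd q), beta (snd (snd q), fst (snd q)))" for q :: "real \<times> 'a \<times> real"
  define H where "H q = K (fst q, s q)" for q
  have Y: "y \<in> topspace ?Y \<longleftrightarrow> fst y \<in> L \<and> snd y \<in> {0..1}" for y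
    using LM by (cases y) (auto simp: topspace_prod_topology)
  have sP: "s (r, y) \<in> topspace TP" if "y \<in> topspace ?Y" for r y
    using that beta(1)[of "(snd y, fst y)"] by (simp add: s_def topspace_TP Y)
  have "continuous_map (prod_topology unit_interval ?Y) TP (\<lambda>q. (snd (snd q), fst (snd q)))"
    by (intro cm_pair cm_compose[OF continuous_map_snd] continuous_map_snd continuous_map_fst)
  note b = cm_compose[OF this beta_continuous]
  have "continuous_map (prod_topology unit_interval ?Y) TQ (\<lambda>q. (fst q, s q))"
    unfolding s_def
    by (intro cm_pair b continuous_map_fst cm_compose[OF continuous_map_snd continuous_map_snd])
  from cm_compose[OF this K(1)] have cH: "continuous_map (prod_topology unit_interval ?Y) sphere2 H"
    unfolding H_def[abs_def] .
  have endY: "y \<in> topspace ?Y" if "y \<in> cylinder_ends L" for y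
    using that by (auto simp: Y cylinder_ends_def)
  have const: "H (r, y) = axis 1 1" if "r \<in> {0..1}" "y \<in> cylinder_ends L" for r y
    unfolding H_def fst_conv by (rule K(2)[OF that(1) sP[OF endY[OF that(2)]]])
      (use that(2) in \<open>auto simp: s_def cylinder_ends_def\<close>)
  have hom: "homotopic_with (\<lambda>_. True) ?X sphere2 (\<lambda>C. H (0, SOME z. z \<in> C)) (\<lambda>C. H (1, SOME z. z \<in> C))"
    by (rule homotopic_with_collapse[OF cH]) (simp add: const)
  \<comment> \<open>A point of the quotient is a singleton or the set of all ends, so whichever
    representative \<open>SOME\<close> picks lies in the cylinder, where \<open>K\<close> is under
    control.\<close>
  have pt: "(SOME z. z \<in> C) \<in> topspace ?Y" if "C \<in> topspace ?X" for C
  proof -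
    from that have "C \<in> collapse (cylinder_ends L) ` topspace ?Y"
      by (simp only: quotient_imp_surjective_map[OF quotient_map_collapse])
    then obtain y where y: "y \<in> topspace ?Y" "C = collapse (cylinder_ends L) y" by (rule imageE)
    have "y \<in> C" unfolding y(2) collapse_def by simp
    then have some: "(SOME z. z \<in> C) \<in> C" by (rule someI)
    have "z \<in> topspace ?Y" if "z \<in> C" for z
    proof (cases "y \<in> cylinder_ends L")
      case True
      then show ?thesis using that endY by (simp only: y(2) collapse_def if_True)
    next
      case False
      then show ?thesis using that y(1) by (simp only: y(2) collapse_def if_False singleton_iff)
    qed
    from this[OF some] show ?thesis .
  qed
  have "H (0, y) = F_map M \<omega> J \<omega>p \<phi> y" if y: "y \<in> topspace ?Y" for y
  proof -
    have "(snd y, fst y) \<in> topspace TP" using y by (simp add: Y topspace_TP)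
    from beta(3)[OF this] show ?thesis using K(3)[OF sP[OF y, of 0]] by (simp add: H_def s_def)
  qed
  then have 0: "homotopic_with (\<lambda>_. True) ?X sphere2 (\<lambda>C. H (0, SOME z. z \<in> C)) ?F"
    by (intro homotopic_with_equal homotopic_with_imp_continuous_maps[THEN conjunct1, OF hom]) (simp_all add: pt)
  have "H (1, y) = axis 1 1" if "y \<in> topspace ?Y" for y
    unfolding H_def fst_conv by (rule K(4)[OF sP[OF that]])
  then have 1: "homotopic_with (\<lambda>_. True) ?X sphere2 (\<lambda>C. H (1, SOME z. z \<in> C)) (\<lambda>_. axis 1 1)"
    by (intro homotopic_with_equal homotopic_with_imp_continuous_maps[THEN conjunct2, OF hom]) (simp_all add: pt)
  have eq: "homotopic_with (\<lambda>_. True) ?X sphere2 ?F (\<lambda>_. axis 1 1)"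
    by (rule homotopic_with_trans[OF homotopic_with_symD[OF 0] homotopic_with_trans[OF hom 1]])
  show ?thesis
    unfolding n_invariant_def null_class_def homotopy_class_def X_space_def
  proof (rule Collect_cong)
    show "homotopic_with (\<lambda>_. True) ?X sphere2 ?F k = homotopic_with (\<lambda>_. True) ?X sphere2 (\<lambda>_. axis 1 1) k" for k
      using homotopic_with_trans[OF eq] homotopic_with_trans[OF homotopic_with_symD[OF eq]] by blast
  qed
qed

end

end

theorem lemma3p2:
  fixes M :: "'a smooth_space"
    and \<omega> \<omega>p :: "'a two_form"
    and J :: "'a endo_field"
    and \<phi> :: "real \<Rightarrow> 'a \<Rightarrow> 'a"
    and L\<^sub>0 N :: "'a set"
  assumes "smooth_4_manifold M"
    and "symplectic_on M (pts M) \<omega>"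
    and "closed_orientable_surface M L\<^sub>0"
    and "smooth_path_of_maps M (pts M) \<phi>"
    and "\<forall>t\<in>{0..1}. \<phi> t \<in> Diff_plus_0 M \<omega>"
    and "\<forall>p\<in>pts M. \<phi> 0 p = p"
    and "lagrangian_surface M \<omega> L\<^sub>0"
    and "lagrangian_surface M \<omega> (\<phi> 1 ` L\<^sub>0)"
    and "\<exists>U. openin (mtop M) U \<and> L\<^sub>0 \<subseteq> U \<and>
           (\<forall>p\<in>U. \<forall>k\<in>charts_at M p. pullback M (\<phi> 1) \<omega> k p = \<omega> k p)"
    and "compatible_acs M \<omega> J"
    and "openin (mtop M) N" and "L\<^sub>0 \<subseteq> N"
    and "symplectic_on M N \<omega>p"
    and "same_orientation_on M N \<omega> \<omega>p"
    and "symplectic_surface M \<omega>p L\<^sub>0"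
    and "\<forall>t\<in>{0..1}. \<forall>x\<in>L\<^sub>0. \<forall>k\<in>charts_at M (\<phi> t x).
           endos_independent
             (moved_acs M (induced_metric \<omega> J) \<phi> \<omega> t k (\<phi> t x))
             (moved_acs M (induced_metric \<omega> J) \<phi> \<omega>p t k (\<phi> t x))"
    and "homotopic_to_lagrangian_isotopy M \<omega> L\<^sub>0 (\<lambda>t. \<phi> t ` L\<^sub>0)"
  shows "n_invariant M \<omega> J \<omega>p \<phi> L\<^sub>0 = null_class M L\<^sub>0"
proof -
  interpret diffeo_path M \<omega> J \<phi>
    by unfold_locales (use assms(1,2,4,5,10) in blast)+
  have LM: "L\<^sub>0 \<subseteq> pts M" using assms(7) by (simp add: lagrangian_surface_def embedded_surface_def)
  have L0: "\<phi> 0 ` L\<^sub>0 = L\<^sub>0" using assms(6) LM by force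
  obtain B where B: "\<forall>k\<in>B. slice_chart M L\<^sub>0 k" "L\<^sub>0 \<subseteq> (\<Union>k\<in>B. fst k)"
    "\<forall>k\<in>B. \<forall>l\<in>B. \<forall>p\<in>fst k \<inter> fst l \<inter> L\<^sub>0.
       tderiv id k l p (axis 1 1) $ 1 * tderiv id k l p (axis 2 1) $ 2 - tderiv id k l p (axis 2 1) $ 1 * tderiv id k l p (axis 1 1) $ 2 > 0"
    using assms(3)[unfolded closed_orientable_surface_def orientable_surface_def Let_def] by (elim conjE exE) (rule that)
  obtain \<Psi> where \<Psi>: "homotopy_of_isotopies M L\<^sub>0 \<Psi>" "\<forall>t\<in>{0..1}. \<Psi> 0 t ` L\<^sub>0 = \<phi> t ` L\<^sub>0"
    "\<forall>s\<in>{0..1}. \<Psi> s 0 ` L\<^sub>0 = \<phi> 0 ` L\<^sub>0 \<and> \<Psi> s 1 ` L\<^sub>0 = \<phi> 1 ` L\<^sub>0"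
    "\<forall>t\<in>{0..1}. lagrangian_surface M \<omega> (\<Psi> 1 t ` L\<^sub>0)"
    using assms(17)[unfolded homotopic_to_lagrangian_isotopy_def] by (elim conjE exE) (rule that)
  \<comment> \<open>At \<open>t = 0\<close> the diffeomorphism is the identity on \<open>M\<close>,
    at \<open>t = 1\<close> it preserves \<omega> near \<open>L\<^sub>0\<close>. This is what makes
    the moved structure coincide with \<open>J\<close> at both ends.\<close>
  have ends: "pullback M (\<phi> t) \<omega> k x = \<omega> k x" if t: "t \<in> {0, 1}" and x: "x \<in> L\<^sub>0" and k: "k \<in> charts_at M x" for t x k
  proof (cases "t = 0")
    case True
    show ?thesis unfolding True by (rule pullback_identity[OF _ _ k]) (use assms(6) in simp_all)
  next
    case False
    with t have "t = 1" by simp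
    with assms(9) x k show ?thesis by blast
  qed
  interpret lagrangian_homotopy M \<omega> J \<phi> L\<^sub>0 \<Psi> B
  proof unfold_locales
    show "homotopy_of_isotopies M L\<^sub>0 \<Psi>" "L\<^sub>0 \<subseteq> pts M" "L\<^sub>0 \<subseteq> (\<Union>\<kappa>\<in>B. fst \<kappa>)" "lagrangian_surface M \<omega> L\<^sub>0"
      by (fact \<Psi>(1) LM B(2) assms(7))+
    show "compactin (mtop M) L\<^sub>0" using assms(3) by (simp add: closed_orientable_surface_def)
    show "slice_chart M L\<^sub>0 \<kappa>" if "\<kappa> \<in> B" for \<kappa> using B(1) that by blast
    show "tderiv id \<kappa> \<kappa>' x (axis 1 1) $ 1 * tderiv id \<kappa> \<kappa>' x (axis 2 1) $ 2
        - tderiv id \<kappa> \<kappa>' x (axis 2 1) $ 1 * tderiv id \<kappa> \<kappa>' x (axis 1 1) $ 2 > 0"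
      if "\<kappa> \<in> B" "\<kappa>' \<in> B" "x \<in> fst \<kappa>" "x \<in> fst \<kappa>'" "x \<in> L\<^sub>0" for \<kappa> \<kappa>' x
      using B(3)[rule_format, OF that(1,2)] that(3-5) by blast
    show "\<Psi> 0 t ` L\<^sub>0 = \<phi> t ` L\<^sub>0" "lagrangian_surface M \<omega> (\<Psi> 1 t ` L\<^sub>0)" if "t \<in> {0..1}" for t
      using that by (fact \<Psi>(2,4)[rule_format])+
    show "lagrangian_surface M \<omega> (\<Psi> s t ` L\<^sub>0)" if "s \<in> {0..1}" "t \<in> {0, 1}" for s t
      using that \<Psi>(3) assms(7,8) L0 by auto
    show "pullback M (\<phi> t) \<omega> k x = \<omega> k x" if "t \<in> {0, 1}" "x \<in> L\<^sub>0" "k \<in> charts_at M x" for t x k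
      by (rule ends[OF that])
  qed
  have "two_form_on M N \<omega>p" using assms(13) by (simp add: symplectic_on_def)
  from n_invariant_null[OF assms(11,12) this assms(14)] show ?thesis using assms(16) by blast
qed

end
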